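(* Let $A,B$ be complete bornological algebras and let $f_0,f_1\colon A\to B$ be AC-homotopic bounded homomorphisms. Then $[f_0]=[f_1]$ in $HA^0(A;B)$. Thus analytic cyclic homology and (bivariant) analytic cyclic cohomology are invariant under absolutely continuous homotopies.
   Context: Bornologies. A convex bornology on a complex vector space $V$ is a family of subsets, called small, containing the points and closed under subsets, sums and circled convex hulls; $V$ is a complete bornological vector space if every small set lies in a small disk (circled convex set) whose linear span with the gauge norm is a Banach space. (Multi)linear maps are bounded if they preserve smallness. $\hat\otimes$ is the completed tensor product (universal for bounded bilinear maps into complete spaces). A complete bornological algebra is a complete bornological vector space with a bounded associative multiplication (unit not required); $A^+=A\oplus\mathbb C$. Absolutely continuous homotopy. $AC([0,1])$ is the Banach algebra of absolutely continuous functions on $[0,1]$ with norm $|f(0)|+\int_0^1|f'(t)|\,dt$, with its norm bounded sets as small sets. $AC([0,1];B)=AC([0,1])\hat\otimes B$, with evaluation homomorphisms $\mathrm{ev}_t$. $f_0,f_1\colon A\to B$ are AC-homotopic if there is a bounded homomorphism $\Phi\colon A\to AC([0,1];B)$ with $\mathrm{ev}_t\circ\Phi=f_t$ for $t=0,1$. Analytic cyclic theory. $\Omega A$ is the algebra of non-commutative differential forms $\langle a_0\rangle da_1\dots da_n$ ($=a_0da_1\dots da_n$ or $da_1\dots da_n$) over the non-unital algebra $A$. $\Omega_{an}A$ is its completion (universal for bounded linear maps into complete spaces) for the convex bornology generated by the sets $\{a_0\}\cup\{\langle a_0\rangle da_1\dots da_n:n\ge1\}$, all $a_j\in S$, $S\subset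 A$ small. The analytic tensor algebra $\mathcal TA$ is the even part of $\Omega_{an}A$ with product $x\odot y=xy-(-1)^{\deg x}dx\,dy$; for a bounded homomorphism $f\colon A\to B$, $\mathcal Tf(\langle a_0\rangle da_1\dots da_{2n})=f\langle a_0\rangle df(a_1)\dots df(a_{2n})$. The X-complex $X(R)$ of a complete bornological algebra $R$ is the $\mathbb Z/2$-graded complex $X_0(R)=R$, $X_1(R)=\Omega^1R/b(\Omega^2R)$, $\Omega^nR=R^+\hat\otimes R^{\hat\otimes n}$ for $n\ge1$, $b(\langle x_0\rangle dx_1dx_2)=\langle x_0\rangle x_1dx_2-\langle x_0\rangle d(x_1x_2)+x_2\langle x_0\rangle dx_1$, with boundaries $\partial_0(x)=dx$ mod $b(\Omega^2R)$, $\partial_1(\langle x\rangle dy)=[\langle x\rangle,y]$. $HA_*(A)$, $HA^*(A)$ are the homology and the cohomology (with bounded linear functionals) of $X(\mathcal TA)$, and $HA^*(A;B)$ is the homology of the complex of bounded linear maps $X(\mathcal TA)\to X(\mathcal TB)$ with boundary $f\mapsto\partial f-(-1)^{\deg f}f\partial$. $[f]\in HA^0(A;B)$ is the class of the chain map $X(\mathcal Tf)$; the functoriality of all three theories is composition with $[f]$. *)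

theory Defs
  imports
    "HOL-Analysis.Analysis"
    "HOL-Library.Poly_Mapping"
    "HOL-Library.Set_Algebras"
    "HOL-Library.Function_Algebras"
begin

section \<open>Complex vector spaces\<close>

class complex_vector = ab_group_add +
  fixes scaleC :: "complex \<Rightarrow> 'a \<Rightarrow> 'a"  (infixr "*\<^sub>C" 75)
  assumes scaleC_add_right: "c *\<^sub>C (x + y) = c *\<^sub>C x + c *\<^sub>C y"
    and scaleC_add_left: "(c + d) *\<^sub>C x = c *\<^sub>C x + d *\<^sub>C x"
    and scaleC_scaleC: "c *\<^sub>C d *\<^sub>C x = (c * d) *\<^sub>C x"
    and scaleC_one: "1 *\<^sub>C x = x"

global_interpretation complex_vector: vector_space "scaleC :: complex \<Rightarrow> 'a \<Rightarrow> 'a::complex_vector"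
  by unfold_locales (simp_all add: scaleC_add_right scaleC_add_left scaleC_scaleC scaleC_one)

text \<open>Notions that enter the axioms of the type classes below have to be defined inside the class
  context.\<close>

definition (in complex_vector) csubspace :: "'a set \<Rightarrow> bool"
  where "csubspace L \<longleftrightarrow> 0 \<in> L \<and> (\<forall>x\<in>L. \<forall>y\<in>L. x + y \<in> L) \<and> (\<forall>c. \<forall>x\<in>L. c *\<^sub>C x \<in> L)"

definition (in complex_vector) cspan :: "'a set \<Rightarrow> 'a set"
  where "cspan S = csubspace hull S"

lemma csubspace_eq: "csubspace = complex_vector.subspace"
  by (simp add: fun_eq_iff csubspace_def complex_vector.subspace_def)

lemma cspan_eq: "cspan = complex_vector.span"
  by (simp add: fun_eq_iff cspan_def complex_vector.span_def csubspace_eq)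

abbreviation clinear :: "('a::complex_vector \<Rightarrow> 'b::complex_vector) \<Rightarrow> bool"
  where "clinear \<equiv> Vector_Spaces.linear scaleC scaleC"

definition cbilinear :: "('a::complex_vector \<Rightarrow> 'b::complex_vector \<Rightarrow> 'c::complex_vector) \<Rightarrow> bool"
  where "cbilinear f \<longleftrightarrow> (\<forall>x. clinear (\<lambda>y. f x y)) \<and> (\<forall>y. clinear (\<lambda>x. f x y))"

lemma clinearI:
  assumes "\<And>x y. f (x + y) = f x + f y" and "\<And>c x. f (c *\<^sub>C x) = c *\<^sub>C f x"
  shows "clinear f"
  using assms
  by (simp add: Vector_Spaces.linear_def module_hom_def module_hom_axioms_def
      complex_vector.module_axioms complex_vector.vector_space_axioms)

lemma clinear_add: "clinear f \<Longrightarrow> f (x + y) = f x + f y"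
  by (simp add: Vector_Spaces.linear_def module_hom_def module_hom_axioms_def)

lemma clinear_scale: "clinear f \<Longrightarrow> f (c *\<^sub>C x) = c *\<^sub>C f x"
  by (simp add: Vector_Spaces.linear_def module_hom_def module_hom_axioms_def)

lemma clinear_zero: "clinear f \<Longrightarrow> f 0 = 0"
  by (metis add_cancel_right_left clinear_add)

instantiation complex :: complex_vector
begin

definition scaleC_complex :: "complex \<Rightarrow> complex \<Rightarrow> complex"
  where "scaleC_complex c x = c * x"

instance
  by standard (simp_all add: scaleC_complex_def algebra_simps)

end

instantiation prod :: (complex_vector, complex_vector) complex_vector
begin

definition scaleC_prod :: "complex \<Rightarrow> 'a \<times> 'b \<Rightarrow> 'a \<times> 'b"
  where "scaleC_prod c x = (c *\<^sub>C fst x, c *\<^sub>C snd x)"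

instance
  by standard
    (simp_all add: scaleC_prod_def scaleC_add_right scaleC_add_left scaleC_scaleC scaleC_one)

end

instantiation poly_mapping :: (type, complex_vector) complex_vector
begin

lift_definition scaleC_poly_mapping :: "complex \<Rightarrow> ('a \<Rightarrow>\<^sub>0 'b) \<Rightarrow> 'a \<Rightarrow>\<^sub>0 'b"
  is "\<lambda>c p k. c *\<^sub>C p k"
  by (erule rev_finite_subset) auto

instance
  by standard
    (transfer; simp add: fun_eq_iff scaleC_add_right scaleC_add_left scaleC_scaleC scaleC_one)+

end

text \<open>The free complex vector space on \<open>'x\<close> is \<open>'x \<Rightarrow>\<^sub>0 complex\<close>, with basis \<open>basis x\<close>.\<close>

abbreviation basis :: "'x \<Rightarrow> 'x \<Rightarrow>\<^sub>0 complex"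
  where "basis x \<equiv> Poly_Mapping.single x 1"

lemma equivp_subspace:
  assumes "csubspace N"
  shows "equivp (\<lambda>x y. x - y \<in> N)"
proof (rule equivpI)
  note sub = assms[unfolded csubspace_eq]
  show "reflp (\<lambda>x y. x - y \<in> N)"
    using complex_vector.subspace_0[OF sub] by (simp add: reflp_def)
  show "symp (\<lambda>x y. x - y \<in> N)"
  proof (rule sympI)
    fix x y assume "x - y \<in> N"
    then have "- (x - y) \<in> N" by (rule complex_vector.subspace_neg[OF sub])
    then show "y - x \<in> N" by simp
  qed
  show "transp (\<lambda>x y. x - y \<in> N)"
  proof (rule transpI)
    fix x y z assume "x - y \<in> N" "y - z \<in> N"
    then have "(x - y) + (y - z) \<in> N" by (rule complex_vector.subspace_add[OF sub])
    then show "x - z \<in> N" by simp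
  qed
qed

lemma subspace_cong:
  assumes "csubspace N"
  shows "x - x' \<in> N \<Longrightarrow> y - y' \<in> N \<Longrightarrow> (x + y) - (x' + y') \<in> N"
    and "x - x' \<in> N \<Longrightarrow> y - y' \<in> N \<Longrightarrow> (x - y) - (x' - y') \<in> N"
    and "x - x' \<in> N \<Longrightarrow> - x - - x' \<in> N"
    and "x - x' \<in> N \<Longrightarrow> c *\<^sub>C x - c *\<^sub>C x' \<in> N"
proof -
  note sub = assms[unfolded csubspace_eq]
  {
  assume *: "x - x' \<in> N" "y - y' \<in> N"
  from complex_vector.subspace_add[OF sub *]
  show "(x + y) - (x' + y') \<in> N" by (simp add: algebra_simps)
  from complex_vector.subspace_diff[OF sub *]
  show "(x - y) - (x' - y') \<in> N" by (simp add: algebra_simps)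
  }
  assume *: "x - x' \<in> N"
  from complex_vector.subspace_neg[OF sub *] show "- x - - x' \<in> N" by simp
  from complex_vector.subspace_scale[OF sub *, of c]
  show "c *\<^sub>C x - c *\<^sub>C x' \<in> N" by (simp add: complex_vector.scale_right_diff_distrib)
qed

section \<open>Bornologies\<close>

definition (in complex_vector) disk :: "'a set \<Rightarrow> bool"
  where "disk S \<longleftrightarrow> S \<noteq> {} \<and> (\<forall>x\<in>S. \<forall>c. cmod c \<le> 1 \<longrightarrow> c *\<^sub>C x \<in> S) \<and>
    (\<forall>x\<in>S. \<forall>y\<in>S. \<forall>t\<in>{0..1}. of_real (1 - t) *\<^sub>C x + of_real t *\<^sub>C y \<in> S)"

definition (in complex_vector) disk_hull :: "'a set \<Rightarrow> 'a set"
  where "disk_hull S = \<Inter>{D. disk D \<and> S \<subseteq> D}"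

definition (in complex_vector) convex_bornology :: "('a set \<Rightarrow> bool) \<Rightarrow> bool"
  where "convex_bornology sm \<longleftrightarrow>
    (\<forall>x. sm {x}) \<and>
    (\<forall>S T. sm S \<longrightarrow> T \<subseteq> S \<longrightarrow> sm T) \<and>
    (\<forall>S T. sm S \<longrightarrow> sm T \<longrightarrow> sm {x + y |x y. x \<in> S \<and> y \<in> T}) \<and>
    (\<forall>S. sm S \<longrightarrow> sm (disk_hull S))"

definition generated_bornology :: "'a::complex_vector set set \<Rightarrow> 'a set \<Rightarrow> bool"
  where "generated_bornology F S \<longleftrightarrow>
    (\<forall>sm. convex_bornology sm \<and> (\<forall>T\<in>F. sm T) \<longrightarrow> sm S)"

text \<open>The purely syntactic class \<open>small_sets\<close> allows a space to be endowed with a family of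
  small sets before the axioms of a bornology are established.\<close>

class small_sets =
  fixes small :: "'a set \<Rightarrow> bool"

class bornological_vector_space = complex_vector + small_sets +
  assumes convex_bornology_small: "convex_bornology small"

definition (in complex_vector) gauge_norm :: "'a set \<Rightarrow> 'a \<Rightarrow> real"
  where "gauge_norm S x = Inf {r. 0 < r \<and> x \<in> (\<lambda>s. of_real r *\<^sub>C s) ` S}"

text \<open>Cauchy sequences and convergence in the linear span of a disk, with its gauge
  (semi-)norm.\<close>

definition (in complex_vector) disk_Cauchy :: "'a set \<Rightarrow> (nat \<Rightarrow> 'a) \<Rightarrow> bool"
  where "disk_Cauchy S X \<longleftrightarrow> range X \<subseteq> cspan S \<and>
    (\<forall>e>0. \<exists>N. \<forall>m\<ge>N. \<forall>n\<ge>N. gauge_norm S (X m - X n) < e)"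

definition (in complex_vector) disk_tendsto :: "'a set \<Rightarrow> (nat \<Rightarrow> 'a) \<Rightarrow> 'a \<Rightarrow> bool"
  where "disk_tendsto S X l \<longleftrightarrow> range X \<subseteq> cspan S \<and> l \<in> cspan S \<and>
    (\<lambda>n. gauge_norm S (X n - l)) \<longlonglongrightarrow> 0"

definition (in complex_vector) Banach_disk :: "'a set \<Rightarrow> bool"
  where "Banach_disk S \<longleftrightarrow> disk S \<and> (\<forall>x\<in>cspan S. gauge_norm S x = 0 \<longrightarrow> x = 0) \<and>
    (\<forall>X. disk_Cauchy S X \<longrightarrow> (\<exists>l. disk_tendsto S X l))"

class complete_bornological_vector_space = bornological_vector_space +
  assumes small_in_Banach_disk: "small S \<Longrightarrow> \<exists>T. S \<subseteq> T \<and> small T \<and> Banach_disk T"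

text \<open>The class \<open>ring\<close> of the library does not require a unit.\<close>

class complete_bornological_algebra = complete_bornological_vector_space + ring +
  assumes scaleC_mult_left: "(c *\<^sub>C x) * y = c *\<^sub>C (x * y)"
    and scaleC_mult_right: "x * (c *\<^sub>C y) = c *\<^sub>C (x * y)"
    and small_mult: "small S \<Longrightarrow> small T \<Longrightarrow> small {x * y |x y. x \<in> S \<and> y \<in> T}"

definition bounded_clinear ::
    "('a::bornological_vector_space \<Rightarrow> 'b::bornological_vector_space) \<Rightarrow> bool"
  where "bounded_clinear f \<longleftrightarrow> clinear f \<and> (\<forall>S. small S \<longrightarrow> small (f ` S))"

definition bounded_cbilinear ::
    "('a::bornological_vector_space \<Rightarrow> 'b::bornological_vector_space \<Rightarrow>
      'c::bornological_vector_space) \<Rightarrow> bool"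
  where "bounded_cbilinear f \<longleftrightarrow> cbilinear f \<and>
    (\<forall>S T. small S \<longrightarrow> small T \<longrightarrow> small {f x y |x y. x \<in> S \<and> y \<in> T})"

definition bounded_hom ::
    "('a::{bornological_vector_space, times} \<Rightarrow> 'b::{bornological_vector_space, times}) \<Rightarrow> bool"
  where "bounded_hom f \<longleftrightarrow> bounded_clinear f \<and> (\<forall>x y. f (x * y) = f x * f y)"

lemma set_plus_eq: "S + T = {x + y |x y. x \<in> S \<and> y \<in> T}"
  by (auto simp: set_plus_def)

lemma convex_bornology_iff:
  "convex_bornology sm \<longleftrightarrow>
    (\<forall>x. sm {x}) \<and>
    (\<forall>S T. sm S \<longrightarrow> T \<subseteq> S \<longrightarrow> sm T) \<and>
    (\<forall>S T. sm S \<longrightarrow> sm T \<longrightarrow> sm (S + T)) \<and>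
    (\<forall>S. sm S \<longrightarrow> sm (disk_hull S))"
  by (simp add: convex_bornology_def set_plus_eq)

lemma disk_0: "disk S \<Longrightarrow> 0 \<in> S"
  unfolding disk_def by (metis complex_vector.scale_zero_left equals0I norm_zero zero_le_one)

lemma disk_scale: "disk S \<Longrightarrow> x \<in> S \<Longrightarrow> cmod c \<le> 1 \<Longrightarrow> c *\<^sub>C x \<in> S"
  unfolding disk_def by blast

lemma disk_convex:
  "disk S \<Longrightarrow> x \<in> S \<Longrightarrow> y \<in> S \<Longrightarrow> 0 \<le> t \<Longrightarrow> t \<le> 1 \<Longrightarrow>
    of_real (1 - t) *\<^sub>C x + of_real t *\<^sub>C y \<in> S"
  unfolding disk_def by (meson atLeastAtMost_iff)

lemma disk_UNIV: "disk UNIV"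
  by (simp add: disk_def)

lemma disk_disk_hull: "disk (disk_hull S)"
proof -
  have "0 \<in> disk_hull S" by (simp add: disk_hull_def disk_0)
  moreover have "c *\<^sub>C x \<in> disk_hull S" if "x \<in> disk_hull S" "cmod c \<le> 1" for c x
    using that disk_scale unfolding disk_hull_def by blast
  moreover have "of_real (1 - t) *\<^sub>C x + of_real t *\<^sub>C y \<in> disk_hull S"
    if "x \<in> disk_hull S" "y \<in> disk_hull S" "t \<in> {0..1}" for x y t
    using that unfolding disk_hull_def
    by (auto simp del: of_real_diff intro!: disk_convex)
  ultimately show ?thesis unfolding disk_def by blast
qed

lemma disk_hull_subset: "S \<subseteq> disk_hull S"
  by (auto simp: disk_hull_def)

lemma disk_hull_least: "disk D \<Longrightarrow> S \<subseteq> D \<Longrightarrow> disk_hull S \<subseteq> D"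
  by (auto simp: disk_hull_def)

lemma disk_vimage:
  assumes "clinear f" "disk D"
  shows "disk (f -` D)"
  unfolding disk_def
proof (intro conjI ballI allI impI)
  have "0 \<in> f -` D" using assms by (simp add: clinear_zero disk_0)
  then show "f -` D \<noteq> {}" by blast
  show "c *\<^sub>C x \<in> f -` D" if "x \<in> f -` D" "cmod c \<le> 1" for c x
    using that by (simp add: clinear_scale[OF assms(1)] disk_scale[OF assms(2)])
  show "of_real (1 - t) *\<^sub>C x + of_real t *\<^sub>C y \<in> f -` D"
    if "x \<in> f -` D" "y \<in> f -` D" "t \<in> {0..1}" for x y t
    using that disk_convex[OF assms(2), of "f x" "f y" t]
    by (simp del: of_real_diff add: clinear_scale[OF assms(1)] clinear_add[OF assms(1)])
qed

lemma disk_image: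
  assumes "clinear f" "disk D"
  shows "disk (f ` D)"
  unfolding disk_def
proof (intro conjI ballI allI impI; (elim imageE)?)
  show "f ` D \<noteq> {}" using disk_0[OF assms(2)] by blast
  show "c *\<^sub>C x \<in> f ` D" if "cmod c \<le> 1" "x = f x'" "x' \<in> D" for c x x'
    using disk_scale[OF assms(2) that(3,1)] that(2)
    by (metis clinear_scale[OF assms(1)] image_eqI)
  show "of_real (1 - t) *\<^sub>C x + of_real t *\<^sub>C y \<in> f ` D"
    if "t \<in> {0..1}" "x = f x'" "x' \<in> D" "y = f y'" "y' \<in> D" for x y t x' y'
  proof -
    have "of_real (1 - t) *\<^sub>C x + of_real t *\<^sub>C y = f (of_real (1 - t) *\<^sub>C x' + of_real t *\<^sub>C y')"
      by (simp only: that clinear_add[OF assms(1)] clinear_scale[OF assms(1)])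
    moreover have "of_real (1 - t) *\<^sub>C x' + of_real t *\<^sub>C y' \<in> D"
      using that by (intro disk_convex[OF assms(2)]) auto
    ultimately show ?thesis by blast
  qed
qed

lemma disk_hull_image: "clinear f \<Longrightarrow> disk_hull (f ` S) = f ` disk_hull S"
proof
  assume f: "clinear f"
  show "disk_hull (f ` S) \<subseteq> f ` disk_hull S"
    by (intro disk_hull_least disk_image f disk_disk_hull image_mono disk_hull_subset)
  have "disk_hull S \<subseteq> f -` disk_hull (f ` S)"
    using disk_hull_subset[of "f ` S"]
    by (intro disk_hull_least disk_vimage f disk_disk_hull) auto
  then show "f ` disk_hull S \<subseteq> disk_hull (f ` S)" by auto
qed

lemma set_plus_image: "clinear f \<Longrightarrow> f ` S + f ` T = f ` (S + T)"
  unfolding set_plus_def by (force simp: clinear_add image_iff)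

lemma convex_bornologyD:
  assumes "convex_bornology sm"
  shows "sm {x}" and "sm S \<Longrightarrow> T \<subseteq> S \<Longrightarrow> sm T" and "sm S \<Longrightarrow> sm T \<Longrightarrow> sm (S + T)"
    and "sm S \<Longrightarrow> sm (disk_hull S)"
proof -
  note * = assms[unfolded convex_bornology_iff]
  show "sm {x}" by (rule *[THEN conjunct1, THEN spec])
  show "sm S \<Longrightarrow> T \<subseteq> S \<Longrightarrow> sm T"
    by (rule *[THEN conjunct2, THEN conjunct1, THEN spec, THEN spec, THEN mp, THEN mp])
  show "sm S \<Longrightarrow> sm T \<Longrightarrow> sm (S + T)"
    by (rule *[THEN conjunct2, THEN conjunct2, THEN conjunct1, THEN spec, THEN spec, THEN mp, THEN mp])
  show "sm S \<Longrightarrow> sm (disk_hull S)"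
    by (rule *[THEN conjunct2, THEN conjunct2, THEN conjunct2, THEN spec, THEN mp])
qed

lemma convex_bornologyI:
  assumes "\<And>x. sm {x}" and "\<And>S T. sm S \<Longrightarrow> T \<subseteq> S \<Longrightarrow> sm T"
    and "\<And>S T. sm S \<Longrightarrow> sm T \<Longrightarrow> sm (S + T)" and "\<And>S. sm S \<Longrightarrow> sm (disk_hull S)"
  shows "convex_bornology sm"
  unfolding convex_bornology_iff using assms by (intro conjI allI impI)

lemma generated_bornologyI:
  assumes "\<And>sm. convex_bornology sm \<Longrightarrow> (\<And>T. T \<in> F \<Longrightarrow> sm T) \<Longrightarrow> sm S"
  shows "generated_bornology F S"
  unfolding generated_bornology_def
proof (intro allI impI; elim conjE)
  fix sm :: "'a set \<Rightarrow> bool" assume "convex_bornology sm" "\<forall>T\<in>F. sm T"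
  from \<open>\<forall>T\<in>F. sm T\<close> have "\<And>T. T \<in> F \<Longrightarrow> sm T" by (rule bspec)
  from \<open>convex_bornology sm\<close> this show "sm S" by (rule assms)
qed

lemma generated_bornologyD:
  assumes "generated_bornology F S" and "convex_bornology sm" and "\<And>T. T \<in> F \<Longrightarrow> sm T"
  shows "sm S"
proof -
  have "\<forall>T\<in>F. sm T" using assms(3) by (rule ballI)
  with assms(2) show ?thesis
    using assms(1)[unfolded generated_bornology_def, THEN spec[of _ sm]] by (simp only: simp_thms)
qed

lemma convex_bornology_generated: "convex_bornology (generated_bornology F)"
proof (rule convex_bornologyI; rule generated_bornologyI)
  fix sm :: "'a set \<Rightarrow> bool" assume sm: "convex_bornology sm" "\<And>T. T \<in> F \<Longrightarrow> sm T"
  note gen = generated_bornologyD[OF _ sm]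
  show "sm {x}" for x by (rule convex_bornologyD(1)[OF sm(1)])
  show "sm T" if "generated_bornology F S" "T \<subseteq> S" for S T
    by (rule convex_bornologyD(2)[OF sm(1) gen[OF that(1)] that(2)])
  show "sm (S + T)" if "generated_bornology F S" "generated_bornology F T" for S T
    by (rule convex_bornologyD(3)[OF sm(1) gen[OF that(1)] gen[OF that(2)]])
  show "sm (disk_hull S)" if "generated_bornology F S" for S
    by (rule convex_bornologyD(4)[OF sm(1) gen[OF that]])
qed

lemma convex_bornology_image:
  assumes f: "clinear f" and surj: "surj f" and B: "convex_bornology sm"
  shows "convex_bornology (\<lambda>T. \<exists>S. sm S \<and> T = f ` S)"
proof (rule convex_bornologyI)
  note cb = convex_bornologyD[OF B]
  show "\<exists>S. sm S \<and> {x} = f ` S" for x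
  proof -
    obtain y where "f y = x" using surj by (metis surjD)
    then show ?thesis using cb(1)[of y] by (intro exI[of _ "{y}"]) simp
  qed
  show "\<exists>S. sm S \<and> U = f ` S" if "\<exists>S. sm S \<and> T = f ` S" "U \<subseteq> T" for T U
  proof -
    obtain S where S: "sm S" "T = f ` S" using \<open>\<exists>S. sm S \<and> T = f ` S\<close> by blast
    then obtain S' where "S' \<subseteq> S" "U = f ` S'" using \<open>U \<subseteq> T\<close> by (metis subset_imageE)
    then show ?thesis using cb(2)[OF S(1)] by blast
  qed
  show "\<exists>S. sm S \<and> T + U = f ` S" if "\<exists>S. sm S \<and> T = f ` S" "\<exists>S. sm S \<and> U = f ` S" for T U
    using that cb(3) set_plus_image[OF f] by metis
  show "\<exists>S. sm S \<and> disk_hull T = f ` S" if "\<exists>S. sm S \<and> T = f ` S" for T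
    using that cb(4) disk_hull_image[OF f] by metis
qed

lemma convex_bornology_vimage:
  assumes f: "clinear f" and B: "convex_bornology sm"
  shows "convex_bornology (\<lambda>S. sm (f ` S))"
proof (rule convex_bornologyI)
  note cb = convex_bornologyD[OF B]
  show "sm (f ` {x})" for x using cb(1) by simp
  show "sm (f ` T)" if "sm (f ` S)" "T \<subseteq> S" for S T
    by (rule cb(2)[OF that(1) image_mono[OF that(2)]])
  show "sm (f ` (S + T))" if "sm (f ` S)" "sm (f ` T)" for S T
    using cb(3)[OF that] by (simp add: set_plus_image[OF f])
  show "sm (f ` disk_hull S)" if "sm (f ` S)" for S
    using cb(4)[OF that] by (simp add: disk_hull_image[OF f])
qed

lemma convex_bornology_conj:
  assumes P: "convex_bornology P" and Q: "convex_bornology Q"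
  shows "convex_bornology (\<lambda>S. P S \<and> Q S)"
proof (rule convex_bornologyI; (elim conjE)?; intro conjI)
  note cb = convex_bornologyD[OF P] convex_bornologyD[OF Q]
  show "P {x}" "Q {x}" for x by (rule cb)+
  show "P T" "Q T" if "T \<subseteq> S" "P S" "Q S" for S T using cb(2,6) that by blast+
  show "P (S + T)" "Q (S + T)" if "P S" "Q S" "P T" "Q T" for S T using that by (simp_all add: cb)
  show "P (disk_hull S)" "Q (disk_hull S)" if "P S" "Q S" for S using that by (simp_all add: cb)
qed

lemmas small_singleton = convex_bornologyD(1)[OF convex_bornology_small]
  and small_subset = convex_bornologyD(2)[OF convex_bornology_small]
  and small_add = convex_bornologyD(3)[OF convex_bornology_small]
  and small_disk_hull = convex_bornologyD(4)[OF convex_bornology_small]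

instantiation complex :: bornological_vector_space
begin

definition small_complex :: "complex set \<Rightarrow> bool"
  where "small_complex S \<longleftrightarrow> bounded S"

instance
proof
  have "disk (cball (0::complex) r)" if "0 \<le> r" for r
  proof -
    have "cmod (of_real (1 - t) * x + of_real t * y) \<le> r"
      if "cmod x \<le> r" "cmod y \<le> r" "0 \<le> t" "t \<le> 1" for x y :: complex and t
    proof -
      have "cmod (of_real (1 - t) * x + of_real t * y) \<le> (1 - t) * cmod x + t * cmod y"
        using that
        by (intro order_trans[OF norm_triangle_ineq]) (simp add: norm_mult flip: of_real_diff)
      also have "\<dots> \<le> r" using that by (intro convex_bound_le) auto
      finally show ?thesis .
    qed
    moreover have "cmod (c * x) \<le> r" if "cmod x \<le> r" "cmod c \<le> 1" for c x :: complex
      using mult_mono[OF that(2,1)] by (simp add: norm_mult)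
    ultimately show ?thesis using \<open>0 \<le> r\<close> by (auto simp: disk_def scaleC_complex_def)
  qed
  then have hull: "bounded (disk_hull S)" if S: "bounded S" for S :: "complex set"
  proof -
    obtain r where "\<forall>x\<in>S. cmod x \<le> r" "0 < r" using S unfolding bounded_pos by blast
    then have "disk_hull S \<subseteq> cball 0 r" using \<open>\<And>r. 0 \<le> r \<Longrightarrow> disk (cball 0 r)\<close>
      by (intro disk_hull_least) auto
    then show ?thesis by (rule bounded_subset[OF bounded_cball])
  qed
  have "bounded (S + T)" if "bounded S" "bounded T" for S T :: "complex set"
  proof -
    have "S + T = (\<Union>x\<in>S. \<Union>y\<in>T. {x + y})" by (auto simp: set_plus_def)
    then show ?thesis using bounded_sums[OF that] by simp
  qed
  then show "convex_bornology (small :: complex set \<Rightarrow> bool)"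
    by (intro convex_bornologyI; unfold small_complex_def)
      (simp, erule (1) bounded_subset, simp, rule hull)
qed

end

lemma clinear_fst: "clinear (fst :: 'a::complex_vector \<times> 'b::complex_vector \<Rightarrow> 'a)"
  by (rule clinearI) (simp_all add: scaleC_prod_def)

lemma clinear_snd: "clinear (snd :: 'a::complex_vector \<times> 'b::complex_vector \<Rightarrow> 'b)"
  by (rule clinearI) (simp_all add: scaleC_prod_def)

instantiation prod :: (bornological_vector_space, bornological_vector_space) bornological_vector_space
begin

definition small_prod :: "('a \<times> 'b) set \<Rightarrow> bool"
  where "small_prod S \<longleftrightarrow> small (fst ` S) \<and> small (snd ` S)"

instance
  by standard
    (unfold small_prod_def, intro convex_bornology_conj convex_bornology_vimage clinear_fst
      clinear_snd convex_bornology_small)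

end

section \<open>Completions\<close>

abbreviation dilate :: "real \<Rightarrow> 'a::complex_vector set \<Rightarrow> 'a set"
  where "dilate r S \<equiv> (\<lambda>s. of_real r *\<^sub>C s) ` S"

lemma dilate_mono:
  assumes "disk S" "0 \<le> r" "r \<le> r'" "0 < r'"
  shows "dilate r S \<subseteq> dilate r' S"
proof
  fix x assume "x \<in> dilate r S"
  then obtain s where s: "s \<in> S" "x = of_real r *\<^sub>C s" by blast
  have "of_real (r / r') *\<^sub>C s \<in> S"
    using assms s by (intro disk_scale) (simp_all add: norm_divide)
  moreover have "x = of_real r' *\<^sub>C of_real (r / r') *\<^sub>C s"
    using assms s by (simp add: scaleC_scaleC)
  ultimately show "x \<in> dilate r' S" by blast
qed

lemma dilate_add:
  assumes "disk S" "x \<in> dilate r S" "y \<in> dilate q S" "0 < r" "0 < q"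
  shows "x + y \<in> dilate (r + q) S"
proof -
  obtain s t where st: "s \<in> S" "x = of_real r *\<^sub>C s" "t \<in> S" "y = of_real q *\<^sub>C t"
    using assms by blast
  let ?u = "of_real (1 - q / (r + q)) *\<^sub>C s + of_real (q / (r + q)) *\<^sub>C t"
  have "?u \<in> S" using assms st by (intro disk_convex) (auto simp: divide_simps)
  moreover have "x + y = of_real (r + q) *\<^sub>C ?u"
  proof -
    have "(r + q) * (1 - q / (r + q)) = r" "(r + q) * (q / (r + q)) = q"
      using assms by (auto simp: field_simps)
    then show ?thesis
      by (simp only: st scaleC_add_right scaleC_scaleC flip: of_real_mult)
  qed
  ultimately show ?thesis by blast
qed

lemma dilate_scale:
  assumes "disk S" "x \<in> dilate r S" "0 \<le> r" "cmod c * r \<le> q" "0 < q"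
  shows "c *\<^sub>C x \<in> dilate q S"
proof -
  obtain s where s: "s \<in> S" "x = of_real r *\<^sub>C s" using assms by blast
  have "(c * of_real r / of_real q) *\<^sub>C s \<in> S"
    using assms s by (intro disk_scale) (auto simp: norm_mult norm_divide divide_simps)
  moreover have "c *\<^sub>C x = of_real q *\<^sub>C (c * of_real r / of_real q) *\<^sub>C s"
    using assms s by (simp add: scaleC_scaleC)
  ultimately show ?thesis by blast
qed

lemma cspan_mono: "S \<subseteq> T \<Longrightarrow> cspan S \<subseteq> cspan T"
  unfolding cspan_eq by (rule complex_vector.span_mono)

lemmas csubspace_cspan = complex_vector.subspace_span[folded cspan_eq csubspace_eq]

lemmas cspan_add = complex_vector.span_add[folded cspan_eq]
  and cspan_diff = complex_vector.span_diff[folded cspan_eq]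
  and cspan_neg = complex_vector.span_neg[folded cspan_eq]
  and cspan_scale = complex_vector.span_scale[folded cspan_eq]
  and cspan_0 = complex_vector.span_zero[folded cspan_eq]
  and cspan_base = complex_vector.span_base[folded cspan_eq]

lemma cspan_disk:
  assumes "disk S" "x \<in> cspan S"
  shows "\<exists>r>0. x \<in> dilate r S"
proof -
  have "csubspace {x. \<exists>r>0. x \<in> dilate r S}"
    unfolding csubspace_def mem_Collect_eq
  proof (intro conjI allI ballI; (elim CollectE exE conjE)?)
    show "\<exists>r>0. 0 \<in> dilate r S"
      using disk_0[OF assms(1)] by (intro exI[of _ 1]) (auto simp: scaleC_one)
    show "\<exists>r>0. x + y \<in> dilate r S"
      if "0 < r" "x \<in> dilate r S" "0 < q" "y \<in> dilate q S" for x y r q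
      using that dilate_add[OF assms(1)] by (intro exI[of _ "r + q"]) simp
    show "\<exists>r>0. c *\<^sub>C x \<in> dilate r S" if "0 < r" "x \<in> dilate r S" for c x r
      using that by (intro exI[of _ "cmod c * r + 1"] conjI dilate_scale[OF assms(1), of _ r])
        (auto intro: add_nonneg_pos)
  qed
  moreover have "S \<subseteq> {x. \<exists>r>0. x \<in> dilate r S}"
    by (auto intro!: exI[of _ "1::real"] simp: scaleC_one)
  ultimately have "cspan S \<subseteq> {x. \<exists>r>0. x \<in> dilate r S}"
    unfolding cspan_eq csubspace_eq by (intro complex_vector.span_minimal)
  then show ?thesis using assms(2) by blast
qed

lemma gauge_norm_nonneg: "disk S \<Longrightarrow> x \<in> cspan S \<Longrightarrow> 0 \<le> gauge_norm S x"
  unfolding gauge_norm_def using cspan_disk[of S x] by (intro cInf_greatest) auto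

lemma gauge_norm_le: "x \<in> dilate r S \<Longrightarrow> 0 < r \<Longrightarrow> gauge_norm S x \<le> r"
  unfolding gauge_norm_def by (intro cInf_lower bdd_belowI[of _ 0]) auto

lemma gauge_norm_less:
  assumes "disk S" "x \<in> cspan S" "gauge_norm S x < r"
  shows "x \<in> dilate r S"
proof -
  obtain q where "0 < q" "x \<in> dilate q S" "q < r"
    using assms cspan_disk[OF assms(1,2)]
      cInf_lessD[of "{r. 0 < r \<and> x \<in> dilate r S}" r] unfolding gauge_norm_def by auto
  then show ?thesis using dilate_mono[OF assms(1), of q r] by auto
qed

lemma disk_Cauchy_iff:
  assumes "disk S"
  shows "disk_Cauchy S X \<longleftrightarrow> range X \<subseteq> cspan S \<and>
    (\<forall>e>0. \<exists>N. \<forall>m\<ge>N. \<forall>n\<ge>N. X m - X n \<in> dilate e S)"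
proof (intro iffI conjI allI impI)
  assume X: "disk_Cauchy S X"
  then show span: "range X \<subseteq> cspan S" by (simp add: disk_Cauchy_def)
  fix e :: real assume "0 < e"
  then obtain N where "\<forall>m\<ge>N. \<forall>n\<ge>N. gauge_norm S (X m - X n) < e"
    using X unfolding disk_Cauchy_def by blast
  moreover have "X m - X n \<in> cspan S" for m n using span by (intro cspan_diff) auto
  ultimately show "\<exists>N. \<forall>m\<ge>N. \<forall>n\<ge>N. X m - X n \<in> dilate e S"
    using gauge_norm_less[OF assms] by blast
next
  assume X: "range X \<subseteq> cspan S \<and> (\<forall>e>0. \<exists>N. \<forall>m\<ge>N. \<forall>n\<ge>N. X m - X n \<in> dilate e S)"
  have "\<exists>N. \<forall>m\<ge>N. \<forall>n\<ge>N. gauge_norm S (X m - X n) < e" if "0 < e" for e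
  proof -
    obtain N where N: "\<forall>m\<ge>N. \<forall>n\<ge>N. X m - X n \<in> dilate (e / 2) S"
      using X \<open>0 < e\<close> half_gt_zero by blast
    then have "\<forall>m\<ge>N. \<forall>n\<ge>N. gauge_norm S (X m - X n) \<le> e / 2"
      using N half_gt_zero[OF \<open>0 < e\<close>] gauge_norm_le by blast
    then show ?thesis using \<open>0 < e\<close> by (intro exI[of _ N]) fastforce
  qed
  then show "disk_Cauchy S X" using X by (simp add: disk_Cauchy_def)
qed

lemma disk_tendsto_iff:
  assumes "disk S"
  shows "disk_tendsto S X l \<longleftrightarrow> range X \<subseteq> cspan S \<and> l \<in> cspan S \<and>
    (\<forall>e>0. \<exists>N. \<forall>n\<ge>N. X n - l \<in> dilate e S)"
proof (intro iffI conjI allI impI)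
  assume X: "disk_tendsto S X l"
  then show span: "range X \<subseteq> cspan S" "l \<in> cspan S" by (simp_all add: disk_tendsto_def)
  fix e :: real assume "0 < e"
  then obtain N where "\<forall>n\<ge>N. \<bar>gauge_norm S (X n - l)\<bar> < e"
    using X LIMSEQ_D[of "\<lambda>n. gauge_norm S (X n - l)" 0 e] unfolding disk_tendsto_def by auto
  moreover have "X n - l \<in> cspan S" for n using span by (intro cspan_diff) auto
  ultimately show "\<exists>N. \<forall>n\<ge>N. X n - l \<in> dilate e S"
    using gauge_norm_less[OF assms] by (metis abs_less_iff)
next
  assume X: "range X \<subseteq> cspan S \<and> l \<in> cspan S \<and> (\<forall>e>0. \<exists>N. \<forall>n\<ge>N. X n - l \<in> dilate e S)"
  have nonneg: "0 \<le> gauge_norm S (X n - l)" for n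
    using X by (intro gauge_norm_nonneg assms cspan_diff) auto
  have "\<exists>N. \<forall>n\<ge>N. norm (gauge_norm S (X n - l) - 0) < e" if "0 < e" for e
  proof -
    obtain N where N: "\<forall>n\<ge>N. X n - l \<in> dilate (e / 2) S"
      using X \<open>0 < e\<close> half_gt_zero by blast
    then have "\<forall>n\<ge>N. gauge_norm S (X n - l) \<le> e / 2"
      using N half_gt_zero[OF \<open>0 < e\<close>] gauge_norm_le by blast
    then show ?thesis using \<open>0 < e\<close> nonneg by (intro exI[of _ N]) fastforce
  qed
  then show "disk_tendsto S X l" using X by (simp add: disk_tendsto_def LIMSEQ_iff)
qed

lemma disk_plus:
  assumes "disk S" "disk T"
  shows "disk (S + T)"
proof -
  have "(x + y) + (x' + y') = (x + x') + (y + y')" for x y x' y' :: 'a by simp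
  moreover have "S + T \<noteq> {}" using disk_0[OF assms(1)] disk_0[OF assms(2)] set_plus_intro by blast
  moreover have "c *\<^sub>C x \<in> S + T" if x: "x \<in> S + T" and c: "cmod c \<le> 1" for c x
  proof -
    obtain a b where "x = a + b" "a \<in> S" "b \<in> T" using x by (rule set_plus_elim)
    then show ?thesis using assms c by (simp add: scaleC_add_right set_plus_intro disk_scale)
  qed
  moreover have "of_real (1 - t) *\<^sub>C x + of_real t *\<^sub>C y \<in> S + T"
    if x: "x \<in> S + T" and y: "y \<in> S + T" and t: "t \<in> {0..1}" for x y t
  proof -
    obtain a b where "x = a + b" and m: "a \<in> S" "b \<in> T" using x by (rule set_plus_elim)
    moreover obtain a' b' where "y = a' + b'" and m': "a' \<in> S" "b' \<in> T"
      using y by (rule set_plus_elim)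
    ultimately have "of_real (1 - t) *\<^sub>C x + of_real t *\<^sub>C y =
        (of_real (1 - t) *\<^sub>C a + of_real t *\<^sub>C a') + (of_real (1 - t) *\<^sub>C b + of_real t *\<^sub>C b')"
      by (simp only: scaleC_add_right ac_simps)
    then show ?thesis
      using m m' t by (simp only:) (intro set_plus_intro disk_convex assms; simp)
  qed
  ultimately show ?thesis unfolding disk_def by blast
qed

lemma dilate_plus: "x \<in> dilate e S \<Longrightarrow> y \<in> dilate e T \<Longrightarrow> x + y \<in> dilate e (S + T)"
  by (auto simp: scaleC_add_right[symmetric] intro!: imageI set_plus_intro)

lemma subset_plus_disk: "disk T \<Longrightarrow> S \<subseteq> S + T" "disk S \<Longrightarrow> T \<subseteq> S + T"
  using set_plus_intro disk_0 by (metis add.right_neutral subsetI, metis add.left_neutral subsetI)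

lemma cspan_plus: "disk S \<Longrightarrow> disk T \<Longrightarrow> x \<in> cspan S \<Longrightarrow> y \<in> cspan T \<Longrightarrow> x + y \<in> cspan (S + T)"
  using subset_plus_disk[of T S] subset_plus_disk[of S T] cspan_mono by (intro cspan_add) blast+

lemma disk_Cauchy_add:
  assumes "disk S" "disk T" "disk_Cauchy S X" "disk_Cauchy T Y"
  shows "disk_Cauchy (S + T) (X + Y)"
  unfolding disk_Cauchy_iff[OF disk_plus[OF assms(1,2)]]
proof (intro conjI allI impI)
  show "range (X + Y) \<subseteq> cspan (S + T)"
    using assms by (auto intro!: cspan_plus simp: disk_Cauchy_def)
  fix e :: real assume "0 < e"
  then obtain N M where N: "\<forall>m\<ge>N. \<forall>n\<ge>N. X m - X n \<in> dilate e S"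
    and M: "\<forall>m\<ge>M. \<forall>n\<ge>M. Y m - Y n \<in> dilate e T"
    using assms by (metis disk_Cauchy_iff)
  have "(X + Y) m - (X + Y) n \<in> dilate e (S + T)" if "m \<ge> max N M" "n \<ge> max N M" for m n
    using dilate_plus[of "X m - X n" e S "Y m - Y n" T] N M that by (simp add: add_diff_add)
  then show "\<exists>N. \<forall>m\<ge>N. \<forall>n\<ge>N. (X + Y) m - (X + Y) n \<in> dilate e (S + T)" by blast
qed

lemma disk_tendsto_add:
  assumes "disk S" "disk T" "disk_tendsto S X l" "disk_tendsto T Y k"
  shows "disk_tendsto (S + T) (X + Y) (l + k)"
  unfolding disk_tendsto_iff[OF disk_plus[OF assms(1,2)]]
proof (intro conjI allI impI)
  show "range (X + Y) \<subseteq> cspan (S + T)" "l + k \<in> cspan (S + T)"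
    using assms by (auto intro!: cspan_plus simp: disk_tendsto_def)
  fix e :: real assume "0 < e"
  then obtain N M where N: "\<forall>n\<ge>N. X n - l \<in> dilate e S" and M: "\<forall>n\<ge>M. Y n - k \<in> dilate e T"
    using assms by (metis disk_tendsto_iff)
  have "(X + Y) n - (l + k) \<in> dilate e (S + T)" if "n \<ge> max N M" for n
    using dilate_plus[of "X n - l" e S "Y n - k" T] N M that by (simp add: add_diff_add)
  then show "\<exists>N. \<forall>n\<ge>N. (X + Y) n - (l + k) \<in> dilate e (S + T)" by blast
qed

lemma disk_Cauchy_scale:
  assumes "disk S" "disk_Cauchy S X"
  shows "disk_Cauchy S (\<lambda>n. c *\<^sub>C X n)"
  unfolding disk_Cauchy_iff[OF assms(1)]
proof (intro conjI allI impI)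
  show "range (\<lambda>n. c *\<^sub>C X n) \<subseteq> cspan S"
    using assms(2) by (auto intro!: cspan_scale simp: disk_Cauchy_def)
  fix e :: real assume e: "0 < e"
  define q where "q = e / (cmod c + 1)"
  have pos: "0 < cmod c + 1" by (simp add: add_nonneg_pos)
  have q: "0 < q" "cmod c * q \<le> e" using e pos by (auto simp: q_def field_simps)
  obtain N where N: "\<forall>m\<ge>N. \<forall>n\<ge>N. X m - X n \<in> dilate q S"
    using assms q disk_Cauchy_iff by metis
  show "\<exists>N. \<forall>m\<ge>N. \<forall>n\<ge>N. c *\<^sub>C X m - c *\<^sub>C X n \<in> dilate e S"
    using N q e assms(1)
    by (auto simp flip: complex_vector.scale_right_diff_distrib
        intro!: exI[of _ N] dilate_scale[of S _ q])
qed

lemma disk_tendsto_scale: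
  assumes "disk S" "disk_tendsto S X l"
  shows "disk_tendsto S (\<lambda>n. c *\<^sub>C X n) (c *\<^sub>C l)"
  unfolding disk_tendsto_iff[OF assms(1)]
proof (intro conjI allI impI)
  show "range (\<lambda>n. c *\<^sub>C X n) \<subseteq> cspan S" "c *\<^sub>C l \<in> cspan S"
    using assms(2) by (auto intro!: cspan_scale simp: disk_tendsto_def)
  fix e :: real assume e: "0 < e"
  define q where "q = e / (cmod c + 1)"
  have pos: "0 < cmod c + 1" by (simp add: add_nonneg_pos)
  have q: "0 < q" "cmod c * q \<le> e" using e pos by (auto simp: q_def field_simps)
  obtain N where N: "\<forall>n\<ge>N. X n - l \<in> dilate q S"
    using assms q disk_tendsto_iff by metis
  show "\<exists>N. \<forall>n\<ge>N. c *\<^sub>C X n - c *\<^sub>C l \<in> dilate e S"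
    using N q e assms(1)
    by (auto simp flip: complex_vector.scale_right_diff_distrib
        intro!: exI[of _ N] dilate_scale[of S _ q])
qed

lemma disk_Cauchy_const: "disk S \<Longrightarrow> x \<in> cspan S \<Longrightarrow> disk_Cauchy S (\<lambda>n. x)"
  using disk_0[of S] by (auto simp: disk_Cauchy_iff intro!: image_eqI[of _ _ 0])

lemma disk_tendsto_const: "disk S \<Longrightarrow> x \<in> cspan S \<Longrightarrow> disk_tendsto S (\<lambda>n. x) x"
  using disk_0[of S] by (auto simp: disk_tendsto_iff intro!: image_eqI[of _ _ 0])

text \<open>
  The completion of a bornological vector space is the separated inductive limit of the Banach
  space completions of the linear spans of the small disks.  It is built in two steps.  An element
  of the inductive limit is represented by a sequence that is Cauchy in the span of some small
  disk, and two such sequences are identified if their difference is a null sequence in the span of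
  some (larger) small disk; the closed unit ball of the completion of the span of \<open>S\<close> consists
  of the classes of the Cauchy sequences in \<open>S\<close>.
\<close>

definition Mackey_Cauchy :: "(nat \<Rightarrow> 'a::bornological_vector_space) \<Rightarrow> bool"
  where "Mackey_Cauchy X \<longleftrightarrow> (\<exists>S. small S \<and> disk S \<and> disk_Cauchy S X)"

definition Mackey_tendsto :: "(nat \<Rightarrow> 'a::bornological_vector_space) \<Rightarrow> 'a \<Rightarrow> bool"
  where "Mackey_tendsto X l \<longleftrightarrow> (\<exists>S. small S \<and> disk S \<and> disk_tendsto S X l)"

lemma Mackey_Cauchy_add: "Mackey_Cauchy X \<Longrightarrow> Mackey_Cauchy Y \<Longrightarrow> Mackey_Cauchy (X + Y)"
  unfolding Mackey_Cauchy_def by (meson disk_Cauchy_add disk_plus small_add)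

lemma Mackey_tendsto_add:
  "Mackey_tendsto X l \<Longrightarrow> Mackey_tendsto Y k \<Longrightarrow> Mackey_tendsto (X + Y) (l + k)"
  unfolding Mackey_tendsto_def by (meson disk_tendsto_add disk_plus small_add)

lemma Mackey_Cauchy_scale: "Mackey_Cauchy X \<Longrightarrow> Mackey_Cauchy (\<lambda>n. c *\<^sub>C X n)"
  unfolding Mackey_Cauchy_def
  by (elim exE conjE) (intro exI conjI disk_Cauchy_scale)

lemma Mackey_tendsto_scale:
  "Mackey_tendsto X l \<Longrightarrow> Mackey_tendsto (\<lambda>n. c *\<^sub>C X n) (c *\<^sub>C l)"
  unfolding Mackey_tendsto_def
  by (elim exE conjE) (intro exI conjI disk_tendsto_scale)

lemma Mackey_Cauchy_const: "Mackey_Cauchy (\<lambda>n. x)"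
  unfolding Mackey_Cauchy_def
  using disk_Cauchy_const cspan_base disk_disk_hull disk_hull_subset small_disk_hull small_singleton
  by (metis insert_subset)

lemma Mackey_tendsto_const: "Mackey_tendsto (\<lambda>n. x) x"
  unfolding Mackey_tendsto_def
  using disk_tendsto_const cspan_base disk_disk_hull disk_hull_subset small_disk_hull small_singleton
  by (metis insert_subset)

lemma scaleC_neg_one: "(\<lambda>n. (- 1) *\<^sub>C X n) = - X"
  by (simp add: fun_eq_iff complex_vector.scale_minus_left scaleC_one)

lemma Mackey_Cauchy_uminus: "Mackey_Cauchy X \<Longrightarrow> Mackey_Cauchy (- X)"
  using Mackey_Cauchy_scale[of X "- 1"] by (simp only: scaleC_neg_one[of X])

lemma Mackey_null_uminus: "Mackey_tendsto X 0 \<Longrightarrow> Mackey_tendsto (- X) 0"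
  using Mackey_tendsto_scale[of X 0 "- 1"] by (simp only: scaleC_neg_one[of X] complex_vector.scale_zero_right)

lemma Mackey_null_add:
  "Mackey_tendsto X 0 \<Longrightarrow> Mackey_tendsto Y 0 \<Longrightarrow> Mackey_tendsto (X + Y) 0"
  using Mackey_tendsto_add[of X 0 Y 0] by simp

definition Mackey_equiv ::
    "(nat \<Rightarrow> 'a::bornological_vector_space) \<Rightarrow> (nat \<Rightarrow> 'a) \<Rightarrow> bool"
  where "Mackey_equiv X Y \<longleftrightarrow> Mackey_Cauchy X \<and> Mackey_Cauchy Y \<and> Mackey_tendsto (X - Y) 0"

lemma part_equivp_Mackey_equiv: "part_equivp Mackey_equiv"
proof (rule part_equivpI)
  have "(\<lambda>n. 0) - (\<lambda>n. 0) = (\<lambda>n::nat. 0 :: 'a)" by (simp add: fun_eq_iff)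
  then show "\<exists>X :: nat \<Rightarrow> 'a. Mackey_equiv X X"
    using Mackey_Cauchy_const[of 0] Mackey_tendsto_const[of 0]
    by (intro exI[of _ "\<lambda>n. 0"]) (simp only: Mackey_equiv_def simp_thms)
  show "symp (Mackey_equiv :: (nat \<Rightarrow> 'a) \<Rightarrow> _)"
    unfolding Mackey_equiv_def by (rule sympI) (metis Mackey_null_uminus minus_diff_eq)
  show "transp (Mackey_equiv :: (nat \<Rightarrow> 'a) \<Rightarrow> _)"
  proof (rule transpI)
    fix X Y Z :: "nat \<Rightarrow> 'a"
    assume XY: "Mackey_equiv X Y" and YZ: "Mackey_equiv Y Z"
    have "Mackey_tendsto ((X - Y) + (Y - Z)) 0"
      using XY YZ unfolding Mackey_equiv_def by (elim conjE) (rule Mackey_null_add)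
    then show "Mackey_equiv X Z" using XY YZ by (simp add: Mackey_equiv_def)
  qed
qed

quotient_type (overloaded) 'a ind_completion =
  "nat \<Rightarrow> 'a::bornological_vector_space" / partial: Mackey_equiv
  by (rule part_equivp_Mackey_equiv)

instantiation ind_completion :: (bornological_vector_space) complex_vector
begin

lift_definition zero_ind_completion :: "'a ind_completion" is "\<lambda>n. 0"
  using Mackey_Cauchy_const[of 0] Mackey_tendsto_const[of 0]
  by (simp only: Mackey_equiv_def fun_diff_def diff_self simp_thms)

lift_definition plus_ind_completion :: "'a ind_completion \<Rightarrow> 'a ind_completion \<Rightarrow> 'a ind_completion"
  is "\<lambda>X Y. X + Y"
  unfolding Mackey_equiv_def add_diff_add
  by (intro conjI Mackey_Cauchy_add Mackey_null_add; elim conjE; assumption)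

lift_definition uminus_ind_completion :: "'a ind_completion \<Rightarrow> 'a ind_completion"
  is "\<lambda>X. - X"
  unfolding Mackey_equiv_def minus_diff_minus
  by (intro conjI Mackey_Cauchy_uminus Mackey_null_uminus; elim conjE; assumption)

definition minus_ind_completion :: "'a ind_completion \<Rightarrow> 'a ind_completion \<Rightarrow> 'a ind_completion"
  where "minus_ind_completion x y = x + - y"

lift_definition scaleC_ind_completion :: "complex \<Rightarrow> 'a ind_completion \<Rightarrow> 'a ind_completion"
  is "\<lambda>c X n. c *\<^sub>C X n"
proof -
  fix c and X Y :: "nat \<Rightarrow> 'a" assume XY: "Mackey_equiv X Y"
  have "(\<lambda>n. c *\<^sub>C X n) - (\<lambda>n. c *\<^sub>C Y n) = (\<lambda>n. c *\<^sub>C (X - Y) n)"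
    by (rule ext) (simp only: fun_diff_def complex_vector.scale_right_diff_distrib)
  moreover have "Mackey_tendsto (\<lambda>n. c *\<^sub>C (X - Y) n) 0"
    using Mackey_tendsto_scale[of "X - Y" 0 c] XY
    by (simp only: Mackey_equiv_def complex_vector.scale_zero_right)
  ultimately show "Mackey_equiv (\<lambda>n. c *\<^sub>C X n) (\<lambda>n. c *\<^sub>C Y n)"
    using XY by (simp only: Mackey_equiv_def Mackey_Cauchy_scale)
qed

instance
proof
  have eq: "Mackey_equiv X Y" if "X = Y" "Mackey_Cauchy X" for X Y :: "nat \<Rightarrow> 'a"
  proof -
    have "X - X = (\<lambda>n. 0)" by (simp add: fun_eq_iff)
    then show ?thesis
      using that Mackey_tendsto_const[of 0] by (simp only: Mackey_equiv_def simp_thms)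
  qed
  have Cauchy: "Mackey_Cauchy X" if "Mackey_equiv X X" for X :: "nat \<Rightarrow> 'a"
    using that by (simp add: Mackey_equiv_def)
  note intros = Mackey_Cauchy_add Mackey_Cauchy_uminus Mackey_Cauchy_scale Mackey_Cauchy_const
  fix x y z :: "'a ind_completion" and c d :: complex
  show "x + y + z = x + (y + z)"
    by transfer (rule eq; (intro intros)?; (drule Cauchy)+; simp add: fun_eq_iff add.assoc)
  show "x + y = y + x"
    by transfer (rule eq; (intro intros)?; (drule Cauchy)+; simp add: fun_eq_iff add.commute)
  show "0 + x = x"
    by transfer (rule eq; (intro intros)?; (drule Cauchy)+; simp add: fun_eq_iff)
  show "- x + x = 0"
    by transfer (rule eq; (intro intros)?; (drule Cauchy)+; simp add: fun_eq_iff)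
  show "x - y = x + - y" by (rule minus_ind_completion_def)
  show "c *\<^sub>C (x + y) = c *\<^sub>C x + c *\<^sub>C y"
    by transfer (rule eq; (intro intros)?; (drule Cauchy)+; simp add: fun_eq_iff scaleC_add_right)
  show "(c + d) *\<^sub>C x = c *\<^sub>C x + d *\<^sub>C x"
    by transfer (rule eq; (intro intros)?; (drule Cauchy)+; simp add: fun_eq_iff scaleC_add_left)
  show "c *\<^sub>C d *\<^sub>C x = (c * d) *\<^sub>C x"
    by transfer (rule eq; (intro intros)?; (drule Cauchy)+; simp add: fun_eq_iff scaleC_scaleC)
  show "1 *\<^sub>C x = x"
    by transfer (rule eq; (intro intros)?; (drule Cauchy)+; simp add: fun_eq_iff scaleC_one)
qed

end

instantiation ind_completion :: (bornological_vector_space) bornological_vector_space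
begin

definition small_ind_completion :: "'a ind_completion set \<Rightarrow> bool"
  where "small_ind_completion = generated_bornology
    {{abs_ind_completion X |X. range X \<subseteq> S \<and> disk_Cauchy S X} |S. small S \<and> disk S}"

instance
  by standard (simp add: small_ind_completion_def[abs_def] convex_bornology_generated)

end

text \<open>
  The second step divides out the closure of \<open>{0}\<close>, that is, the smallest subspace that is closed
  under the convergence of sequences in the spans of small disks.
\<close>

definition Mackey_closed :: "'a::bornological_vector_space set \<Rightarrow> bool"
  where "Mackey_closed L \<longleftrightarrow> (\<forall>X l. range X \<subseteq> L \<longrightarrow> Mackey_tendsto X l \<longrightarrow> l \<in> L)"

definition closed_cspan :: "'a::bornological_vector_space set \<Rightarrow> 'a set"
  where "closed_cspan S = \<Inter>{L. csubspace L \<and> Mackey_closed L \<and> S \<subseteq> L}"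

lemma csubspace_closed_cspan: "csubspace (closed_cspan S)"
  by (auto simp: closed_cspan_def csubspace_def)

lemma closed_cspan_0: "0 \<in> closed_cspan S"
  and closed_cspan_add: "x \<in> closed_cspan S \<Longrightarrow> y \<in> closed_cspan S \<Longrightarrow> x + y \<in> closed_cspan S"
  and closed_cspan_scale: "x \<in> closed_cspan S \<Longrightarrow> c *\<^sub>C x \<in> closed_cspan S"
  using csubspace_closed_cspan[of S] by (simp_all add: csubspace_def)

quotient_type (overloaded) 'a separated =
  "'a::bornological_vector_space" / "\<lambda>x y. x - y \<in> closed_cspan {0}"
  by (rule equivp_subspace[OF csubspace_closed_cspan])

instantiation separated :: (bornological_vector_space) complex_vector
begin

lift_definition zero_separated :: "'a separated" is 0 .

lift_definition plus_separated :: "'a separated \<Rightarrow> 'a separated \<Rightarrow> 'a separated"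
  is "(+)" by (rule subspace_cong(1)[OF csubspace_closed_cspan])

lift_definition minus_separated :: "'a separated \<Rightarrow> 'a separated \<Rightarrow> 'a separated"
  is "(-)" by (rule subspace_cong(2)[OF csubspace_closed_cspan])

lift_definition uminus_separated :: "'a separated \<Rightarrow> 'a separated"
  is uminus by (rule subspace_cong(3)[OF csubspace_closed_cspan])

lift_definition scaleC_separated :: "complex \<Rightarrow> 'a separated \<Rightarrow> 'a separated"
  is scaleC by (rule subspace_cong(4)[OF csubspace_closed_cspan])

instance
  by standard (transfer; simp add: csubspace_closed_cspan[unfolded csubspace_def] ac_simps
      scaleC_add_right scaleC_add_left scaleC_scaleC scaleC_one)+

end

instantiation separated :: (bornological_vector_space) bornological_vector_space
begin

definition small_separated :: "'a separated set \<Rightarrow> bool"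
  where "small_separated T \<longleftrightarrow> (\<exists>S. small S \<and> T = abs_separated ` S)"

instance
proof
  have "clinear (abs_separated :: 'a \<Rightarrow> _)"
    by (rule clinearI) (simp_all add: plus_separated.abs_eq scaleC_separated.abs_eq)
  moreover have "surj (abs_separated :: 'a \<Rightarrow> _)"
    using Quotient_abs_rep[OF Quotient_separated] by (rule surjI)
  ultimately show "convex_bornology (small :: 'a separated set \<Rightarrow> bool)"
    unfolding small_separated_def[abs_def]
    by (rule convex_bornology_image) (rule convex_bornology_small)
qed

end

type_synonym 'a completion = "'a ind_completion separated"

definition to_completion :: "'a::bornological_vector_space \<Rightarrow> 'a completion"
  where "to_completion x = abs_separated (abs_ind_completion (\<lambda>n. x))"

text \<open>The extension of a bounded linear map into a complete space to the completion, given by the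
  universal property.\<close>

definition completion_lift ::
    "('a::bornological_vector_space \<Rightarrow> 'b::bornological_vector_space) \<Rightarrow> 'a completion \<Rightarrow> 'b"
  where "completion_lift f =
    (THE g. bounded_clinear g \<and> (\<forall>x. g (to_completion x) = f x))"

text \<open>The completion of a bornological algebra is an algebra, with products computed on
  representatives.\<close>

instantiation ind_completion :: ("{bornological_vector_space, times}") times
begin

definition times_ind_completion :: "'a ind_completion \<Rightarrow> 'a ind_completion \<Rightarrow> 'a ind_completion"
  where "x * y = abs_ind_completion (\<lambda>n. rep_ind_completion x n * rep_ind_completion y n)"

instance ..

end

instantiation separated :: ("{bornological_vector_space, times}") times
begin

definition times_separated :: "'a separated \<Rightarrow> 'a separated \<Rightarrow> 'a separated"
  where "x * y = abs_separated (rep_separated x * rep_separated y)"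

instance ..

end

section \<open>Tensor products\<close>

definition tensor_relations ::
    "(('a::complex_vector \<times> 'b::complex_vector) \<Rightarrow>\<^sub>0 complex) set"
  where "tensor_relations =
    {basis (x + x', y) - basis (x, y) - basis (x', y) |x x' y. True} \<union>
    {basis (x, y + y') - basis (x, y) - basis (x, y') |x y y'. True} \<union>
    {basis (c *\<^sub>C x, y) - c *\<^sub>C basis (x, y) |c x y. True} \<union>
    {basis (x, c *\<^sub>C y) - c *\<^sub>C basis (x, y) |c x y. True}"

quotient_type (overloaded) ('a, 'b) tensor =
  "('a::complex_vector \<times> 'b::complex_vector) \<Rightarrow>\<^sub>0 complex"
  / "\<lambda>p q. p - q \<in> cspan tensor_relations"
  by (rule equivp_subspace[OF csubspace_cspan])

instantiation tensor :: (complex_vector, complex_vector) complex_vector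
begin

lift_definition zero_tensor :: "('a, 'b) tensor" is 0 .

lift_definition plus_tensor :: "('a, 'b) tensor \<Rightarrow> ('a, 'b) tensor \<Rightarrow> ('a, 'b) tensor"
  is "(+)" by (rule subspace_cong(1)[OF csubspace_cspan])

lift_definition minus_tensor :: "('a, 'b) tensor \<Rightarrow> ('a, 'b) tensor \<Rightarrow> ('a, 'b) tensor"
  is "(-)" by (rule subspace_cong(2)[OF csubspace_cspan])

lift_definition uminus_tensor :: "('a, 'b) tensor \<Rightarrow> ('a, 'b) tensor"
  is uminus by (rule subspace_cong(3)[OF csubspace_cspan])

lift_definition scaleC_tensor :: "complex \<Rightarrow> ('a, 'b) tensor \<Rightarrow> ('a, 'b) tensor"
  is scaleC by (rule subspace_cong(4)[OF csubspace_cspan])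

instance
  by standard (transfer; simp add: cspan_0 ac_simps
      scaleC_add_right scaleC_add_left scaleC_scaleC scaleC_one)+

end

lift_definition pure_tensor :: "'a::complex_vector \<Rightarrow> 'b::complex_vector \<Rightarrow> ('a, 'b) tensor"
  is "\<lambda>x y. basis (x, y)" .

instantiation tensor ::
  ("{complex_vector, small_sets}", "{complex_vector, small_sets}") bornological_vector_space
begin

definition small_tensor :: "('a, 'b) tensor set \<Rightarrow> bool"
  where "small_tensor = generated_bornology
    {{pure_tensor x y |x y. x \<in> S \<and> y \<in> T} |S T. small S \<and> small T}"

instance
  by standard (simp add: small_tensor_def[abs_def] convex_bornology_generated)

end

type_synonym ('a, 'b) ctensor = "('a, 'b) tensor completion"

definition ctensor_pure ::
    "'a::{complex_vector, small_sets} \<Rightarrow> 'b::{complex_vector, small_sets} \<Rightarrow> ('a, 'b) ctensor"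
  (infixl "\<otimes>\<^sub>c" 75)
  where "x \<otimes>\<^sub>c y = to_completion (pure_tensor x y)"

text \<open>The bounded linear map on the completed tensor product induced by a bounded bilinear map
  into a complete space.\<close>

definition ctensor_lift ::
    "('a::{complex_vector, small_sets} \<Rightarrow> 'b::{complex_vector, small_sets} \<Rightarrow>
      'c::bornological_vector_space) \<Rightarrow> ('a, 'b) ctensor \<Rightarrow> 'c"
  where "ctensor_lift f = (THE g. bounded_clinear g \<and> (\<forall>x y. g (x \<otimes>\<^sub>c y) = f x y))"

instantiation tensor :: ("{complex_vector, times}", "{complex_vector, times}") times
begin

definition times_tensor :: "('a, 'b) tensor \<Rightarrow> ('a, 'b) tensor \<Rightarrow> ('a, 'b) tensor"
  where "times_tensor = (THE m. cbilinear m \<and>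
    (\<forall>x y x' y'. m (pure_tensor x y) (pure_tensor x' y') = pure_tensor (x * x') (y * y')))"

instance ..

end

section \<open>Absolutely continuous homotopies\<close>

definition nonoverlapping :: "real \<Rightarrow> real \<Rightarrow> nat \<Rightarrow> (nat \<Rightarrow> real) \<Rightarrow> (nat \<Rightarrow> real) \<Rightarrow> bool"
  where "nonoverlapping a b n l r \<longleftrightarrow> (\<forall>i<n. a \<le> l i \<and> l i \<le> r i \<and> r i \<le> b) \<and>
    disjoint_family_on (\<lambda>i. {l i<..<r i}) {..<n}"

definition abs_continuous_on :: "real \<Rightarrow> real \<Rightarrow> (real \<Rightarrow> complex) \<Rightarrow> bool"
  where "abs_continuous_on a b f \<longleftrightarrow>
    (\<forall>e>0. \<exists>\<delta>>0. \<forall>n l r. nonoverlapping a b n l r \<longrightarrow> (\<Sum>i<n. r i - l i) < \<delta> \<longrightarrow>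
      (\<Sum>i<n. cmod (f (r i) - f (l i))) < e)"

lemma abs_continuous_on_const: "abs_continuous_on a b (\<lambda>t. c)"
  unfolding abs_continuous_on_def by (intro allI impI exI[of _ "1::real"] conjI) simp_all

text \<open>\<open>f\<close> is controlled by \<open>g\<close> and \<open>h\<close>; this covers sums, products and scalar multiples.\<close>

lemma abs_continuous_on_dominated:
  assumes g: "abs_continuous_on a b g" and h: "abs_continuous_on a b h" and "0 \<le> C"
    and f: "\<And>s t. a \<le> s \<Longrightarrow> s \<le> t \<Longrightarrow> t \<le> b \<Longrightarrow>
      cmod (f t - f s) \<le> C * (cmod (g t - g s) + cmod (h t - h s))"
  shows "abs_continuous_on a b f"
  unfolding abs_continuous_on_def
proof (intro allI impI)
  fix e :: real assume "0 < e"
  define q where "q = e / (C + 1) / 2"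
  have q: "0 < q" "C * (q + q) < e"
  proof -
    have C: "0 < C + 1" using \<open>0 \<le> C\<close> by simp
    then show "0 < q" using \<open>0 < e\<close> by (simp add: q_def)
    have "q + q = e / (C + 1)" by (simp only: q_def field_sum_of_halves)
    then have "C * (q + q) = e * (C / (C + 1))" by simp
    also have "\<dots> < e * 1" using C \<open>0 < e\<close> by (intro mult_strict_left_mono) simp_all
    finally show "C * (q + q) < e" by simp
  qed
  obtain d where d: "0 < d" "\<And>n l r. nonoverlapping a b n l r \<Longrightarrow> (\<Sum>i<n. r i - l i) < d \<Longrightarrow>
      (\<Sum>i<n. cmod (g (r i) - g (l i))) < q"
    using g[unfolded abs_continuous_on_def, rule_format, OF q(1)] by blast
  obtain d' where d': "0 < d'" "\<And>n l r. nonoverlapping a b n l r \<Longrightarrow> (\<Sum>i<n. r i - l i) < d' \<Longrightarrow>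
      (\<Sum>i<n. cmod (h (r i) - h (l i))) < q"
    using h[unfolded abs_continuous_on_def, rule_format, OF q(1)] by blast
  show "\<exists>\<delta>>0. \<forall>n l r. nonoverlapping a b n l r \<longrightarrow> (\<Sum>i<n. r i - l i) < \<delta> \<longrightarrow>
      (\<Sum>i<n. cmod (f (r i) - f (l i))) < e"
  proof (intro exI[of _ "min d d'"] conjI allI impI)
    show "0 < min d d'" using d(1) d'(1) by simp
    fix n l r
    assume lr: "nonoverlapping a b n l r" and len: "(\<Sum>i<n. r i - l i) < min d d'"
    have "(\<Sum>i<n. cmod (f (r i) - f (l i))) \<le>
        (\<Sum>i<n. C * (cmod (g (r i) - g (l i)) + cmod (h (r i) - h (l i))))"
      using lr by (intro sum_mono f) (simp_all add: nonoverlapping_def)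
    also have "\<dots> = C * ((\<Sum>i<n. cmod (g (r i) - g (l i))) + (\<Sum>i<n. cmod (h (r i) - h (l i))))"
      by (simp only: sum_distrib_left[symmetric] sum.distrib)
    also have "\<dots> \<le> C * (q + q)"
      using less_imp_le[OF d(2)[OF lr]] less_imp_le[OF d'(2)[OF lr]] len \<open>0 \<le> C\<close>
      by (intro mult_left_mono add_mono) simp_all
    finally show "(\<Sum>i<n. cmod (f (r i) - f (l i))) < e" using q(2) by simp
  qed
qed

lemma abs_continuous_on_continuous:
  assumes "abs_continuous_on a b f"
  shows "continuous_on {a..b} f"
  unfolding continuous_on_iff
proof (intro ballI allI impI)
  fix x e assume x: "x \<in> {a..b}" and "0 < (e::real)"
  obtain d where d: "0 < d" "\<And>n l r. nonoverlapping a b n l r \<Longrightarrow> (\<Sum>i<n. r i - l i) < d \<Longrightarrow>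
      (\<Sum>i<n. cmod (f (r i) - f (l i))) < e"
    using assms[unfolded abs_continuous_on_def, rule_format, OF \<open>0 < e\<close>] by blast
  have "dist (f y) (f x) < e" if y: "y \<in> {a..b}" "dist y x < d" for y
  proof -
    have "nonoverlapping a b 1 (\<lambda>_. min x y) (\<lambda>_. max x y)"
      using x y by (simp add: nonoverlapping_def disjoint_family_on_def)
    note * = d(2)[OF this]
    show ?thesis
    proof (cases "x \<le> y")
      case True
      then show ?thesis using * y(2) by (simp add: dist_norm max_def min_def)
    next
      case False
      then show ?thesis using * y(2) by (simp add: dist_norm max_def min_def norm_minus_commute)
    qed
  qed
  then show "\<exists>d>0. \<forall>y\<in>{a..b}. dist y x < d \<longrightarrow> dist (f y) (f x) < e" using d(1) by blast
qed

lemma abs_continuous_on_bounded: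
  assumes "abs_continuous_on a b f"
  shows "\<exists>M\<ge>0. \<forall>t\<in>{a..b}. cmod (f t) \<le> M"
proof -
  have "bounded (f ` {a..b})"
    by (intro compact_imp_bounded compact_continuous_image abs_continuous_on_continuous assms) simp
  then obtain M where "\<forall>x\<in>f ` {a..b}. cmod x \<le> M" "0 < M" unfolding bounded_pos by blast
  then show ?thesis by (intro exI[of _ M]) auto
qed

lemma abs_continuous_on_add:
  assumes "abs_continuous_on a b f" "abs_continuous_on a b g"
  shows "abs_continuous_on a b (\<lambda>t. f t + g t)"
  by (rule abs_continuous_on_dominated[OF assms, of 1])
    (auto simp: add_diff_add intro: norm_triangle_ineq)

lemma abs_continuous_on_mult:
  assumes f: "abs_continuous_on a b f" and g: "abs_continuous_on a b g"
  shows "abs_continuous_on a b (\<lambda>t. f t * g t)"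
proof -
  obtain M where M: "0 \<le> M" "\<forall>t\<in>{a..b}. cmod (f t) \<le> M"
    using abs_continuous_on_bounded[OF f] by blast
  obtain M' where M': "0 \<le> M'" "\<forall>t\<in>{a..b}. cmod (g t) \<le> M'"
    using abs_continuous_on_bounded[OF g] by blast
  show ?thesis
  proof (rule abs_continuous_on_dominated[OF f g, of "M + M'"])
    fix s t assume st: "a \<le> s" "s \<le> t" "t \<le> b"
    have "f t * g t - f s * g s = g t * (f t - f s) + f s * (g t - g s)"
      by (simp add: algebra_simps)
    then have "cmod (f t * g t - f s * g s) \<le> cmod (g t) * cmod (f t - f s) + cmod (f s) * cmod (g t - g s)"
      by (metis norm_mult norm_triangle_ineq)
    also have "\<dots> \<le> M' * cmod (f t - f s) + M * cmod (g t - g s)"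
      using M M' st by (intro add_mono mult_right_mono) auto
    also have "\<dots> \<le> (M + M') * (cmod (f t - f s) + cmod (g t - g s))"
      using M(1) M'(1) by (simp add: algebra_simps)
    finally show "cmod (f t * g t - f s * g s) \<le> (M + M') * (cmod (f t - f s) + cmod (g t - g s))" .
  qed (use M M' in simp)
qed

text \<open>A function on \<open>[0, 1]\<close> is represented by its extension by zero to the real line.\<close>

typedef AC = "{f. abs_continuous_on 0 1 f \<and> (\<forall>t. t \<notin> {0..1} \<longrightarrow> f t = 0)}"
  by (rule exI[of _ "\<lambda>t. 0"]) (simp add: abs_continuous_on_const)

setup_lifting type_definition_AC

instantiation AC :: complex_vector
begin

lift_definition zero_AC :: AC is "\<lambda>t. 0"
  by (simp add: abs_continuous_on_const)

lift_definition plus_AC :: "AC \<Rightarrow> AC \<Rightarrow> AC" is "\<lambda>f g t. f t + g t"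
  by (simp add: abs_continuous_on_add)

lift_definition scaleC_AC :: "complex \<Rightarrow> AC \<Rightarrow> AC" is "\<lambda>c f t. c * f t"
  by (simp add: abs_continuous_on_mult abs_continuous_on_const)

definition uminus_AC :: "AC \<Rightarrow> AC" where "uminus_AC f = (- 1) *\<^sub>C f"

definition minus_AC :: "AC \<Rightarrow> AC \<Rightarrow> AC" where "minus_AC f g = f + - g"

instance
  by standard
    (unfold minus_AC_def uminus_AC_def, (transfer, simp add: fun_eq_iff algebra_simps)+)

end

instantiation AC :: times
begin

lift_definition times_AC :: "AC \<Rightarrow> AC \<Rightarrow> AC" is "\<lambda>f g t. f t * g t"
  by (simp add: abs_continuous_on_mult)

instance ..

end

text \<open>An absolutely continuous function is differentiable almost everywhere, so that the value of
  \<open>vector_derivative\<close> at the remaining points does not affect the integral.\<close>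

definition AC_norm :: "AC \<Rightarrow> real"
  where "AC_norm f = cmod (Rep_AC f 0) +
    integral {0..1} (\<lambda>t. cmod (vector_derivative (Rep_AC f) (at t within {0..1})))"

instantiation AC :: small_sets
begin

definition small_AC :: "AC set \<Rightarrow> bool"
  where "small_AC F \<longleftrightarrow> (\<exists>C. \<forall>f\<in>F. AC_norm f \<le> C)"

instance ..

end

definition AC_eval :: "real \<Rightarrow> (AC, 'b::bornological_vector_space) ctensor \<Rightarrow> 'b"
  where "AC_eval t = ctensor_lift (\<lambda>f y. Rep_AC f t *\<^sub>C y)"

definition AC_homotopic ::
    "('a::complete_bornological_algebra \<Rightarrow> 'b::complete_bornological_algebra) \<Rightarrow> ('a \<Rightarrow> 'b) \<Rightarrow> bool"
  where "AC_homotopic f\<^sub>0 f\<^sub>1 \<longleftrightarrow>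
    (\<exists>\<Phi> :: 'a \<Rightarrow> (AC, 'b) ctensor. bounded_hom \<Phi> \<and>
      AC_eval 0 \<circ> \<Phi> = f\<^sub>0 \<and> AC_eval 1 \<circ> \<Phi> = f\<^sub>1)"

section \<open>Non-commutative differential forms and the analytic tensor algebra\<close>

text \<open>
  The generator \<open>(Some a\<^sub>0, [a\<^sub>1, \<dots>, a\<^sub>n])\<close> stands for \<open>a\<^sub>0 da\<^sub>1 \<dots> da\<^sub>n\<close> and
  \<open>(None, [a\<^sub>1, \<dots>, a\<^sub>n])\<close> for \<open>da\<^sub>1 \<dots> da\<^sub>n\<close>, subject to multilinearity.  The empty form
  \<open>(None, [])\<close> would be a unit; it is set to zero because forms of degree zero are elements of
  the non-unital algebra.
\<close>

definition omega_relations :: "(('a::complex_vector option \<times> 'a list) \<Rightarrow>\<^sub>0 complex) set"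
  where "omega_relations =
    {basis (None, [])} \<union>
    {basis (Some (x + y), as) - basis (Some x, as) - basis (Some y, as) |x y as. True} \<union>
    {basis (Some (c *\<^sub>C x), as) - c *\<^sub>C basis (Some x, as) |c x as. True} \<union>
    {basis (a, us @ (x + y) # vs) - basis (a, us @ x # vs) - basis (a, us @ y # vs)
      |a us x y vs. True} \<union>
    {basis (a, us @ (c *\<^sub>C x) # vs) - c *\<^sub>C basis (a, us @ x # vs) |a us c x vs. True}"

quotient_type (overloaded) 'a omega =
  "('a::complex_vector option \<times> 'a list) \<Rightarrow>\<^sub>0 complex" / "\<lambda>p q. p - q \<in> cspan omega_relations"
  by (rule equivp_subspace[OF csubspace_cspan])

instantiation omega :: (complex_vector) complex_vector
begin

lift_definition zero_omega :: "'a omega" is 0 .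

lift_definition plus_omega :: "'a omega \<Rightarrow> 'a omega \<Rightarrow> 'a omega"
  is "(+)" by (rule subspace_cong(1)[OF csubspace_cspan])

lift_definition minus_omega :: "'a omega \<Rightarrow> 'a omega \<Rightarrow> 'a omega"
  is "(-)" by (rule subspace_cong(2)[OF csubspace_cspan])

lift_definition uminus_omega :: "'a omega \<Rightarrow> 'a omega"
  is uminus by (rule subspace_cong(3)[OF csubspace_cspan])

lift_definition scaleC_omega :: "complex \<Rightarrow> 'a omega \<Rightarrow> 'a omega"
  is scaleC by (rule subspace_cong(4)[OF csubspace_cspan])

instance
  by standard (transfer; simp add: cspan_0 ac_simps
      scaleC_add_right scaleC_add_left scaleC_scaleC scaleC_one)+

end

lift_definition form :: "'a::complex_vector option \<Rightarrow> 'a list \<Rightarrow> 'a omega"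
  is "\<lambda>a as. basis (a, as)" .

abbreviation proper_form :: "'a option \<Rightarrow> 'a list \<Rightarrow> bool"
  where "proper_form a as \<equiv> (a, as) \<noteq> (None, [])"

instantiation omega :: (bornological_vector_space) bornological_vector_space
begin

definition small_omega :: "'a omega set \<Rightarrow> bool"
  where "small_omega = generated_bornology
    {{form a as |a as. set_option a \<union> set as \<subseteq> S \<and> proper_form a as} |S. small S}"

instance
  by standard (simp add: small_omega_def[abs_def] convex_bornology_generated)

end

text \<open>\<open>form_mult a (rev as) b bs\<close> is the product of \<open>form a as\<close> with \<open>b db\<^sub>1 \<dots> db\<^sub>n\<close>; the
  second equation is the Leibniz rule \<open>da b = d(a b) - a db\<close>.\<close>

fun form_mult ::
    "'a::{complex_vector, times} option \<Rightarrow> 'a list \<Rightarrow> 'a \<Rightarrow> 'a list \<Rightarrow> 'a omega" where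
  "form_mult None [] b bs = form (Some b) bs"
| "form_mult (Some a\<^sub>0) [] b bs = form (Some (a\<^sub>0 * b)) bs"
| "form_mult a\<^sub>0 (a # as) b bs =
    form a\<^sub>0 (rev as @ (a * b) # bs) - form_mult a\<^sub>0 as a (b # bs)"

instantiation omega :: ("{complex_vector, times}") times
begin

definition times_omega :: "'a omega \<Rightarrow> 'a omega \<Rightarrow> 'a omega"
  where "times_omega = (THE m. cbilinear m \<and>
    (\<forall>a as b bs. proper_form a as \<longrightarrow> m (form a as) (form (Some b) bs) = form_mult a (rev as) b bs) \<and>
    (\<forall>a as bs. proper_form a as \<longrightarrow> bs \<noteq> [] \<longrightarrow> m (form a as) (form None bs) = form a (as @ bs)))"

instance ..

end

definition omega_d :: "'a::complex_vector omega \<Rightarrow> 'a omega"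
  where "omega_d = (THE D. clinear D \<and>
    (\<forall>a as. D (form (Some a) as) = form None (a # as)) \<and> (\<forall>as. D (form None as) = 0))"

type_synonym 'a omega_an = "'a omega completion"

definition omega_an_d :: "'a::bornological_vector_space omega_an \<Rightarrow> 'a omega_an"
  where "omega_an_d = completion_lift (\<lambda>x. to_completion (omega_d x))"

text \<open>The even part of \<open>\<Omega>\<^sub>a\<^sub>n A\<close> is the closure of the space of even forms.\<close>

typedef (overloaded) 'a tensor_alg =
  "closed_cspan {to_completion (form a as) |a as. even (length as)} ::
    'a::bornological_vector_space omega_an set"
  by (rule exI[of _ 0]) (rule closed_cspan_0)

setup_lifting type_definition_tensor_alg

instantiation tensor_alg :: (bornological_vector_space) complex_vector
begin

lift_definition zero_tensor_alg :: "'a tensor_alg" is 0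
  by (rule closed_cspan_0)

lift_definition plus_tensor_alg :: "'a tensor_alg \<Rightarrow> 'a tensor_alg \<Rightarrow> 'a tensor_alg" is "(+)"
  by (rule closed_cspan_add)

lift_definition scaleC_tensor_alg :: "complex \<Rightarrow> 'a tensor_alg \<Rightarrow> 'a tensor_alg" is scaleC
  by (rule closed_cspan_scale)

definition uminus_tensor_alg :: "'a tensor_alg \<Rightarrow> 'a tensor_alg"
  where "uminus_tensor_alg x = (- 1) *\<^sub>C x"

definition minus_tensor_alg :: "'a tensor_alg \<Rightarrow> 'a tensor_alg \<Rightarrow> 'a tensor_alg"
  where "minus_tensor_alg x y = x + - y"

instance
  by standard
    (unfold minus_tensor_alg_def uminus_tensor_alg_def, (transfer,
      simp add: ac_simps scaleC_add_right scaleC_add_left scaleC_scaleC scaleC_one)+)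

end

instantiation tensor_alg :: (bornological_vector_space) bornological_vector_space
begin

definition small_tensor_alg :: "'a tensor_alg set \<Rightarrow> bool"
  where "small_tensor_alg S \<longleftrightarrow> small (Rep_tensor_alg ` S)"

instance
proof
  have "clinear (Rep_tensor_alg :: 'a tensor_alg \<Rightarrow> _)"
    by (rule clinearI) (simp_all add: plus_tensor_alg.rep_eq scaleC_tensor_alg.rep_eq)
  then show "convex_bornology (small :: 'a tensor_alg set \<Rightarrow> bool)"
    unfolding small_tensor_alg_def[abs_def]
    by (rule convex_bornology_vimage) (rule convex_bornology_small)
qed

end

text \<open>The Fedosov product \<open>x \<odot> y = x y - dx dy\<close> on forms of even degree.\<close>

instantiation tensor_alg :: ("{bornological_vector_space, times}") times
begin

definition times_tensor_alg :: "'a tensor_alg \<Rightarrow> 'a tensor_alg \<Rightarrow> 'a tensor_alg"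
  where "x * y = Abs_tensor_alg (Rep_tensor_alg x * Rep_tensor_alg y -
    omega_an_d (Rep_tensor_alg x) * omega_an_d (Rep_tensor_alg y))"

instance ..

end

definition even_form :: "'a::bornological_vector_space option \<Rightarrow> 'a list \<Rightarrow> 'a tensor_alg"
  where "even_form a as = Abs_tensor_alg (to_completion (form a as))"

definition tensor_alg_map ::
    "('a::bornological_vector_space \<Rightarrow> 'b::bornological_vector_space) \<Rightarrow>
      'a tensor_alg \<Rightarrow> 'b tensor_alg"
  where "tensor_alg_map f = (THE g. bounded_clinear g \<and>
    (\<forall>a as. even (length as) \<longrightarrow> g (even_form a as) = even_form (map_option f a) (map f as)))"

section \<open>The X-complex\<close>

text \<open>The unitalisation \<open>R\<^sup>+\<close> is \<open>R \<times> \<complex>\<close>; \<open>(0, 1)\<close> is its unit.  The products of elements of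
  \<open>R\<^sup>+\<close> with elements of \<open>R\<close> lie in \<open>R\<close>.\<close>

type_synonym 'r unitalisation = "'r \<times> complex"

definition unital_mult_right ::
    "'r::{complex_vector, times} unitalisation \<Rightarrow> 'r \<Rightarrow> 'r"  (infixl "\<cdot>\<^sub>r" 70)
  where "x \<cdot>\<^sub>r y = fst x * y + snd x *\<^sub>C y"

definition unital_mult_left ::
    "'r::{complex_vector, times} \<Rightarrow> 'r unitalisation \<Rightarrow> 'r"  (infixl "\<cdot>\<^sub>l" 70)
  where "y \<cdot>\<^sub>l x = y * fst x + snd x *\<^sub>C y"

text \<open>The form \<open>\<langle>x\<^sub>0\<rangle> dx\<^sub>1 \<dots> dx\<^sub>n\<close> is \<open>x\<^sub>0 \<otimes> x\<^sub>1 \<otimes> \<dots> \<otimes> x\<^sub>n\<close>.\<close>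

type_synonym 'r Omega1 = "('r unitalisation, 'r) ctensor"
type_synonym 'r Omega2 = "('r Omega1, 'r) ctensor"

definition hochschild_b ::
    "'r::{bornological_vector_space, times} Omega2 \<Rightarrow> 'r Omega1"
  where "hochschild_b = (THE g. bounded_clinear g \<and>
    (\<forall>x\<^sub>0 x\<^sub>1 x\<^sub>2. g (x\<^sub>0 \<otimes>\<^sub>c x\<^sub>1 \<otimes>\<^sub>c x\<^sub>2) =
      (x\<^sub>0 \<cdot>\<^sub>r x\<^sub>1, 0) \<otimes>\<^sub>c x\<^sub>2 - x\<^sub>0 \<otimes>\<^sub>c (x\<^sub>1 * x\<^sub>2) + (x\<^sub>2 \<cdot>\<^sub>l x\<^sub>0, 0) \<otimes>\<^sub>c x\<^sub>1))"

text \<open>The range of the linear map \<open>hochschild_b\<close> is already a subspace.\<close>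

quotient_type (overloaded) 'r X1 =
  "'r::{bornological_vector_space, times} Omega1"
  / "\<lambda>x y. x - y \<in> cspan (range (hochschild_b :: 'r Omega2 \<Rightarrow> 'r Omega1))"
  by (rule equivp_subspace[OF csubspace_cspan])

instantiation X1 :: ("{bornological_vector_space, times}") complex_vector
begin

lift_definition zero_X1 :: "'a X1" is 0 .

lift_definition plus_X1 :: "'a X1 \<Rightarrow> 'a X1 \<Rightarrow> 'a X1"
  is "(+)" by (rule subspace_cong(1)[OF csubspace_cspan])

lift_definition minus_X1 :: "'a X1 \<Rightarrow> 'a X1 \<Rightarrow> 'a X1"
  is "(-)" by (rule subspace_cong(2)[OF csubspace_cspan])

lift_definition uminus_X1 :: "'a X1 \<Rightarrow> 'a X1"
  is uminus by (rule subspace_cong(3)[OF csubspace_cspan])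

lift_definition scaleC_X1 :: "complex \<Rightarrow> 'a X1 \<Rightarrow> 'a X1"
  is scaleC by (rule subspace_cong(4)[OF csubspace_cspan])

instance
  by standard (transfer; simp add: cspan_0 ac_simps
      scaleC_add_right scaleC_add_left scaleC_scaleC scaleC_one)+

end

instantiation X1 :: ("{bornological_vector_space, times}") bornological_vector_space
begin

definition small_X1 :: "'a X1 set \<Rightarrow> bool"
  where "small_X1 T \<longleftrightarrow> (\<exists>S. small S \<and> T = abs_X1 ` S)"

instance
proof
  have "clinear (abs_X1 :: 'a Omega1 \<Rightarrow> _)"
    by (rule clinearI) (simp_all add: plus_X1.abs_eq scaleC_X1.abs_eq)
  moreover have "surj (abs_X1 :: 'a Omega1 \<Rightarrow> _)"
    using Quotient_abs_rep[OF Quotient_X1] by (rule surjI)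
  ultimately show "convex_bornology (small :: 'a X1 set \<Rightarrow> bool)"
    unfolding small_X1_def[abs_def]
    by (rule convex_bornology_image) (rule convex_bornology_small)
qed

end

definition X1_form :: "'r::{bornological_vector_space, times} unitalisation \<Rightarrow> 'r \<Rightarrow> 'r X1"
  where "X1_form x y = abs_X1 (x \<otimes>\<^sub>c y)"

definition X_boundary0 :: "'r::{bornological_vector_space, times} \<Rightarrow> 'r X1"
  where "X_boundary0 x = X1_form (0, 1) x"

definition X_boundary1 :: "'r::{bornological_vector_space, times} X1 \<Rightarrow> 'r"
  where "X_boundary1 = (THE g. bounded_clinear g \<and> (\<forall>x y. g (X1_form x y) = x \<cdot>\<^sub>r y - y \<cdot>\<^sub>l x))"

text \<open>A \<open>\<int>/2\<close>-graded space is a pair; degrees are natural numbers, of which only the parity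
  matters.\<close>

type_synonym 'r X = "'r \<times> 'r X1"

definition degree_part :: "nat \<Rightarrow> ('v::zero \<times> 'w::zero) set"
  where "degree_part k = (if even k then UNIV \<times> {0} else {0} \<times> UNIV)"

definition X_boundary :: "'r::{bornological_vector_space, times} X \<Rightarrow> 'r X"
  where "X_boundary z = (X_boundary1 (snd z), X_boundary0 (fst z))"

definition Omega1_map ::
    "('r::{bornological_vector_space, times} \<Rightarrow> 's::{bornological_vector_space, times}) \<Rightarrow>
      'r Omega1 \<Rightarrow> 's Omega1"
  where "Omega1_map f = ctensor_lift (\<lambda>x y. (f (fst x), snd x) \<otimes>\<^sub>c f y)"

text \<open>For a bounded homomorphism \<open>f\<close>, the map \<open>Omega1_map f\<close> is compatible with \<open>hochschild_b\<close>,
  so that the choice of a representative does not matter.\<close>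

definition X1_map ::
    "('r::{bornological_vector_space, times} \<Rightarrow> 's::{bornological_vector_space, times}) \<Rightarrow>
      'r X1 \<Rightarrow> 's X1"
  where "X1_map f \<xi> = abs_X1 (Omega1_map f (rep_X1 \<xi>))"

definition X_map ::
    "('r::{bornological_vector_space, times} \<Rightarrow> 's::{bornological_vector_space, times}) \<Rightarrow>
      'r X \<Rightarrow> 's X"
  where "X_map f z = (f (fst z), X1_map f (snd z))"

section \<open>Analytic cyclic homology and cohomology\<close>

type_synonym 'a XT = "'a tensor_alg X"

definition XT_map ::
    "('a::complete_bornological_algebra \<Rightarrow> 'b::complete_bornological_algebra) \<Rightarrow> 'a XT \<Rightarrow> 'b XT"
  where "XT_map f = X_map (tensor_alg_map f)"

text \<open>Homology classes are cosets \<open>z +o B\<close> of the group \<open>B\<close> of boundaries.\<close>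

definition HA_boundaries :: "nat \<Rightarrow> 'a::complete_bornological_algebra XT set"
  where "HA_boundaries k = X_boundary ` degree_part (k + 1)"

definition HA_homology :: "nat \<Rightarrow> 'a::complete_bornological_algebra XT set set"
  where "HA_homology k = {z +o HA_boundaries k |z. z \<in> degree_part k \<and> X_boundary z = 0}"

definition XT_functionals :: "nat \<Rightarrow> ('a::complete_bornological_algebra XT \<Rightarrow> complex) set"
  where "XT_functionals k = {\<phi>. bounded_clinear \<phi> \<and> (\<forall>z\<in>degree_part (k + 1). \<phi> z = 0)}"

definition HA_coboundaries :: "nat \<Rightarrow> ('a::complete_bornological_algebra XT \<Rightarrow> complex) set"
  where "HA_coboundaries k = (\<lambda>\<phi>. \<phi> \<circ> X_boundary) ` XT_functionals (k + 1)"

definition HA_cohomology :: "nat \<Rightarrow> ('a::complete_bornological_algebra XT \<Rightarrow> complex) set set"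
  where "HA_cohomology k =
    {\<phi> +o HA_coboundaries k |\<phi>. \<phi> \<in> XT_functionals k \<and> \<phi> \<circ> X_boundary = 0}"

definition XT_homs ::
    "nat \<Rightarrow> ('a::complete_bornological_algebra XT \<Rightarrow> 'b::complete_bornological_algebra XT) set"
  where "XT_homs k = {\<phi>. bounded_clinear \<phi> \<and>
    (\<forall>j. \<phi> ` degree_part j \<subseteq> degree_part (j + k))}"

definition hom_boundary ::
    "nat \<Rightarrow> ('a::complete_bornological_algebra XT \<Rightarrow> 'b::complete_bornological_algebra XT) \<Rightarrow>
      'a XT \<Rightarrow> 'b XT"
  where "hom_boundary k \<phi> z = X_boundary (\<phi> z) - (- 1) ^ k *\<^sub>C \<phi> (X_boundary z)"

definition HA_hom_boundaries ::
    "nat \<Rightarrow> ('a::complete_bornological_algebra XT \<Rightarrow> 'b::complete_bornological_algebra XT) set"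
  where "HA_hom_boundaries k = hom_boundary (k + 1) ` XT_homs (k + 1)"

definition HA_bivariant ::
    "nat \<Rightarrow> ('a::complete_bornological_algebra XT \<Rightarrow> 'b::complete_bornological_algebra XT) set set"
  where "HA_bivariant k =
    {\<phi> +o HA_hom_boundaries k |\<phi>. \<phi> \<in> XT_homs k \<and> hom_boundary k \<phi> = 0}"

definition HA_class ::
    "('a::complete_bornological_algebra \<Rightarrow> 'b::complete_bornological_algebra) \<Rightarrow>
      ('a XT \<Rightarrow> 'b XT) set"
  where "HA_class f = XT_map f +o HA_hom_boundaries 0"

text \<open>Composition with \<open>[f]\<close>, computed on representatives; the result does not depend on the
  choice of the representative, so the union is that of a constant family.\<close>

definition HA_homology_map ::
    "nat \<Rightarrow> ('a::complete_bornological_algebra \<Rightarrow> 'b::complete_bornological_algebra) \<Rightarrow>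
      'a XT set \<Rightarrow> 'b XT set"
  where "HA_homology_map k f \<zeta> = (\<Union>z\<in>\<zeta>. XT_map f z +o HA_boundaries k)"

definition HA_cohomology_map ::
    "nat \<Rightarrow> ('a::complete_bornological_algebra \<Rightarrow> 'b::complete_bornological_algebra) \<Rightarrow>
      ('b XT \<Rightarrow> complex) set \<Rightarrow> ('a XT \<Rightarrow> complex) set"
  where "HA_cohomology_map k f \<xi> = (\<Union>\<phi>\<in>\<xi>. (\<phi> \<circ> XT_map f) +o HA_coboundaries k)"

definition HA_bivariant_push ::
    "nat \<Rightarrow> ('a::complete_bornological_algebra \<Rightarrow> 'b::complete_bornological_algebra) \<Rightarrow>
      ('d::complete_bornological_algebra XT \<Rightarrow> 'a XT) set \<Rightarrow> ('d XT \<Rightarrow> 'b XT) set"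
  where "HA_bivariant_push k f \<kappa> = (\<Union>\<phi>\<in>\<kappa>. (XT_map f \<circ> \<phi>) +o HA_hom_boundaries k)"

definition HA_bivariant_pull ::
    "nat \<Rightarrow> ('a::complete_bornological_algebra \<Rightarrow> 'b::complete_bornological_algebra) \<Rightarrow>
      ('b XT \<Rightarrow> 'd::complete_bornological_algebra XT) set \<Rightarrow> ('a XT \<Rightarrow> 'd XT) set"
  where "HA_bivariant_pull k f \<kappa> = (\<Union>\<phi>\<in>\<kappa>. (\<phi> \<circ> XT_map f) +o HA_hom_boundaries k)"

end

theory Submission
  imports Defs
begin

text \<open>
  An AC-homotopy extends to a bounded homomorphism \<open>F\<close> from \<open>R = \<T>A\<close> to \<open>AC([0,1]; \<T>B)\<close>, because the
  linear map it induces has analytically nilpotent curvature. By the universal property of \<open>R\<close> there is a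
  connection \<open>\<phi> : R \<rightarrow> \<Omega>\<^sup>2R\<close> with \<open>\<phi>(xy) = x \<phi>(y) + \<phi>(x) y + dx dy\<close> that vanishes on the generators; let
  \<open>\<psi>(x dy) = x \<phi>(y)\<close>. The homotopy between the two maps of X-complexes is Cartan's formula:
  \<open>h\<^sub>0(x)\<close> is the integral over \<open>[0,1]\<close> of the derivative of \<open>F\<close> contracted with \<open>\<phi>(x)\<close>, and \<open>h\<^sub>1(\<omega>)\<close> that of its contraction
  with \<open>\<omega> + b \<psi>(\<omega>)\<close>. The second homotopy identity only has to be checked modulo commutators on the forms
  \<open>x da\<close> with \<open>a\<close> a generator, since the operator \<open>1 + b \<psi>\<close> vanishes on commutators and a trace on
  \<open>\<Omega>\<^sup>1R\<close> is determined by its values on such forms.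
\<close>

section \<open>Bornologies and completions\<close>

text \<open>A trace can be compared on generators only if its target is separated, while the second
  homotopy identity is wanted modulo commutators. So the commutator occurring on x da is exhibited
  as the image of an explicit bounded map \<open>beta\<close>; the identity becomes an equation
  between one-forms, and the space of commutators need not be known to be closed. The derivative of
  F(x) is in general merely integrable in t, hence no element of AC([0,1]; TB). It enters only
  through the form \<open>AC_int\<close>, the integral of f g', with a weight c carried along:
  multiplying the integrand by f \<otimes> s moves f into the weight and lets s act on the result.
  Thus all integrals are operations on completed tensor products. Nilpotent curvature means a small
  set stable under multiplication by curvatures. For the homotopy it comes from the ball of radius
  1/2 in AC, closed under products since the norm of f g is at most twice the product of the norms;
  for the connection, from doubling the entries of forms, which gains 1/4 per curvature. The norm of
  AC is given by pointwise derivatives. Radon-Nikodym provides a density, and Henstock's lemma with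
  Vitali's theorem identifies it with the derivative.\<close>

lemma dilate_one [simp]: "dilate 1 S = S" by (simp add: scaleC_one)

lemma dilateI: "y \<in> S ==> x = of_real r *\<^sub>C y ==> x \<in> dilate r S" by blast

lemma clinear_scaleC: "clinear (\<lambda>x::'a::complex_vector. c *\<^sub>C x)"
  by (rule clinearI) (simp_all add: scaleC_add_right scaleC_scaleC mult.commute)

lemma clinear_uminus: "clinear f ==> f (- x) = - f x" by (metis add.right_inverse add_eq_0_iff clinear_add clinear_zero)

lemma clinear_diff: "clinear f ==> f (x - y) = f x - f y"
  by (metis clinear_add clinear_uminus uminus_add_conv_diff add.commute)

lemma clinear_compose: "clinear f ==> clinear g ==> clinear (\<lambda>x. g (f x))"
  by (intro clinearI) (simp_all add: clinear_add clinear_scale)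

lemma clinear_plus: "clinear f ==> clinear g ==> clinear (\<lambda>x. f x + g x)"
  by (intro clinearI) (simp_all add: clinear_add clinear_scale scaleC_add_right algebra_simps)

lemma clinear_minus: "clinear f ==> clinear g ==> clinear (\<lambda>x. f x - g x)" by (intro clinearI)
    (simp_all add: clinear_add clinear_scale complex_vector.scale_right_diff_distrib algebra_simps)

lemma clinear_neg: "clinear f ==> clinear (\<lambda>x. - f x)"
  by (intro clinearI) (simp_all add: clinear_add clinear_scale complex_vector.scale_minus_right)

lemma clinear_const_zero: "clinear (\<lambda>x. 0)" by (intro clinearI) simp_all

lemma clinear_id: "clinear (\<lambda>x. x)" by (intro clinearI) simp_all

lemma clinear_scaleC_fun: "clinear f ==> clinear (\<lambda>x. c *\<^sub>C f x)" using clinear_compose[OF _ clinear_scaleC] .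

lemma dilate_image: "clinear f ==> f ` dilate r S = dilate r (f ` S)" by (simp add: image_image clinear_scale)

lemma disk_dilate: "disk S ==> disk (dilate r S)" by (rule disk_image[OF clinear_scaleC])

lemma dilate_uminus: "disk S ==> x \<in> dilate r S ==> - x \<in> dilate r S" using disk_scale[OF disk_dilate, of S x r "-1"]
  by (simp add: complex_vector.scale_minus_left scaleC_one)

lemma dilate_diff:
  "disk S ==> x \<in> dilate r S ==> y \<in> dilate q S ==> 0 < r ==> 0 < q ==> x - y \<in> dilate (r + q) S"
  using dilate_add[of S x r "- y" q] dilate_uminus[of S y q] by simp

lemma dilate_cspan: "x \<in> dilate r S ==> x \<in> cspan S" by (auto intro: cspan_scale cspan_base)

lemma disk_zero_dilate: "disk S ==> 0 \<in> dilate r S" by (rule disk_0[OF disk_dilate])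

lemma disk_add_dilate: "disk S ==> x \<in> S ==> y \<in> S ==> x + y \<in> dilate 2 S" using dilate_add[of S x 1 y 1] by simp

lemma disk_uminus: "disk S ==> x \<in> S ==> - x \<in> S" using dilate_uminus[of S x 1] by simp

lemma dilate_inverse_mem:
  assumes r: "0 < r"
  shows "x \<in> dilate r S \<longleftrightarrow> of_real (1 / r) *\<^sub>C x \<in> S"
proof
  assume "of_real (1 / r) *\<^sub>C x \<in> S"
  thus "x \<in> dilate r S" using r by (intro dilateI[of "of_real (1 / r) *\<^sub>C x"]) (simp_all add: scaleC_scaleC scaleC_one)
qed (use r in \<open>auto simp: scaleC_scaleC scaleC_one\<close>)

lemma small_hull_disk: "small S ==> \<exists>D. small D \<and> disk D \<and> (S :: 'a::bornological_vector_space set) \<subseteq> D"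
  using small_disk_hull disk_disk_hull disk_hull_subset by metis

text \<open>The axioms of a bornology contain sums and disk hulls but no scalar multiples. An
  integer multiple of a disk lies in an iterated sum of it, and any other factor is absorbed by a
  larger integer.\<close>

lemma small_dilate:
  assumes "small (S :: 'a::bornological_vector_space set)"
  shows "small (dilate r S)"
proof -
  let ?D = "disk_hull S"
  have D: "small ?D" "disk ?D" using assms by (simp_all add: small_disk_hull disk_disk_hull)
  have *: "small (dilate (real (Suc n)) ?D)" for n
  proof (induction n)
    case 0
    thus ?case using D by simp
  next
    case (Suc n)
    have "dilate (real (Suc (Suc n))) ?D \<subseteq> dilate (real (Suc n)) ?D + ?D"
    proof
      fix x assume "x \<in> dilate (real (Suc (Suc n))) ?D"
      then obtain y where y: "y \<in> ?D" "x = of_real (real (Suc (Suc n))) *\<^sub>C y" by blast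
      moreover have "of_real (real (Suc (Suc n))) = (of_real (real (Suc n)) + 1 :: complex)" by simp
      ultimately have "x = of_real (real (Suc n)) *\<^sub>C y + y" by (simp only: scaleC_add_left scaleC_one)
      thus "x \<in> dilate (real (Suc n)) ?D + ?D" using y(1) by (auto intro: set_plus_intro)
    qed
    thus ?case using small_subset small_add Suc D(1) by metis
  qed
  obtain n where n: "\<bar>r\<bar> \<le> real (Suc n)" using real_arch_simple[of "\<bar>r\<bar>"] le_Suc_eq
    by (metis of_nat_le_iff order_trans lessI less_imp_le)
  have "dilate r S \<subseteq> dilate (real (Suc n)) ?D"
  proof
    fix x assume "x \<in> dilate r S"
    then obtain y where y: "y \<in> S" "x = of_real r *\<^sub>C y" by blast
    hence "y \<in> dilate 1 ?D" using disk_hull_subset by auto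
    thus "x \<in> dilate (real (Suc n)) ?D"
      unfolding y(2) using n by (intro dilate_scale[OF D(2), of y 1]) (auto simp del: of_nat_Suc)
  qed
  thus ?thesis using * small_subset by metis
qed

text \<open>Disks contain 0, so both sets lie in the sum of disks around them.\<close>

lemma small_Un:
  assumes "small S" "small (T :: 'a::bornological_vector_space set)"
  shows "small (S \<union> T)"
proof -
  obtain D E where "small D" "disk D" "S \<subseteq> D" "small E" "disk E" "T \<subseteq> E" using assms small_hull_disk by metis
  thus ?thesis using small_add[of D E] small_subset[of "D + E" "S \<union> T"] subset_plus_disk[of E D] subset_plus_disk[of D E]
    by blast
qed

lemma small_empty: "small ({} :: 'a::bornological_vector_space set)" using small_subset[OF small_singleton] by blast

lemma small_insert: "small S ==> small (insert (x::'a::bornological_vector_space) S)"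
  using small_Un[OF small_singleton] by (metis insert_is_Un)

lemma small_finite: "finite S ==> small (S :: 'a::bornological_vector_space set)"
  by (induction rule: finite_induct) (auto intro: small_insert small_empty)

lemma image_dilate_subset:
  assumes "clinear f" "f ` S \<subseteq> dilate r T" "x \<in> dilate q S"
  shows "f x \<in> dilate (q * r) T"
proof -
  obtain y where y: "y \<in> S" "x = of_real q *\<^sub>C y" using assms(3) by blast
  have "f y \<in> dilate r T" using assms(2) y(1) by (rule subsetD[OF _ imageI])
  then obtain z where "z \<in> T" "f y = of_real r *\<^sub>C z" by blast
  thus ?thesis using y by (intro dilateI[of z]) (simp_all add: clinear_scale[OF assms(1)] scaleC_scaleC)
qed

lemma image_cspan_subset:
  assumes "clinear f" "disk S" "f ` S \<subseteq> dilate r T" "x \<in> cspan S"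
  shows "f x \<in> cspan T"
proof -
  obtain q where "x \<in> dilate q S" using cspan_disk[OF assms(2,4)] by (elim exE conjE)
  from image_dilate_subset[OF assms(1,3) this] show ?thesis by (rule dilate_cspan)
qed

text \<open>The factor \<open>r\<close> allows \<open>f\<close> to be the identity between two disks
  of which one absorbs the other, as for \<open>S + S\<close> and \<open>S\<close>; see
  \<open>disk_Cauchy_mono\<close>.\<close>

lemma disk_Cauchy_transfer:
  assumes "clinear f" "disk S" "disk T" "f ` S \<subseteq> dilate r T" "0 < r" "disk_Cauchy S X"
  shows "disk_Cauchy T (\<lambda>n. f (X n))" unfolding disk_Cauchy_iff[OF assms(3)]
proof (intro conjI allI impI)
  note X = assms(6)[unfolded disk_Cauchy_iff[OF assms(2)]]
  show "range (\<lambda>n. f (X n)) \<subseteq> cspan T" using X image_cspan_subset[OF assms(1,2,4)] by (simp add: image_subset_iff)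
  fix e :: real assume "0 < e"
  hence "0 < e / r" using assms(5) by simp
  then obtain N where N: "\<forall>m\<ge>N. \<forall>n\<ge>N. X m - X n \<in> dilate (e / r) S" using X by metis
  have "f (X m) - f (X n) \<in> dilate e T" if "m \<ge> N" "n \<ge> N" for m n
    using image_dilate_subset[OF assms(1,4) N[rule_format, OF that]] assms(5) by (simp add: clinear_diff[OF assms(1)])
  thus "\<exists>N. \<forall>m\<ge>N. \<forall>n\<ge>N. f (X m) - f (X n) \<in> dilate e T" by (intro exI[of _ N] allI impI)
qed

lemma disk_tendsto_transfer:
  assumes "clinear f" "disk S" "disk T" "f ` S \<subseteq> dilate r T" "0 < r" "disk_tendsto S X l"
  shows "disk_tendsto T (\<lambda>n. f (X n)) (f l)" unfolding disk_tendsto_iff[OF assms(3)]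
proof (intro conjI allI impI)
  note X = assms(6)[unfolded disk_tendsto_iff[OF assms(2)]]
  show "range (\<lambda>n. f (X n)) \<subseteq> cspan T" "f l \<in> cspan T"
    using X image_cspan_subset[OF assms(1,2,4)] by (simp_all add: image_subset_iff)
  fix e :: real assume "0 < e"
  hence "0 < e / r" using assms(5) by simp
  then obtain N where N: "\<forall>n\<ge>N. X n - l \<in> dilate (e / r) S" using X by metis
  have "f (X n) - f l \<in> dilate e T" if "n \<ge> N" for n
    using image_dilate_subset[OF assms(1,4) N[rule_format, OF that]] assms(5) by (simp add: clinear_diff[OF assms(1)])
  thus "\<exists>N. \<forall>n\<ge>N. f (X n) - f l \<in> dilate e T" by (intro exI[of _ N] allI impI)
qed

lemmas disk_Cauchy_mono = disk_Cauchy_transfer[OF clinear_id, unfolded image_ident]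
  and disk_tendsto_mono = disk_tendsto_transfer[OF clinear_id, unfolded image_ident]

lemma blinear_clinear: "bounded_clinear f ==> clinear f" and blinear_small: "bounded_clinear f ==> small S ==> small (f ` S)"
  by (auto simp: bounded_clinear_def)

lemma bounded_clinearI: "clinear f ==> (\<And>S. small S ==> small (f ` S)) ==> bounded_clinear f" by (auto simp: bounded_clinear_def)

lemma
  assumes "bounded_clinear f"
  shows blin_add: "f (x + y) = f x + f y" and blin_diff: "f (x - y) = f x - f y"
    and blin_scale: "f (c *\<^sub>C x) = c *\<^sub>C f x" and blin_zero: "f 0 = 0" and blin_uminus: "f (- x) = - f x"
  using blinear_clinear[OF assms] by (simp_all add: clinear_add clinear_diff clinear_scale clinear_zero clinear_uminus)

lemma blinear_disk:
  assumes "bounded_clinear f" "small S"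
  obtains T where "small T" "disk T" "f ` S \<subseteq> T" using assms small_hull_disk blinear_small by metis

lemma blinear_Mackey_Cauchy:
  assumes "bounded_clinear f" "Mackey_Cauchy X"
  shows "Mackey_Cauchy (\<lambda>n. f (X n))"
proof -
  obtain S where S: "small S" "disk S" "disk_Cauchy S X" using assms unfolding Mackey_Cauchy_def by blast
  obtain T where T: "small T" "disk T" "f ` S \<subseteq> T" using blinear_disk[OF assms(1) S(1)] .
  hence "disk_Cauchy T (\<lambda>n. f (X n))" by (intro disk_Cauchy_transfer[of f S T 1 X] S blinear_clinear assms(1)) simp_all
  thus ?thesis using T unfolding Mackey_Cauchy_def by blast
qed

lemma blinear_Mackey_tendsto:
  assumes "bounded_clinear f" "Mackey_tendsto X l"
  shows "Mackey_tendsto (\<lambda>n. f (X n)) (f l)"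
proof -
  obtain S where S: "small S" "disk S" "disk_tendsto S X l" using assms unfolding Mackey_tendsto_def by blast
  obtain T where T: "small T" "disk T" "f ` S \<subseteq> T" using blinear_disk[OF assms(1) S(1)] .
  hence "disk_tendsto T (\<lambda>n. f (X n)) (f l)"
    by (intro disk_tendsto_transfer[of f S T 1 X] S blinear_clinear assms(1)) simp_all
  thus ?thesis using T unfolding Mackey_tendsto_def by blast
qed

text \<open>\<open>l\<close> itself may lie outside the span of \<open>S\<close>: only the
  differences are measured by \<open>S\<close>, and the constant sequence, which converges for some
  other disk, is added back.\<close>

lemma Mackey_tendsto_nullI:
  assumes "small S" "disk S" "\<And>n. X n - l \<in> cspan S" "\<And>e. 0 < e ==> \<exists>N. \<forall>n\<ge>N. X n - l \<in> dilate e S"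
  shows "Mackey_tendsto X (l::'a::bornological_vector_space)"
proof -
  have "disk_tendsto S (\<lambda>n. X n - l) 0" unfolding disk_tendsto_iff[OF assms(2)] using assms by (auto intro: cspan_0)
  hence "Mackey_tendsto (\<lambda>n. X n - l) 0" using assms unfolding Mackey_tendsto_def by blast
  from Mackey_tendsto_add[OF this Mackey_tendsto_const[of l]]
  show ?thesis by (simp add: plus_fun_def)
qed

lemma Mackey_tendsto_iff_diff: "Mackey_tendsto X l \<longleftrightarrow> Mackey_tendsto (\<lambda>n. X n - l) 0"
proof
  assume "Mackey_tendsto X l"
  from Mackey_tendsto_add[OF this Mackey_tendsto_const[of "-l"]]
  show "Mackey_tendsto (\<lambda>n. X n - l) 0" by (simp add: plus_fun_def)
next
  assume "Mackey_tendsto (\<lambda>n. X n - l) 0"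
  from Mackey_tendsto_add[OF this Mackey_tendsto_const[of l]]
  show "Mackey_tendsto X l" by (simp add: plus_fun_def)
qed

section \<open>Separated and complete bornological spaces\<close>

definition bseparated :: "'a::bornological_vector_space itself => bool"
  where "bseparated _ \<longleftrightarrow> (\<forall>x::'a. Mackey_tendsto (\<lambda>n. x) 0 \<longrightarrow> x = 0)"

text \<open>Completeness is a predicate on types, rather than a class, since it holds for the
  type \<open>'a ind_completion separated\<close> but not for \<open>'a separated\<close>. The disk \<open>T\<close> contains the limits
  of all sequences in \<open>S\<close>; this makes extensions by continuity bounded.\<close>

definition bcomplete :: "'a::bornological_vector_space itself => bool"
  where "bcomplete _ \<longleftrightarrow> bseparated TYPE('a) \<and>
    (\<forall>S::'a set. small S \<longrightarrow> disk S \<longrightarrow> (\<exists>T. small T \<and> disk T \<and>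
      (\<forall>X. range X \<subseteq> S \<longrightarrow> disk_Cauchy S X \<longrightarrow> (\<exists>l\<in>T. Mackey_tendsto X l))))"

lemma bcomplete_separated: "bcomplete TYPE('a::bornological_vector_space) ==> bseparated TYPE('a)" by (simp add: bcomplete_def)

lemma Mackey_tendsto_unique:
  assumes "bseparated TYPE('a::bornological_vector_space)" "Mackey_tendsto X l" "Mackey_tendsto X (k::'a)"
  shows "l = k"
proof -
  have "Mackey_tendsto (\<lambda>n. (-1) *\<^sub>C (X n - l)) ((-1) *\<^sub>C 0)"
    using assms(2) unfolding Mackey_tendsto_iff_diff[of X l] by (rule Mackey_tendsto_scale)
  from Mackey_tendsto_add[OF this assms(3)[unfolded Mackey_tendsto_iff_diff[of X k]]]
  have "Mackey_tendsto (\<lambda>n. l - k) 0" by (simp add: plus_fun_def complex_vector.scale_minus_left scaleC_one)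
  hence "l - k = 0" using assms(1) unfolding bseparated_def by blast
  thus ?thesis by simp
qed

text \<open>A Cauchy sequence lies a priori only in the span of its disk. From some \<open>N\<close>
  on its terms lie in \<open>X N + S\<close>, and the hull of the finitely many terms up to
  \<open>N\<close> is added to \<open>S\<close>.\<close>

lemma Mackey_Cauchy_scaled:
  assumes "Mackey_Cauchy X"
  shows "\<exists>S. small S \<and> disk S \<and> range X \<subseteq> S \<and> disk_Cauchy S X"
proof -
  obtain S where S: "small S" "disk S" "disk_Cauchy S X" using assms unfolding Mackey_Cauchy_def by blast
  obtain N where N: "\<forall>m\<ge>N. \<forall>n\<ge>N. X m - X n \<in> dilate 1 S"
    using S(3) unfolding disk_Cauchy_iff[OF S(2)] by (meson zero_less_one)
  let ?T = "disk_hull (X ` {..N}) + S"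
  have d: "disk (disk_hull (X ` {..N}))" by (rule disk_disk_hull)
  have T: "small ?T" "disk ?T" using small_add[OF small_disk_hull[OF small_finite] S(1)] disk_plus[OF d S(2)] by simp_all
  have "X n \<in> ?T" for n
  proof (cases "n \<le> N")
    case True
    hence "X n \<in> disk_hull (X ` {..N})" by (intro subsetD[OF disk_hull_subset]) simp
    thus ?thesis by (rule subsetD[OF subset_plus_disk(1)[OF S(2)]])
  next
    case False
    hence "X n - X N \<in> S" using N by simp
    moreover have "X N \<in> disk_hull (X ` {..N})" by (intro subsetD[OF disk_hull_subset]) simp
    ultimately have "X N + (X n - X N) \<in> ?T" by (intro set_plus_intro)
    thus ?thesis by simp
  qed
  moreover have "disk_Cauchy ?T X"
    by (rule disk_Cauchy_mono[OF S(2) T(2) _ _ S(3), of 1]) (simp_all add: subset_plus_disk(2)[OF d])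
  ultimately show ?thesis using T by (intro exI[of _ ?T]) (simp add: image_subset_iff)
qed

lemma bcomplete_convergent:
  fixes X :: "nat => 'a::bornological_vector_space"
  assumes "bcomplete TYPE('a)" "Mackey_Cauchy X"
  shows "\<exists>l. Mackey_tendsto X l" using Mackey_Cauchy_scaled[OF assms(2)] assms(1) unfolding bcomplete_def by meson

lemma bcomplete_complete_class: "bcomplete TYPE('a::complete_bornological_vector_space)" unfolding bcomplete_def
proof (intro conjI allI impI)
  show "bseparated TYPE('a)" unfolding bseparated_def
  proof (intro allI impI)
    fix x :: 'a assume "Mackey_tendsto (\<lambda>n. x) 0"
    then obtain S where S: "small S" "disk S" "disk_tendsto S (\<lambda>n. x) 0" unfolding Mackey_tendsto_def by blast
    obtain T where T: "S \<subseteq> T" "Banach_disk T" using small_in_Banach_disk[OF S(1)] by blast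
    hence "disk_tendsto T (\<lambda>n. x) 0" using disk_tendsto_mono[OF S(2) _ _ _ S(3), of T 1] unfolding Banach_disk_def by auto
    hence "gauge_norm T x = 0" "x \<in> cspan T" unfolding disk_tendsto_def by (auto simp: LIMSEQ_const_iff)
    thus "x = 0" using T(2) unfolding Banach_disk_def by blast
  qed
  fix S :: "'a set" assume S: "small S" "disk S"
  obtain T where T: "S \<subseteq> T" "small T" "Banach_disk T" using small_in_Banach_disk[OF S(1)] by blast
  hence dT: "disk T" by (simp add: Banach_disk_def)
  \<comment> \<open>The limit is found as \<open>X N - (X N - l)\<close> with both terms in
    \<open>T\<close>; \<open>T + T\<close> is used since a disk need not be closed for its gauge
    norm.\<close>
  have "\<exists>l\<in>T + T. Mackey_tendsto X l" if X: "range X \<subseteq> S" "disk_Cauchy S X" for X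
  proof -
    have "disk_Cauchy T X" using disk_Cauchy_mono[OF S(2) dT, of 1] T(1) X(2) by auto
    then obtain l where l: "disk_tendsto T X l" using T(3) unfolding Banach_disk_def by blast
    then obtain N where "\<forall>n\<ge>N. X n - l \<in> dilate 1 T" unfolding disk_tendsto_iff[OF dT] by (meson zero_less_one)
    hence "X N - l \<in> T" by auto
    hence "- (X N - l) \<in> T" by (rule disk_uminus[OF dT])
    moreover have "X N \<in> T" using X(1) T(1) by (simp add: image_subset_iff subset_iff)
    ultimately have "X N + - (X N - l) \<in> T + T" by (intro set_plus_intro)
    thus ?thesis using l T(2) dT unfolding Mackey_tendsto_def by (intro bexI[of _ l]) auto
  qed
  thus "\<exists>T. small T \<and> disk T \<and> (\<forall>X. range X \<subseteq> S \<longrightarrow> disk_Cauchy S X \<longrightarrow> (\<exists>l\<in>T. Mackey_tendsto X l))"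
    using small_add[OF T(2) T(2)] disk_plus[OF dT dT] by blast
qed

text \<open>The set where two bounded maps into a separated space agree is a subspace closed under
  Mackey limits.\<close>

lemma blinear_eq_on_closed_cspan:
  assumes f: "bounded_clinear f" and g: "bounded_clinear (g :: 'a::bornological_vector_space => 'b)"
    and sep: "bseparated TYPE('b::bornological_vector_space)" and eq: "\<And>x. x \<in> S ==> f x = g x" and x: "x \<in> closed_cspan S"
  shows "f x = g x"
proof -
  let ?L = "{x. f x = g x}"
  have "csubspace ?L" using f g unfolding bounded_clinear_def csubspace_def
    by (auto simp: clinear_zero clinear_add clinear_scale)
  moreover have "Mackey_closed ?L" unfolding Mackey_closed_def
  proof (intro allI impI)
    fix X l assume X: "range X \<subseteq> ?L" "Mackey_tendsto X l"
    have "(\<lambda>n. f (X n)) = (\<lambda>n. g (X n))" using X(1) by auto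
    thus "l \<in> ?L" using blinear_Mackey_tendsto[OF f X(2)] blinear_Mackey_tendsto[OF g X(2)]
        Mackey_tendsto_unique[OF sep] by auto
  qed
  ultimately have "closed_cspan S \<subseteq> ?L" using eq unfolding closed_cspan_def by blast
  thus ?thesis using x by blast
qed

lemma closed_cspan_superset: "S \<subseteq> closed_cspan S" by (auto simp: closed_cspan_def)

lemma Mackey_closed_closed_cspan: "Mackey_closed (closed_cspan S)" unfolding Mackey_closed_def closed_cspan_def by blast

lemma blinear_zero: "bounded_clinear (\<lambda>x. 0)"
  by (rule bounded_clinearI) (auto simp: clinear_const_zero image_constant_conv small_empty small_singleton)

lemma blinear_id: "bounded_clinear (\<lambda>x. x)" by (rule bounded_clinearI) (auto simp: clinear_id)

lemma blinear_compose:
  "bounded_clinear f ==> bounded_clinear g ==> bounded_clinear (\<lambda>x. g (f x))"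
  unfolding bounded_clinear_def by (auto simp: clinear_compose simp flip: image_image[of g f])

lemma blinear_plus:
  assumes "bounded_clinear f" "bounded_clinear g"
  shows "bounded_clinear (\<lambda>x. f x + g x)"
proof (rule bounded_clinearI)
  show "clinear (\<lambda>x. f x + g x)" using assms by (auto simp: bounded_clinear_def clinear_plus)
  fix S :: "'a set" assume "small S"
  hence "small (f ` S + g ` S)" using assms small_add by (auto simp: bounded_clinear_def)
  thus "small ((\<lambda>x. f x + g x) ` S)" by (rule small_subset) (auto intro: set_plus_intro)
qed

lemma blinear_scaleC_right: "bounded_clinear (\<lambda>x::'a::bornological_vector_space. c *\<^sub>C x)"
proof (rule bounded_clinearI[OF clinear_scaleC])
  fix S :: "'a set" assume S: "small S"
  let ?D = "disk_hull S"
  have "(\<lambda>x. c *\<^sub>C x) ` S \<subseteq> dilate (cmod c + 1) ?D"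
  proof clarify
    fix x assume "x \<in> S"
    hence "x \<in> dilate 1 ?D" using disk_hull_subset by auto
    thus "c *\<^sub>C x \<in> dilate (cmod c + 1) ?D" by (intro dilate_scale[OF disk_disk_hull, of x 1]) (auto intro: add_nonneg_pos)
  qed
  thus "small ((\<lambda>x. c *\<^sub>C x) ` S)" using small_dilate[OF small_disk_hull[OF S]] small_subset by metis
qed

lemma blinear_scaleC: "bounded_clinear f ==> bounded_clinear (\<lambda>x. c *\<^sub>C f x)"
  using blinear_compose[OF _ blinear_scaleC_right] .

lemma blinear_minus:
  assumes "bounded_clinear f" "bounded_clinear g"
  shows "bounded_clinear (\<lambda>x. f x - g x)" using blinear_plus[OF assms(1) blinear_scaleC[OF assms(2), of "-1"]]
  by (simp add: complex_vector.scale_minus_left scaleC_one)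

lemma blinear_uminus: "bounded_clinear f ==> bounded_clinear (\<lambda>x. - f x)" using blinear_minus[OF blinear_zero] by simp

text \<open>Boundedness uniform in a parameter. It is the form that joint boundedness takes when a
  multilinear map is extended one argument at a time, the other arguments being parameters.\<close>

definition equibounded ::
    "'i set => ('i => 'a::bornological_vector_space => 'b::bornological_vector_space) => bool"
  where "equibounded I f \<longleftrightarrow> (\<forall>S. small S \<longrightarrow> small (\<Union>i\<in>I. f i ` S))"

lemma equibounded_singleton: "equibounded {i} f \<longleftrightarrow> (\<forall>S. small S \<longrightarrow> small (f i ` S))" by (simp add: equibounded_def)

lemma equibounded_bounded: "equibounded I f ==> i \<in> I ==> clinear (f i) ==> bounded_clinear (f i)"
  unfolding equibounded_def by (intro bounded_clinearI) (auto intro: small_subset[of "\<Union>i\<in>I. f i ` S" for S])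

subsection \<open>Elements of the completion as classes of Cauchy sequences\<close>

definition cseq :: "(nat => 'a::bornological_vector_space) => 'a completion"
  where "cseq X = abs_separated (abs_ind_completion X)"

lemma to_completion_cseq: "to_completion x = cseq (\<lambda>n. x)" by (simp add: to_completion_def cseq_def)

lemma Mackey_equiv_refl: "Mackey_Cauchy X ==> Mackey_equiv X X"
  using Mackey_tendsto_const[of 0] by (simp add: Mackey_equiv_def zero_fun_def)

lemma Mackey_equiv_Cauchy: "Mackey_equiv X X \<longleftrightarrow> Mackey_Cauchy X" using Mackey_equiv_refl Mackey_equiv_def by metis

lemma ind_completion_exhaust: "\<exists>X. Mackey_Cauchy X \<and> x = abs_ind_completion X"
  by (metis Mackey_equiv_Cauchy Quotient3_ind_completion Quotient3_abs_rep Quotient3_rep_reflp)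

lemma Mackey_equiv_rep_abs: "Mackey_Cauchy X ==> Mackey_equiv (rep_ind_completion (abs_ind_completion X)) X"
  using rep_abs_rsp_left[OF Quotient3_ind_completion, of X X] Mackey_equiv_refl by metis

lemma separated_exhaust: "\<exists>y. x = abs_separated y" by (metis Quotient3_abs_rep Quotient3_separated)

lemma abs_separated_eq_iff: "abs_separated x = abs_separated y \<longleftrightarrow> x - y \<in> closed_cspan {0}" by (metis separated.abs_eq_iff)

lemma rep_abs_separated: "rep_separated (abs_separated x) - x \<in> closed_cspan {0}"
  by (metis Quotient3_abs_rep Quotient3_separated abs_separated_eq_iff)

lemma clinear_abs_separated: "clinear (abs_separated :: 'a::bornological_vector_space => _)"
  by (rule clinearI) (simp_all add: plus_separated.abs_eq scaleC_separated.abs_eq)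

lemma blinear_abs_separated: "bounded_clinear (abs_separated :: 'a::bornological_vector_space => _)"
  by (rule bounded_clinearI) (auto simp: clinear_abs_separated small_separated_def)

lemma completion_exhaust: "\<exists>X. Mackey_Cauchy X \<and> x = cseq X" using separated_exhaust ind_completion_exhaust cseq_def by metis

lemma abs_ind_add:
  "Mackey_Cauchy X ==> Mackey_Cauchy Y ==>
    abs_ind_completion X + abs_ind_completion Y = abs_ind_completion (\<lambda>n. X n + Y n)"
  using plus_ind_completion.abs_eq[of X Y] by (simp add: Mackey_equiv_Cauchy plus_fun_def)

lemma abs_ind_scale:
  "Mackey_Cauchy X ==> c *\<^sub>C abs_ind_completion X = abs_ind_completion (\<lambda>n. c *\<^sub>C X n)"
  using scaleC_ind_completion.abs_eq[of X c] by (simp add: Mackey_equiv_Cauchy)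

lemma abs_ind_minus:
  assumes "Mackey_Cauchy X" "Mackey_Cauchy Y"
  shows "abs_ind_completion X - abs_ind_completion Y = abs_ind_completion (\<lambda>n. X n - Y n)"
proof -
  have "abs_ind_completion X + (-1) *\<^sub>C abs_ind_completion Y = abs_ind_completion (\<lambda>n. X n + (-1) *\<^sub>C Y n)"
    unfolding abs_ind_scale[OF assms(2)] by (rule abs_ind_add[OF assms(1) Mackey_Cauchy_scale[OF assms(2)]])
  thus ?thesis by (simp add: complex_vector.scale_minus_left scaleC_one)
qed

lemma abs_ind_eqI:
  "Mackey_Cauchy X ==> Mackey_Cauchy Y ==> Mackey_tendsto (\<lambda>n. X n - Y n) 0 ==>
    abs_ind_completion X = abs_ind_completion Y"
  by (rule Quotient3_rel_abs[OF Quotient3_ind_completion]) (simp add: Mackey_equiv_def fun_diff_def)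

lemma cseq_add: "Mackey_Cauchy X ==> Mackey_Cauchy Y ==> cseq X + cseq Y = cseq (\<lambda>n. X n + Y n)"
  by (simp add: cseq_def abs_ind_add plus_separated.abs_eq)

lemma cseq_scale: "Mackey_Cauchy X ==> c *\<^sub>C cseq X = cseq (\<lambda>n. c *\<^sub>C X n)"
  by (simp add: cseq_def abs_ind_scale scaleC_separated.abs_eq)

lemma cseq_minus: "Mackey_Cauchy X ==> Mackey_Cauchy Y ==> cseq X - cseq Y = cseq (\<lambda>n. X n - Y n)"
  by (simp add: cseq_def abs_ind_minus minus_separated.abs_eq)

lemma clinear_to_completion: "clinear to_completion"
  by (rule clinearI) (simp_all add: to_completion_cseq cseq_add cseq_scale Mackey_Cauchy_const)

text \<open>\<open>ihat S\<close> is the unit ball of the completed span of \<open>S\<close> before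
  separation and \<open>hat S\<close> its image afterwards. Every small set of the completion is
  contained in such a ball (\<open>small_completionD\<close>), so its elements are represented by
  Cauchy sequences in one disk.\<close>

definition ihat :: "'a::bornological_vector_space set => 'a ind_completion set"
  where "ihat S = {abs_ind_completion X |X. range X \<subseteq> S \<and> disk_Cauchy S X}"

definition hat :: "'a::bornological_vector_space set => 'a completion set"
  where "hat S = {cseq X |X. range X \<subseteq> S \<and> disk_Cauchy S X}"

lemma hat_ihat: "hat S = abs_separated ` ihat S" by (auto simp: hat_def ihat_def cseq_def)

lemma disk_Cauchy_Mackey: "small S ==> disk S ==> disk_Cauchy S X ==> Mackey_Cauchy X" by (auto simp: Mackey_Cauchy_def)

lemma disk_Cauchy_lincomb:
  assumes "disk S" "disk_Cauchy S X" "disk_Cauchy S Y"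
  shows "disk_Cauchy S (\<lambda>n. c *\<^sub>C X n + d *\<^sub>C Y n)"
proof -
  let ?f = "\<lambda>x. of_real (1/2) *\<^sub>C x :: 'a"
  have "disk_Cauchy (S + S) (\<lambda>n. c *\<^sub>C X n + d *\<^sub>C Y n)"
    using disk_Cauchy_add[OF assms(1,1) disk_Cauchy_scale[OF assms(1,2), of c] disk_Cauchy_scale[OF assms(1,3), of d]]
    by (simp add: plus_fun_def)
  moreover have "S + S \<subseteq> dilate 2 S" using disk_add_dilate[OF assms(1)] by (auto elim!: set_plus_elim)
  ultimately show ?thesis using disk_Cauchy_mono[OF disk_plus[OF assms(1,1)] assms(1), of 2] by simp
qed

lemma disk_ihat:
  assumes S: "small S" "disk S"
  shows "disk (ihat S)" unfolding disk_def
proof (intro conjI ballI allI impI)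
  have "abs_ind_completion (\<lambda>n. 0) \<in> ihat S"
    using disk_0[OF S(2)] disk_Cauchy_const[OF S(2) cspan_0] by (auto simp: ihat_def)
  thus "ihat S \<noteq> {}" by blast
next
  fix x and c assume "x \<in> ihat S" and c: "cmod c \<le> 1"
  then obtain X where X: "x = abs_ind_completion X" "range X \<subseteq> S" "disk_Cauchy S X" unfolding ihat_def by blast
  have "c *\<^sub>C x = abs_ind_completion (\<lambda>n. c *\<^sub>C X n)" using X disk_Cauchy_Mackey[OF S] by (simp add: abs_ind_scale)
  thus "c *\<^sub>C x \<in> ihat S" unfolding ihat_def using X c disk_scale[OF S(2)] disk_Cauchy_scale[OF S(2) X(3)] by blast
next
  fix x y and t :: real assume "x \<in> ihat S" "y \<in> ihat S" and t: "t \<in> {0..1}"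
  then obtain X Y where X: "x = abs_ind_completion X" "range X \<subseteq> S" "disk_Cauchy S X"
    and Y: "y = abs_ind_completion Y" "range Y \<subseteq> S" "disk_Cauchy S Y" unfolding ihat_def by blast
  have "of_real (1 - t) *\<^sub>C x + of_real t *\<^sub>C y =
      abs_ind_completion (\<lambda>n. of_real (1 - t) *\<^sub>C X n + of_real t *\<^sub>C Y n)"
    using X Y disk_Cauchy_Mackey[OF S] by (simp add: abs_ind_scale abs_ind_add Mackey_Cauchy_scale del: of_real_diff)
  moreover have "of_real (1 - t) *\<^sub>C X n + of_real t *\<^sub>C Y n \<in> S" for n
    using X Y t disk_convex[OF S(2), of "X n" "Y n" t] by (auto simp del: of_real_diff)
  ultimately show "of_real (1 - t) *\<^sub>C x + of_real t *\<^sub>C y \<in> ihat S" unfolding ihat_def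
    using disk_Cauchy_lincomb[OF S(2) X(3) Y(3)] by blast
qed

lemma small_ihat: "small S ==> disk S ==> small (ihat S)" unfolding small_ind_completion_def ihat_def
  by (rule generated_bornologyI) blast

lemma ihat_add:
  assumes "small S" "disk S" "small T" "disk T"
  shows "ihat S + ihat T \<subseteq> ihat (S + T)"
proof
  fix z assume "z \<in> ihat S + ihat T"
  then obtain x y where z: "z = x + y" "x \<in> ihat S" "y \<in> ihat T" by (rule set_plus_elim)
  then obtain X Y where X: "x = abs_ind_completion X" "range X \<subseteq> S" "disk_Cauchy S X"
    and Y: "y = abs_ind_completion Y" "range Y \<subseteq> T" "disk_Cauchy T Y" unfolding ihat_def by blast
  have "z = abs_ind_completion (X + Y)" unfolding z(1) X(1) Y(1)
    using X Y assms disk_Cauchy_Mackey by (subst abs_ind_add) (auto simp: plus_fun_def)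
  moreover have "range (X + Y) \<subseteq> S + T" using X(2) Y(2) by (auto intro: set_plus_intro)
  ultimately show "z \<in> ihat (S + T)" using disk_Cauchy_add[OF assms(2,4) X(3) Y(3)] unfolding ihat_def by blast
qed

text \<open>The sets contained in some \<open>ihat S\<close> form a convex bornology that contains
  the generators: points by \<open>Mackey_Cauchy_scaled\<close>, sums by \<open>ihat_add\<close>,
  hulls because \<open>ihat S\<close> is a disk.\<close>

lemma small_ind_completionD:
  assumes "small (T :: 'a::bornological_vector_space ind_completion set)"
  shows "\<exists>S. small S \<and> disk S \<and> T \<subseteq> ihat S"
proof (rule generated_bornologyD[OF assms[unfolded small_ind_completion_def]])
  show "convex_bornology (\<lambda>T. \<exists>S::'a set. small S \<and> disk S \<and> T \<subseteq> ihat S)"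
  proof (rule convex_bornologyI)
    fix x :: "'a ind_completion"
    obtain X where "Mackey_Cauchy X" "x = abs_ind_completion X" using ind_completion_exhaust by blast
    thus "\<exists>S. small S \<and> disk S \<and> {x} \<subseteq> ihat S" using Mackey_Cauchy_scaled[of X] unfolding ihat_def by blast
  next
    fix T U :: "'a ind_completion set"
    assume "\<exists>S. small S \<and> disk S \<and> T \<subseteq> ihat S" "\<exists>S. small S \<and> disk S \<and> U \<subseteq> ihat S"
    then obtain S S' where S: "small S" "disk S" "T \<subseteq> ihat S" and S': "small S'" "disk S'" "U \<subseteq> ihat S'" by blast
    hence "T + U \<subseteq> ihat (S + S')" using ihat_add[of S S'] set_plus_mono2 by blast
    thus "\<exists>S. small S \<and> disk S \<and> T + U \<subseteq> ihat S" using S S' small_add disk_plus by metis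
  next
    fix T :: "'a ind_completion set"
    assume "\<exists>S. small S \<and> disk S \<and> T \<subseteq> ihat S"
    thus "\<exists>S. small S \<and> disk S \<and> disk_hull T \<subseteq> ihat S" using disk_ihat disk_hull_least by metis
  qed blast
  fix T :: "'a ind_completion set"
  assume "T \<in> {{abs_ind_completion X |X. range X \<subseteq> S \<and> disk_Cauchy S X} |S. small S \<and> disk S}"
  thus "\<exists>S. small S \<and> disk S \<and> T \<subseteq> ihat S" unfolding ihat_def by blast
qed

lemma disk_hat: "small S ==> disk S ==> disk (hat S)" unfolding hat_ihat by (intro disk_image clinear_abs_separated disk_ihat)

lemma small_hat: "small S ==> disk S ==> small (hat S)"
  unfolding hat_ihat using blinear_abs_separated blinear_small small_ihat by metis

lemma small_completionD:
  assumes "small (T :: 'a::bornological_vector_space completion set)"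
  shows "\<exists>S. small S \<and> disk S \<and> T \<subseteq> hat S"
proof -
  obtain U where U: "small U" "T = abs_separated ` U" using assms unfolding small_separated_def by blast
  thus ?thesis using small_ind_completionD[OF U(1)] unfolding hat_ihat by blast
qed

text \<open>The class of a sequence depends only on its tail. Replacing the first \<open>N\<close>
  terms by 0 and dividing by \<open>r\<close> gives a sequence inside \<open>S\<close>.\<close>

lemma abs_ind_in_dilate:
  assumes S: "small S" "disk S" and X: "disk_Cauchy S X" and r: "0 < r" and N: "\<And>n. n \<ge> N ==> X n \<in> dilate r S"
  shows "abs_ind_completion X \<in> dilate r (ihat S)"
proof -
  define Y where "Y n = (if n \<ge> N then X n else 0)" for n
  have Yr: "Y n \<in> dilate r S" for n using N disk_zero_dilate[OF S(2)] by (simp add: Y_def)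
  have YC: "disk_Cauchy S Y" unfolding disk_Cauchy_iff[OF S(2)]
  proof (intro conjI allI impI)
    show "range Y \<subseteq> cspan S" using Yr dilate_cspan by blast
    fix e :: real assume "0 < e"
    then obtain M where "\<forall>m\<ge>M. \<forall>n\<ge>M. X m - X n \<in> dilate e S" using X disk_Cauchy_iff[OF S(2)] by metis
    hence "\<forall>m\<ge>max M N. \<forall>n\<ge>max M N. Y m - Y n \<in> dilate e S" by (simp add: Y_def)
    thus "\<exists>N. \<forall>m\<ge>N. \<forall>n\<ge>N. Y m - Y n \<in> dilate e S" by blast
  qed
  have XY: "abs_ind_completion X = abs_ind_completion Y"
  proof (rule abs_ind_eqI)
    show "Mackey_Cauchy X" "Mackey_Cauchy Y" using S X YC disk_Cauchy_Mackey by blast+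
    show "Mackey_tendsto (\<lambda>n. X n - Y n) 0"
    proof (rule Mackey_tendsto_nullI[OF S])
      show "X n - Y n - 0 \<in> cspan S" for n using X YC unfolding disk_Cauchy_def by (simp add: cspan_diff image_subset_iff)
      show "\<exists>N. \<forall>n\<ge>N. X n - Y n - 0 \<in> dilate e S" for e
        using disk_zero_dilate[OF S(2)] by (auto simp: Y_def intro!: exI[of _ N])
    qed
  qed
  define Z where "Z n = of_real (1 / r) *\<^sub>C Y n" for n
  have Z: "disk_Cauchy S Z" using disk_Cauchy_scale[OF S(2) YC] unfolding Z_def .
  have ZS: "range Z \<subseteq> S" using Yr dilate_inverse_mem[OF r] unfolding Z_def by blast
  have YZ: "(\<lambda>n. of_real r *\<^sub>C Z n) = Y" using r by (simp add: Z_def scaleC_scaleC scaleC_one)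
  have "abs_ind_completion Y = of_real r *\<^sub>C abs_ind_completion Z"
    by (simp only: abs_ind_scale[OF disk_Cauchy_Mackey[OF S Z]] YZ)
  thus ?thesis using Z ZS unfolding XY by (auto simp: ihat_def)
qed

lemma cseq_in_dilate:
  assumes S: "small S" "disk S" and X: "disk_Cauchy S X" and r: "0 < r" and N: "\<And>n. n \<ge> N ==> X n \<in> dilate r S"
  shows "cseq X \<in> dilate r (hat S)" unfolding cseq_def hat_ihat dilate_image[OF clinear_abs_separated, symmetric]
  using abs_ind_in_dilate[OF assms] by blast

lemma cseq_in_hat: "range X \<subseteq> S ==> disk_Cauchy S X ==> cseq X \<in> hat S" by (auto simp: hat_def)

lemma to_completion_hat: "disk S ==> x \<in> S ==> to_completion x \<in> hat S"
  unfolding to_completion_cseq by (intro cseq_in_hat) (auto intro!: disk_Cauchy_const cspan_base)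

lemma blinear_to_completion: "bounded_clinear to_completion"
proof (rule bounded_clinearI[OF clinear_to_completion])
  fix S :: "'a set" assume S: "small S"
  hence "to_completion ` S \<subseteq> hat (disk_hull S)" using disk_hull_subset by (auto intro!: to_completion_hat disk_disk_hull)
  thus "small (to_completion ` S)" using small_hat[OF small_disk_hull[OF S] disk_disk_hull] small_subset by blast
qed

text \<open>The difference is represented by \<open>\<lambda>m. X n - X m\<close>, whose tail lies
  in \<open>dilate e S\<close> for large \<open>n\<close>.\<close>

lemma to_completion_approx:
  assumes S: "small S" "disk S" "disk_Cauchy S X" and "0 < e"
  shows "\<exists>N. \<forall>n\<ge>N. to_completion (X n) - cseq X \<in> dilate e (hat S)"
proof -
  obtain N where N: "\<forall>m\<ge>N. \<forall>n\<ge>N. X m - X n \<in> dilate e S" using S(3) \<open>0 < e\<close> disk_Cauchy_iff[OF S(2)] by metis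
  have "to_completion (X n) - cseq X \<in> dilate e (hat S)" if "n \<ge> N" for n
  proof -
    have XnC: "disk_Cauchy S (\<lambda>m. X n)" using S(3) by (intro disk_Cauchy_const S) (auto simp: disk_Cauchy_def)
    have C: "disk_Cauchy S (\<lambda>m. X n - X m)" using disk_Cauchy_lincomb[OF S(2) XnC S(3), of 1 "-1"]
      by (simp add: scaleC_one complex_vector.scale_minus_left)
    have "to_completion (X n) - cseq X = cseq (\<lambda>m. X n - X m)"
      unfolding to_completion_cseq using S disk_Cauchy_Mackey Mackey_Cauchy_const by (intro cseq_minus) blast+
    thus ?thesis using cseq_in_dilate[OF S(1,2) C \<open>0 < e\<close>, of N] N that by metis
  qed
  thus ?thesis by blast
qed

lemma to_completion_tendsto:
  assumes "Mackey_Cauchy X"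
  shows "Mackey_tendsto (\<lambda>n. to_completion (X n)) (cseq X)"
proof -
  obtain S where S: "small S" "disk S" "range X \<subseteq> S" "disk_Cauchy S X" using Mackey_Cauchy_scaled[OF assms] by blast
  show ?thesis
  proof (rule Mackey_tendsto_nullI[OF small_hat[OF S(1,2)] disk_hat[OF S(1,2)]])
    show "to_completion (X n) - cseq X \<in> cspan (hat S)" for n
      using S by (intro cspan_diff cspan_base to_completion_hat cseq_in_hat) auto
  qed (rule to_completion_approx[OF S(1,2,4)])
qed

lemma completion_ext:
  fixes f g :: "'a::bornological_vector_space completion => 'b::bornological_vector_space"
  assumes "bounded_clinear f" "bounded_clinear g" "bseparated TYPE('b)" and "\<And>x. f (to_completion x) = g (to_completion x)"
  shows "f = g"
proof
  fix x :: "'a completion"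
  obtain X where X: "Mackey_Cauchy X" "x = cseq X" using completion_exhaust by blast
  show "f x = g x" unfolding X(2) using blinear_Mackey_tendsto[OF assms(1) to_completion_tendsto[OF X(1)]]
      blinear_Mackey_tendsto[OF assms(2) to_completion_tendsto[OF X(1)]]
      Mackey_tendsto_unique[OF assms(3)] by (simp add: assms(4))
qed

text \<open>If x lies in every positive multiple of \<open>hat S\<close>, a representative \<xi>
  differs from elements \<open>\<eta> n\<close> of ever smaller multiples of \<open>ihat S\<close>
  by elements of the closure of 0. These differences converge to \<xi>, which therefore lies in that
  closure.\<close>

lemma bseparated_completion: "bseparated TYPE('a::bornological_vector_space completion)" unfolding bseparated_def
proof (intro allI impI)
  fix x :: "'a completion" assume "Mackey_tendsto (\<lambda>n. x) 0"
  then obtain U where U: "small U" "disk U" "disk_tendsto U (\<lambda>n. x) 0" unfolding Mackey_tendsto_def by blast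
  obtain S where S: "small S" "disk S" "U \<subseteq> hat S" using small_completionD[OF U(1)] by blast
  have "disk_tendsto (hat S) (\<lambda>n. x) 0" using disk_tendsto_mono[OF U(2) disk_hat[OF S(1,2)], of 1] S(3) U(3) by simp
  hence x: "x \<in> dilate e (hat S)" if "0 < e" for e
    using that unfolding disk_tendsto_iff[OF disk_hat[OF S(1,2)]] by (metis diff_zero order_refl)
  obtain \<xi> where \<xi>: "x = abs_separated \<xi>" using separated_exhaust by blast
  have "\<exists>\<eta>. \<eta> \<in> dilate (1 / real (Suc n)) (ihat S) \<and> \<xi> - \<eta> \<in> closed_cspan {0}" for n
  proof -
    have "x \<in> abs_separated ` dilate (1 / real (Suc n)) (ihat S)"
      using x[of "1 / real (Suc n)"] unfolding hat_ihat dilate_image[OF clinear_abs_separated] by simp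
    then obtain \<eta> where "\<eta> \<in> dilate (1 / real (Suc n)) (ihat S)" "x = abs_separated \<eta>" by (elim imageE[of x])
    thus ?thesis using abs_separated_eq_iff[of \<xi> \<eta>] \<xi> by (intro exI[of _ \<eta>]) simp
  qed
  then obtain \<eta> where \<eta>: "\<And>n. \<eta> n \<in> dilate (1 / real (Suc n)) (ihat S)" "\<And>n. \<xi> - \<eta> n \<in> closed_cspan {0}" by metis
  have "Mackey_tendsto (\<lambda>n. \<xi> - \<eta> n) \<xi>"
  proof (rule Mackey_tendsto_nullI[OF small_ihat[OF S(1,2)] disk_ihat[OF S(1,2)]])
    show "\<xi> - \<eta> n - \<xi> \<in> cspan (ihat S)" for n using cspan_neg[OF dilate_cspan[OF \<eta>(1)[of n]]] by simp
    fix e :: real assume "0 < e"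
    then obtain N where "1 / real (Suc N) < e" using nat_approx_posE by metis
    hence "1 / real (Suc n) \<le> e" if "n \<ge> N" for n
      using that by (smt (verit) frac_le of_nat_0_less_iff of_nat_le_iff Suc_le_mono zero_less_Suc)
    hence "\<xi> - \<eta> n - \<xi> \<in> dilate e (ihat S)" if "n \<ge> N" for n
      using that \<eta>(1)[of n] dilate_mono[OF disk_ihat[OF S(1,2)], of "1 / real (Suc n)" e] \<open>0 < e\<close>
        dilate_uminus[OF disk_ihat[OF S(1,2)]] by auto
    thus "\<exists>N. \<forall>n\<ge>N. \<xi> - \<eta> n - \<xi> \<in> dilate e (ihat S)" by blast
  qed
  hence "\<xi> \<in> closed_cspan {0}"
    by (rule Mackey_closed_closed_cspan[unfolded Mackey_closed_def, rule_format, rotated]) (use \<eta>(2) in \<open>simp add: image_subset_iff\<close>)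
  thus "x = 0" unfolding \<xi> zero_separated_def by (simp add: abs_separated_eq_iff)
qed

text \<open>The limit has to be represented by a sequence in the original space. A subsequence whose
  increments lie in 2^-k \<open>H\<close> is written as a telescoping series; representatives of its
  partial sums are chosen coherently, and a diagonal sequence through them represents the
  limit.\<close>

lemma bcomplete_completion: "bcomplete TYPE('a::bornological_vector_space completion)" unfolding bcomplete_def
proof (intro conjI allI impI)
  show "bseparated TYPE('a completion)" by (rule bseparated_completion)
  fix U :: "'a completion set" assume U: "small U" "disk U"
  obtain S where S: "small S" "disk S" "U \<subseteq> hat S" using small_completionD[OF U(1)] by (elim exE conjE)
  define H where "H = hat S"
  have H: "small H" "disk H" unfolding H_def by (rule small_hat[OF S(1,2)], rule disk_hat[OF S(1,2)])
  define p :: "nat => real" where "p k = 1 / 2 ^ k" for k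
  have p: "0 < p k" "p k = 2 * p (Suc k)" "p 0 = 1" for k by (simp_all add: p_def)
  have p_le: "p M \<le> p N" if "N \<le> M" for N M using that by (simp add: p_def field_simps power_increasing)
  have p_small: "\<exists>N. C * p N < e" if "0 < e" for C e :: real
    using real_arch_pow[of 2 "C / e"] that by (auto simp: field_simps p_def)
  have "\<exists>l\<in>dilate 4 H. Mackey_tendsto x l" if x: "range x \<subseteq> U" "disk_Cauchy U x" for x
  proof -
    have "disk_Cauchy H x" by (rule disk_Cauchy_mono[OF U(2) H(2) _ _ x(2), of 1]) (simp_all add: S(3) H_def)
    hence "\<exists>N. \<forall>m\<ge>N. \<forall>n\<ge>N. x m - x n \<in> dilate (p k) H" for k unfolding disk_Cauchy_iff[OF H(2)] using p(1) by blast
    then obtain \<mu> where \<mu>: "\<And>k m n. m \<ge> \<mu> k ==> n \<ge> \<mu> k ==> x m - x n \<in> dilate (p k) H" by metis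
    \<comment> \<open>Partial sums of \<open>\<mu>\<close> dominate it and never decrease, so
      successive indices satisfy the Cauchy estimate of the lower one.\<close>
    define \<nu> where "\<nu> k = (\<Sum>i\<le>k. \<mu> i)" for k
    have \<nu>: "\<mu> k \<le> \<nu> k" "\<nu> k \<le> \<nu> (Suc k)" for k by (simp_all add: \<nu>_def member_le_sum)
    have "x (\<nu> 0) \<in> H" using x(1) S(3) by (auto simp: H_def)
    then obtain Z0 where Z0: "x (\<nu> 0) = cseq Z0" "range Z0 \<subseteq> S" "disk_Cauchy S Z0" unfolding H_def hat_def by blast
    have "\<exists>Z. x (\<nu> (Suc k)) - x (\<nu> k) = of_real (p k) *\<^sub>C cseq Z \<and> range Z \<subseteq> S \<and> disk_Cauchy S Z" for k
    proof -
      have "x (\<nu> (Suc k)) - x (\<nu> k) \<in> dilate (p k) H" using \<nu> by (intro \<mu>) (meson order_trans)+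
      thus ?thesis unfolding H_def hat_def by (elim imageE CollectE exE conjE) metis
    qed
    then obtain Z where Z: "\<And>k. x (\<nu> (Suc k)) - x (\<nu> k) = of_real (p k) *\<^sub>C cseq (Z k)"
      "\<And>k. range (Z k) \<subseteq> S" "\<And>k. disk_Cauchy S (Z k)" by metis
    \<comment> \<open>\<open>W N\<close> represents \<open>x (\<nu> N)\<close> by telescoping
      (\<open>Wx\<close>). All partial sums use the same sequences \<open>Z k\<close>, so they can
      be compared term by term.\<close>
    define W where "W N m = Z0 m + (\<Sum>k<N. of_real (p k) *\<^sub>C Z k m)" for N m
    have W0: "W 0 = Z0" by (simp add: W_def fun_eq_iff)
    have WSuc: "W (Suc N) = (\<lambda>m. 1 *\<^sub>C W N m + of_real (p N) *\<^sub>C Z N m)" for N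
      by (simp add: W_def fun_eq_iff add.assoc scaleC_one)
    have WC: "disk_Cauchy S (W N)" for N
    proof (induction N)
      case 0
      thus ?case using Z0(3) by (simp only: W0)
    next
      case (Suc N)
      thus ?case unfolding WSuc by (intro disk_Cauchy_lincomb[OF S(2)] Z(3))
    qed
    note MC = disk_Cauchy_Mackey[OF S(1,2)]
    have Wx: "cseq (W N) = x (\<nu> N)" for N
    proof (induction N)
      case 0
      thus ?case using Z0 by (simp add: W0)
    next
      case (Suc N)
      have "cseq (W (Suc N)) = 1 *\<^sub>C cseq (W N) + of_real (p N) *\<^sub>C cseq (Z N)"
        unfolding WSuc using MC[OF WC[of N]] MC[OF Z(3)[of N]] by (simp only: cseq_scale cseq_add Mackey_Cauchy_scale)
      thus ?case using Suc Z(1)[of N] by (simp add: scaleC_one algebra_simps)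
    qed
    have "\<exists>k. \<forall>m\<ge>k. W N m - W N k \<in> dilate (p N) S" for N
    proof -
      have "\<exists>k. \<forall>m\<ge>k. \<forall>n\<ge>k. W N m - W N n \<in> dilate (p N) S"
        using WC[of N] unfolding disk_Cauchy_iff[OF S(2)] using p(1) by blast
      thus ?thesis by (metis order_refl)
    qed
    then obtain \<kappa> where \<kappa>: "\<And>N m. m \<ge> \<kappa> N ==> W N m - W N (\<kappa> N) \<in> dilate (p N) S" by metis
    \<comment> \<open>The geometric series gives \<open>2 * p N - 2 * p (N + j)\<close>; the
      additional \<open>p N\<close> keeps the factor positive at \<open>j = 0\<close>, as
      \<open>dilate_add\<close> requires.\<close>
    have tail: "W (N + j) m - W N m \<in> dilate (3 * p N - 2 * p (N + j)) S" for N j m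
    proof (induction j)
      case 0
      show ?case using disk_zero_dilate[OF S(2)] by simp
    next
      case (Suc j)
      have "Z (N + j) m \<in> S" using Z(2)[of "N + j"] by auto
      hence "of_real (p (N + j)) *\<^sub>C Z (N + j) m \<in> dilate (p (N + j)) S" by (intro dilateI) auto
      moreover have "0 < 3 * p N - 2 * p (N + j)" using p_le[of N "N + j"] p(1)[of N] by simp
      ultimately have *: "(W (N + j) m - W N m) + of_real (p (N + j)) *\<^sub>C Z (N + j) m \<in>
          dilate (3 * p N - 2 * p (N + j) + p (N + j)) S"
        by (intro dilate_add[OF S(2) Suc]) (simp_all only: p(1) diff_0_right)
      have "3 * p N - 2 * p (N + j) + p (N + j) = 3 * p N - 2 * p (N + Suc j)" using p(2)[of "N + j"] by simp
      moreover have "(W (N + j) m - W N m) + of_real (p (N + j)) *\<^sub>C Z (N + j) m = W (N + Suc j) m - W N m"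
        by (simp add: WSuc scaleC_one)
      ultimately show ?case using * by (simp only:)
    qed
    have tail': "W M m - W N m \<in> dilate (3 * p N) S" if NM: "N \<le> M" for N M m
    proof -
      obtain j where j: "M = N + j" using le_Suc_ex[OF NM] by blast
      have "0 \<le> 3 * p N - 2 * p (N + j)" using p_le[of N "N + j"] p(1)[of N] by simp
      thus ?thesis unfolding j using tail[of N j m] p(1)[of N] p(1)[of "N + j"]
        by (intro subsetD[OF dilate_mono[OF S(2), of "3 * p N - 2 * p (N + j)" "3 * p N"]]) simp_all
    qed
    \<comment> \<open>Diagonal sequence: \<open>W N\<close> is frozen at an index beyond which it
      moves by at most \<open>p N\<close>. The constants below come from comparisons at a common
      index: 5 = 1 + 3 + 1 for \<open>Y N - Y M\<close>, 4 = 3 + 1 for \<open>Y N\<close>, and 6 = 1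
      + 5, 7 = 1 + 6 for the convergence.\<close>
    define Y where "Y N = W N (\<kappa> N)" for N
    have Ydiff: "Y N - Y M \<in> dilate (5 * p N) S" if "N \<le> M" for N M
    proof -
      let ?m = "max (\<kappa> N) (\<kappa> M)"
      have a: "- (W N ?m - Y N) \<in> dilate (p N) S" unfolding Y_def by (intro dilate_uminus[OF S(2)] \<kappa>) simp
      have b: "- (W M ?m - W N ?m) \<in> dilate (3 * p N) S" by (intro dilate_uminus[OF S(2)] tail' that)
      have "W M ?m - Y M \<in> dilate (p M) S" unfolding Y_def by (intro \<kappa>) simp
      hence c: "W M ?m - Y M \<in> dilate (p N) S" using that by (intro subsetD[OF dilate_mono[OF S(2), of "p M" "p N"]])
          (simp_all add: p_le less_imp_le[OF p(1)] p(1))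
      have "(- (W N ?m - Y N) + - (W M ?m - W N ?m)) + (W M ?m - Y M) \<in> dilate (p N + 3 * p N + p N) S"
        by (intro dilate_add[OF S(2)] a b c) (simp_all add: add_pos_pos p(1))
      thus ?thesis by simp
    qed
    have YS: "Y N \<in> dilate 4 S" for N
    proof -
      have "W N (\<kappa> N) - W 0 (\<kappa> N) \<in> dilate 3 S" using tail'[of 0 N "\<kappa> N"] p(3) by simp
      moreover have "W 0 (\<kappa> N) \<in> dilate 1 S" using Z0(2) by (auto simp: W0)
      ultimately have "(W N (\<kappa> N) - W 0 (\<kappa> N)) + W 0 (\<kappa> N) \<in> dilate (3 + 1) S" by (intro dilate_add[OF S(2)]) simp_all
      thus ?thesis by (simp add: Y_def)
    qed
    have YC: "disk_Cauchy S Y" unfolding disk_Cauchy_iff[OF S(2)]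
    proof (intro conjI allI impI)
      show "range Y \<subseteq> cspan S" using dilate_cspan[OF YS] by (simp add: image_subset_iff)
      fix e :: real assume "0 < e"
      then obtain N where N: "10 * p N < e" using p_small by blast
      have "Y m - Y n \<in> dilate e S" if "m \<ge> N" "n \<ge> N" for m n
      proof -
        have "- (Y N - Y m) + (Y N - Y n) \<in> dilate (5 * p N + 5 * p N) S"
          by (intro dilate_add[OF S(2)] dilate_uminus[OF S(2)] Ydiff that) (simp_all add: p(1))
        hence "Y m - Y n \<in> dilate (10 * p N) S" by simp
        thus ?thesis using N \<open>0 < e\<close> p(1)[of N] by (intro subsetD[OF dilate_mono[OF S(2), of "10 * p N" e]]) simp_all
      qed
      thus "\<exists>N. \<forall>m\<ge>N. \<forall>n\<ge>N. Y m - Y n \<in> dilate e S" by (intro exI[of _ N] allI impI)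
    qed
    have xY: "x (\<nu> N) - cseq Y \<in> dilate (6 * p N) H" for N
    proof -
      have "W N m - Y m \<in> dilate (6 * p N) S" if "m \<ge> max (\<kappa> N) N" for m
      proof -
        have "(W N m - Y N) + (Y N - Y m) \<in> dilate (p N + 5 * p N) S"
        proof (intro dilate_add[OF S(2)] Ydiff)
          show "W N m - Y N \<in> dilate (p N) S" unfolding Y_def using that by (intro \<kappa>) simp
        qed (use that p(1)[of N] in simp_all)
        thus ?thesis by simp
      qed
      moreover have "disk_Cauchy S (\<lambda>m. W N m - Y m)" using disk_Cauchy_lincomb[OF S(2) WC[of N] YC, of 1 "-1"]
        by (simp add: scaleC_one complex_vector.scale_minus_left)
      ultimately have "cseq (\<lambda>m. W N m - Y m) \<in> dilate (6 * p N) H"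
        unfolding H_def using p(1)[of N] by (intro cseq_in_dilate[OF S(1,2), where N = "max (\<kappa> N) N"]) simp_all
      thus ?thesis by (simp add: cseq_minus[OF MC[OF WC] MC[OF YC], symmetric] Wx)
    qed
    have lY: "cseq Y \<in> dilate 4 H" unfolding H_def by (rule cseq_in_dilate[OF S(1,2) YC, where N = 0]) (use YS in simp_all)
    have "Mackey_tendsto x (cseq Y)"
    proof (rule Mackey_tendsto_nullI[OF H])
      show "x n - cseq Y \<in> cspan H" for n
      proof (intro cspan_diff)
        show "x n \<in> cspan H" using x(1) S(3) by (intro cspan_base) (auto simp: H_def)
        show "cseq Y \<in> cspan H" using dilate_cspan[OF lY] .
      qed
      fix e :: real assume "0 < e"
      then obtain N where N: "7 * p N < e" using p_small by blast
      have "x n - cseq Y \<in> dilate e H" if "n \<ge> \<nu> N" for n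
      proof -
        have "(x n - x (\<nu> N)) + (x (\<nu> N) - cseq Y) \<in> dilate (p N + 6 * p N) H"
          using that \<nu>(1)[of N] by (intro dilate_add[OF H(2)] xY \<mu>) (simp_all add: p(1))
        hence "x n - cseq Y \<in> dilate (7 * p N) H" by simp
        thus ?thesis using N \<open>0 < e\<close> p(1)[of N] by (intro subsetD[OF dilate_mono[OF H(2), of "7 * p N" e]]) simp_all
      qed
      thus "\<exists>N. \<forall>n\<ge>N. x n - cseq Y \<in> dilate e H" by (intro exI[of _ "\<nu> N"] allI impI)
    qed
    thus ?thesis using lY by (intro bexI[of _ "cseq Y"])
  qed
  thus "\<exists>T. small T \<and> disk T \<and> (\<forall>X. range X \<subseteq> U \<longrightarrow> disk_Cauchy U X \<longrightarrow> (\<exists>l\<in>T. Mackey_tendsto X l))"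
    using small_dilate[OF H(1), of 4] disk_dilate[OF H(2), of 4] by (intro exI[of _ "dilate 4 H"] conjI allI impI)
qed

section \<open>Extension of bounded maps to completions\<close>

lemma Mackey_tendsto_minus:
  "Mackey_tendsto X l ==> Mackey_tendsto Y k ==> Mackey_tendsto (\<lambda>n. X n - Y n) (l - k)"
  using Mackey_tendsto_add[OF _ Mackey_tendsto_scale[of Y k "-1"], of X l]
  by (simp add: plus_fun_def complex_vector.scale_minus_left scaleC_one)

lemma Mackey_tendsto_plus:
  "Mackey_tendsto X l ==> Mackey_tendsto Y k ==> Mackey_tendsto (\<lambda>n. X n + Y n) (l + k)"
  using Mackey_tendsto_add[of X l Y k] by (simp add: plus_fun_def)

text \<open>\<open>L\<close> takes limits of \<open>f\<close> along representing sequences. It is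
  bounded because completeness encloses the limits of all Cauchy sequences in one disk in one small
  set, and it descends to the separated quotient because a bounded map into a separated space kills
  the closure of 0.\<close>

lemma completion_lift_exists:
  fixes f :: "'a::bornological_vector_space => 'b::bornological_vector_space"
  assumes f: "bounded_clinear f" and cpl: "bcomplete TYPE('b)"
  shows "\<exists>g. bounded_clinear g \<and> (\<forall>x. g (to_completion x) = f x)"
proof -
  note uniq = Mackey_tendsto_unique[OF bcomplete_separated[OF cpl]]
  define L where "L \<xi> = (THE l. Mackey_tendsto (\<lambda>n. f (rep_ind_completion \<xi> n)) l)" for \<xi>
  have L: "Mackey_tendsto (\<lambda>n. f (X n)) (L (abs_ind_completion X))" if X: "Mackey_Cauchy X" for X
  proof -
    let ?R = "rep_ind_completion (abs_ind_completion X)"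
    have R: "Mackey_Cauchy ?R" "Mackey_tendsto (\<lambda>n. ?R n - X n) 0"
      using Mackey_equiv_rep_abs[OF X] by (simp_all add: Mackey_equiv_def fun_diff_def)
    obtain l where "Mackey_tendsto (\<lambda>n. f (?R n)) l"
      using bcomplete_convergent[OF cpl blinear_Mackey_Cauchy[OF f R(1)]] by blast
    hence l: "Mackey_tendsto (\<lambda>n. f (?R n)) (L (abs_ind_completion X))"
      unfolding L_def using uniq by (metis (no_types, lifting) theI)
    from Mackey_tendsto_minus[OF this blinear_Mackey_tendsto[OF f R(2)]]
    show ?thesis using f by (simp add: clinear_diff clinear_zero bounded_clinear_def)
  qed
  have f': "clinear f" using f by (rule blinear_clinear)
  have Llin: "clinear L"
  proof (rule clinearI)
    fix x y :: "'a ind_completion" and c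
    obtain X Y where X: "Mackey_Cauchy X" "x = abs_ind_completion X" and Y: "Mackey_Cauchy Y" "y = abs_ind_completion Y"
      using ind_completion_exhaust by metis
    have "Mackey_Cauchy (\<lambda>n. X n + Y n)" using Mackey_Cauchy_add[OF X(1) Y(1)] by (simp add: plus_fun_def)
    from L[OF this] have "Mackey_tendsto (\<lambda>n. f (X n) + f (Y n)) (L (x + y))"
      using X Y by (simp add: abs_ind_add clinear_add[OF f'])
    moreover have "Mackey_tendsto (\<lambda>n. f (X n) + f (Y n)) (L x + L y)"
      using Mackey_tendsto_plus[OF L[OF X(1)] L[OF Y(1)]] X Y by simp
    ultimately show "L (x + y) = L x + L y" by (rule uniq)
    from L[OF Mackey_Cauchy_scale[OF X(1), of c]]
    have "Mackey_tendsto (\<lambda>n. c *\<^sub>C f (X n)) (L (c *\<^sub>C x))" using X by (simp add: abs_ind_scale clinear_scale[OF f'])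
    moreover have "Mackey_tendsto (\<lambda>n. c *\<^sub>C f (X n)) (c *\<^sub>C L x)" using Mackey_tendsto_scale[OF L[OF X(1)]] X by simp
    ultimately show "L (c *\<^sub>C x) = c *\<^sub>C L x" by (rule uniq)
  qed
  have Lbd: "bounded_clinear L"
  proof (rule bounded_clinearI[OF Llin])
    fix U :: "'a ind_completion set" assume "small U"
    then obtain S where S: "small S" "disk S" "U \<subseteq> ihat S" using small_ind_completionD by blast
    obtain P where P: "small P" "disk P" "f ` S \<subseteq> P" using blinear_disk[OF f S(1)] .
    obtain T where T: "small T" "\<And>X. range X \<subseteq> P ==> disk_Cauchy P X ==> \<exists>l\<in>T. Mackey_tendsto X l"
      using cpl P unfolding bcomplete_def by metis
    have "L x \<in> T" if "x \<in> U" for x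
    proof -
      obtain X where X: "x = abs_ind_completion X" "range X \<subseteq> S" "disk_Cauchy S X"
        using \<open>x \<in> U\<close> S(3) unfolding ihat_def by blast
      have "disk_Cauchy P (\<lambda>n. f (X n))" by (rule disk_Cauchy_transfer[OF f' S(2) P(2) _ _ X(3), of 1]) (use P in simp_all)
      moreover have "range (\<lambda>n. f (X n)) \<subseteq> P" using X(2) P(3) by (auto simp: image_subset_iff)
      ultimately obtain l where "l \<in> T" "Mackey_tendsto (\<lambda>n. f (X n)) l" using T(2) by blast
      thus ?thesis using uniq L[OF disk_Cauchy_Mackey[OF S(1,2) X(3)]] X(1) by metis
    qed
    thus "small (L ` U)" using small_subset[OF T(1)] by (meson image_subsetI)
  qed
  have L0: "L \<xi> = L \<eta>" if "\<xi> - \<eta> \<in> closed_cspan {0}" for \<xi> \<eta>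
    using blinear_eq_on_closed_cspan[OF Lbd blinear_zero bcomplete_separated[OF cpl] _ that]
    by (simp add: clinear_zero[OF Llin] clinear_diff[OF Llin])
  define g where "g x = L (rep_separated x)" for x
  have g: "g (abs_separated \<xi>) = L \<xi>" for \<xi> unfolding g_def by (rule L0[OF rep_abs_separated])
  have "clinear g"
  proof (rule clinearI)
    fix x y :: "'a completion" and c
    obtain \<xi> \<eta> where "x = abs_separated \<xi>" "y = abs_separated \<eta>" using separated_exhaust by metis
    thus "g (x + y) = g x + g y" "g (c *\<^sub>C x) = c *\<^sub>C g x"
      using Llin by (simp_all add: plus_separated.abs_eq scaleC_separated.abs_eq g clinear_add clinear_scale)
  qed
  hence "bounded_clinear g"
  proof (rule bounded_clinearI)
    fix U :: "'a completion set" assume "small U"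
    then obtain V where "small V" "U = abs_separated ` V" unfolding small_separated_def by blast
    thus "small (g ` U)" using blinear_small[OF Lbd] by (simp add: image_image g)
  qed
  moreover have "g (to_completion x) = f x" for x
    using L[OF Mackey_Cauchy_const[of x]] uniq[OF _ Mackey_tendsto_const] by (simp add: to_completion_def g)
  ultimately show ?thesis by blast
qed

lemma
  fixes f :: "'a::bornological_vector_space => 'b::bornological_vector_space"
  assumes f: "bounded_clinear f" and cpl: "bcomplete TYPE('b)"
  shows blinear_completion_lift: "bounded_clinear (completion_lift f)"
    and completion_lift_to_completion: "completion_lift f (to_completion x) = f x"
proof -
  have "\<exists>!g. bounded_clinear g \<and> (\<forall>x. g (to_completion x) = f x)"
    using completion_lift_exists[OF f cpl] completion_ext[OF _ _ bcomplete_separated[OF cpl]] by metis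
  hence "bounded_clinear (completion_lift f) \<and> (\<forall>x. completion_lift f (to_completion x) = f x)"
    unfolding completion_lift_def by (rule theI')
  thus "bounded_clinear (completion_lift f)" "completion_lift f (to_completion x) = f x" by blast+
qed

lemma completion_lift_tendsto:
  fixes f :: "'a::bornological_vector_space => 'b::bornological_vector_space"
  assumes f: "bounded_clinear f" and cpl: "bcomplete TYPE('b)" and X: "Mackey_Cauchy X"
  shows "Mackey_tendsto (\<lambda>n. f (X n)) (completion_lift f (cseq X))"
  using blinear_Mackey_tendsto[OF blinear_completion_lift[OF f cpl] to_completion_tendsto[OF X]]
  by (simp add: completion_lift_to_completion[OF f cpl])

lemma completion_lift_cseq:
  assumes f: "bounded_clinear f" and X: "Mackey_Cauchy X"
  shows "completion_lift (\<lambda>x. to_completion (f x)) (cseq X) = cseq (\<lambda>n. f (X n))"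
proof (rule Mackey_tendsto_unique[OF bseparated_completion])
  show "Mackey_tendsto (\<lambda>n. to_completion (f (X n))) (completion_lift (\<lambda>x. to_completion (f x)) (cseq X))"
    by (rule completion_lift_tendsto[OF blinear_compose[OF f blinear_to_completion] bcomplete_completion X])
  show "Mackey_tendsto (\<lambda>n. to_completion (f (X n))) (cseq (\<lambda>n. f (X n)))"
    by (rule to_completion_tendsto[OF blinear_Mackey_Cauchy[OF f X]])
qed

text \<open>One disk \<open>P\<close> contains the images of \<open>S\<close> under all members of
  the family, and one small set contains the limits of all Cauchy sequences in
  \<open>P\<close>.\<close>

lemma equibounded_completion_lift:
  fixes f :: "'i => 'a::bornological_vector_space => 'b::bornological_vector_space"
  assumes lin: "\<And>i. i \<in> I ==> clinear (f i)" and eq: "equibounded I f" and cpl: "bcomplete TYPE('b)"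
  shows "equibounded I (\<lambda>i. completion_lift (f i))" unfolding equibounded_def
proof (intro allI impI)
  fix U :: "'a completion set" assume "small U"
  then obtain S where S: "small S" "disk S" "U \<subseteq> hat S" using small_completionD by blast
  have "small (\<Union>i\<in>I. f i ` S)" using eq S(1) unfolding equibounded_def by blast
  then obtain P where P: "small P" "disk P" "(\<Union>i\<in>I. f i ` S) \<subseteq> P" using small_hull_disk by blast
  obtain T where T: "small T" "\<And>X. range X \<subseteq> P ==> disk_Cauchy P X ==> \<exists>l\<in>T. Mackey_tendsto X l"
    using cpl P unfolding bcomplete_def by metis
  have "completion_lift (f i) x \<in> T" if "i \<in> I" "x \<in> U" for i x
  proof -
    have fS: "f i ` S \<subseteq> P" using P(3) that(1) by blast
    obtain X where X: "x = cseq X" "range X \<subseteq> S" "disk_Cauchy S X" using \<open>x \<in> U\<close> S(3) unfolding hat_def by blast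
    have "disk_Cauchy P (\<lambda>n. f i (X n))"
      by (rule disk_Cauchy_transfer[OF lin[OF that(1)] S(2) P(2) _ _ X(3), of 1]) (use fS in simp_all)
    moreover have "range (\<lambda>n. f i (X n)) \<subseteq> P" using X(2) fS by (auto simp: image_subset_iff)
    ultimately obtain l where l: "l \<in> T" "Mackey_tendsto (\<lambda>n. f i (X n)) l" using T(2) by blast
    have "Mackey_tendsto (\<lambda>n. f i (X n)) (completion_lift (f i) x)"
      unfolding X(1) by (rule completion_lift_tendsto[OF equibounded_bounded[OF eq that(1) lin[OF that(1)]]
            cpl disk_Cauchy_Mackey[OF S(1,2) X(3)]])
    thus ?thesis using Mackey_tendsto_unique[OF bcomplete_separated[OF cpl] _ l(2)] l(1) by metis
  qed
  thus "small (\<Union>i\<in>I. completion_lift (f i) ` U)" by (intro small_subset[OF T(1)]) auto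
qed

lemma blinear_fst: "bounded_clinear (fst :: 'a::bornological_vector_space \<times> 'b::bornological_vector_space => 'a)"
  by (rule bounded_clinearI) (simp_all add: clinear_fst small_prod_def)

lemma blinear_snd: "bounded_clinear (snd :: 'a::bornological_vector_space \<times> 'b::bornological_vector_space => 'b)"
  by (rule bounded_clinearI) (simp_all add: clinear_snd small_prod_def)

lemma blinear_Pair:
  assumes "bounded_clinear f" "bounded_clinear g"
  shows "bounded_clinear (\<lambda>x. (f x, g x))"
proof (rule bounded_clinearI)
  show "clinear (\<lambda>x. (f x, g x))" using assms
    by (intro clinearI) (simp_all add: scaleC_prod_def bounded_clinear_def clinear_add clinear_scale)
  show "small ((\<lambda>x. (f x, g x)) ` S)" if "small S" for S
    using assms that by (simp add: small_prod_def image_image bounded_clinear_def)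
qed

lemma bcomplete_prod:
  assumes "bcomplete TYPE('a::bornological_vector_space)" "bcomplete TYPE('b::bornological_vector_space)"
  shows "bcomplete TYPE('a \<times> 'b)" unfolding bcomplete_def
proof (intro conjI allI impI)
  show "bseparated TYPE('a \<times> 'b)" unfolding bseparated_def
  proof (intro allI impI)
    fix x :: "'a \<times> 'b" assume x: "Mackey_tendsto (\<lambda>n. x) 0"
    from blinear_Mackey_tendsto[OF blinear_fst x] blinear_Mackey_tendsto[OF blinear_snd x]
    show "x = 0" using assms[THEN bcomplete_separated] unfolding bseparated_def by (auto simp: prod_eq_iff)
  qed
  fix S :: "('a \<times> 'b) set" assume S: "small S" "disk S"
  have S1: "small (fst ` S)" "disk (fst ` S)" and S2: "small (snd ` S)" "disk (snd ` S)"
    using S by (simp_all add: small_prod_def disk_image clinear_fst clinear_snd)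
  obtain T1 where T1: "small T1" "disk T1" "\<And>X. range X \<subseteq> fst ` S ==> disk_Cauchy (fst ` S) X ==> \<exists>l\<in>T1. Mackey_tendsto X l"
    using assms(1) S1 unfolding bcomplete_def by metis
  obtain T2 where T2: "small T2" "disk T2" "\<And>X. range X \<subseteq> snd ` S ==> disk_Cauchy (snd ` S) X ==> \<exists>l\<in>T2. Mackey_tendsto X l"
    using assms(2) S2 unfolding bcomplete_def by metis
  have "\<exists>l\<in>T1 \<times> T2. Mackey_tendsto X l" if X: "range X \<subseteq> S" "disk_Cauchy S X" for X
  proof -
    have "disk_Cauchy (fst ` S) (\<lambda>n. fst (X n))" "disk_Cauchy (snd ` S) (\<lambda>n. snd (X n))"
      by (rule disk_Cauchy_transfer[OF _ S(2) _ _ _ X(2), of _ _ 1]; use S1 S2 in \<open>simp add: clinear_fst clinear_snd\<close>)+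
    moreover have "range (\<lambda>n. fst (X n)) \<subseteq> fst ` S" "range (\<lambda>n. snd (X n)) \<subseteq> snd ` S" using X(1) by auto
    ultimately obtain k l where kl: "k \<in> T1" "l \<in> T2" "Mackey_tendsto (\<lambda>n. fst (X n)) k" "Mackey_tendsto (\<lambda>n. snd (X n)) l"
      using T1(3) T2(3) by meson
    have "bounded_clinear (\<lambda>x. (x, 0) :: 'a \<times> 'b)" "bounded_clinear (\<lambda>x. (0, x) :: 'a \<times> 'b)"
      by (intro blinear_Pair blinear_id blinear_zero)+
    from Mackey_tendsto_plus[OF blinear_Mackey_tendsto[OF this(1) kl(3)] blinear_Mackey_tendsto[OF this(2) kl(4)]]
    have "Mackey_tendsto X (k, l)" by simp
    thus ?thesis using kl by blast
  qed
  moreover have "small (T1 \<times> T2)" using T1(1) T2(1) by (auto simp: small_prod_def intro: small_subset small_empty)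
  moreover have "disk (T1 \<times> T2)" using T1(2) T2(2) unfolding disk_def by (auto simp: scaleC_prod_def simp del: of_real_diff)
  ultimately show "\<exists>T. small T \<and> disk T \<and> (\<forall>X. range X \<subseteq> S \<longrightarrow> disk_Cauchy S X \<longrightarrow> (\<exists>l\<in>T. Mackey_tendsto X l))"
    by (intro exI[of _ "T1 \<times> T2"] conjI allI impI)
qed

section \<open>Tensor products and multilinear extension\<close>

definition free_lift :: "('x => 'c::complex_vector) => ('x \<Rightarrow>\<^sub>0 complex) => 'c"
  where "free_lift \<phi> p = (\<Sum>k\<in>Poly_Mapping.keys p. Poly_Mapping.lookup p k *\<^sub>C \<phi> k)"

lemma clinear_free_lift: "clinear (free_lift \<phi>)"
proof (rule clinearI)
  show "free_lift \<phi> (p + q) = free_lift \<phi> p + free_lift \<phi> q" for p q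
    unfolding free_lift_def by (rule setsum_keys_plus_distrib) (simp_all add: scaleC_add_left)
  show "free_lift \<phi> (c *\<^sub>C p) = c *\<^sub>C free_lift \<phi> p" for c p
  proof -
    have "free_lift \<phi> (c *\<^sub>C p) = (\<Sum>k\<in>Poly_Mapping.keys p. Poly_Mapping.lookup (c *\<^sub>C p) k *\<^sub>C \<phi> k)" unfolding free_lift_def
      by (rule sum.mono_neutral_left) (auto simp: in_keys_iff scaleC_poly_mapping.rep_eq)
    thus ?thesis by (simp add: free_lift_def scaleC_poly_mapping.rep_eq scaleC_complex_def
          complex_vector.scale_sum_right scaleC_scaleC)
  qed
qed

lemma free_lift_basis [simp]: "free_lift \<phi> (basis x) = \<phi> x" by (simp add: free_lift_def scaleC_one)

lemma cspan_basis: "p \<in> cspan (range basis)"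
proof -
  have "p = (\<Sum>k\<in>Poly_Mapping.keys p. Poly_Mapping.lookup p k *\<^sub>C basis k)"
  proof (rule poly_mapping_eqI)
    fix j
    have "Poly_Mapping.lookup (\<Sum>k\<in>Poly_Mapping.keys p. Poly_Mapping.lookup p k *\<^sub>C basis k) j =
        (\<Sum>k\<in>Poly_Mapping.keys p. if k = j then Poly_Mapping.lookup p j else 0)"
      by (simp add: lookup_sum scaleC_poly_mapping.rep_eq lookup_single scaleC_complex_def when_def if_distrib cong: if_cong)
    thus "Poly_Mapping.lookup p j = Poly_Mapping.lookup (\<Sum>k\<in>Poly_Mapping.keys p. Poly_Mapping.lookup p k *\<^sub>C basis k) j"
      by (simp add: in_keys_iff)
  qed
  thus ?thesis by (metis (no_types, lifting) complex_vector.span_sum cspan_base cspan_eq cspan_scale rangeI)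
qed

lemma clinear_zero_on_cspan:
  assumes "clinear f" "\<And>x. x \<in> S ==> f x = 0" "x \<in> cspan S"
  shows "f x = 0" using assms(3) unfolding cspan_eq
  by (rule complex_vector.span_induct_alt) (simp_all add: assms clinear_zero clinear_add clinear_scale)

lemma clinear_eq_on_cspan:
  assumes "clinear f" "clinear g" "\<And>x. x \<in> S ==> f x = g x" "x \<in> cspan S"
  shows "f x = g x" using clinear_zero_on_cspan[OF clinear_minus[OF assms(1,2)] _ assms(4)] assms(3) by simp

lemma clinear_cspan_mem:
  assumes "clinear f" "\<And>x. x \<in> S ==> f x \<in> cspan T" "x \<in> cspan S"
  shows "f x \<in> cspan T" using assms(3) unfolding cspan_eq by (rule complex_vector.span_induct_alt)
    (use assms in \<open>simp_all add: clinear_zero clinear_add clinear_scale cspan_add cspan_scale cspan_0 flip: cspan_eq\<close>)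

lemma cbilinearI: "(\<And>x. clinear (\<lambda>y. f x y)) ==> (\<And>y. clinear (\<lambda>x. f x y)) ==> cbilinear f" by (simp add: cbilinear_def)

lemma cbilinear_right: "cbilinear f ==> clinear (\<lambda>y. f x y)" and cbilinear_left: "cbilinear f ==> clinear (\<lambda>x. f x y)"
  by (simp_all add: cbilinear_def)

lemma clinear_abs_tensor: "clinear abs_tensor" by (rule clinearI) (simp_all add: plus_tensor.abs_eq scaleC_tensor.abs_eq)

lemma tensor_exhaust: "\<exists>p. t = abs_tensor p"
  by (intro exI[of _ "rep_tensor t"] Quotient3_abs_rep[OF Quotient3_tensor, symmetric])

lemma cspan_pure_tensor: "(t :: ('a::complex_vector, 'b::complex_vector) tensor) \<in> cspan {pure_tensor x y |x y. True}"
proof -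
  obtain p where p: "t = abs_tensor p" using tensor_exhaust by blast
  show ?thesis unfolding p
  proof (rule clinear_cspan_mem[OF clinear_abs_tensor _ cspan_basis])
    fix q :: "('a \<times> 'b) \<Rightarrow>\<^sub>0 complex" assume "q \<in> range basis"
    thus "abs_tensor q \<in> cspan {pure_tensor x y |x y. True}"
      by (auto intro!: cspan_base simp: pure_tensor.abs_eq[symmetric]) blast
  qed
qed

lemma tensor_ext:
  assumes "clinear f" "clinear g" "\<And>x y. f (pure_tensor x y) = g (pure_tensor x y)"
  shows "f = (g :: ('a::complex_vector, 'b::complex_vector) tensor => 'c::complex_vector)"
proof
  fix t :: "('a, 'b) tensor"
  show "f t = g t" by (rule clinear_eq_on_cspan[OF assms(1,2) _ cspan_pure_tensor]) (use assms(3) in auto)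
qed

lemma cbilinear_pure_tensor: "cbilinear pure_tensor"
proof -
  have rel: "abs_tensor p = abs_tensor q" if "p - q \<in> tensor_relations" for p q :: "('a \<times> 'b) \<Rightarrow>\<^sub>0 complex"
    using that by (simp add: tensor.abs_eq_iff cspan_base)
  have "pure_tensor x (y + y') = pure_tensor x y + pure_tensor x y'" for x :: 'a and y y' :: 'b
    unfolding pure_tensor.abs_eq plus_tensor.abs_eq
    by (rule rel) (simp add: tensor_relations_def diff_diff_eq[symmetric], blast)
  moreover have "pure_tensor (x + x') y = pure_tensor x y + pure_tensor x' y" for x x' :: 'a and y :: 'b
    unfolding pure_tensor.abs_eq plus_tensor.abs_eq
    by (rule rel) (simp add: tensor_relations_def diff_diff_eq[symmetric], blast)
  moreover have "pure_tensor (c *\<^sub>C x) y = c *\<^sub>C pure_tensor x y" for c and x :: 'a and y :: 'b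
    unfolding pure_tensor.abs_eq scaleC_tensor.abs_eq by (rule rel) (simp add: tensor_relations_def, blast)
  moreover have "pure_tensor x (c *\<^sub>C y) = c *\<^sub>C pure_tensor x y" for c and x :: 'a and y :: 'b
    unfolding pure_tensor.abs_eq scaleC_tensor.abs_eq by (rule rel) (simp add: tensor_relations_def, blast)
  ultimately show ?thesis by (intro cbilinearI clinearI)
qed

definition tensor_lift ::
    "('a::complex_vector => 'b::complex_vector => 'c::complex_vector) => ('a, 'b) tensor => 'c"
  where "tensor_lift f = (THE g. clinear g \<and> (\<forall>x y. g (pure_tensor x y) = f x y))"

lemma
  fixes f :: "'a::complex_vector => 'b::complex_vector => 'c::complex_vector"
  assumes f: "cbilinear f"
  shows clinear_tensor_lift: "clinear (tensor_lift f)" and tensor_lift_pure: "tensor_lift f (pure_tensor x y) = f x y"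
proof -
  let ?L = "free_lift (\<lambda>(x, y). f x y)"
  have L0: "?L r = 0" if "r \<in> tensor_relations" for r
    using that cbilinear_right[OF f] cbilinear_left[OF f] unfolding tensor_relations_def
    by (auto simp: clinear_diff[OF clinear_free_lift] clinear_scale[OF clinear_free_lift]
        clinear_add[where f = "\<lambda>y. f _ y"] clinear_add[where f = "\<lambda>x. f x _"]
        clinear_scale[where f = "\<lambda>y. f _ y"] clinear_scale[where f = "\<lambda>x. f x _"])
  have L: "?L p = ?L q" if "abs_tensor p = abs_tensor q" for p q :: "('a \<times> 'b) \<Rightarrow>\<^sub>0 complex"
    using clinear_zero_on_cspan[OF clinear_free_lift L0, where x = "p - q"] that
    by (simp add: tensor.abs_eq_iff clinear_diff[OF clinear_free_lift])
  define g where "g t = ?L (rep_tensor t)" for t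
  have g: "g (abs_tensor p) = ?L p" for p unfolding g_def by (intro L Quotient3_abs_rep[OF Quotient3_tensor])
  have "clinear g"
  proof (rule clinearI)
    fix s t :: "('a, 'b) tensor" and c
    obtain p q where "s = abs_tensor p" "t = abs_tensor q" using tensor_exhaust by metis
    thus "g (s + t) = g s + g t" "g (c *\<^sub>C s) = c *\<^sub>C g s" by (simp_all add: plus_tensor.abs_eq scaleC_tensor.abs_eq g
          clinear_add[OF clinear_free_lift] clinear_scale[OF clinear_free_lift])
  qed
  moreover have "g (pure_tensor x y) = f x y" for x y by (simp add: pure_tensor.abs_eq g)
  ultimately have "\<exists>!g. clinear g \<and> (\<forall>x y. g (pure_tensor x y) = f x y)" using tensor_ext by (metis (no_types, lifting))
  hence "clinear (tensor_lift f) \<and> (\<forall>x y. tensor_lift f (pure_tensor x y) = f x y)" unfolding tensor_lift_def by (rule theI')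
  thus "clinear (tensor_lift f)" "tensor_lift f (pure_tensor x y) = f x y" by blast+
qed

section \<open>Bounded families and bounded bilinear maps\<close>

lemma small_pure_tensor:
  "small S ==> small T ==> small {pure_tensor x y |x y. x \<in> S \<and> y \<in> T}"
  unfolding small_tensor_def by (rule generated_bornologyI) blast

definition equibounded2 ::
    "'i set => ('i => 'a::bornological_vector_space => 'b::bornological_vector_space =>
      'c::bornological_vector_space) => bool"
  where "equibounded2 I f \<longleftrightarrow> (\<forall>S T. small S \<longrightarrow> small T \<longrightarrow> small (\<Union>i\<in>I. {f i x y |x y. x \<in> S \<and> y \<in> T}))"

lemma clinear_image_disk_hull: "clinear f ==> f ` S \<subseteq> D ==> disk D ==> f ` disk_hull S \<subseteq> D"
  by (metis disk_hull_image disk_hull_least)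

text \<open>Checking a family on a generated bornology reduces to the generators, since the sets
  with small total image form a convex bornology. Boundedness at each point is a separate hypothesis
  because singletons belong to every bornology.\<close>

lemma convex_bornology_equibounded:
  fixes f :: "'i => 'a::complex_vector => 'b::bornological_vector_space"
  assumes lin: "\<And>i. i \<in> I ==> clinear (f i)" and pt: "\<And>x. small {f i x |i. i \<in> I}"
  shows "convex_bornology (\<lambda>S. small (\<Union>i\<in>I. f i ` S))"
proof (rule convex_bornologyI)
  show "small (\<Union>i\<in>I. f i ` {x})" for x by (rule small_subset[OF pt[of x]]) auto
  show "small (\<Union>i\<in>I. f i ` T)" if "small (\<Union>i\<in>I. f i ` S)" "T \<subseteq> S" for S T
    by (rule small_subset[OF that(1)]) (use that(2) in auto)
  show "small (\<Union>i\<in>I. f i ` (S + T))" if "small (\<Union>i\<in>I. f i ` S)" "small (\<Union>i\<in>I. f i ` T)" for S T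
  proof (rule small_subset[OF small_add[OF that]], rule UN_least, rule image_subsetI)
    fix i z assume i: "i \<in> I" and "z \<in> S + T"
    then obtain x y where "z = x + y" "x \<in> S" "y \<in> T" by (elim set_plus_elim)
    thus "f i z \<in> (\<Union>i\<in>I. f i ` S) + (\<Union>i\<in>I. f i ` T)" using i lin[OF i] by (auto simp: clinear_add intro!: set_plus_intro)
  qed
  show "small (\<Union>i\<in>I. f i ` disk_hull S)" if S: "small (\<Union>i\<in>I. f i ` S)" for S
  proof -
    obtain D where D: "small D" "disk D" "(\<Union>i\<in>I. f i ` S) \<subseteq> D" using small_hull_disk[OF S] by blast
    have "f i ` disk_hull S \<subseteq> D" if "i \<in> I" for i
      by (rule clinear_image_disk_hull[OF lin[OF that] _ D(2)]) (use D(3) that in blast)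
    thus ?thesis by (intro small_subset[OF D(1)] UN_least)
  qed
qed

text \<open>Supplies the hypothesis at single points: the values at a linear combination lie in a
  sum of multiples of small sets.\<close>

lemma small_family_cspan:
  fixes f :: "'i => 'a::complex_vector => 'b::bornological_vector_space"
  assumes lin: "\<And>i. i \<in> I ==> clinear (f i)" and S: "\<And>x. x \<in> S ==> small {f i x |i. i \<in> I}" and x: "x \<in> cspan S"
  shows "small {f i x |i. i \<in> I}" using x unfolding cspan_eq
proof (rule complex_vector.span_induct_alt)
  show "small {f i 0 |i. i \<in> I}" by (rule small_subset[OF small_singleton[of 0]]) (auto simp: clinear_zero lin)
  fix c x y assume "x \<in> S" and y: "small {f i y |i. i \<in> I}"
  have "small ((\<lambda>z. c *\<^sub>C z) ` {f i x |i. i \<in> I})" using S[OF \<open>x \<in> S\<close>] blinear_small[OF blinear_scaleC_right] by blast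
  from small_add[OF this y] show "small {f i (c *\<^sub>C x + y) |i. i \<in> I}"
  proof (rule small_subset, clarify)
    fix i assume "i \<in> I"
    hence "c *\<^sub>C f i x + f i y \<in> (\<lambda>z. c *\<^sub>C z) ` {f i x |i. i \<in> I} + {f i y |i. i \<in> I}" by (intro set_plus_intro) blast+
    thus "f i (c *\<^sub>C x + y) \<in> (\<lambda>z. c *\<^sub>C z) ` {f i x |i. i \<in> I} + {f i y |i. i \<in> I}"
      by (simp add: clinear_add clinear_scale lin \<open>i \<in> I\<close>)
  qed
qed

lemma equibounded_tensor_lift:
  fixes f :: "'i => 'a::bornological_vector_space => 'b::bornological_vector_space => 'c::bornological_vector_space"
  assumes lin: "\<And>i. i \<in> I ==> cbilinear (f i)" and eq: "equibounded2 I f"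
  shows "equibounded I (\<lambda>i. tensor_lift (f i))" unfolding equibounded_def
proof (intro allI impI)
  fix U :: "('a, 'b) tensor set" assume U: "small U"
  note lin' = clinear_tensor_lift[OF lin]
  show "small (\<Union>i\<in>I. tensor_lift (f i) ` U)"
  proof (rule generated_bornologyD[OF U[unfolded small_tensor_def] convex_bornology_equibounded])
    show "clinear (tensor_lift (f i))" if "i \<in> I" for i using lin'[OF that] .
    show "small {tensor_lift (f i) t |i. i \<in> I}" for t
    proof (rule small_family_cspan[OF lin' _ cspan_pure_tensor])
      fix t :: "('a, 'b) tensor" assume "t \<in> {pure_tensor x y |x y. True}"
      then obtain x y where t: "t = pure_tensor x y" by blast
      have "small (\<Union>i\<in>I. {f i x' y' |x' y'. x' \<in> {x} \<and> y' \<in> {y}})"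
        by (rule eq[unfolded equibounded2_def, rule_format, OF small_singleton small_singleton])
      thus "small {tensor_lift (f i) t |i. i \<in> I}" by (rule small_subset) (auto simp: t tensor_lift_pure[OF lin])
    qed
    fix T :: "('a, 'b) tensor set"
    assume "T \<in> {{pure_tensor x y |x y. x \<in> S \<and> y \<in> T} |S T. small S \<and> small T}"
    then obtain S S' where T: "small S" "small S'" "T = {pure_tensor x y |x y. x \<in> S \<and> y \<in> S'}" by blast
    have "small (\<Union>i\<in>I. {f i x y |x y. x \<in> S \<and> y \<in> S'})" using eq T(1,2) unfolding equibounded2_def by blast
    thus "small (\<Union>i\<in>I. tensor_lift (f i) ` T)" by (rule small_subset) (auto simp: T(3) tensor_lift_pure[OF lin], blast)
  qed
qed

lemma bounded_cbilinearI:
  assumes "\<And>x. clinear (\<lambda>y. f x y)" "\<And>y. clinear (\<lambda>x. f x y)"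
    and "\<And>S T. small S ==> small T ==> small {f x y |x y. x \<in> S \<and> y \<in> T}"
  shows "bounded_cbilinear f" using assms by (simp add: bounded_cbilinear_def cbilinear_def)

lemma
  assumes "bounded_cbilinear f"
  shows bbil_cbilinear: "cbilinear f" and bbil_small: "small S ==> small T ==> small {f x y |x y. x \<in> S \<and> y \<in> T}"
    and bbil_clinear_right: "clinear (\<lambda>y. f x y)" and bbil_clinear_left: "clinear (\<lambda>x. f x y)"
  using assms by (auto simp: bounded_cbilinear_def cbilinear_def)

lemma bbil_right:
  assumes "bounded_cbilinear f"
  shows "bounded_clinear (\<lambda>y. f x y)"
proof (rule bounded_clinearI[OF bbil_clinear_right[OF assms]])
  fix S :: "'b set" assume "small S"
  from bbil_small[OF assms small_singleton[of x] this]
  show "small ((\<lambda>y. f x y) ` S)" by (rule small_subset) auto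
qed

lemma bbil_left:
  assumes "bounded_cbilinear f"
  shows "bounded_clinear (\<lambda>x. f x y)"
proof (rule bounded_clinearI[OF bbil_clinear_left[OF assms]])
  fix S :: "'a set" assume "small S"
  from bbil_small[OF assms this small_singleton[of y]]
  show "small ((\<lambda>x. f x y) ` S)" by (rule small_subset) auto
qed

lemma bounded_cbilinearI_equibounded:
  assumes "\<And>x. clinear (\<lambda>y. f x y)" "\<And>y. clinear (\<lambda>x. f x y)" and "\<And>S. small S ==> equibounded S f"
  shows "bounded_cbilinear f"
proof (rule bounded_cbilinearI[OF assms(1,2)])
  fix S :: "'a set" and T :: "'b set" assume "small S" "small T"
  hence "small (\<Union>i\<in>S. f i ` T)" using assms(3) unfolding equibounded_def by blast
  thus "small {f x y |x y. x \<in> S \<and> y \<in> T}" by (rule small_subset) blast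
qed

lemma bbil_compose:
  assumes f: "bounded_cbilinear f" and g: "bounded_clinear g" and h: "bounded_clinear h"
  shows "bounded_cbilinear (\<lambda>x y. f (g x) (h y))"
proof (rule bounded_cbilinearI)
  show "clinear (\<lambda>y. f (g x) (h y))" for x using clinear_compose[OF blinear_clinear[OF h] bbil_clinear_right[OF f]] .
  show "clinear (\<lambda>x. f (g x) (h y))" for y using clinear_compose[OF blinear_clinear[OF g] bbil_clinear_left[OF f]] .
  fix S :: "'d set" and T :: "'e set" assume "small S" "small T"
  hence "small {f x y |x y. x \<in> g ` S \<and> y \<in> h ` T}" by (intro bbil_small[OF f] blinear_small[OF g] blinear_small[OF h])
  thus "small {f (g x) (h y) |x y. x \<in> S \<and> y \<in> T}" by (rule small_subset) blast
qed

lemma blinear_cbilinear_compose: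
  assumes f: "bounded_cbilinear f" and g: "bounded_clinear g"
  shows "bounded_cbilinear (\<lambda>x y. g (f x y))"
proof (rule bounded_cbilinearI)
  show "clinear (\<lambda>y. g (f x y))" for x using clinear_compose[OF bbil_clinear_right[OF f] blinear_clinear[OF g]] .
  show "clinear (\<lambda>x. g (f x y))" for y using clinear_compose[OF bbil_clinear_left[OF f] blinear_clinear[OF g]] .
  fix S :: "'a set" and T :: "'b set" assume "small S" "small T"
  hence "small (g ` {f x y |x y. x \<in> S \<and> y \<in> T})" by (intro bbil_small[OF f] blinear_small[OF g])
  thus "small {g (f x y) |x y. x \<in> S \<and> y \<in> T}" by (rule small_subset) blast
qed

lemma bbil_plus:
  assumes f: "bounded_cbilinear f" and g: "bounded_cbilinear g"
  shows "bounded_cbilinear (\<lambda>x y. f x y + g x y)"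
proof (rule bounded_cbilinearI)
  show "clinear (\<lambda>y. f x y + g x y)" for x by (intro clinear_plus bbil_clinear_right f g)
  show "clinear (\<lambda>x. f x y + g x y)" for y by (intro clinear_plus bbil_clinear_left f g)
  fix S :: "'a set" and T :: "'b set" assume "small S" "small T"
  from small_add[OF bbil_small[OF f this] bbil_small[OF g this]]
  show "small {f x y + g x y |x y. x \<in> S \<and> y \<in> T}" by (rule small_subset) (auto intro: set_plus_intro)
qed

lemma bbil_uminus: "bounded_cbilinear f ==> bounded_cbilinear (\<lambda>x y. - f x y)"
  using blinear_cbilinear_compose[OF _ blinear_uminus[OF blinear_id]] .

lemma bbil_minus:
  "bounded_cbilinear f ==> bounded_cbilinear g ==> bounded_cbilinear (\<lambda>x y. f x y - g x y)"
  using bbil_plus[OF _ bbil_uminus] by simp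

lemma bbil_flip:
  assumes f: "bounded_cbilinear f"
  shows "bounded_cbilinear (\<lambda>x y. f y x)"
proof (rule bounded_cbilinearI)
  show "clinear (f x)" "clinear (\<lambda>x. f x y)" for x y using f by (rule bbil_clinear_right bbil_clinear_left)+
  fix S :: "'b set" and T :: "'a set" assume "small S" "small T"
  from bbil_small[OF f this(2,1)]
  show "small {f y x |x y. x \<in> S \<and> y \<in> T}" by (rule small_subset) blast
qed

lemma bbil_pure_tensor: "bounded_cbilinear pure_tensor"
  using cbilinear_pure_tensor small_pure_tensor by (auto simp: bounded_cbilinear_def)

lemma blinear_tensor_lift:
  assumes "bounded_cbilinear f"
  shows "bounded_clinear (tensor_lift f)"
proof (rule bounded_clinearI[OF clinear_tensor_lift[OF bbil_cbilinear[OF assms]]])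
  have "equibounded {()} (\<lambda>_. tensor_lift f)"
    by (rule equibounded_tensor_lift) (use assms in \<open>simp_all add: bounded_cbilinear_def equibounded2_def\<close>)
  thus "small (tensor_lift f ` S)" if "small S" for S using that by (simp add: equibounded_singleton)
qed

lemma bbil_ctensor_pure: "bounded_cbilinear (\<otimes>\<^sub>c)" unfolding ctensor_pure_def
  by (rule blinear_cbilinear_compose[OF bbil_pure_tensor blinear_to_completion])

lemma ctensor_ext:
  fixes f g :: "('a::bornological_vector_space, 'b::bornological_vector_space) ctensor => 'c::bornological_vector_space"
  assumes "bounded_clinear f" "bounded_clinear g" "bseparated TYPE('c)" and "\<And>x y. f (x \<otimes>\<^sub>c y) = g (x \<otimes>\<^sub>c y)"
  shows "f = g"
proof (rule completion_ext[OF assms(1,2,3)])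
  fix t :: "('a, 'b) tensor"
  have "(\<lambda>t. f (to_completion t)) = (\<lambda>t. g (to_completion t))"
    by (rule tensor_ext; (intro clinear_compose[OF clinear_to_completion] blinear_clinear assms(1,2))?)
      (use assms(4) in \<open>simp add: ctensor_pure_def\<close>)
  thus "f (to_completion t) = g (to_completion t)" by meson
qed

lemma ctensor_lift_eq:
  fixes f :: "'a::bornological_vector_space => 'b::bornological_vector_space => 'c::bornological_vector_space"
  assumes f: "bounded_cbilinear f" and cpl: "bcomplete TYPE('c)"
  shows "ctensor_lift f = completion_lift (tensor_lift f)" unfolding ctensor_lift_def
proof (rule the_equality)
  note b = blinear_tensor_lift[OF f]
  show *: "bounded_clinear (completion_lift (tensor_lift f)) \<and> (\<forall>x y. completion_lift (tensor_lift f) (x \<otimes>\<^sub>c y) = f x y)"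
    by (simp add: blinear_completion_lift[OF b cpl] ctensor_pure_def completion_lift_to_completion[OF b cpl]
        tensor_lift_pure[OF bbil_cbilinear[OF f]])
  show "g = completion_lift (tensor_lift f)" if "bounded_clinear g \<and> (\<forall>x y. g (x \<otimes>\<^sub>c y) = f x y)" for g
    by (rule ctensor_ext[OF _ _ bcomplete_separated[OF cpl]]) (use that * in simp_all)
qed

lemma
  fixes f :: "'a::bornological_vector_space => 'b::bornological_vector_space => 'c::bornological_vector_space"
  assumes f: "bounded_cbilinear f" and cpl: "bcomplete TYPE('c)"
  shows blinear_ctensor_lift: "bounded_clinear (ctensor_lift f)" and ctensor_lift_pure: "ctensor_lift f (x \<otimes>\<^sub>c y) = f x y"
  unfolding ctensor_lift_eq[OF f cpl]
  by (simp_all add: blinear_completion_lift[OF blinear_tensor_lift[OF f] cpl] ctensor_pure_def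
      completion_lift_to_completion[OF blinear_tensor_lift[OF f] cpl]
      tensor_lift_pure[OF bbil_cbilinear[OF f]])

lemma equibounded_ctensor_lift:
  fixes f :: "'i => 'a::bornological_vector_space => 'b::bornological_vector_space => 'c::bornological_vector_space"
  assumes lin: "\<And>i. i \<in> I ==> bounded_cbilinear (f i)" and eq: "equibounded2 I f" and cpl: "bcomplete TYPE('c)"
  shows "equibounded I (\<lambda>i. ctensor_lift (f i))"
proof -
  have "equibounded I (\<lambda>i. completion_lift (tensor_lift (f i)))"
    using lin by (intro equibounded_completion_lift[OF _ _ cpl] equibounded_tensor_lift eq clinear_tensor_lift bbil_cbilinear)
  thus ?thesis using lin by (simp add: equibounded_def ctensor_lift_eq[OF _ cpl])
qed

definition btrilinear ::
    "('u::bornological_vector_space => 'a::bornological_vector_space => 'b::bornological_vector_space =>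
      'c::bornological_vector_space) => bool"
  where "btrilinear f \<longleftrightarrow> (\<forall>u x. clinear (\<lambda>y. f u x y)) \<and> (\<forall>u y. clinear (\<lambda>x. f u x y)) \<and>
    (\<forall>x y. clinear (\<lambda>u. f u x y)) \<and>
    (\<forall>R S T. small R \<longrightarrow> small S \<longrightarrow> small T \<longrightarrow> small {f u x y |u x y. u \<in> R \<and> x \<in> S \<and> y \<in> T})"

lemma btrilinearI:
  assumes "\<And>u x. clinear (\<lambda>y. f u x y)" "\<And>u y. clinear (\<lambda>x. f u x y)" "\<And>x y. clinear (\<lambda>u. f u x y)"
    and "\<And>R S T. small R ==> small S ==> small T ==> small {f u x y |u x y. u \<in> R \<and> x \<in> S \<and> y \<in> T}"
  shows "btrilinear f" using assms by (simp add: btrilinear_def)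

lemma btrilinear_cbilinear:
  fixes f :: "'u::bornological_vector_space => 'a::bornological_vector_space => 'b::bornological_vector_space =>
    'c::bornological_vector_space"
  assumes "btrilinear f"
  shows "bounded_cbilinear (f u)"
proof (rule bounded_cbilinearI)
  fix S :: "'a set" and T :: "'b set" assume "small S" "small T"
  hence "small {f u' x y |u' x y. u' \<in> {u} \<and> x \<in> S \<and> y \<in> T}"
    using assms small_singleton[of u] unfolding btrilinear_def by blast
  thus "small {f u x y |x y. x \<in> S \<and> y \<in> T}" by (rule small_subset) auto
qed (use assms in \<open>simp_all add: btrilinear_def\<close>)

text \<open>A small set of parameters gives an equibounded family of bilinear maps, hence of lifts;
  linearity in the parameter follows from uniqueness of the lift.\<close>

lemma bbil_ctensor_lift:
  fixes f :: "'u::bornological_vector_space => 'a::bornological_vector_space => 'b::bornological_vector_space =>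
    'c::bornological_vector_space"
  assumes f: "btrilinear f" and cpl: "bcomplete TYPE('c)"
  shows "bounded_cbilinear (\<lambda>u. ctensor_lift (f u))"
proof (rule bounded_cbilinearI_equibounded)
  note bil = btrilinear_cbilinear[OF f]
  note bl = blinear_ctensor_lift[OF bil cpl] and pure = ctensor_lift_pure[OF bil cpl]
  have lin: "clinear (\<lambda>u. f u x y)" for x y using f by (simp add: btrilinear_def)
  show "clinear (ctensor_lift (f u))" for u by (rule blinear_clinear[OF bl])
  show "clinear (\<lambda>u. ctensor_lift (f u) t)" for t
  proof (rule clinearI)
    have "ctensor_lift (f (u + v)) = (\<lambda>t. ctensor_lift (f u) t + ctensor_lift (f v) t)" for u v
      by (rule ctensor_ext[OF bl blinear_plus[OF bl bl] bcomplete_separated[OF cpl]]) (simp add: pure clinear_add[OF lin])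
    thus "ctensor_lift (f (u + v)) t = ctensor_lift (f u) t + ctensor_lift (f v) t" for u v by simp
    have "ctensor_lift (f (c *\<^sub>C u)) = (\<lambda>t. c *\<^sub>C ctensor_lift (f u) t)" for c u
      by (rule ctensor_ext[OF bl blinear_scaleC[OF bl] bcomplete_separated[OF cpl]]) (simp add: pure clinear_scale[OF lin])
    thus "ctensor_lift (f (c *\<^sub>C u)) t = c *\<^sub>C ctensor_lift (f u) t" for c u by simp
  qed
  fix R :: "'u set" assume R: "small R"
  show "equibounded R (\<lambda>u. ctensor_lift (f u))"
  proof (rule equibounded_ctensor_lift[OF bil _ cpl])
    show "equibounded2 R f" unfolding equibounded2_def
    proof (intro allI impI)
      fix S :: "'a set" and T :: "'b set" assume "small S" "small T"
      hence "small {f u x y |u x y. u \<in> R \<and> x \<in> S \<and> y \<in> T}" using f R unfolding btrilinear_def by blast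
      thus "small (\<Union>i\<in>R. {f i x y |x y. x \<in> S \<and> y \<in> T})" by (rule small_subset) blast
    qed
  qed
qed

section \<open>Products on completions\<close>

lemma disk_Cauchy_bilinear:
  assumes f: "cbilinear f" and S: "disk S" and T: "disk T" and P: "disk P" and sub: "\<And>x y. x \<in> S ==> y \<in> T ==> f x y \<in> P"
    and X: "range X \<subseteq> S" "disk_Cauchy S X" and Y: "range Y \<subseteq> T" "disk_Cauchy T Y"
  shows "disk_Cauchy P (\<lambda>n. f (X n) (Y n))" unfolding disk_Cauchy_iff[OF P]
proof (intro conjI allI impI)
  have XS: "X n \<in> S" and YT: "Y n \<in> T" for n using X(1) Y(1) by auto
  show "range (\<lambda>n. f (X n) (Y n)) \<subseteq> cspan P" using sub[OF XS YT] cspan_base by auto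
  fix e :: real assume "0 < e"
  hence e2: "0 < e / 2" by simp
  obtain N where N: "\<forall>m\<ge>N. \<forall>n\<ge>N. X m - X n \<in> dilate (e / 2) S" using X(2) e2 disk_Cauchy_iff[OF S] by metis
  obtain M where M: "\<forall>m\<ge>M. \<forall>n\<ge>M. Y m - Y n \<in> dilate (e / 2) T" using Y(2) e2 disk_Cauchy_iff[OF T] by metis
  have "f (X m) (Y m) - f (X n) (Y n) \<in> dilate e P" if mn: "m \<ge> max N M" "n \<ge> max N M" for m n
  proof -
    obtain s where s: "s \<in> S" "X m - X n = of_real (e / 2) *\<^sub>C s" using N mn by (meson imageE max.bounded_iff)
    obtain t where t: "t \<in> T" "Y m - Y n = of_real (e / 2) *\<^sub>C t" using M mn by (meson imageE max.bounded_iff)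
    have "f (X m) (Y m) - f (X n) (Y n) = f (X m - X n) (Y m) + f (X n) (Y m - Y n)"
      by (simp add: clinear_diff[OF cbilinear_left[OF f]] clinear_diff[OF cbilinear_right[OF f]])
    also have "\<dots> = of_real (e / 2) *\<^sub>C f s (Y m) + of_real (e / 2) *\<^sub>C f (X n) t"
      unfolding s t by (simp only: clinear_scale[OF cbilinear_left[OF f]] clinear_scale[OF cbilinear_right[OF f]])
    also have "\<dots> \<in> dilate (e / 2 + e / 2) P" by (rule dilate_add[OF P _ _ e2 e2]; intro imageI sub XS YT s t)
    finally show ?thesis by simp
  qed
  thus "\<exists>N. \<forall>m\<ge>N. \<forall>n\<ge>N. f (X m) (Y m) - f (X n) (Y n) \<in> dilate e P" by (intro exI[of _ "max N M"]) blast
qed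

lemma bbil_disk:
  assumes "bounded_cbilinear f" "small S" "small T"
  obtains P where "small P" "disk P" "\<And>x y. x \<in> S ==> y \<in> T ==> f x y \<in> P"
proof -
  obtain P where "small P" "disk P" "{f x y |x y. x \<in> S \<and> y \<in> T} \<subseteq> P"
    using small_hull_disk[OF bbil_small[OF assms]] by blast
  thus ?thesis using that by blast
qed

lemma Mackey_Cauchy_bilinear:
  assumes f: "bounded_cbilinear f" and X: "Mackey_Cauchy X" and Y: "Mackey_Cauchy Y"
  shows "Mackey_Cauchy (\<lambda>n. f (X n) (Y n))"
proof -
  obtain S where S: "small S" "disk S" "range X \<subseteq> S" "disk_Cauchy S X" using Mackey_Cauchy_scaled[OF X] by blast
  obtain T where T: "small T" "disk T" "range Y \<subseteq> T" "disk_Cauchy T Y" using Mackey_Cauchy_scaled[OF Y] by blast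
  obtain P where P: "small P" "disk P" "\<And>x y. x \<in> S ==> y \<in> T ==> f x y \<in> P" using bbil_disk[OF f S(1) T(1)] by blast
  show ?thesis using disk_Cauchy_bilinear[OF bbil_cbilinear[OF f] S(2) T(2) P(2,3) S(3,4) T(3,4)] P(1,2)
    unfolding Mackey_Cauchy_def by blast
qed

lemma Mackey_null_bilinear_left:
  assumes f: "bounded_cbilinear f" and X: "Mackey_tendsto X 0" and Y: "Mackey_Cauchy Y"
  shows "Mackey_tendsto (\<lambda>n. f (X n) (Y n)) 0"
proof -
  obtain S where S: "small S" "disk S" "disk_tendsto S X 0" using X unfolding Mackey_tendsto_def by blast
  obtain T where T: "small T" "disk T" "range Y \<subseteq> T" "disk_Cauchy T Y" using Mackey_Cauchy_scaled[OF Y] by blast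
  obtain P where P: "small P" "disk P" "\<And>x y. x \<in> S ==> y \<in> T ==> f x y \<in> P" using bbil_disk[OF f S(1) T(1)] by blast
  note Xs = S(3)[unfolded disk_tendsto_iff[OF S(2)]]
  have f_dilate: "f x y \<in> dilate r P" if "x \<in> dilate r S" "y \<in> T" for x y r
    using that P(3) by (auto simp: blin_scale[OF bbil_left[OF f]])
  have YT: "Y n \<in> T" for n using T(3) by auto
  show ?thesis
  proof (rule Mackey_tendsto_nullI[OF P(1,2)])
    fix n
    have "X n \<in> cspan S" using Xs by auto
    then obtain r where "X n \<in> dilate r S" using cspan_disk[OF S(2)] by meson
    thus "f (X n) (Y n) - 0 \<in> cspan P" using dilate_cspan[OF f_dilate[OF _ YT]] by simp
  next
    fix e :: real assume "0 < e"
    then obtain N where "\<forall>n\<ge>N. X n \<in> dilate e S" using Xs by auto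
    hence "\<forall>n\<ge>N. f (X n) (Y n) - 0 \<in> dilate e P" using f_dilate[OF _ YT] by simp
    thus "\<exists>N. \<forall>n\<ge>N. f (X n) (Y n) - 0 \<in> dilate e P" by (rule exI)
  qed
qed

text \<open>Independence of the representatives that the definition chooses: the error splits into
  two products of a null sequence with a Cauchy sequence.\<close>

lemma times_abs_ind_completion:
  fixes X Y :: "nat => 'a::{bornological_vector_space, times}"
  assumes m: "bounded_cbilinear ((*) :: 'a => 'a => 'a)" and X: "Mackey_Cauchy X" and Y: "Mackey_Cauchy Y"
  shows "abs_ind_completion X * abs_ind_completion Y = abs_ind_completion (\<lambda>n. X n * Y n)"
proof -
  let ?X = "rep_ind_completion (abs_ind_completion X)" and ?Y = "rep_ind_completion (abs_ind_completion Y)"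
  have X': "Mackey_Cauchy ?X" "Mackey_tendsto (\<lambda>n. ?X n - X n) 0"
    and Y': "Mackey_Cauchy ?Y" "Mackey_tendsto (\<lambda>n. ?Y n - Y n) 0"
    using Mackey_equiv_rep_abs[OF X] Mackey_equiv_rep_abs[OF Y] by (simp_all add: Mackey_equiv_def fun_diff_def)
  note lin = blin_diff[OF bbil_left[OF m]] blin_diff[OF bbil_right[OF m]]
  show ?thesis unfolding times_ind_completion_def
  proof (rule abs_ind_eqI)
    show "Mackey_Cauchy (\<lambda>n. ?X n * ?Y n)" by (rule Mackey_Cauchy_bilinear[OF m X'(1) Y'(1)])
    show "Mackey_Cauchy (\<lambda>n. X n * Y n)" by (rule Mackey_Cauchy_bilinear[OF m X Y])
    have "Mackey_tendsto (\<lambda>n. (?X n - X n) * ?Y n + X n * (?Y n - Y n)) (0 + 0)"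
      by (rule Mackey_tendsto_plus[OF Mackey_null_bilinear_left[OF m X'(2) Y'(1)]
            Mackey_null_bilinear_left[OF bbil_flip[OF m] Y'(2) X]])
    thus "Mackey_tendsto (\<lambda>n. ?X n * ?Y n - X n * Y n) 0" by (simp add: lin)
  qed
qed

lemma bbil_times_ind_completion:
  assumes m: "bounded_cbilinear ((*) :: 'a::{bornological_vector_space, times} => 'a => 'a)"
  shows "bounded_cbilinear ((*) :: 'a ind_completion => 'a ind_completion => 'a ind_completion)"
proof (rule bounded_cbilinearI)
  note tm = times_abs_ind_completion[OF m]
  note C = Mackey_Cauchy_add[unfolded plus_fun_def] Mackey_Cauchy_scale Mackey_Cauchy_bilinear[OF m]
  note lin = blin_add[OF bbil_left[OF m]] blin_add[OF bbil_right[OF m]]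
    blin_scale[OF bbil_left[OF m]] blin_scale[OF bbil_right[OF m]]
  fix x :: "'a ind_completion"
  obtain X where X: "Mackey_Cauchy X" "x = abs_ind_completion X" using ind_completion_exhaust by blast
  show "clinear (\<lambda>y. x * y)"
  proof (rule clinearI)
    fix y z :: "'a ind_completion" and c
    obtain Y Z where "Mackey_Cauchy Y" "y = abs_ind_completion Y" "Mackey_Cauchy Z" "z = abs_ind_completion Z"
      using ind_completion_exhaust by metis
    thus "x * (y + z) = x * y + x * z" "x * (c *\<^sub>C y) = c *\<^sub>C (x * y)"
      using X by (simp_all add: abs_ind_add abs_ind_scale tm C lin)
  qed
  show "clinear (\<lambda>y. y * x)"
  proof (rule clinearI)
    fix y z :: "'a ind_completion" and c
    obtain Y Z where "Mackey_Cauchy Y" "y = abs_ind_completion Y" "Mackey_Cauchy Z" "z = abs_ind_completion Z"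
      using ind_completion_exhaust by metis
    thus "(y + z) * x = y * x + z * x" "(c *\<^sub>C y) * x = c *\<^sub>C (y * x)"
      using X by (simp_all add: abs_ind_add abs_ind_scale tm C lin)
  qed
next
  fix U V :: "'a ind_completion set" assume "small U" "small V"
  then obtain S T where S: "small S" "disk S" "U \<subseteq> ihat S" and T: "small T" "disk T" "V \<subseteq> ihat T"
    using small_ind_completionD by metis
  obtain P where P: "small P" "disk P" "\<And>x y. x \<in> S ==> y \<in> T ==> x * y \<in> P" using bbil_disk[OF m S(1) T(1)] by blast
  have "x * y \<in> ihat P" if xy: "x \<in> U" "y \<in> V" for x y
  proof -
    obtain X where X: "x = abs_ind_completion X" "range X \<subseteq> S" "disk_Cauchy S X" using xy S(3) unfolding ihat_def by blast
    obtain Y where Y: "y = abs_ind_completion Y" "range Y \<subseteq> T" "disk_Cauchy T Y" using xy T(3) unfolding ihat_def by blast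
    have "x * y = abs_ind_completion (\<lambda>n. X n * Y n)"
      unfolding X(1) Y(1) using X Y S T disk_Cauchy_Mackey by (intro times_abs_ind_completion[OF m])
    moreover have "disk_Cauchy P (\<lambda>n. X n * Y n)"
      using X Y S T P by (intro disk_Cauchy_bilinear[OF bbil_cbilinear[OF m]])
    moreover have "range (\<lambda>n. X n * Y n) \<subseteq> P" using P(3) X(2) Y(2) by (auto simp: image_subset_iff)
    ultimately show ?thesis unfolding ihat_def by blast
  qed
  thus "small {x * y |x y. x \<in> U \<and> y \<in> V}" by (intro small_subset[OF small_ihat[OF P(1,2)]]) blast
qed

text \<open>The closure of 0 is an ideal: multiplication by a fixed element followed by the quotient
  map is bounded into a separated space and kills 0, hence also the closure of 0.\<close>

lemma times_abs_separated:
  fixes \<xi> \<eta> :: "'a::{bornological_vector_space, times} ind_completion"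
  assumes m: "bounded_cbilinear ((*) :: 'a => 'a => 'a)"
  shows "abs_separated \<xi> * abs_separated \<eta> = abs_separated (\<xi> * \<eta>)"
proof -
  note m' = bbil_times_ind_completion[OF m]
  have z1: "abs_separated (\<alpha> * \<beta>) = 0" if "\<beta> \<in> closed_cspan {0}" for \<alpha> \<beta> :: "'a ind_completion"
    by (rule blinear_eq_on_closed_cspan[OF blinear_compose[OF bbil_right[OF m'] blinear_abs_separated]
          blinear_zero bseparated_completion _ that])
      (simp add: blin_zero[OF bbil_right[OF m']] clinear_zero[OF clinear_abs_separated])
  have z2: "abs_separated (\<beta> * \<alpha>) = 0" if "\<beta> \<in> closed_cspan {0}" for \<alpha> \<beta> :: "'a ind_completion"
    by (rule blinear_eq_on_closed_cspan[OF blinear_compose[OF bbil_left[OF m'] blinear_abs_separated]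
          blinear_zero bseparated_completion _ that])
      (simp add: blin_zero[OF bbil_left[OF m']] clinear_zero[OF clinear_abs_separated])
  let ?x = "rep_separated (abs_separated \<xi>)" and ?y = "rep_separated (abs_separated \<eta>)"
  have "abs_separated ((?x - \<xi>) * ?y) + abs_separated (\<xi> * (?y - \<eta>)) = 0" by (simp add: z1 z2 rep_abs_separated)
  hence "abs_separated (?x * ?y) - abs_separated (\<xi> * \<eta>) = 0"
    by (simp add: blin_diff[OF bbil_left[OF m']] blin_diff[OF bbil_right[OF m']]
        clinear_diff[OF clinear_abs_separated])
  thus ?thesis by (simp add: times_separated_def)
qed

lemma bbil_times_completion:
  assumes m: "bounded_cbilinear ((*) :: 'a::{bornological_vector_space, times} => 'a => 'a)"
  shows "bounded_cbilinear ((*) :: 'a completion => 'a completion => 'a completion)"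
proof (rule bounded_cbilinearI)
  note m' = bbil_times_ind_completion[OF m]
  note tm = times_abs_separated[OF m]
  note lin = blin_add[OF bbil_left[OF m']] blin_add[OF bbil_right[OF m']]
    blin_scale[OF bbil_left[OF m']] blin_scale[OF bbil_right[OF m']]
    plus_separated.abs_eq scaleC_separated.abs_eq
  fix x :: "'a completion"
  obtain \<xi> where x: "x = abs_separated \<xi>" using separated_exhaust by blast
  show "clinear (\<lambda>y. x * y)"
  proof (rule clinearI)
    fix y z :: "'a completion" and c
    obtain \<eta> \<zeta> where "y = abs_separated \<eta>" "z = abs_separated \<zeta>" using separated_exhaust by metis
    thus "x * (y + z) = x * y + x * z" "x * (c *\<^sub>C y) = c *\<^sub>C (x * y)" by (simp_all add: x tm lin)
  qed
  show "clinear (\<lambda>y. y * x)"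
  proof (rule clinearI)
    fix y z :: "'a completion" and c
    obtain \<eta> \<zeta> where "y = abs_separated \<eta>" "z = abs_separated \<zeta>" using separated_exhaust by metis
    thus "(y + z) * x = y * x + z * x" "(c *\<^sub>C y) * x = c *\<^sub>C (y * x)" by (simp_all add: x tm lin)
  qed
next
  fix U V :: "'a completion set" assume "small U" "small V"
  then obtain S T where S: "small S" "U = abs_separated ` S" and T: "small T" "V = abs_separated ` T"
    unfolding small_separated_def by blast
  have "small (abs_separated ` {x * y |x y. x \<in> S \<and> y \<in> T})" by (intro blinear_small[OF blinear_abs_separated]
        bbil_small[OF bbil_times_ind_completion[OF m]] S T)
  thus "small {x * y |x y. x \<in> U \<and> y \<in> V}" by (rule small_subset) (auto simp: S(2) T(2) times_abs_separated[OF m], blast)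
qed

lemma cseq_times:
  fixes X Y :: "nat => 'a::{bornological_vector_space, times}"
  assumes "bounded_cbilinear ((*) :: 'a => 'a => 'a)" "Mackey_Cauchy X" "Mackey_Cauchy Y"
  shows "cseq X * cseq Y = cseq (\<lambda>n. X n * Y n)"
  by (simp add: cseq_def times_abs_separated[OF assms(1)] times_abs_ind_completion[OF assms])

lemma to_completion_times:
  assumes "bounded_cbilinear ((*) :: 'a::{bornological_vector_space, times} => 'a => 'a)"
  shows "to_completion (x * y) = to_completion x * to_completion (y :: 'a)"
  by (simp add: to_completion_cseq cseq_times[OF assms Mackey_Cauchy_const Mackey_Cauchy_const])

lemma hat_times:
  fixes S T P :: "'a::{bornological_vector_space, times} set"
  assumes m: "bounded_cbilinear ((*) :: 'a => 'a => 'a)" and S: "small S" "disk S" and T: "small T" "disk T" and P: "disk P"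
    and sub: "\<And>x y. x \<in> S ==> y \<in> T ==> x * y \<in> P" and x: "x \<in> hat S" "y \<in> hat T"
  shows "x * y \<in> hat P"
proof -
  obtain X where X: "x = cseq X" "range X \<subseteq> S" "disk_Cauchy S X" using x unfolding hat_def by blast
  obtain Y where Y: "y = cseq Y" "range Y \<subseteq> T" "disk_Cauchy T Y" using x unfolding hat_def by blast
  have "x * y = cseq (\<lambda>n. X n * Y n)" unfolding X(1) Y(1) using X Y S T disk_Cauchy_Mackey by (intro cseq_times[OF m])
  moreover have "disk_Cauchy P (\<lambda>n. X n * Y n)"
    using X Y S T P sub by (intro disk_Cauchy_bilinear[OF bbil_cbilinear[OF m]])
  moreover have "range (\<lambda>n. X n * Y n) \<subseteq> P" using sub X(2) Y(2) by (auto simp: image_subset_iff)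
  ultimately show ?thesis unfolding hat_def by blast
qed

lemma completion_times_assoc:
  assumes m: "bounded_cbilinear ((*) :: 'a::{bornological_vector_space, times} => 'a => 'a)"
    and assoc: "\<And>x y z :: 'a. (x * y) * z = x * (y * z)"
  shows "(x * y) * z = x * (y * z :: 'a completion)"
proof -
  obtain X Y Z where "Mackey_Cauchy X" "x = cseq X" "Mackey_Cauchy Y" "y = cseq Y" "Mackey_Cauchy Z" "z = cseq Z"
    using completion_exhaust by metis
  thus ?thesis by (simp add: cseq_times[OF m] Mackey_Cauchy_bilinear[OF m] assoc)
qed

subsection \<open>Products on tensor products\<close>

definition tensor_lift2 ::
    "('a::complex_vector => 'b::complex_vector => 'c::complex_vector => 'd::complex_vector => 'e::complex_vector) =>
      ('a, 'b) tensor => ('c, 'd) tensor => 'e"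
  where "tensor_lift2 f s t = tensor_lift (\<lambda>x y. tensor_lift (f x y) t) s"

lemma clinear_tensor_lift_param:
  assumes "\<And>u. cbilinear (f u)" "\<And>x y. clinear (\<lambda>u. f u x y)"
  shows "clinear (\<lambda>u. tensor_lift (f u) t)"
proof (rule clinearI)
  note lin = clinear_tensor_lift[OF assms(1)] and pure = tensor_lift_pure[OF assms(1)]
  have "tensor_lift (f (u + v)) = (\<lambda>t. tensor_lift (f u) t + tensor_lift (f v) t)" for u v
    by (rule tensor_ext[OF lin clinear_plus[OF lin lin]]) (simp add: pure clinear_add[OF assms(2)])
  thus "tensor_lift (f (u + v)) t = tensor_lift (f u) t + tensor_lift (f v) t" for u v by simp
  have "tensor_lift (f (c *\<^sub>C u)) = (\<lambda>t. c *\<^sub>C tensor_lift (f u) t)" for c u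
    by (rule tensor_ext[OF lin clinear_scaleC_fun[OF lin]]) (simp add: pure clinear_scale[OF assms(2)])
  thus "tensor_lift (f (c *\<^sub>C u)) t = c *\<^sub>C tensor_lift (f u) t" for c u by simp
qed

text \<open>The universal property is used twice. Small sets of \<open>x\<close> and
  \<open>y\<close> index the inner family of lifts, and a small set of second arguments then indexes
  the outer one.\<close>

lemma
  fixes f :: "'a::bornological_vector_space => 'b::bornological_vector_space => 'c::bornological_vector_space =>
    'd::bornological_vector_space => 'e::bornological_vector_space"
  assumes lin: "\<And>x y. cbilinear (f x y)" "\<And>z w. cbilinear (\<lambda>x y. f x y z w)"
    and bd: "\<And>Q R S T. small Q ==> small R ==> small S ==> small T ==>
      small {f x y z w |x y z w. x \<in> Q \<and> y \<in> R \<and> z \<in> S \<and> w \<in> T}"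
  shows bbil_tensor_lift2: "bounded_cbilinear (tensor_lift2 f)"
    and tensor_lift2_pure: "tensor_lift2 f (pure_tensor x y) (pure_tensor z w) = f x y z w"
proof -
  have lin2: "cbilinear (\<lambda>x y. tensor_lift (f x y) t)" for t
    by (intro cbilinearI clinear_tensor_lift_param lin cbilinear_right[OF lin(2)] cbilinear_left[OF lin(2)])
  show "tensor_lift2 f (pure_tensor x y) (pure_tensor z w) = f x y z w"
    by (simp add: tensor_lift2_def tensor_lift_pure[OF lin2] tensor_lift_pure[OF lin(1)] tensor_lift_pure[OF lin(2)])
  have eqx: "equibounded ((\<lambda>(x, y). (x, y)) ` (Q \<times> R)) (\<lambda>(x, y). tensor_lift (f x y))"
    if "small Q" "small R" for Q R
  proof -
    have "equibounded (Q \<times> R) (\<lambda>i. tensor_lift (f (fst i) (snd i)))"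
    proof (rule equibounded_tensor_lift[OF lin(1)], unfold equibounded2_def, intro allI impI)
      fix S :: "'c set" and T :: "'d set" assume "small S" "small T"
      from bd[OF that this] show "small (\<Union>i\<in>Q \<times> R. {f (fst i) (snd i) x y |x y. x \<in> S \<and> y \<in> T})"
        by (rule small_subset) (auto, blast)
    qed
    thus ?thesis by (simp add: case_prod_unfold)
  qed
  show "bounded_cbilinear (tensor_lift2 f)"
  proof (rule bounded_cbilinearI)
    show "clinear (\<lambda>t. tensor_lift2 f s t)" for s unfolding tensor_lift2_def
      by (intro clinear_tensor_lift_param lin2 clinear_tensor_lift[OF lin(1)])
    show "clinear (\<lambda>s. tensor_lift2 f s t)" for t unfolding tensor_lift2_def by (rule clinear_tensor_lift[OF lin2])
    fix U :: "('a, 'b) tensor set" and V :: "('c, 'd) tensor set" assume U: "small U" and V: "small V"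
    have "equibounded V (\<lambda>t. tensor_lift (\<lambda>x y. tensor_lift (f x y) t))"
    proof (rule equibounded_tensor_lift[OF lin2], unfold equibounded2_def, intro allI impI)
      fix Q :: "'a set" and R :: "'b set" assume "small Q" "small R"
      from eqx[OF this] V have "small (\<Union>i\<in>Q \<times> R. (case i of (x, y) => tensor_lift (f x y)) ` V)"
        unfolding equibounded_def by simp
      thus "small (\<Union>t\<in>V. {tensor_lift (f x y) t |x y. x \<in> Q \<and> y \<in> R})" by (rule small_subset) fastforce
    qed
    hence "small (\<Union>t\<in>V. tensor_lift (\<lambda>x y. tensor_lift (f x y) t) ` U)" using U unfolding equibounded_def by blast
    thus "small {tensor_lift2 f x y |x y. x \<in> U \<and> y \<in> V}" by (rule small_subset) (auto simp: tensor_lift2_def)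
  qed
qed

lemma cbilinear_tensor_ext:
  assumes f: "cbilinear f" and g: "cbilinear g"
    and eq: "\<And>x y z w. f (pure_tensor x y) (pure_tensor z w) = g (pure_tensor x y) (pure_tensor z w)"
  shows "f = (g :: ('a::complex_vector, 'b::complex_vector) tensor => ('c::complex_vector, 'd::complex_vector) tensor => 'e::complex_vector)"
proof (intro ext)
  fix s t
  have "f (pure_tensor x y) = g (pure_tensor x y)" for x y
    by (rule tensor_ext[OF cbilinear_right[OF f] cbilinear_right[OF g] eq])
  hence "(\<lambda>s. f s t) = (\<lambda>s. g s t)" by (intro tensor_ext cbilinear_left f g) simp
  thus "f s t = g s t" by meson
qed

lemma
  assumes ma: "bounded_cbilinear ((*) :: 'a::{bornological_vector_space, times} => 'a => 'a)"
    and mb: "bounded_cbilinear ((*) :: 'b::{bornological_vector_space, times} => 'b => 'b)"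
  shows bbil_times_tensor: "bounded_cbilinear ((*) :: ('a, 'b) tensor => ('a, 'b) tensor => ('a, 'b) tensor)"
    and times_tensor_pure: "pure_tensor x y * pure_tensor x' y' = (pure_tensor (x * x') (y * y') :: ('a, 'b) tensor)"
proof -
  let ?f = "\<lambda>x y x' y'. pure_tensor (x * x') (y * y') :: ('a, 'b) tensor"
  let ?m = "tensor_lift2 ?f"
  note pt = bbil_cbilinear[OF bbil_pure_tensor]
  have lin: "cbilinear (?f x y)" "cbilinear (\<lambda>x y. ?f x y x' y')" for x y x' y'
    by (intro cbilinearI clinear_compose[OF _ cbilinear_left[OF pt]] clinear_compose[OF _ cbilinear_right[OF pt]]
        bbil_clinear_left[OF ma] bbil_clinear_right[OF ma]
        bbil_clinear_left[OF mb] bbil_clinear_right[OF mb])+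
  have bd: "small {?f x y z w |x y z w. x \<in> Q \<and> y \<in> R \<and> z \<in> S \<and> w \<in> T}"
    if "small Q" "small R" "small S" "small T" for Q R S T
    by (rule small_subset[OF small_pure_tensor[OF bbil_small[OF ma that(1,3)] bbil_small[OF mb that(2,4)]]])
      blast
  note b = bbil_tensor_lift2[OF lin bd] and p = tensor_lift2_pure[OF lin bd]
  have "((*) :: ('a, 'b) tensor => _) = ?m" unfolding times_tensor_def
  proof (rule the_equality)
    show *: "cbilinear ?m \<and> (\<forall>x y x' y'. ?m (pure_tensor x y) (pure_tensor x' y') = pure_tensor (x * x') (y * y'))"
      using bbil_cbilinear[OF b] p by blast
    show "m = ?m" if "cbilinear m \<and> (\<forall>x y x' y'. m (pure_tensor x y) (pure_tensor x' y') = pure_tensor (x * x') (y * y'))" for m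
      by (rule cbilinear_tensor_ext) (use that * in auto)
  qed
  thus "bounded_cbilinear ((*) :: ('a, 'b) tensor => ('a, 'b) tensor => ('a, 'b) tensor)"
    "pure_tensor x y * pure_tensor x' y' = (pure_tensor (x * x') (y * y') :: ('a, 'b) tensor)" using b p by simp_all
qed

lemma times_tensor_assoc:
  assumes ma: "bounded_cbilinear ((*) :: 'a::{bornological_vector_space, times} => 'a => 'a)"
    and mb: "bounded_cbilinear ((*) :: 'b::{bornological_vector_space, times} => 'b => 'b)"
    and aa: "\<And>x y z :: 'a. (x * y) * z = x * (y * z)" and ab: "\<And>x y z :: 'b. (x * y) * z = x * (y * z)"
  shows "(x * y) * z = x * (y * z :: ('a, 'b) tensor)"
proof -
  note m = bbil_cbilinear[OF bbil_times_tensor[OF ma mb]]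
  note p = times_tensor_pure[OF ma mb]
  note l = cbilinear_left[OF m] and r = cbilinear_right[OF m]
  have "(\<lambda>x y. (x * y) * pure_tensor z w) = (\<lambda>x y. x * (y * pure_tensor z w :: ('a, 'b) tensor))" for z w
  proof (rule cbilinear_tensor_ext)
    show "cbilinear (\<lambda>x y. (x * y) * (pure_tensor z w :: ('a, 'b) tensor))"
      by (intro cbilinearI clinear_compose[OF r l] clinear_compose[OF l l])
    show "cbilinear (\<lambda>x y. x * (y * (pure_tensor z w :: ('a, 'b) tensor)))" by (intro cbilinearI clinear_compose[OF l r] l)
  qed (simp add: p aa ab)
  hence "(\<lambda>z. (x * y) * z) = (\<lambda>z. x * (y * z))" by (intro tensor_ext r clinear_compose[OF r r]) metis
  thus ?thesis by meson
qed

section \<open>Non-commutative differential forms\<close>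

definition mlist :: "('a::complex_vector list => 'c::complex_vector) => bool"
  where "mlist f \<longleftrightarrow> (\<forall>us vs. clinear (\<lambda>x. f (us @ x # vs)))"

text \<open>These are the conditions under which \<open>f\<close> respects the relations of
  \<open>omega\<close>; the value at \<open>None []\<close> is prescribed because the empty form is
  zero there.\<close>

definition mform :: "('a::complex_vector option => 'a list => 'c::complex_vector) => bool"
  where "mform f \<longleftrightarrow> f None [] = 0 \<and> (\<forall>as. clinear (\<lambda>x. f (Some x) as)) \<and> (\<forall>a. mlist (f a))"

definition omega_lift :: "('a::complex_vector option => 'a list => 'c::complex_vector) => 'a omega => 'c"
  where "omega_lift f t = free_lift (\<lambda>(a, as). f a as) (rep_omega t)"

lemma clinear_abs_omega: "clinear abs_omega" by (rule clinearI) (simp_all add: plus_omega.abs_eq scaleC_omega.abs_eq)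

lemma omega_exhaust: "\<exists>p. t = abs_omega p"
  by (intro exI[of _ "rep_omega t"] Quotient3_abs_rep[OF Quotient3_omega, symmetric])

lemma form_None_Nil [simp]: "form None [] = 0" unfolding form.abs_eq zero_omega_def
  by (subst omega.abs_eq_iff) (simp add: cspan_base omega_relations_def)

lemma mform_form: "mform form"
proof -
  have rel: "abs_omega p = abs_omega q" if "p - q \<in> omega_relations" for p q :: "('a option \<times> 'a list) \<Rightarrow>\<^sub>0 complex"
    using that by (simp add: omega.abs_eq_iff cspan_base)
  have "clinear (\<lambda>x. form (Some x) as)" for as :: "'a list" unfolding form.abs_eq
    by (rule clinearI; unfold plus_omega.abs_eq scaleC_omega.abs_eq; rule rel)
      (simp add: omega_relations_def diff_diff_eq[symmetric], blast)+
  moreover have "clinear (\<lambda>x. form a (us @ x # vs))" for a :: "'a option" and us vs unfolding form.abs_eq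
    by (rule clinearI; unfold plus_omega.abs_eq scaleC_omega.abs_eq; rule rel)
      (simp add: omega_relations_def diff_diff_eq[symmetric], blast)+
  ultimately show ?thesis by (simp add: mform_def mlist_def)
qed

lemma clinear_form_Some: "clinear (\<lambda>x. form (Some x) as)" and clinear_form_list: "clinear (\<lambda>x. form a (us @ x # vs))"
  by (rule mform_form[unfolded mform_def mlist_def, THEN conjunct2, THEN conjunct1, rule_format])
    (rule mform_form[unfolded mform_def mlist_def, THEN conjunct2, THEN conjunct2, rule_format])

lemma cspan_forms: "(t :: 'a::complex_vector omega) \<in> cspan {form a as |a as. proper_form a as}"
proof -
  obtain p where p: "t = abs_omega p" using omega_exhaust by blast
  show ?thesis unfolding p
  proof (rule clinear_cspan_mem[OF clinear_abs_omega _ cspan_basis])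
    fix q :: "('a option \<times> 'a list) \<Rightarrow>\<^sub>0 complex" assume "q \<in> range basis"
    then obtain a as where "abs_omega q = form a as" by (auto simp: form.abs_eq)
    thus "abs_omega q \<in> cspan {form a as |a as. proper_form a as}"
      by (cases "proper_form a as") (auto intro!: cspan_base cspan_0)
  qed
qed

lemma omega_ext:
  assumes "clinear f" "clinear g" "\<And>a as. proper_form a as ==> f (form a as) = g (form a as)"
  shows "f = (g :: 'a::complex_vector omega => 'c::complex_vector)"
proof
  fix t :: "'a omega"
  show "f t = g t" by (rule clinear_eq_on_cspan[OF assms(1,2) _ cspan_forms]) (use assms(3) in auto)
qed

lemma
  assumes f: "mform f"
  shows clinear_omega_lift: "clinear (omega_lift f)" and omega_lift_form: "omega_lift f (form a as) = f a as"
proof -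
  let ?L = "free_lift (\<lambda>(a, as). f a as)"
  have l: "clinear (\<lambda>x. f (Some x) as)" "clinear (\<lambda>x. f a (us @ x # vs))" for a as us vs
    using f by (simp_all add: mform_def mlist_def)
  have L0: "?L r = 0" if "r \<in> omega_relations" for r
    using that f clinear_add[OF l(1)] clinear_scale[OF l(1)] clinear_add[OF l(2)] clinear_scale[OF l(2)]
    unfolding omega_relations_def mform_def
    by (auto simp: clinear_diff[OF clinear_free_lift] clinear_scale[OF clinear_free_lift])
  have L: "?L p = ?L q" if "abs_omega p = abs_omega q" for p q
    using clinear_zero_on_cspan[OF clinear_free_lift L0, where x = "p - q"] that
    by (simp add: omega.abs_eq_iff clinear_diff[OF clinear_free_lift])
  have g: "omega_lift f (abs_omega p) = ?L p" for p
    unfolding omega_lift_def by (intro L Quotient3_abs_rep[OF Quotient3_omega])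
  show "clinear (omega_lift f)"
  proof (rule clinearI)
    fix s t :: "'a omega" and c
    obtain p q where "s = abs_omega p" "t = abs_omega q" using omega_exhaust by metis
    thus "omega_lift f (s + t) = omega_lift f s + omega_lift f t" "omega_lift f (c *\<^sub>C s) = c *\<^sub>C omega_lift f s"
      by (simp_all add: plus_omega.abs_eq scaleC_omega.abs_eq g
          clinear_add[OF clinear_free_lift] clinear_scale[OF clinear_free_lift])
  qed
  show "omega_lift f (form a as) = f a as" by (simp add: form.abs_eq g)
qed

lemma clinear_omega_lift_param:
  assumes "\<And>u. mform (f u)" "\<And>a as. clinear (\<lambda>u. f u a as)"
  shows "clinear (\<lambda>u. omega_lift (f u) t)"
proof (rule clinearI)
  note lin = clinear_omega_lift[OF assms(1)] and pure = omega_lift_form[OF assms(1)]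
  have "omega_lift (f (u + v)) = (\<lambda>t. omega_lift (f u) t + omega_lift (f v) t)" for u v
    by (rule omega_ext[OF lin clinear_plus[OF lin lin]]) (simp add: pure clinear_add[OF assms(2)])
  thus "omega_lift (f (u + v)) t = omega_lift (f u) t + omega_lift (f v) t" for u v by simp
  have "omega_lift (f (c *\<^sub>C u)) = (\<lambda>t. c *\<^sub>C omega_lift (f u) t)" for c u
    by (rule omega_ext[OF lin clinear_scaleC_fun[OF lin]]) (simp add: pure clinear_scale[OF assms(2)])
  thus "omega_lift (f (c *\<^sub>C u)) t = c *\<^sub>C omega_lift (f u) t" for c u by simp
qed

text \<open>The generators of the analytic bornology: all entries come from one small set, while the
  degree is arbitrary.\<close>

definition forms :: "'a::bornological_vector_space set => 'a omega set"
  where "forms S = {form a as |a as. set_option a \<union> set as \<subseteq> S \<and> proper_form a as}"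

lemma formsI: "set_option a \<subseteq> S ==> set as \<subseteq> S ==> proper_form a as ==> form a as \<in> forms S" unfolding forms_def by blast

lemma small_omega_forms: "small = generated_bornology {forms S |S. small S}" by (simp add: small_omega_def forms_def)

lemma small_forms: "small S ==> small (forms S)" unfolding small_omega_forms by (rule generated_bornologyI) blast

lemma blinear_omegaI:
  assumes "clinear f" "\<And>S. small S ==> small (f ` forms S)"
  shows "bounded_clinear (f :: 'a::bornological_vector_space omega => 'c::bornological_vector_space)"
proof (rule bounded_clinearI[OF assms(1)])
  fix U :: "'a omega set" assume "small U"
  thus "small (f ` U)" unfolding small_omega_forms
    by (rule generated_bornologyD[OF _ convex_bornology_vimage[OF assms(1) convex_bornology_small]]) (use assms(2) in auto)
qed

text \<open>A single form has finitely many entries, and finite sets are small. This is the span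
  condition of \<open>bbil_generated\<close>.\<close>

lemma cspan_Union_forms: "(t :: 'a::bornological_vector_space omega) \<in> cspan (\<Union>{forms S |S. small S})"
proof -
  have "{form a as |a as. proper_form a as} \<subseteq> \<Union>{forms S |S. small (S :: 'a set)}"
  proof
    fix w :: "'a omega" assume "w \<in> {form a as |a as. proper_form a as}"
    then obtain a as where w: "w = form a as" and "proper_form a as" by blast
    hence "form a as \<in> forms (set_option a \<union> set as)" by (intro formsI) auto
    moreover have "finite (set_option a \<union> set as)" by (cases a) auto
    hence "small (set_option a \<union> set as)" by (rule small_finite)
    ultimately show "w \<in> \<Union>{forms S |S. small (S :: 'a set)}" unfolding w by blast
  qed
  thus ?thesis using cspan_mono cspan_forms by blast
qed

text \<open>Two passes: with one argument ranging over a generating set, the other may be taken from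
  any small set by \<open>convex_bornology_equibounded\<close>; then the roles are exchanged. The
  span hypotheses provide boundedness at single points.\<close>

lemma bbil_generated:
  assumes h: "cbilinear h" and F: "small = generated_bornology F" and G: "small = generated_bornology G"
    and spF: "\<And>x. x \<in> cspan (\<Union>F)" and spG: "\<And>y. y \<in> cspan (\<Union>G)"
    and sm: "\<And>S T. S \<in> F ==> T \<in> G ==> small {h x y |x y. x \<in> S \<and> y \<in> T}"
  shows "bounded_cbilinear h"
proof -
  note l = cbilinear_left[OF h] and r = cbilinear_right[OF h]
  have 1: "small (\<Union>y\<in>V. (\<lambda>x. h x y) ` U)" if V: "V \<in> G" and U: "small U" for U V
  proof (rule generated_bornologyD[OF U[unfolded F] convex_bornology_equibounded[OF l]])
    show "small {h x y |y. y \<in> V}" for x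
    proof (rule small_family_cspan[OF l _ spF])
      fix x assume "x \<in> \<Union>F"
      then obtain S where S: "S \<in> F" "x \<in> S" by blast
      from sm[OF S(1) V] show "small {h x y |y. y \<in> V}" by (rule small_subset) (use S(2) in blast)
    qed
    fix S assume "S \<in> F"
    from sm[OF this V] show "small (\<Union>y\<in>V. (\<lambda>x. h x y) ` S)" by (rule small_subset) blast
  qed
  show ?thesis
  proof (rule bounded_cbilinearI[OF r l])
    fix U :: "'a set" and V :: "'b set" assume U: "small U" and V: "small V"
    have "small (\<Union>x\<in>U. (\<lambda>y. h x y) ` V)"
    proof (rule generated_bornologyD[OF V[unfolded G] convex_bornology_equibounded[OF r]])
      show "small {h x y |x. x \<in> U}" for y
      proof (rule small_family_cspan[OF r _ spG])
        fix y assume "y \<in> \<Union>G"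
        then obtain T where T: "T \<in> G" "y \<in> T" by blast
        from 1[OF T(1) U] show "small {h x y |x. x \<in> U}" by (rule small_subset) (use T(2) in blast)
      qed
      fix T assume "T \<in> G"
      from 1[OF this U] show "small (\<Union>x\<in>U. (\<lambda>y. h x y) ` T)" by (rule small_subset) blast
    qed
    thus "small {h x y |x y. x \<in> U \<and> y \<in> V}" by (rule small_subset) blast
  qed
qed

subsection \<open>The product of differential forms\<close>

lemma clinear_times_right: "clinear (\<lambda>y. x * (y :: 'a::complete_bornological_algebra))"
  and clinear_times_left: "clinear (\<lambda>x. x * (y :: 'a::complete_bornological_algebra))"
  by (rule clinearI; simp add: distrib_left distrib_right scaleC_mult_left scaleC_mult_right)+

lemma clinear_form_Cons: "clinear (\<lambda>x. form a (x # vs))" using clinear_form_list[of a "[]" vs] by simp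

text \<open>The prefix \<open>us\<close> is included because the recursion pushes entries onto the
  front of the right-hand list.\<close>

lemma form_mult_linear_bs: "clinear (\<lambda>y. form_mult a ras b (us @ (y::'a::complete_bornological_algebra) # vs))"
proof (induction ras arbitrary: b us)
  case Nil
  thus ?case by (cases a) (simp_all add: clinear_form_list)
next
  case (Cons x ras)
  have "clinear (\<lambda>y. form a ((rev ras @ (x * b) # us) @ y # vs))" by (rule clinear_form_list)
  moreover have "clinear (\<lambda>y. form_mult a ras x ((b # us) @ y # vs))" by (rule Cons)
  ultimately show ?case using clinear_minus by fastforce
qed

lemma form_mult_linear_b: "clinear (\<lambda>b::'a::complete_bornological_algebra. form_mult a ras b bs)"
proof (cases ras)
  case Nil
  thus ?thesis by (cases a) (simp_all add: clinear_form_Some clinear_compose[OF clinear_times_right clinear_form_Some])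
next
  case (Cons x ras)
  have "clinear (\<lambda>b. form a (rev ras @ (x * b) # bs))" by (rule clinear_compose[OF clinear_times_right clinear_form_list])
  moreover have "clinear (\<lambda>b. form_mult a ras x (b # bs))" using form_mult_linear_bs[of a ras x "[]"] by simp
  ultimately show ?thesis unfolding Cons form_mult.simps by (rule clinear_minus)
qed

lemma form_mult_linear_ras: "clinear (\<lambda>y. form_mult a (us @ (y::'a::complete_bornological_algebra) # vs) b bs)"
proof (induction us arbitrary: b bs)
  case Nil
  have "clinear (\<lambda>y. form a (rev vs @ (y * b) # bs))" by (rule clinear_compose[OF clinear_times_left clinear_form_list])
  thus ?case by (simp add: clinear_minus form_mult_linear_b)
next
  case (Cons x us)
  have "clinear (\<lambda>y. form a (rev vs @ y # (rev us @ (x * b) # bs)))" by (rule clinear_form_list)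
  from clinear_minus[OF this Cons] show ?case by simp
qed

lemma form_mult_linear_a: "clinear (\<lambda>y::'a::complete_bornological_algebra. form_mult (Some y) ras b bs)"
proof (induction ras arbitrary: b bs)
  case Nil
  thus ?case by (simp add: clinear_compose[OF clinear_times_left clinear_form_Some])
next
  case (Cons x ras)
  from clinear_minus[OF clinear_form_Some Cons] show ?case by simp
qed

text \<open>\<open>fappend xs\<close> is right multiplication by \<open>dx\<^sub>1 \<dots> dx\<^sub>n\<close>, \<open>rmult b\<close> is right multiplication by \<open>b\<close>, and
  \<open>fsign\<close> is the grading operator.\<close>

lemma clinear_if: "clinear f ==> clinear g ==> clinear (\<lambda>x. if P then f x else g x)" by (cases P) simp_all

lemma clinear_case_option:
  "clinear f ==> (\<And>c. clinear (g c)) ==> clinear (\<lambda>x. case a of None => f x | Some c => g c x)" by (cases a) simp_all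

definition fappend :: "'a::complex_vector list => 'a omega => 'a omega"
  where "fappend xs = omega_lift (\<lambda>a as. if proper_form a as then form a (as @ xs) else 0)"

definition rmult :: "'a::{complex_vector, times} => 'a omega => 'a omega"
  where "rmult b = omega_lift (\<lambda>a as. if proper_form a as then form_mult a (rev as) b [] else 0)"

definition fsign :: "'a::complex_vector omega => 'a omega"
  where "fsign = omega_lift (\<lambda>a as. (- 1) ^ length as *\<^sub>C form a as)"

lemma mform_fappend: "mform (\<lambda>a as. if proper_form a as then form a (as @ xs) else 0)"
  by (simp add: mform_def mlist_def clinear_form_Some clinear_form_list)

lemma mform_rmult: "mform (\<lambda>a as. if proper_form a as then form_mult a (rev as) (b::'a::complete_bornological_algebra) [] else 0)"
  by (simp add: mform_def mlist_def form_mult_linear_a form_mult_linear_ras)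

lemma mform_fsign: "mform (\<lambda>a as. (- 1) ^ length as *\<^sub>C form a as)"
  by (simp add: mform_def mlist_def clinear_form_Some clinear_form_list clinear_neg clinear_scaleC_fun)

lemmas clinear_fappend = clinear_omega_lift[OF mform_fappend, folded fappend_def]
  and clinear_rmult = clinear_omega_lift[OF mform_rmult, folded rmult_def]
  and clinear_fsign = clinear_omega_lift[OF mform_fsign, folded fsign_def]

lemma fappend_form: "proper_form a as ==> fappend xs (form a as) = form a (as @ xs)"
  unfolding fappend_def omega_lift_form[OF mform_fappend] by simp

lemma rmult_form: "proper_form a as ==> rmult (b::'a::complete_bornological_algebra) (form a as) = form_mult a (rev as) b []"
  unfolding rmult_def omega_lift_form[OF mform_rmult] by simp

lemma fsign_form: "fsign (form a as) = (- 1) ^ length as *\<^sub>C form a as"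
  by (simp add: fsign_def omega_lift_form[OF mform_fsign])

lemma clinear_fappend_param: "clinear (\<lambda>y. fappend (us @ y # vs) w)" unfolding fappend_def
proof (rule clinear_omega_lift_param[OF mform_fappend])
  have "clinear (\<lambda>y. form a ((as @ us) @ y # vs))" for a :: "'a option" and as by (rule clinear_form_list)
  thus "clinear (\<lambda>y. if proper_form a as then form a (as @ us @ y # vs) else 0)" for a :: "'a option" and as
    by (intro clinear_if clinear_const_zero) simp
qed

lemma clinear_rmult_param: "clinear (\<lambda>b::'a::complete_bornological_algebra. rmult b w)" unfolding rmult_def
  by (rule clinear_omega_lift_param[OF mform_rmult]) (intro clinear_if clinear_const_zero form_mult_linear_b)

lemmas omega_op_add = clinear_add[OF clinear_fappend] clinear_add[OF clinear_rmult] clinear_add[OF clinear_fsign]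
  and omega_op_diff = clinear_diff[OF clinear_fappend] clinear_diff[OF clinear_rmult] clinear_diff[OF clinear_fsign]
  and omega_op_uminus = clinear_uminus[OF clinear_fappend] clinear_uminus[OF clinear_rmult] clinear_uminus[OF clinear_fsign]
  and omega_op_scale = clinear_scale[OF clinear_fappend] clinear_scale[OF clinear_rmult] clinear_scale[OF clinear_fsign]
  and omega_op_0 = clinear_zero[OF clinear_fappend] clinear_zero[OF clinear_rmult] clinear_zero[OF clinear_fsign]

lemma fappend_Nil: "fappend [] w = w"
proof -
  have "fappend [] = (\<lambda>w. w :: 'a omega)" by (rule omega_ext[OF clinear_fappend clinear_id]) (simp add: fappend_form)
  thus ?thesis by metis
qed

lemma fappend_fappend: "fappend ys (fappend xs w) = fappend (xs @ ys) w"
proof -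
  have "(\<lambda>w. fappend ys (fappend xs w)) = fappend (xs @ ys)"
    by (rule omega_ext[OF clinear_compose[OF clinear_fappend clinear_fappend] clinear_fappend]) (auto simp: fappend_form)
  thus ?thesis by metis
qed

lemma form_snoc: "proper_form a as ==> form a (as @ [x]) = fappend [x] (form a as)" by (simp add: fappend_form)

lemma fappend_form_mult:
  "fappend cs (form_mult a ras (b::'a::complete_bornological_algebra) bs) = form_mult a ras b (bs @ cs)"
proof (induction ras arbitrary: b bs)
  case Nil
  thus ?case by (cases a) (simp_all add: fappend_form)
next
  case (Cons x ras)
  thus ?case by (simp add: omega_op_diff fappend_form)
qed

text \<open>The Leibniz rule (\<omega> da) b = \<omega> d(a b) - (\<omega> a) db. Later identities
  for \<open>rmult\<close> are inductions on the last entry of a form based on this rule.\<close>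

lemma rmult_fappend:
  "rmult (b::'a::complete_bornological_algebra) (fappend [a] w) = fappend [a * b] w - fappend [b] (rmult a w)"
proof -
  have "(\<lambda>w. rmult b (fappend [a] w)) = (\<lambda>w. fappend [a * b] w - fappend [b] (rmult a w))"
    by (rule omega_ext[OF clinear_compose[OF clinear_fappend clinear_rmult]
          clinear_minus[OF clinear_fappend clinear_compose[OF clinear_rmult clinear_fappend]]])
      (simp add: fappend_form rmult_form fappend_form_mult)
  thus ?thesis by metis
qed

lemma rmult_None: "rmult (b::'a::complete_bornological_algebra) (form None [a]) = form None [a * b] - form (Some a) [b]"
  by (simp add: rmult_form)

lemma rmult_Some: "rmult (b::'a::complete_bornological_algebra) (form (Some a) []) = form (Some (a * b)) []"
  by (simp add: rmult_form)

text \<open>The following lemma needs the statement for all \<open>b\<close> and \<open>c\<close> in the induction step, so it is proved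
  for a fixed form first.\<close>

lemma rmult_rmult: "rmult (c::'a::complete_bornological_algebra) (rmult b w) = rmult (b * c) w"
proof -
  have *: "rmult c (rmult b (form a as)) = rmult (b * c) (form a as)" if "proper_form a as" for a as and b c :: 'a using that
  proof (induction as arbitrary: b c rule: rev_induct)
    case Nil
    thus ?case by (cases a) (auto simp: rmult_Some mult.assoc)
  next
    case (snoc x xs)
    show ?case
    proof (cases "proper_form a xs")
      case True
      note IH = snoc.IH[OF True]
      show ?thesis unfolding form_snoc[OF True] rmult_fappend omega_op_diff IH by (simp add: mult.assoc omega_op_diff IH)
    next
      case False
      thus ?thesis by (simp add: rmult_None omega_op_diff rmult_form mult.assoc)
    qed
  qed
  have "(\<lambda>w. rmult c (rmult b w)) = rmult (b * c)"
    by (rule omega_ext[OF clinear_compose[OF clinear_rmult clinear_rmult] clinear_rmult *])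
  thus ?thesis by metis
qed

text \<open>Right multiplication by b db1 ... dbn is multiplication by b followed by appending the
  differentials. Associativity thereby reduces to left multiplication by x commuting with
  \<open>rmult\<close> and \<open>fappend\<close>.\<close>

definition omega_times :: "'a::{complex_vector, times} omega => 'a omega => 'a omega"
  where "omega_times x = omega_lift (\<lambda>b bs. case b of Some c => fappend bs (rmult c x)
    | None => if bs = [] then 0 else fappend bs x)"

lemma mform_times: "mform (\<lambda>b bs. case b of Some c => fappend bs (rmult (c::'a::complete_bornological_algebra) x)
    | None => if bs = [] then 0 else fappend bs x)"
proof -
  have "clinear (\<lambda>y. case a of Some c => fappend (us @ y # vs) (rmult c x)
      | None => if us @ y # vs = [] then 0 else fappend (us @ y # vs) x)" for a :: "'a option" and us vs
    by (intro clinear_case_option) (simp_all add: clinear_fappend_param)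
  thus ?thesis by (simp add: mform_def mlist_def clinear_compose[OF clinear_rmult_param clinear_fappend])
qed

lemma cbilinear_omega_times: "cbilinear (omega_times :: 'a::complete_bornological_algebra omega => _)"
proof (rule cbilinearI)
  show "clinear (omega_times x)" for x :: "'a omega" unfolding omega_times_def by (rule clinear_omega_lift[OF mform_times])
  show "clinear (\<lambda>x. omega_times x y)" for y :: "'a omega" unfolding omega_times_def
    by (rule clinear_omega_lift_param[OF mform_times])
      (intro clinear_case_option clinear_if clinear_const_zero clinear_fappend clinear_compose[OF clinear_rmult clinear_fappend])
qed

lemma cbilinear_omega_ext:
  assumes f: "cbilinear f" and g: "cbilinear g"
    and eq: "\<And>a as b bs. proper_form a as ==> proper_form b bs ==> f (form a as) (form b bs) = g (form a as) (form b bs)"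
  shows "f = (g :: 'a::complex_vector omega => 'b::complex_vector omega => 'e::complex_vector)"
proof (intro ext)
  fix s t
  have "f (form a as) = g (form a as)" if "proper_form a as" for a as
    by (rule omega_ext[OF cbilinear_right[OF f] cbilinear_right[OF g] eq[OF that]])
  hence "(\<lambda>s. f s t) = (\<lambda>s. g s t)" by (intro omega_ext cbilinear_left f g) simp
  thus "f s t = g s t" by meson
qed

lemma times_omega_eq: "(x :: 'a::complete_bornological_algebra omega) * y = omega_times x y"
proof -
  have "((*) :: 'a omega => _) = omega_times" unfolding times_omega_def
  proof (rule the_equality)
    show *: "cbilinear (omega_times :: 'a omega => _) \<and>
      (\<forall>a as b bs. proper_form a as \<longrightarrow> omega_times (form a as) (form (Some b) bs) = form_mult a (rev as) (b::'a) bs) \<and>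
      (\<forall>a as bs. proper_form a as \<longrightarrow> bs \<noteq> [] \<longrightarrow> omega_times (form a as) (form None bs) = form a (as @ (bs::'a list)))"
      by (auto simp: cbilinear_omega_times omega_times_def omega_lift_form[OF mform_times] rmult_form fappend_form fappend_form_mult)
    show "m = omega_times" if "cbilinear m \<and>
      (\<forall>a as b bs. proper_form a as \<longrightarrow> m (form a as) (form (Some b) bs) = form_mult a (rev as) (b::'a) bs) \<and>
      (\<forall>a as bs. proper_form a as \<longrightarrow> bs \<noteq> [] \<longrightarrow> m (form a as) (form None bs) = form a (as @ (bs::'a list)))" for m
    proof (rule cbilinear_omega_ext)
      show "m (form a as) (form b bs) = omega_times (form a as) (form b bs)"
        if "proper_form a as" "proper_form b bs" for a as b bs using that * \<open>cbilinear m \<and> _\<close> by (cases b) auto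
    qed (use that * in auto)
  qed
  thus ?thesis by metis
qed

lemma times_form_Some: "x * form (Some b) bs = fappend bs (rmult (b::'a::complete_bornological_algebra) x)"
  and times_form_None: "bs \<noteq> [] ==> x * form None bs = fappend (bs :: 'a list) x"
  by (simp_all add: times_omega_eq omega_times_def omega_lift_form[OF mform_times])

lemma cbilinear_times_omega: "cbilinear ((*) :: 'a::complete_bornological_algebra omega => _)"
  using cbilinear_omega_times by (simp add: cbilinear_def times_omega_eq)

lemmas clinear_times_omega_right = cbilinear_right[OF cbilinear_times_omega]
  and clinear_times_omega_left = cbilinear_left[OF cbilinear_times_omega]

lemma times_fappend: "x * fappend cs y = fappend cs (x * (y :: 'a::complete_bornological_algebra omega))"
proof -
  have "(\<lambda>y. x * fappend cs y) = (\<lambda>y. fappend cs (x * y))"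
  proof (rule omega_ext[OF clinear_compose[OF clinear_fappend clinear_times_omega_right]
          clinear_compose[OF clinear_times_omega_right clinear_fappend]])
    show "x * fappend cs (form a as) = fappend cs (x * form a as)" if "proper_form a as" for a as
      using that by (cases a) (simp_all add: fappend_form times_form_Some times_form_None fappend_fappend)
  qed
  thus ?thesis by metis
qed

lemma times_rmult: "x * rmult c y = rmult c (x * (y :: 'a::complete_bornological_algebra omega))"
proof -
  have *: "x * rmult c (form a as) = rmult c (x * form a as)" if "proper_form a as" for a as and c :: 'a using that
  proof (induction as arbitrary: c rule: rev_induct)
    case Nil
    thus ?case by (cases a) (auto simp: rmult_Some times_form_Some fappend_Nil rmult_rmult)
  next
    case (snoc y ys)
    show ?case
    proof (cases "proper_form a ys")
      case True
      show ?thesis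
        by (simp add: form_snoc[OF True] rmult_fappend times_fappend clinear_diff[OF clinear_times_omega_right] snoc.IH[OF True])
    next
      case False
      thus ?thesis
        by (simp add: rmult_None times_form_None rmult_fappend clinear_diff[OF clinear_times_omega_right] times_form_Some)
    qed
  qed
  have "(\<lambda>y. x * rmult c y) = (\<lambda>y. rmult c (x * y))"
    by (rule omega_ext[OF clinear_compose[OF clinear_rmult clinear_times_omega_right]
          clinear_compose[OF clinear_times_omega_right clinear_rmult] *])
  thus ?thesis by metis
qed

lemma times_omega_assoc: "(x * y) * z = x * (y * (z :: 'a::complete_bornological_algebra omega))"
proof -
  have "(\<lambda>z. (x * y) * z) = (\<lambda>z. x * (y * z))"
  proof (rule omega_ext[OF clinear_times_omega_right clinear_compose[OF clinear_times_omega_right clinear_times_omega_right]])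
    show "(x * y) * form a as = x * (y * form a as)" if "proper_form a as" for a as
      using that by (cases a) (simp_all add: times_form_Some times_form_None times_fappend times_rmult)
  qed
  thus ?thesis by metis
qed

definition omega_dd :: "'a::complex_vector omega => 'a omega"
  where "omega_dd = omega_lift (\<lambda>a as. case a of Some b => form None (b # as) | None => 0)"

lemma mform_dd: "mform (\<lambda>a as. case a of Some b => form None (b # as) | None => 0)"
proof -
  have "clinear (\<lambda>x. form None ((b # us) @ x # vs))" for b :: 'a and us vs by (rule clinear_form_list)
  hence "clinear (\<lambda>y. case a of Some b => form None (b # us @ y # vs) | None => 0)" for a :: "'a option" and us vs
    by (intro clinear_case_option clinear_const_zero) simp
  thus ?thesis by (simp add: mform_def mlist_def clinear_form_Cons)
qed

lemma omega_d_eq: "(omega_d :: 'a::complex_vector omega => _) = omega_dd" unfolding omega_d_def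
proof (rule the_equality)
  show *: "clinear (omega_dd :: 'a omega => _) \<and> (\<forall>a::'a. \<forall>as. omega_dd (form (Some a) as) = form None (a # as)) \<and>
      (\<forall>as::'a list. omega_dd (form None as) = 0)"
    by (simp add: omega_dd_def clinear_omega_lift[OF mform_dd] omega_lift_form[OF mform_dd])
  show "D = omega_dd" if D: "clinear D \<and> (\<forall>a as. D (form (Some a) as) = form None (a # as)) \<and> (\<forall>as. D (form None as) = 0)" for D :: "'a omega => 'a omega"
  proof (rule omega_ext)
    show "D (form a as) = omega_dd (form a as)" for a as using D * by (cases a) auto
  qed (use D * in auto)
qed

lemma clinear_omega_d: "clinear omega_d" and omega_d_Some: "omega_d (form (Some a) as) = form None (a # as)"
  and omega_d_None: "omega_d (form None as) = 0"
  by (simp_all add: omega_d_eq omega_dd_def clinear_omega_lift[OF mform_dd] omega_lift_form[OF mform_dd])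

lemma omega_d_fappend: "omega_d (fappend xs w) = fappend xs (omega_d w)"
proof -
  have "(\<lambda>w. omega_d (fappend xs w)) = (\<lambda>w. fappend xs (omega_d w))"
  proof (rule omega_ext[OF clinear_compose[OF clinear_fappend clinear_omega_d] clinear_compose[OF clinear_omega_d clinear_fappend]])
    show "omega_d (fappend xs (form a as)) = fappend xs (omega_d (form a as))" if "proper_form a as" for a as
      using that by (cases a) (simp_all add: fappend_form omega_d_Some omega_d_None omega_op_0)
  qed
  thus ?thesis by metis
qed

lemma omega_d_d: "omega_d (omega_d w) = (0 :: 'a::complex_vector omega)"
proof -
  have "(\<lambda>w. omega_d (omega_d w)) = (\<lambda>w. 0 :: 'a omega)"
  proof (rule omega_ext[OF clinear_compose[OF clinear_omega_d clinear_omega_d] clinear_const_zero])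
    show "omega_d (omega_d (form a as)) = 0" for a and as :: "'a list"
      by (cases a) (simp_all add: omega_d_Some omega_d_None clinear_zero[OF clinear_omega_d])
  qed
  thus ?thesis by metis
qed

lemma fsign_fappend: "fsign (fappend xs w) = (- 1) ^ length xs *\<^sub>C fappend xs (fsign w)"
proof -
  have "(\<lambda>w. fsign (fappend xs w)) = (\<lambda>w. (- 1) ^ length xs *\<^sub>C fappend xs (fsign w))"
    by (rule omega_ext[OF clinear_compose[OF clinear_fappend clinear_fsign]
          clinear_scaleC_fun[OF clinear_compose[OF clinear_fsign clinear_fappend]]])
      (auto simp: fappend_form fsign_form omega_op_scale power_add scaleC_scaleC mult.commute)
  thus ?thesis by metis
qed

lemma scaleC_minus_one: "(- 1) *\<^sub>C x = - x" by (simp add: complex_vector.scale_minus_left scaleC_one)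

lemma fsign_rmult: "fsign (rmult (b::'a::complete_bornological_algebra) w) = rmult b (fsign w)"
proof -
  have *: "fsign (rmult b (form a as)) = rmult b (fsign (form a as))" if "proper_form a as" for a as and b :: 'a using that
  proof (induction as arbitrary: b rule: rev_induct)
    case Nil
    thus ?case by (cases a) (auto simp: rmult_Some fsign_form scaleC_one)
  next
    case (snoc y ys)
    show ?case
    proof (cases "proper_form a ys")
      case True
      show ?thesis by (simp add: form_snoc[OF True] rmult_fappend fsign_fappend omega_op_diff snoc.IH[OF True]
            scaleC_minus_one omega_op_uminus)
    next
      case False
      thus ?thesis by (simp add: rmult_None omega_op_diff fsign_form scaleC_minus_one omega_op_uminus)
    qed
  qed
  have "(\<lambda>w. fsign (rmult b w)) = (\<lambda>w. rmult b (fsign w))"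
    by (rule omega_ext[OF clinear_compose[OF clinear_rmult clinear_fsign] clinear_compose[OF clinear_fsign clinear_rmult] *])
  thus ?thesis by metis
qed

lemma fsign_times: "fsign (x * y) = fsign x * fsign (y :: 'a::complete_bornological_algebra omega)"
proof -
  have "(\<lambda>y. fsign (x * y)) = (\<lambda>y. fsign x * fsign y)"
  proof (rule omega_ext[OF clinear_compose[OF clinear_times_omega_right clinear_fsign]
        clinear_compose[OF clinear_fsign clinear_times_omega_right]])
    show "fsign (x * form a as) = fsign x * fsign (form a as)" if "proper_form a as" for a as using that
      by (cases a) (simp_all add: times_form_Some times_form_None fsign_form fsign_fappend fsign_rmult
          clinear_scale[OF clinear_times_omega_right])
  qed
  thus ?thesis by metis
qed

lemma fsign_omega_d: "fsign (omega_d w) = - omega_d (fsign (w :: 'a::complex_vector omega))"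
proof -
  have "(\<lambda>w. fsign (omega_d w)) = (\<lambda>w. - omega_d (fsign (w :: 'a omega)))"
  proof (rule omega_ext[OF clinear_compose[OF clinear_omega_d clinear_fsign]
        clinear_neg[OF clinear_compose[OF clinear_fsign clinear_omega_d]]])
    show "fsign (omega_d (form a as)) = - omega_d (fsign (form a as))" for a and as :: "'a list"
      by (cases a) (simp_all add: omega_d_Some omega_d_None fsign_form clinear_scale[OF clinear_omega_d] omega_op_0
          complex_vector.scale_minus_left)
  qed
  thus ?thesis by metis
qed

lemma omega_d_rmult:
  "omega_d (rmult (b::'a::complete_bornological_algebra) w) = rmult b (omega_d w) + fappend [b] (fsign w)"
proof -
  have *: "omega_d (rmult b (form a as)) = rmult b (omega_d (form a as)) + fappend [b] (fsign (form a as))"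
    if "proper_form a as" for a as and b :: 'a using that
  proof (induction as arbitrary: b rule: rev_induct)
    case Nil
    thus ?case by (cases a) (auto simp: rmult_Some omega_d_Some rmult_None fsign_form scaleC_one fappend_form)
  next
    case (snoc y ys)
    show ?case
    proof (cases "proper_form a ys")
      case True
      show ?thesis
        by (simp add: form_snoc[OF True] rmult_fappend omega_d_fappend fsign_fappend clinear_diff[OF clinear_omega_d]
            snoc.IH[OF True] omega_op_add omega_op_uminus scaleC_minus_one)
    next
      case False
      thus ?thesis
        by (simp add: rmult_None clinear_diff[OF clinear_omega_d] omega_d_Some omega_d_None fsign_form scaleC_minus_one
            omega_op_uminus omega_op_0 fappend_form)
    qed
  qed
  have "(\<lambda>w. omega_d (rmult b w)) = (\<lambda>w. rmult b (omega_d w) + fappend [b] (fsign w))"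
    by (rule omega_ext[OF clinear_compose[OF clinear_rmult clinear_omega_d]
          clinear_plus[OF clinear_compose[OF clinear_omega_d clinear_rmult] clinear_compose[OF clinear_fsign clinear_fappend]] *])
  thus ?thesis by metis
qed

lemma omega_d_times:
  "omega_d (x * y) = omega_d x * y + fsign x * omega_d (y :: 'a::complete_bornological_algebra omega)"
proof -
  have "(\<lambda>y. omega_d (x * y)) = (\<lambda>y. omega_d x * y + fsign x * omega_d y)"
  proof (rule omega_ext[OF clinear_compose[OF clinear_times_omega_right clinear_omega_d]
        clinear_plus[OF clinear_times_omega_right clinear_compose[OF clinear_omega_d clinear_times_omega_right]]])
    show "omega_d (x * form a as) = omega_d x * form a as + fsign x * omega_d (form a as)" if "proper_form a as" for a as
      using that
      by (cases a) (simp_all add: times_form_Some times_form_None omega_d_fappend omega_d_rmult omega_d_Some omega_d_None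
          omega_op_add fappend_fappend clinear_zero[OF clinear_times_omega_right])
  qed
  thus ?thesis by metis
qed

subsection \<open>Boundedness\<close>

lemma blinear_omega_d: "bounded_clinear (omega_d :: 'a::bornological_vector_space omega => _)"
proof (rule blinear_omegaI[OF clinear_omega_d])
  fix S :: "'a set" assume S: "small S"
  have "omega_d ` forms S \<subseteq> insert 0 (forms S)"
  proof (rule image_subsetI)
    fix w assume "w \<in> forms S"
    then obtain a as where w: "w = form a as" "set_option a \<subseteq> S" "set as \<subseteq> S" unfolding forms_def by auto
    show "omega_d w \<in> insert 0 (forms S)"
    proof (cases a)
      case (Some b)
      hence "form None (b # as) \<in> forms S" using w by (intro formsI) auto
      thus ?thesis by (simp add: w Some omega_d_Some)
    qed (simp add: w omega_d_None)
  qed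
  thus "small (omega_d ` forms S)" by (rule small_subset[OF small_insert[OF small_forms[OF S]]])
qed

lemma blinear_fsign: "bounded_clinear (fsign :: 'a::bornological_vector_space omega => _)"
proof (rule blinear_omegaI[OF clinear_fsign])
  fix S :: "'a set" assume S: "small S"
  have "fsign ` forms S \<subseteq> disk_hull (forms S)"
  proof (rule image_subsetI)
    fix w assume w: "w \<in> forms S"
    then obtain a as where "w = form a as" unfolding forms_def by auto
    hence "fsign w = (- 1) ^ length as *\<^sub>C w" by (simp add: fsign_form)
    moreover have "w \<in> disk_hull (forms S)" using w by (rule subsetD[OF disk_hull_subset])
    ultimately show "fsign w \<in> disk_hull (forms S)" by (simp add: disk_scale[OF disk_disk_hull] norm_power)
  qed
  thus "small (fsign ` forms S)" by (rule small_subset[OF small_disk_hull[OF small_forms[OF S]]])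
qed

lemma form_map_scale: "form a (map ((*\<^sub>C) c) as) = c ^ length as *\<^sub>C form a as"
proof -
  have "form a (map ((*\<^sub>C) c) as @ bs) = c ^ length as *\<^sub>C form a (as @ bs)" for bs
  proof (induction as arbitrary: bs rule: rev_induct)
    case Nil
    thus ?case by (simp add: scaleC_one)
  next
    case (snoc x xs)
    have "form a (map ((*\<^sub>C) c) (xs @ [x]) @ bs) = c ^ length xs *\<^sub>C form a (xs @ (c *\<^sub>C x) # bs)"
      using snoc[of "(c *\<^sub>C x) # bs"] by simp
    thus ?case by (simp add: clinear_scale[OF clinear_form_list] scaleC_scaleC mult.commute)
  qed
  from this[of "[]"] show ?thesis by simp
qed

text \<open>Doubling the entries gains a factor \<open>2\<^sup>n\<close> on \<open>n\<close>-forms, which absorbs the number of terms in a product.\<close>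

lemma form_in_dilate:
  assumes "set_option a \<subseteq> D" "set as \<subseteq> D" "proper_form a as" "D \<subseteq> dilate 2 D"
  shows "form a as \<in> dilate (1 / 2 ^ length as) (disk_hull (forms (dilate 2 D)))"
proof (rule dilateI)
  have "form a (map ((*\<^sub>C) (of_real 2)) as) \<in> forms (dilate 2 D)" using assms by (intro formsI) auto
  thus "form a (map ((*\<^sub>C) (of_real 2)) as) \<in> disk_hull (forms (dilate 2 D))" by (rule subsetD[OF disk_hull_subset])
  show "form a as = of_real (1 / 2 ^ length as) *\<^sub>C form a (map ((*\<^sub>C) (of_real 2)) as)"
    by (simp only: form_map_scale scaleC_scaleC) (simp add: scaleC_one)
qed

text \<open>The expansion has \<open>Suc (length ras)\<close> terms, each of degree
  \<open>length ras + length bs\<close>. A term contains at most one product of two elements of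
  \<open>S\<close>, so its entries stay in \<open>D\<close> and \<open>form_in_dilate\<close>
  applies to it.\<close>

lemma form_mult_in_dilate:
  fixes a :: "'a::complete_bornological_algebra option"
  assumes D: "D \<subseteq> dilate 2 D" "S \<subseteq> D" "\<And>x y. x \<in> S ==> y \<in> S ==> x * y \<in> D"
    and S: "set_option a \<subseteq> S" "set ras \<subseteq> S" "b \<in> S" "set bs \<subseteq> S"
  shows "form_mult a ras b bs \<in>
    dilate (real (Suc (length ras)) / 2 ^ (length ras + length bs)) (disk_hull (forms (dilate 2 D)))" using S(2-4)
proof (induction ras arbitrary: b bs)
  case Nil
  show ?case
  proof (cases a)
    case None
    thus ?thesis using form_in_dilate[of "Some b" D bs] Nil D by auto
  next
    case (Some a0)
    hence "a0 * b \<in> D" using D(3) S(1) Nil by auto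
    thus ?thesis using form_in_dilate[of "Some (a0 * b)" D bs] Nil D Some by auto
  qed
next
  case (Cons x ras)
  let ?K = "disk_hull (forms (dilate 2 D))"
  let ?n = "length (x # ras) + length bs"
  have "x * b \<in> D" using D(3) Cons.prems by auto
  hence "form a (rev ras @ (x * b) # bs) \<in> dilate (1 / 2 ^ length (rev ras @ (x * b) # bs)) ?K"
    using S(1) Cons.prems D by (intro form_in_dilate) auto
  moreover have "form_mult a ras x (b # bs) \<in> dilate (real (Suc (length ras)) / 2 ^ (length ras + length (b # bs))) ?K"
    using Cons.prems by (intro Cons.IH) auto
  ultimately have "form a (rev ras @ (x * b) # bs) - form_mult a ras x (b # bs) \<in>
      dilate (1 / 2 ^ ?n + real (Suc (length ras)) / 2 ^ ?n) ?K" by (intro dilate_diff[OF disk_disk_hull]) simp_all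
  moreover have "1 / 2 ^ ?n + real (Suc (length ras)) / 2 ^ ?n = real (Suc (length (x # ras))) / 2 ^ ?n"
    by (simp add: add_divide_distrib)
  ultimately show ?case by (simp only: form_mult.simps)
qed

lemma bbil_times: "bounded_cbilinear ((*) :: 'a::complete_bornological_algebra => 'a => 'a)"
  by (rule bounded_cbilinearI[OF clinear_times_right clinear_times_left small_mult])

lemma bbil_times_omega: "bounded_cbilinear ((*) :: 'a::complete_bornological_algebra omega => _)"
proof (rule bbil_generated[OF cbilinear_times_omega small_omega_forms small_omega_forms
      cspan_Union_forms cspan_Union_forms])
  fix F G :: "'a omega set" assume "F \<in> {forms S |S. small S}" "G \<in> {forms S |S. small S}"
  then obtain S1 S2 where F: "small S1" "F = forms S1" and G: "small S2" "G = forms S2" by blast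
  define S where "S = S1 \<union> S2"
  have S: "small S" "S1 \<subseteq> S" "S2 \<subseteq> S" using F G by (simp_all add: S_def small_Un)
  have "small (S \<union> {x * y |x y. x \<in> S \<and> y \<in> S})" using S(1) by (intro small_Un small_mult)
  then obtain D where D: "small D" "disk D" "S \<union> {x * y |x y. x \<in> S \<and> y \<in> S} \<subseteq> D" using small_hull_disk by blast
  have D2: "D \<subseteq> dilate 2 D" using dilate_mono[OF D(2), of 1 2] by simp
  let ?K = "disk_hull (forms (dilate 2 D))"
  have K: "small ?K" by (intro small_disk_hull small_forms small_dilate D(1))
  have "form a as * form b bs \<in> ?K"
    if "set_option a \<subseteq> S" "set as \<subseteq> S" "proper_form a as" "set_option b \<subseteq> S" "set bs \<subseteq> S" "proper_form b bs" for a as b bs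
  proof (cases b)
    case None
    hence "form a as * form b bs = form a (as @ bs)" using that by (simp add: times_form_None fappend_form)
    also have "\<dots> \<in> forms (dilate 2 D)" using that D(3) D2 by (intro formsI) auto
    finally show ?thesis by (rule subsetD[OF disk_hull_subset])
  next
    case (Some c)
    hence *: "form a as * form b bs = form_mult a (rev as) c bs"
      using that by (simp add: times_form_Some rmult_form fappend_form_mult)
    have "form_mult a (rev as) c bs \<in>
        dilate (real (Suc (length (rev as))) / 2 ^ (length (rev as) + length bs)) ?K"
    proof (rule form_mult_in_dilate[OF D2])
      show "S \<subseteq> D" "\<And>x y. x \<in> S ==> y \<in> S ==> x * y \<in> D" using D(3) by blast+
    qed (use that Some in auto)
    moreover have "real (Suc (length as)) / 2 ^ (length as + length bs) \<le> 1"
    proof -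
      have "Suc n \<le> 2 ^ n" for n by (induction n) auto
      hence "Suc (length as) \<le> 2 ^ length as * 2 ^ length bs"
        using mult_le_mono[of "Suc (length as)" "2 ^ length as" 1 "2 ^ length bs"] by simp
      hence "real (Suc (length as)) \<le> 2 ^ (length as + length bs)"
        by (metis of_nat_le_iff of_nat_numeral of_nat_power power_add)
      thus ?thesis by (simp add: divide_le_eq)
    qed
    ultimately show ?thesis unfolding *
      using dilate_mono[OF disk_disk_hull, of "real (Suc (length as)) / 2 ^ (length as + length bs)" 1 "forms (dilate 2 D)"]
      by auto
  qed
  hence "{x * y |x y. x \<in> F \<and> y \<in> G} \<subseteq> ?K" using S unfolding F(2) G(2) forms_def by blast
  thus "small {x * y |x y. x \<in> F \<and> y \<in> G}" by (rule small_subset[OF K])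
qed

section \<open>The analytic tensor algebra\<close>

lemma completion_bilinear_ext:
  fixes f g :: "'a::bornological_vector_space completion => 'b::bornological_vector_space completion => 'c::bornological_vector_space"
  assumes f: "bounded_cbilinear f" and g: "bounded_cbilinear g" and sep: "bseparated TYPE('c)"
    and eq: "\<And>x y. f (to_completion x) (to_completion y) = g (to_completion x) (to_completion y)"
  shows "f x y = g x y"
proof -
  have "f (to_completion x) = g (to_completion x)" for x
    by (rule completion_ext[OF bbil_right[OF f] bbil_right[OF g] sep eq])
  hence "(\<lambda>x. f x y) = (\<lambda>x. g x y)" by (intro completion_ext[OF bbil_left[OF f] bbil_left[OF g] sep]) simp
  thus ?thesis by meson
qed

lemma closed_cspan_image:
  assumes f: "bounded_clinear f" and sub: "\<And>x. x \<in> S ==> f x \<in> closed_cspan T" and x: "x \<in> closed_cspan S"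
  shows "f x \<in> closed_cspan T"
proof -
  let ?L = "{x. f x \<in> closed_cspan T}"
  note lin = blinear_clinear[OF f]
  have "csubspace ?L" unfolding csubspace_def
    by (auto simp: clinear_zero[OF lin] clinear_add[OF lin] clinear_scale[OF lin] closed_cspan_0 closed_cspan_add closed_cspan_scale)
  moreover have "Mackey_closed ?L" unfolding Mackey_closed_def
  proof (intro allI impI)
    fix X l assume X: "range X \<subseteq> ?L" "Mackey_tendsto X l"
    have "range (\<lambda>n. f (X n)) \<subseteq> closed_cspan T" using X(1) by auto
    thus "l \<in> ?L" using blinear_Mackey_tendsto[OF f X(2)] Mackey_closed_closed_cspan unfolding Mackey_closed_def by blast
  qed
  ultimately have "closed_cspan S \<subseteq> ?L" using sub unfolding closed_cspan_def by blast
  thus ?thesis using x by blast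
qed

lemma closed_cspan_range_to_completion: "x \<in> closed_cspan (range to_completion)"
proof -
  obtain X where X: "Mackey_Cauchy X" "x = cseq X" using completion_exhaust by blast
  have "range (\<lambda>n. to_completion (X n)) \<subseteq> closed_cspan (range to_completion)"
    using closed_cspan_superset[of "range to_completion"] by auto
  from Mackey_closed_closed_cspan[unfolded Mackey_closed_def, rule_format, OF this to_completion_tendsto[OF X(1)]]
  show ?thesis unfolding X(2) .
qed

lemma cspan_subset_closed_cspan: "cspan S \<subseteq> closed_cspan S"
  unfolding cspan_def by (rule hull_minimal[of S "closed_cspan S" csubspace, OF closed_cspan_superset csubspace_closed_cspan])

text \<open>Limits are taken in the larger space and projected back. It is applied to even forms
  inside all forms.\<close>

lemma bcomplete_retract:
  fixes i :: "'a::bornological_vector_space => 'b::bornological_vector_space"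
  assumes i: "bounded_clinear i" and p: "bounded_clinear p" and pi: "\<And>x. p (i x) = x" and cpl: "bcomplete TYPE('b)"
  shows "bcomplete TYPE('a)" unfolding bcomplete_def
proof (intro conjI allI impI)
  show "bseparated TYPE('a)" unfolding bseparated_def
  proof (intro allI impI)
    fix x :: 'a assume "Mackey_tendsto (\<lambda>n. x) 0"
    from blinear_Mackey_tendsto[OF i this]
    have "i x = 0" using bcomplete_separated[OF cpl] blin_zero[OF i] unfolding bseparated_def by simp
    thus "x = 0" using pi[of x] blin_zero[OF p] by simp
  qed
  fix S :: "'a set" assume S: "small S" "disk S"
  obtain S' where S': "small S'" "disk S'" "i ` S \<subseteq> S'" using blinear_disk[OF i S(1)] .
  obtain T where T: "small T" "disk T" "\<And>X. range X \<subseteq> S' ==> disk_Cauchy S' X ==> \<exists>l\<in>T. Mackey_tendsto X l"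
    using cpl S'(1,2) unfolding bcomplete_def by metis
  have "\<exists>l\<in>p ` T. Mackey_tendsto X l" if X: "range X \<subseteq> S" "disk_Cauchy S X" for X
  proof -
    have "disk_Cauchy S' (\<lambda>n. i (X n))"
      by (rule disk_Cauchy_transfer[OF blinear_clinear[OF i] S(2) S'(2) _ _ X(2), of 1]) (use S'(3) in simp_all)
    moreover have "range (\<lambda>n. i (X n)) \<subseteq> S'" using X(1) S'(3) by auto
    ultimately obtain l where "l \<in> T" "Mackey_tendsto (\<lambda>n. i (X n)) l" using T(3) by blast
    thus ?thesis using blinear_Mackey_tendsto[OF p, of "\<lambda>n. i (X n)" l] by (auto simp: pi)
  qed
  thus "\<exists>T. small T \<and> disk T \<and> (\<forall>X. range X \<subseteq> S \<longrightarrow> disk_Cauchy S X \<longrightarrow> (\<exists>l\<in>T. Mackey_tendsto X l))"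
    using blinear_small[OF p T(1)] disk_image[OF blinear_clinear[OF p] T(2)] by (intro exI[of _ "p ` T"] conjI allI impI)
qed

definition fsign_an :: "'a::bornological_vector_space omega_an => 'a omega_an"
  where "fsign_an = completion_lift (\<lambda>x. to_completion (fsign x))"

lemma blinear_fsign_an: "bounded_clinear fsign_an"
  and fsign_an_to_completion: "fsign_an (to_completion w) = to_completion (fsign w)"
  and blinear_omega_an_d: "bounded_clinear omega_an_d"
  and omega_an_d_to_completion: "omega_an_d (to_completion w) = to_completion (omega_d w)"
  unfolding fsign_an_def omega_an_d_def by (intro blinear_completion_lift completion_lift_to_completion bcomplete_completion
      blinear_compose[OF _ blinear_to_completion] blinear_fsign blinear_omega_d)+

abbreviation even_span :: "'a::bornological_vector_space omega_an set"
  where "even_span \<equiv> closed_cspan {to_completion (form a as) |a as. even (length as)}"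

lemma even_span_fsign: "x \<in> even_span ==> fsign_an x = x"
  by (rule blinear_eq_on_closed_cspan[OF blinear_fsign_an blinear_id bseparated_completion])
    (auto simp: fsign_an_to_completion fsign_form scaleC_one)

text \<open>Continuity reduces the claim to single forms, on which 1 plus the grading operator is
  twice the form or 0.\<close>

lemma symmetrize_even_span: "x + fsign_an x \<in> even_span"
proof (rule closed_cspan_image[OF blinear_plus[OF blinear_id blinear_fsign_an] _
      closed_cspan_range_to_completion])
  fix x :: "'a omega_an" assume "x \<in> range to_completion"
  then obtain w where w: "x = to_completion w" by blast
  have lin: "clinear (\<lambda>w :: 'a omega. to_completion (w + fsign w))"
    by (rule clinear_compose[OF clinear_plus[OF clinear_id clinear_fsign] clinear_to_completion])
  have "to_completion (w + fsign w) \<in> cspan {to_completion (form a as) |(a :: 'a option) as. even (length as)}"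
  proof (rule clinear_cspan_mem[OF lin _ cspan_forms])
    fix v :: "'a omega" assume "v \<in> {form a as |a as. proper_form a as}"
    then obtain a as where v: "v = form a as" by blast
    show "to_completion (v + fsign v) \<in> cspan {to_completion (form a as) |(a :: 'a option) as. even (length as)}"
    proof (cases "even (length as)")
      case True
      hence "to_completion v \<in> cspan {to_completion (form a as) |(a :: 'a option) as. even (length as)}"
        unfolding v by (intro cspan_base) blast
      thus ?thesis using True by (simp add: v fsign_form scaleC_one clinear_add[OF clinear_to_completion] cspan_add)
    next
      case False
      thus ?thesis by (simp add: v fsign_form scaleC_minus_one clinear_zero[OF clinear_to_completion] cspan_0)
    qed
  qed
  hence "to_completion (w + fsign w) \<in> even_span" by (rule subsetD[OF cspan_subset_closed_cspan])
  thus "x + fsign_an x \<in> even_span" by (simp add: w fsign_an_to_completion clinear_add[OF clinear_to_completion])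
qed

lemma half_symmetrize_even_span: "(1 / 2) *\<^sub>C (x + fsign_an x) \<in> even_span"
  by (rule closed_cspan_scale[OF symmetrize_even_span])

lemma half_double: "(1 / 2) *\<^sub>C (x + x) = (x :: 'a::complex_vector)"
proof -
  have "(1 / 2) *\<^sub>C (x + x) = (1 / 2 + 1 / 2) *\<^sub>C x" by (simp only: scaleC_add_left scaleC_add_right)
  thus ?thesis by (simp add: scaleC_one)
qed

text \<open>Turns membership in a closed span into an equation, so that stability of the even part
  under the Fedosov product becomes a computation.\<close>

lemma even_span_iff: "x \<in> even_span \<longleftrightarrow> fsign_an x = x"
  using even_span_fsign half_symmetrize_even_span[of x] by (auto simp: half_double)

lemma clinear_Rep_tensor_alg: "clinear Rep_tensor_alg"
  by (rule clinearI) (simp_all add: plus_tensor_alg.rep_eq scaleC_tensor_alg.rep_eq)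

lemma blinear_Rep_tensor_alg: "bounded_clinear Rep_tensor_alg"
  by (rule bounded_clinearI[OF clinear_Rep_tensor_alg]) (simp add: small_tensor_alg_def)

lemmas Rep_tensor_alg_linear = plus_tensor_alg.rep_eq scaleC_tensor_alg.rep_eq zero_tensor_alg.rep_eq
  clinear_diff[OF clinear_Rep_tensor_alg] clinear_uminus[OF clinear_Rep_tensor_alg]

lemma blinear_Abs_tensor_alg:
  assumes f: "bounded_clinear f" and even: "\<And>x. f x \<in> even_span"
  shows "bounded_clinear (\<lambda>x. Abs_tensor_alg (f x))"
proof (rule bounded_clinearI)
  note RA = Abs_tensor_alg_inverse[OF even]
  show "clinear (\<lambda>x. Abs_tensor_alg (f x))" by (rule clinearI; rule Rep_tensor_alg_inject[THEN iffD1])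
      (simp_all only: Rep_tensor_alg_linear RA blin_add[OF f]
        blin_scale[OF f] Abs_tensor_alg_inverse[OF closed_cspan_add[OF even even]]
        Abs_tensor_alg_inverse[OF closed_cspan_scale[OF even]])
  show "small ((\<lambda>x. Abs_tensor_alg (f x)) ` S)" if "small S" for S
    using blinear_small[OF f that] by (simp add: small_tensor_alg_def image_image RA)
qed

definition even_proj :: "'a::bornological_vector_space omega_an => 'a tensor_alg"
  where "even_proj x = Abs_tensor_alg ((1 / 2) *\<^sub>C (x + fsign_an x))"

lemma blinear_even_proj: "bounded_clinear even_proj" unfolding even_proj_def
  by (intro blinear_Abs_tensor_alg half_symmetrize_even_span blinear_scaleC blinear_plus
      blinear_id blinear_fsign_an)

lemma even_proj_Rep: "even_proj (Rep_tensor_alg t) = t"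
  using even_span_fsign[OF Rep_tensor_alg, of t] by (simp add: even_proj_def half_double Rep_tensor_alg_inverse)

lemma bcomplete_tensor_alg: "bcomplete TYPE('a::bornological_vector_space tensor_alg)"
  by (rule bcomplete_retract[OF blinear_Rep_tensor_alg blinear_even_proj even_proj_Rep bcomplete_completion])

lemma Rep_even_form: "even (length as) ==> Rep_tensor_alg (even_form a as) = to_completion (form a as)"
  unfolding even_form_def by (rule Abs_tensor_alg_inverse, rule subsetD[OF closed_cspan_superset]) blast

lemma even_form_None_Nil [simp]: "even_form None [] = 0" by (rule Rep_tensor_alg_inject[THEN iffD1])
    (simp add: Rep_even_form Rep_tensor_alg_linear clinear_zero[OF clinear_to_completion])

text \<open>Composition with \<open>even_proj\<close> moves the comparison to the full completion,
  where the forms span a dense subspace; odd forms are sent to zero.\<close>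

lemma tensor_alg_ext:
  fixes f g :: "'a::bornological_vector_space tensor_alg => 'c::bornological_vector_space"
  assumes f: "bounded_clinear f" and g: "bounded_clinear g" and sep: "bseparated TYPE('c)"
    and eq: "\<And>a as. proper_form a as ==> even (length as) ==> f (even_form a as) = g (even_form a as)"
  shows "f = g"
proof -
  have "(\<lambda>x. f (even_proj x)) = (\<lambda>x. g (even_proj x))"
  proof (rule completion_ext[OF blinear_compose[OF blinear_even_proj f]
        blinear_compose[OF blinear_even_proj g] sep])
    note l = clinear_compose[OF clinear_to_completion clinear_compose[OF blinear_clinear[OF blinear_even_proj]]]
    have "(\<lambda>w. f (even_proj (to_completion w))) = (\<lambda>w. g (even_proj (to_completion w)))"
    proof (rule omega_ext[OF l l])
      fix a as assume p: "proper_form a (as :: 'a list)"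
      show "f (even_proj (to_completion (form a as))) = g (even_proj (to_completion (form a as)))"
      proof (cases "even (length as)")
        case True
        hence "even_proj (to_completion (form a as)) = even_form a as" by (simp add: Rep_even_form[symmetric] even_proj_Rep)
        thus ?thesis using eq[OF p True] by simp
      next
        case False
        hence "even_proj (to_completion (form a as)) = Abs_tensor_alg 0"
          by (simp add: even_proj_def fsign_an_to_completion fsign_form scaleC_minus_one clinear_uminus[OF clinear_to_completion])
        hence "even_proj (to_completion (form a as)) = 0" by (simp add: zero_tensor_alg_def)
        thus ?thesis using f g by (simp add: bounded_clinear_def clinear_zero)
      qed
    qed (use f g in \<open>simp_all add: bounded_clinear_def\<close>)
    thus "f (even_proj (to_completion w)) = g (even_proj (to_completion w))" for w by meson
  qed
  thus ?thesis using even_proj_Rep by (metis ext)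
qed

definition even_forms :: "'a::bornological_vector_space set => 'a tensor_alg set"
  where "even_forms S = {even_form a as |a as. set_option a \<union> set as \<subseteq> S \<and> even (length as)}"

lemma small_even_forms:
  assumes "small S"
  shows "small (even_forms S)" unfolding even_forms_def small_tensor_alg_def
proof (rule small_subset[OF blinear_small[OF blinear_to_completion small_insert[OF small_forms[OF assms]]]])
  show "Rep_tensor_alg ` {even_form a as |a as. set_option a \<union> set as \<subseteq> S \<and> even (length as)}
      \<subseteq> to_completion ` insert 0 (forms S)"
  proof (rule image_subsetI)
    fix t assume "t \<in> {even_form a as |a as. set_option a \<union> set as \<subseteq> S \<and> even (length as)}"
    then obtain a as where t: "t = even_form a as" "set_option a \<subseteq> S" "set as \<subseteq> S" "even (length as)" by auto
    hence "form a as \<in> insert 0 (forms S)" by (cases "proper_form a as") (auto intro: formsI)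
    moreover have "Rep_tensor_alg t = to_completion (form a as)" using t by (simp add: Rep_even_form)
    ultimately show "Rep_tensor_alg t \<in> to_completion ` insert 0 (forms S)" by (simp only: imageI)
  qed
qed

subsection \<open>The Fedosov product\<close>

lemmas bbil_times_omega_an = bbil_times_completion[OF bbil_times_omega]
lemmas clinear_times_omega_an_right = bbil_clinear_right[OF bbil_times_omega_an]
  and clinear_times_omega_an_left = bbil_clinear_left[OF bbil_times_omega_an]
lemmas omega_an_assoc = completion_times_assoc[OF bbil_times_omega times_omega_assoc]

lemma fsign_an_times: "fsign_an (x * y) = fsign_an x * fsign_an (y :: 'a::complete_bornological_algebra omega_an)"
  by (rule completion_bilinear_ext[OF blinear_cbilinear_compose[OF bbil_times_omega_an blinear_fsign_an]
        bbil_compose[OF bbil_times_omega_an blinear_fsign_an blinear_fsign_an] bseparated_completion])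
    (simp add: fsign_an_to_completion fsign_times flip: to_completion_times[OF bbil_times_omega])

lemma omega_an_d_times:
  "omega_an_d (x * y) = omega_an_d x * y + fsign_an x * omega_an_d (y :: 'a::complete_bornological_algebra omega_an)"
  by (rule completion_bilinear_ext[OF blinear_cbilinear_compose[OF bbil_times_omega_an blinear_omega_an_d]
        bbil_plus[OF bbil_compose[OF bbil_times_omega_an blinear_omega_an_d blinear_id]
        bbil_compose[OF bbil_times_omega_an blinear_fsign_an blinear_omega_an_d]] bseparated_completion])
    (simp add: fsign_an_to_completion omega_an_d_to_completion omega_d_times clinear_add[OF clinear_to_completion]
      flip: to_completion_times[OF bbil_times_omega])

lemma omega_an_d_d: "omega_an_d (omega_an_d x) = (0 :: 'a::bornological_vector_space omega_an)"
proof -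
  have "(\<lambda>x. omega_an_d (omega_an_d x)) = (\<lambda>x. 0 :: 'a omega_an)"
    by (rule completion_ext[OF blinear_compose[OF blinear_omega_an_d blinear_omega_an_d]
          blinear_zero bseparated_completion])
      (simp add: omega_an_d_to_completion omega_d_d clinear_zero[OF clinear_to_completion])
  thus ?thesis by metis
qed

lemma fsign_an_d: "fsign_an (omega_an_d x) = - omega_an_d (fsign_an (x :: 'a::bornological_vector_space omega_an))"
proof -
  have "(\<lambda>x. fsign_an (omega_an_d x)) = (\<lambda>x. - omega_an_d (fsign_an (x :: 'a omega_an)))"
    by (rule completion_ext[OF blinear_compose[OF blinear_omega_an_d blinear_fsign_an]
          blinear_uminus[OF blinear_compose[OF blinear_fsign_an blinear_omega_an_d]] bseparated_completion])
      (simp add: omega_an_d_to_completion fsign_an_to_completion fsign_omega_d clinear_uminus[OF clinear_to_completion])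
  thus ?thesis by metis
qed

text \<open>The definition of the product passes through \<open>Abs_tensor_alg\<close>, so the
  combination has to be shown even: the grading operator changes the sign of both differentials and
  fixes their product.\<close>

lemma Rep_times:
  "Rep_tensor_alg (x * y) = Rep_tensor_alg x * Rep_tensor_alg y -
    omega_an_d (Rep_tensor_alg x) * omega_an_d (Rep_tensor_alg (y :: 'a::complete_bornological_algebra tensor_alg))"
proof -
  let ?x = "Rep_tensor_alg x" and ?y = "Rep_tensor_alg y"
  have xy: "fsign_an ?x = ?x" "fsign_an ?y = ?y" by (intro even_span_fsign Rep_tensor_alg)+
  have "fsign_an (?x * ?y - omega_an_d ?x * omega_an_d ?y) = ?x * ?y - (- omega_an_d ?x) * (- omega_an_d ?y)"
    by (simp add: blin_diff[OF blinear_fsign_an] fsign_an_times fsign_an_d xy)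
  also have "\<dots> = ?x * ?y - omega_an_d ?x * omega_an_d ?y"
    by (simp add: clinear_uminus[OF clinear_times_omega_an_right] clinear_uminus[OF clinear_times_omega_an_left])
  finally have "?x * ?y - omega_an_d ?x * omega_an_d ?y \<in> even_span" by (simp only: even_span_iff)
  thus ?thesis unfolding times_tensor_alg_def by (rule Abs_tensor_alg_inverse)
qed

instance tensor_alg :: (complete_bornological_algebra) ring
proof
  note lin = clinear_add[OF clinear_times_omega_an_right] clinear_add[OF clinear_times_omega_an_left]
    clinear_diff[OF clinear_times_omega_an_right] clinear_diff[OF clinear_times_omega_an_left]
    blin_add[OF blinear_omega_an_d]
    blin_diff[OF blinear_omega_an_d]
  fix x y z :: "'a tensor_alg"
  have even: "fsign_an (Rep_tensor_alg x) = Rep_tensor_alg x" for x :: "'a tensor_alg"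
    by (intro even_span_fsign Rep_tensor_alg)
  have even': "fsign_an (omega_an_d (Rep_tensor_alg x)) = - omega_an_d (Rep_tensor_alg x)" for x :: "'a tensor_alg"
    by (simp add: fsign_an_d even)
  \<comment> \<open>Both sides become xyz - dx dy z - dx y dz - x dy dz, since d is a derivation on
    even elements and d(dx dy) = 0.\<close>
  show "x * y * z = x * (y * z)" by (rule Rep_tensor_alg_inject[THEN iffD1])
      (simp add: Rep_times lin omega_an_d_times even even' omega_an_d_d omega_an_assoc
        clinear_zero[OF clinear_times_omega_an_right] clinear_zero[OF clinear_times_omega_an_left] algebra_simps)
  show "(x + y) * z = x * z + y * z" "x * (y + z) = x * y + x * z"
    by (rule Rep_tensor_alg_inject[THEN iffD1], simp add: Rep_times Rep_tensor_alg_linear lin)+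
qed

lemma tensor_alg_scaleC_left: "(c *\<^sub>C x) * y = c *\<^sub>C (x * (y :: 'a::complete_bornological_algebra tensor_alg))"
  and tensor_alg_scaleC_right: "x * (c *\<^sub>C y) = c *\<^sub>C (x * (y :: 'a::complete_bornological_algebra tensor_alg))"
  by (rule Rep_tensor_alg_inject[THEN iffD1],
    simp add: Rep_times Rep_tensor_alg_linear clinear_scale[OF clinear_times_omega_an_right] clinear_scale[OF clinear_times_omega_an_left]
      blin_scale[OF blinear_omega_an_d] complex_vector.scale_right_diff_distrib)+

lemma bbil_times_tensor_alg:
  "bounded_cbilinear ((*) :: 'a::complete_bornological_algebra tensor_alg => 'a tensor_alg => 'a tensor_alg)"
proof (rule bounded_cbilinearI)
  show "clinear (\<lambda>y. x * y)" "clinear (\<lambda>x. x * y)" for x y :: "'a tensor_alg"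
    by (rule clinearI; simp add: distrib_left distrib_right tensor_alg_scaleC_left tensor_alg_scaleC_right)+
  fix S T :: "'a tensor_alg set" assume S: "small S" and T: "small T"
  let ?h = "\<lambda>x y. Rep_tensor_alg x * Rep_tensor_alg y - omega_an_d (Rep_tensor_alg x) * omega_an_d (Rep_tensor_alg y)"
  have "bounded_cbilinear (?h :: 'a tensor_alg => 'a tensor_alg => _)"
    by (intro bbil_minus bbil_compose[OF bbil_times_omega_an]
        blinear_compose[OF blinear_Rep_tensor_alg blinear_omega_an_d] blinear_Rep_tensor_alg)
  from bbil_small[OF this S T] show "small {x * y |x y. x \<in> S \<and> y \<in> T}"
    unfolding small_tensor_alg_def by (rule small_subset) (auto simp: Rep_times, blast)
qed

section \<open>Generators and curvature of the tensor algebra\<close>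

definition tsigma :: "'a::bornological_vector_space => 'a tensor_alg"
  where "tsigma a = even_form (Some a) []"

text \<open>The curvature \<sigma>(ab) - \<sigma>(a) \<sigma>(b) of the linear map
  \<open>tsigma\<close>, which the Fedosov product makes the two-form da db
  (\<open>tsigma_times\<close>).\<close>

definition tcurv :: "'a::bornological_vector_space => 'a => 'a tensor_alg"
  where "tcurv a b = even_form None [a, b]"

lemma tsigma_times: "tsigma a * tsigma b = tsigma (a * b) - tcurv a (b :: 'a::complete_bornological_algebra)"
proof (rule Rep_tensor_alg_inject[THEN iffD1])
  note h = to_completion_times[OF bbil_times_omega, symmetric]
  have "form (Some a) [] * form (Some b) [] = form (Some (a * b)) []" by (simp add: times_form_Some rmult_Some fappend_Nil)
  moreover have "form None [a] * form None [b] = form None [a, b]" by (simp add: times_form_None fappend_form)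
  ultimately show "Rep_tensor_alg (tsigma a * tsigma b) = Rep_tensor_alg (tsigma (a * b) - tcurv a b)"
    by (simp add: Rep_times tsigma_def tcurv_def Rep_even_form omega_an_d_to_completion omega_d_Some h Rep_tensor_alg_linear)
qed

text \<open>The factor da db is closed, so the correction in the Fedosov product vanishes. Hence
  every even form is a product of at most one generator with curvatures to its right, the basis of
  \<open>even_form_induct\<close>.\<close>

lemma even_form_snoc:
  assumes "even (length as)" "proper_form a as"
  shows "even_form a (as @ [x, y]) = even_form a as * tcurv x (y :: 'a::complete_bornological_algebra)"
proof (rule Rep_tensor_alg_inject[THEN iffD1])
  note h = to_completion_times[OF bbil_times_omega, symmetric]
  show "Rep_tensor_alg (even_form a (as @ [x, y])) = Rep_tensor_alg (even_form a as * tcurv x y)"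
    using assms by (simp add: Rep_times tcurv_def Rep_even_form omega_an_d_to_completion omega_d_None h
        times_form_None fappend_form clinear_zero[OF clinear_to_completion] clinear_zero[OF clinear_times_omega_an_right])
qed

lemma blinear_tsigma: "bounded_clinear (tsigma :: 'a::bornological_vector_space => _)"
proof (rule bounded_clinearI)
  show "clinear (tsigma :: 'a => _)" by (rule clinearI; rule Rep_tensor_alg_inject[THEN iffD1])
      (simp_all add: tsigma_def Rep_even_form Rep_tensor_alg_linear clinear_add[OF clinear_form_Some]
        clinear_scale[OF clinear_form_Some] clinear_add[OF clinear_to_completion] clinear_scale[OF clinear_to_completion])
  fix S :: "'a set" assume "small S"
  from small_even_forms[OF this] show "small (tsigma ` S)" by (rule small_subset) (force simp: tsigma_def even_forms_def)
qed

text \<open>A form of the Bianchi identity, from associativity of the product of three generators.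
  It lets a generator pass a curvature, leaving the curvatures on the right.\<close>

lemma tcurv_tsigma:
  "tcurv u v * tsigma b = tcurv u (v * b) - tcurv (u * v) b + tsigma u * tcurv v (b :: 'a::complete_bornological_algebra)"
proof -
  have c: "tcurv x y = tsigma (x * y) - tsigma x * tsigma y" for x y :: 'a using tsigma_times[of x y] by simp
  show ?thesis unfolding c by (simp add: algebra_simps)
qed

lemma even_list_induct [consumes 1, case_names Nil snoc]:
  assumes "even (length as)" and "P []" and "\<And>us u v. even (length us) ==> P us ==> P (us @ [u, v])"
  shows "P as" using assms(1)
proof (induction as rule: length_induct)
  case (1 xs)
  show ?case
  proof (cases xs rule: rev_cases)
    case Nil
    thus ?thesis using assms(2) by simp
  next
    case (snoc ys v)
    show ?thesis
    proof (cases ys rule: rev_cases)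
      case Nil
      thus ?thesis using 1 snoc by simp
    next
      case (snoc us u)
      thus ?thesis using 1 \<open>xs = ys @ [v]\<close> assms(3)[of us u v] by simp
    qed
  qed
qed

lemma even_form_induct [consumes 2, case_names sigma curv step]:
  assumes "proper_form a as" "even (length as)" and sigma: "\<And>c. P (tsigma c)" and curv: "\<And>u v. P (tcurv u v)"
    and step: "\<And>y u v. P y ==> P (y * tcurv u v)"
  shows "P (even_form a (as :: 'a::complete_bornological_algebra list))" using assms(2,1)
proof (induction as rule: even_list_induct)
  case Nil
  then obtain c where "a = Some c" by auto
  thus ?case using sigma[of c] by (simp add: tsigma_def)
next
  case (snoc us u v)
  show ?case
  proof (cases "proper_form a us")
    case True
    thus ?thesis using step[OF snoc.IH[OF True]] by (simp only: even_form_snoc[OF snoc.hyps True])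
  next
    case False
    thus ?thesis using curv[of u v] by (simp add: tcurv_def)
  qed
qed

lemma even_forms_tsigma: "a \<in> S ==> tsigma a \<in> even_forms S"
  unfolding even_forms_def tsigma_def by (intro CollectI exI[of _ "Some a"] exI[of _ "[]"]) simp

lemma even_forms_tcurv: "u \<in> S ==> v \<in> S ==> tcurv u v \<in> even_forms S"
  unfolding even_forms_def tcurv_def by (intro CollectI exI[of _ None] exI[of _ "[u, v]"]) simp

lemma even_forms_times:
  assumes "y \<in> even_forms S" "u \<in> S" "v \<in> S"
  shows "y * tcurv u v \<in> even_forms (S :: 'a::complete_bornological_algebra set)"
proof -
  obtain a as where y: "y = even_form a as" "set_option a \<union> set as \<subseteq> S" "even (length as)"
    using assms(1) unfolding even_forms_def by auto
  show ?thesis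
  proof (cases "proper_form a as")
    case True
    hence "y * tcurv u v = even_form a (as @ [u, v])" unfolding y(1) by (rule even_form_snoc[OF y(3), symmetric])
    thus ?thesis unfolding even_forms_def using y(2,3) assms by (intro CollectI exI[of _ a] exI[of _ "as @ [u, v]"]) simp
  next
    case False
    hence "y * tcurv u v = even_form None []" using y(1) by simp
    thus ?thesis unfolding even_forms_def by (intro CollectI exI[of _ None] exI[of _ "[]"]) simp
  qed
qed

subsection \<open>The universal property\<close>

text \<open>With \<open>fstart\<close>, this evaluates l(a0) w(a1, a2) w(a3, a4) ... from left to
  right, the value that a homomorphism must take on a form. Lists of odd length get 0, which keeps
  the function multilinear on all lists.\<close>

fun facc :: "('e => 'e => 'e) => ('a => 'a => 'e) => 'e::zero => 'a list => 'e" where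
  "facc m w p [] = p"
| "facc m w p [x] = 0"
| "facc m w p (u # v # as) = facc m w (m p (w u v)) as"

fun fstart :: "('e => 'e => 'e) => ('a => 'a => 'e) => ('a => 'e::zero) => 'a option => 'a list => 'e" where
  "fstart m w l (Some a) as = facc m w (l a) as"
| "fstart m w l None (u # v # as) = facc m w (w u v) as"
| "fstart m w l None [] = 0"
| "fstart m w l None [x] = 0"

lemma facc_snoc: "even (length as) ==> facc m w p (as @ [u, v]) = m (facc m w p as) (w u v)"
  by (induction m w p as rule: facc.induct) auto

lemma fstart_snoc:
  "even (length as) ==> proper_form a as ==> fstart m w l a (as @ [u, v]) = m (fstart m w l a as) (w u v)"
  by (cases "(m, w, l, a, as)" rule: fstart.cases) (auto simp: facc_snoc)

lemma clinear_facc: "cbilinear m ==> clinear (\<lambda>p. facc m w p as)"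
proof (induction as rule: induct_list012)
  case (3 u v as)
  thus ?case using clinear_compose[OF cbilinear_left[OF 3(3), of "w u v"] 3(1)] by simp
qed (simp_all add: clinear_id clinear_const_zero)

lemma mlist_facc:
  assumes m: "cbilinear m" and w: "cbilinear w"
  shows "clinear (\<lambda>x. facc m w p (us @ x # vs))"
proof (induction us arbitrary: p rule: induct_list012)
  case 1
  show ?case
  proof (cases vs)
    case (Cons v vs')
    show ?thesis using clinear_compose[OF clinear_compose[OF cbilinear_left[OF w] cbilinear_right[OF m]] clinear_facc[OF m]]
      by (simp add: Cons)
  qed (simp add: clinear_const_zero)
next
  case (2 u)
  show ?case
    using clinear_compose[OF clinear_compose[OF cbilinear_right[OF w] cbilinear_right[OF m]] clinear_facc[OF m]] by simp
qed simp

lemma mform_fstart: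
  assumes m: "cbilinear m" and w: "cbilinear w" and l: "clinear l"
  shows "mform (fstart m w l)"
proof -
  have "clinear (\<lambda>x. fstart m w l None (us @ x # vs))" for us vs
  proof (cases us)
    case Nil
    show ?thesis
    proof (cases vs)
      case (Cons v vs')
      show ?thesis using clinear_compose[OF cbilinear_left[OF w] clinear_facc[OF m]] by (simp add: Nil Cons)
    qed (simp add: Nil clinear_const_zero)
  next
    case (Cons u us')
    show ?thesis
    proof (cases us')
      case Nil
      show ?thesis using clinear_compose[OF cbilinear_right[OF w] clinear_facc[OF m]] by (simp add: Nil Cons)
    next
      case (Cons v us'')
      thus ?thesis using mlist_facc[OF m w] by (simp add: \<open>us = u # us'\<close>)
    qed
  qed
  moreover have "clinear (\<lambda>x. fstart m w l (Some a) (us @ x # vs))" for a us vs using mlist_facc[OF m w] by simp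
  ultimately have "mlist (fstart m w l a)" for a unfolding mlist_def by (cases a) blast+
  moreover have "clinear (\<lambda>x. fstart m w l (Some x) as)" for as using clinear_compose[OF l clinear_facc[OF m]] by simp
  ultimately show ?thesis by (simp add: mform_def)
qed

lemma facc_mem:
  assumes "\<And>p u v. p \<in> P ==> u \<in> S ==> v \<in> S ==> m p (w u v) \<in> P" "p \<in> P" "set as \<subseteq> S"
  shows "facc m w p as \<in> insert 0 P" using assms(2,3)
proof (induction as arbitrary: p rule: induct_list012)
  case (3 u v as)
  have "m p (w u v) \<in> P" using 3(3,4) by (intro assms(1)) auto
  thus ?case using 3(1,4) by simp
qed simp_all

text \<open>The hypothesis \<open>inv\<close> says that the curvature of the linear map \<open>l\<close> is analytically nilpotent.\<close>

lemma tensor_alg_universal: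
  fixes m :: "'e::bornological_vector_space => 'e => 'e" and l :: "'a::complete_bornological_algebra => 'e"
  assumes cpl: "bcomplete TYPE('e)" and m: "bounded_cbilinear m" and assoc: "\<And>x y z. m (m x y) z = m x (m y z)"
    and l: "bounded_clinear l" and w: "\<And>a b. w a b = l (a * b) - m (l a) (l b)"
    and inv: "\<And>S. small S ==> \<exists>P. small P \<and> (\<forall>a\<in>S. l a \<in> P) \<and> (\<forall>a\<in>S. \<forall>b\<in>S. w a b \<in> P) \<and>
      (\<forall>p\<in>P. \<forall>a\<in>S. \<forall>b\<in>S. m p (w a b) \<in> P)"
  shows "\<exists>G. bounded_clinear G \<and> (\<forall>a. G (tsigma a) = l a) \<and> (\<forall>x y. G (x * y) = m (G x) (G y))"
proof -
  note l' = blinear_clinear[OF l] and ml = bbil_clinear_left[OF m] and mr = bbil_clinear_right[OF m]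
  have wb: "cbilinear w"
  proof (rule cbilinearI; rule clinearI)
    fix a b c and z
    show "w a (b + c) = w a b + w a c" "w (b + c) a = w b a + w c a"
      by (simp_all only: w distrib_left distrib_right clinear_add[OF l'] clinear_add[OF mr] clinear_add[OF ml] add_diff_add)
    show "w a (z *\<^sub>C b) = z *\<^sub>C w a b" "w (z *\<^sub>C b) a = z *\<^sub>C w b a"
      by (simp_all only: w scaleC_mult_right scaleC_mult_left clinear_scale[OF l'] clinear_scale[OF mr] clinear_scale[OF ml]
          complex_vector.scale_right_diff_distrib)
  qed
  let ?f = "fstart m w l"
  note mf = mform_fstart[OF bbil_cbilinear[OF m] wb l']
  have g: "bounded_clinear (omega_lift ?f)"
  proof (rule blinear_omegaI[OF clinear_omega_lift[OF mf]])
    fix S :: "'a set" assume "small S"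
    then obtain P where P0: "small P \<and> (\<forall>a\<in>S. l a \<in> P) \<and> (\<forall>a\<in>S. \<forall>b\<in>S. w a b \<in> P) \<and>
      (\<forall>p\<in>P. \<forall>a\<in>S. \<forall>b\<in>S. m p (w a b) \<in> P)" by (rule exE[OF inv])
    hence P: "small P" "\<forall>a\<in>S. l a \<in> P" "\<forall>a\<in>S. \<forall>b\<in>S. w a b \<in> P" by simp_all
    have P4: "m p (w a b) \<in> P" if "p \<in> P" "a \<in> S" "b \<in> S" for p a b using P0 that by simp
    have acc: "facc m w p as \<in> insert 0 P" if "p \<in> P" "set as \<subseteq> S" for p as
      by (rule facc_mem[where m = m and w = w, OF P4 that])
    have "?f a as \<in> insert 0 P" if "set_option a \<subseteq> S" "set as \<subseteq> S" for a as
    proof (cases a)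
      case None
      show ?thesis
      proof (cases as rule: remdups_adj.cases)
        case (3 u v as')
        thus ?thesis using that P(3) acc[of "w u v" as'] by (simp add: None)
      qed (simp_all add: None)
    next
      case (Some c)
      thus ?thesis using that P(2) acc[of "l c" as] by simp
    qed
    hence "omega_lift ?f ` forms S \<subseteq> insert 0 P"
      unfolding forms_def by (intro image_subsetI; elim CollectE exE conjE) (simp only: omega_lift_form[OF mf] Un_subset_iff)
    thus "small (omega_lift ?f ` forms S)" by (rule small_subset[OF small_insert[OF P(1)]])
  qed
  define G where "G t = completion_lift (omega_lift ?f) (Rep_tensor_alg t)" for t
  have G: "bounded_clinear G" unfolding G_def
    by (intro blinear_compose[OF blinear_Rep_tensor_alg] blinear_completion_lift g cpl)
  note G' = blinear_clinear[OF G] and sep = bcomplete_separated[OF cpl]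
  have G_form: "G (even_form a as) = ?f a as" if "even (length as)" for a as
    using that by (simp add: G_def Rep_even_form completion_lift_to_completion[OF g cpl] omega_lift_form[OF mf])
  have G_sigma: "G (tsigma a) = l a" and G_curv: "G (tcurv a b) = w a b" for a b
    by (simp_all add: tsigma_def tcurv_def G_form)
  note tr = bbil_right[OF bbil_times_tensor_alg] and tl = bbil_left[OF bbil_times_tensor_alg]
  have mul_curv: "G (y * tcurv u v) = m (G y) (w u v)" for y u v
  proof -
    have "(\<lambda>y. G (y * tcurv u v)) = (\<lambda>y. m (G y) (w u v))"
      by (rule tensor_alg_ext[OF blinear_compose[OF tl G] blinear_compose[OF G bbil_left[OF m]] sep])
        (simp add: G_form fstart_snoc flip: even_form_snoc)
    thus ?thesis by metis
  qed
  have w_id: "m (w u v) (l b) = w u (v * b) - w (u * v) b + m (l u) (w v b)" for u v b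
    unfolding w by (simp add: clinear_diff[OF ml] clinear_diff[OF mr] assoc mult.assoc)
  \<comment> \<open>In the induction the generator \<open>b\<close> is carried across the last
    curvature by \<open>w_id\<close>, the image of \<open>tcurv_tsigma\<close>. This leaves the
    generator \<open>u\<close> further left, so the hypothesis is needed for all generators.\<close>
  have mul_sigma: "G (y * tsigma b) = m (G y) (l b)" for y b
  proof -
    have "(\<lambda>y. G (y * tsigma b)) = (\<lambda>y. m (G y) (l b))"
    proof (rule tensor_alg_ext[OF blinear_compose[OF tl G] blinear_compose[OF G bbil_left[OF m]] sep])
      fix a as assume "proper_form a (as :: 'a list)" "even (length as)"
      hence "\<forall>b. G (even_form a as * tsigma b) = m (G (even_form a as)) (l b)"
      proof (induction rule: even_form_induct)
        case (sigma c)
        show ?case by (simp add: G_sigma tsigma_times clinear_diff[OF G'] G_curv w)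
      next
        case (curv u v)
        show ?case by (simp add: tcurv_tsigma clinear_add[OF G'] clinear_diff[OF G'] mul_curv G_curv G_sigma w_id)
      next
        case (step y u v)
        have "G (y * tcurv u v * tsigma b) = m (G (y * tcurv u v)) (l b)" for b
        proof -
          have "G (y * tcurv u v * tsigma b) = G (y * tcurv u (v * b)) - G (y * tcurv (u * v) b) + G ((y * tsigma u) * tcurv v b)"
            by (simp add: mult.assoc tcurv_tsigma distrib_left right_diff_distrib clinear_add[OF G'] clinear_diff[OF G'])
          also have "\<dots> = m (G y) (w u (v * b) - w (u * v) b + m (l u) (w v b))"
            by (simp add: mul_curv step assoc clinear_diff[OF mr] clinear_add[OF mr])
          also have "\<dots> = m (G (y * tcurv u v)) (l b)" by (simp add: w_id[symmetric] mul_curv assoc)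
          finally show ?thesis .
        qed
        thus ?case by blast
      qed
      thus "G (even_form a as * tsigma b) = m (G (even_form a as)) (l b)" by blast
    qed
    thus ?thesis by metis
  qed
  have "G (x * y) = m (G x) (G y)" for x y
  proof -
    have "(\<lambda>y. G (x * y)) = (\<lambda>y. m (G x) (G y))"
    proof (rule tensor_alg_ext[OF blinear_compose[OF tr G] blinear_compose[OF G bbil_right[OF m]] sep])
      fix a as assume "proper_form a (as :: 'a list)" "even (length as)"
      thus "G (x * even_form a as) = m (G x) (G (even_form a as))"
        by (rule even_form_induct) (simp_all add: mul_sigma G_sigma mul_curv G_curv assoc flip: mult.assoc)
    qed
    thus ?thesis by metis
  qed
  thus ?thesis using G G_sigma by blast
qed

lemma tensor_alg_hom_ext:
  fixes f g :: "'a::complete_bornological_algebra tensor_alg => 'e::bornological_vector_space"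
  assumes f: "bounded_clinear f" and g: "bounded_clinear g" and sep: "bseparated TYPE('e)"
    and fm: "\<And>x y. f (x * y) = m (f x) (f y)" and gm: "\<And>x y. g (x * y) = m (g x) (g y)"
    and eq: "\<And>a. f (tsigma a) = g (tsigma a)"
  shows "f = g"
proof (rule tensor_alg_ext[OF f g sep])
  have c: "tcurv u v = tsigma (u * v) - tsigma u * tsigma v" for u v :: 'a using tsigma_times[of u v] by simp
  have cu: "f (tcurv u v) = g (tcurv u v)" for u v unfolding c by (simp add: blin_diff[OF f] blin_diff[OF g] fm gm eq)
  fix a as assume "proper_form a (as :: 'a list)" "even (length as)"
  thus "f (even_form a as) = g (even_form a as)" by (rule even_form_induct) (simp_all add: eq cu fm gm)
qed

text \<open>Since \<open>f\<close> is multiplicative, the curvature of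
  \<open>\<lambda>a. tsigma (f a)\<close> consists of the elements \<open>tcurv (f a) (f b)\<close>,
  and the even forms with entries in the image of \<open>S\<close> absorb them. The formula on forms
  then identifies the extension \<open>G\<close> with \<open>tensor_alg_map f\<close>.\<close>

lemma
  fixes f :: "'a::complete_bornological_algebra => 'b::complete_bornological_algebra"
  assumes f: "bounded_hom f"
  shows blinear_tensor_alg_map: "bounded_clinear (tensor_alg_map f)"
    and tensor_alg_map_times: "tensor_alg_map f (x * y) = tensor_alg_map f x * tensor_alg_map f y"
    and tensor_alg_map_tsigma: "tensor_alg_map f (tsigma a) = tsigma (f a)"
proof -
  have fb: "bounded_clinear f" and fm: "f (x * y) = f x * f y" for x y using f by (simp_all add: bounded_hom_def)
  have curv: "tcurv (f a) (f b) = tsigma (f (a * b)) - tsigma (f a) * tsigma (f b)" for a b by (simp add: tsigma_times fm)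
  obtain G where G: "bounded_clinear G" "\<And>a. G (tsigma a) = tsigma (f a)" "\<And>x y. G (x * y) = G x * G y"
  proof -
    have "\<exists>P. small P \<and> (\<forall>a\<in>S. tsigma (f a) \<in> P) \<and> (\<forall>a\<in>S. \<forall>b\<in>S. tcurv (f a) (f b) \<in> P) \<and>
        (\<forall>p\<in>P. \<forall>a\<in>S. \<forall>b\<in>S. p * tcurv (f a) (f b) \<in> P)" if "small S" for S
    proof (intro exI conjI ballI)
      show "small (even_forms (f ` S))" by (rule small_even_forms[OF blinear_small[OF fb that]])
    qed (intro even_forms_tsigma even_forms_tcurv even_forms_times imageI; assumption)+
    from tensor_alg_universal[OF bcomplete_tensor_alg bbil_times_tensor_alg mult.assoc
        blinear_compose[OF fb blinear_tsigma] curv this]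
    show ?thesis using that by blast
  qed
  have G_curv: "G (tcurv u v) = tcurv (f u) (f v)" for u v
  proof -
    have "tcurv u v = tsigma (u * v) - tsigma u * tsigma v" using tsigma_times[of u v] by simp
    thus ?thesis by (simp add: blin_diff[OF G(1)] G(2,3) curv)
  qed
  have G_form: "G (even_form a as) = even_form (map_option f a) (map f as)" if "even (length as)" for a as using that
  proof (induction as rule: even_list_induct)
    case Nil
    thus ?case using blin_zero[OF G(1)] by (cases a) (simp_all add: G(2) flip: tsigma_def)
  next
    case (snoc us u v)
    show ?case
    proof (cases "proper_form a us")
      case True
      hence "proper_form (map_option f a) (map f us)" by auto
      thus ?thesis using snoc even_form_snoc[of "map f us" "map_option f a" "f u" "f v"]
        by (simp add: even_form_snoc[OF snoc.hyps True] G(3) G_curv)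
    next
      case False
      hence "even_form a (us @ [u, v]) = tcurv u v" by (simp add: tcurv_def)
      thus ?thesis using False by (simp add: G_curv) (simp add: tcurv_def)
    qed
  qed
  have eq: "tensor_alg_map f = G" unfolding tensor_alg_map_def
  proof (rule the_equality)
    show "bounded_clinear G \<and> (\<forall>a as. even (length as) \<longrightarrow> G (even_form a as) = even_form (map_option f a) (map f as))"
      using G(1) G_form by blast
    show "g = G" if "bounded_clinear g \<and> (\<forall>a as. even (length as) \<longrightarrow> g (even_form a as) = even_form (map_option f a) (map f as))" for g
      by (rule tensor_alg_ext[OF _ G(1) bcomplete_separated[OF bcomplete_tensor_alg]]) (use that G_form in auto)
  qed
  show "bounded_clinear (tensor_alg_map f)" "tensor_alg_map f (x * y) = tensor_alg_map f x * tensor_alg_map f y"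
    "tensor_alg_map f (tsigma a) = tsigma (f a)" using G by (simp_all add: eq)
qed

section \<open>Absolutely continuous functions\<close>

lemma cball_midpoint: "cball ((x + y) / 2) (\<bar>y - x\<bar> / 2) = {min x y..max x (y::real)}"
  by (auto simp: dist_real_def min_def max_def abs_if field_simps split: if_splits)

text \<open>Brings the error of the difference quotient at \<open>x\<close> into the shape that
  Henstock's lemma controls, on the interval between \<open>x\<close> and \<open>y\<close> whichever
  of them is larger.\<close>

lemma indefinite_integral_difference:
  fixes h :: "real => 'b::euclidean_space"
  assumes "h integrable_on {a..b}" "x \<in> {a..b}" "y \<in> {a..b}"
  shows "norm (integral {a..y} h - integral {a..x} h - (y - x) *\<^sub>R h x) =
    norm (\<bar>y - x\<bar> *\<^sub>R h x - integral {min x y..max x y} h)"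
proof (cases "x \<le> y")
  case True
  have "integral {a..x} h + integral {x..y} h = integral {a..y} h"
    using assms True by (intro Henstock_Kurzweil_Integration.integral_combine integrable_subinterval_real[OF assms(1)]; auto)
  hence "integral {a..y} h - integral {a..x} h - (y - x) *\<^sub>R h x = - ((y - x) *\<^sub>R h x - integral {x..y} h)"
    by (simp add: algebra_simps)
  thus ?thesis using True by (simp only: norm_minus_cancel)
next
  case False
  have "integral {a..y} h + integral {y..x} h = integral {a..x} h"
    using assms False by (intro Henstock_Kurzweil_Integration.integral_combine integrable_subinterval_real[OF assms(1)]; auto)
  hence "integral {a..y} h - integral {a..x} h - (y - x) *\<^sub>R h x = (x - y) *\<^sub>R h x - integral {y..x} h"
    by (simp add: algebra_simps)
  thus ?thesis using False by simp
qed

text \<open>On the exceptional set the difference quotient misses the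
  integrand by \<open>e\<close> on arbitrarily short intervals; by Henstock's lemma, disjoint such intervals have
  small total length, and by Vitali's theorem they cover.\<close>

lemma indefinite_integral_exceptional_negligible:
  fixes h :: "real => 'b::euclidean_space"
  assumes h: "h integrable_on {a..b}" and "0 < e"
  shows "negligible {x \<in> {a..b}. \<forall>d>0. \<exists>y\<in>{a..b}. y \<noteq> x \<and> \<bar>y - x\<bar> < d \<and>
    e * \<bar>y - x\<bar> < norm (integral {a..y} h - integral {a..x} h - (y - x) *\<^sub>R h x)}" (is "negligible ?E")
  unfolding negligible_outer_le
proof (intro allI impI)
  fix \<eta> :: real assume "0 < \<eta>"
  hence "0 < e * \<eta>" using \<open>0 < e\<close> by simp
  have h': "h integrable_on cbox a b" using h by simp
  obtain \<gamma> where \<gamma>: "gauge \<gamma>" and hen: "\<And>p. p tagged_partial_division_of cbox a b ==> \<gamma> fine p ==>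
      sum (\<lambda>(x, k). norm (measure lborel k *\<^sub>R h x - integral k h)) p < e * \<eta>"
    using Henstock_lemma[OF h' \<open>0 < e * \<eta>\<close>] by blast
  \<comment> \<open>An index is a pair: a tag in the exceptional set and a second point witnessing a
    bad difference quotient. Vitali's theorem needs balls, hence the description of the interval by
    its midpoint below; the tag is an endpoint.\<close>
  define I where "I i = {min (fst i) (snd i)..max (fst i) (snd i :: real)}" for i
  define K where "K = {i. fst i \<in> ?E \<and> snd i \<in> {a..b} \<and> snd i \<noteq> fst i \<and> I i \<subseteq> \<gamma> (fst i) \<and>
    e * \<bar>snd i - fst i\<bar> < norm (integral {a..snd i} h - integral {a..fst i} h - (snd i - fst i) *\<^sub>R h (fst i))}"
  let ?c = "\<lambda>i. (fst i + snd i) / 2 :: real" and ?r = "\<lambda>i. \<bar>snd i - fst i\<bar> / 2 :: real"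
  have I: "cball (?c i) (?r i) = I i" for i by (simp add: I_def cball_midpoint)
  obtain C where C: "countable C" "C \<subseteq> K" "pairwise (\<lambda>i j. disjnt (I i) (I j)) C" "negligible (?E - (\<Union>i\<in>C. I i))"
  proof (rule Vitali_covering_theorem_cballs[of K ?r ?E ?c])
    show "0 < ?r i" if "i \<in> K" for i using that by (simp add: K_def)
    show "\<exists>i. i \<in> K \<and> x \<in> cball (?c i) (?r i) \<and> ?r i < d" if x: "x \<in> ?E" and "0 < d" for x d
    proof -
      obtain \<delta> where \<delta>: "0 < \<delta>" "ball x \<delta> \<subseteq> \<gamma> x" using \<gamma> unfolding gauge_def open_contains_ball by blast
      have "0 < min \<delta> d" using \<delta>(1) \<open>0 < d\<close> by simp
      then obtain y where y: "y \<in> {a..b}" "y \<noteq> x" "\<bar>y - x\<bar> < min \<delta> d"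
        "e * \<bar>y - x\<bar> < norm (integral {a..y} h - integral {a..x} h - (y - x) *\<^sub>R h x)" using x by blast
      have "I (x, y) \<subseteq> ball x \<delta>" using y(3) by (auto simp: I_def dist_real_def min_def max_def split: if_splits)
      hence "(x, y) \<in> K" using x y \<delta>(2) by (simp add: K_def)
      moreover have "x \<in> cball (?c (x, y)) (?r (x, y))" unfolding I by (simp add: I_def)
      ultimately show ?thesis using y(3) \<open>0 < d\<close> by (intro exI[of _ "(x, y)"] conjI) simp_all
    qed
  qed (auto simp: I intro: that)
  \<comment> \<open>Disjoint intervals from \<open>C\<close> form a tagged partial division fine for
    \<open>\<gamma>\<close>. Each has error above \<open>e\<close> times its length while the errors
    add up to less than \<open>e * \<eta>\<close>, so the lengths add up to at most
    \<open>\<eta>\<close>.\<close>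
  have bound: "measure lebesgue (\<Union>i\<in>F. I i) \<le> \<eta>" if F: "F \<subseteq> C" "finite F" for F
  proof -
    let ?p = "(\<lambda>i. (fst i, I i)) ` F"
    have FK: "i \<in> K" if "i \<in> F" for i using that F C(2) by blast
    have disj: "I i \<inter> I j = {}" if "i \<in> F" "j \<in> F" "i \<noteq> j" for i j
      using that F C(3) unfolding pairwise_def disjnt_def by blast
    have ne: "fst i \<in> I i" for i by (simp add: I_def)
    have inj: "inj_on (\<lambda>i. (fst i, I i)) F"
    proof (rule inj_onI)
      fix i j assume ij: "i \<in> F" "j \<in> F" "(fst i, I i) = (fst j, I j)"
      show "i = j"
      proof (rule ccontr)
        assume "i \<noteq> j"
        from disj[OF ij(1,2) this] ij(3) ne[of i] show False by auto
      qed
    qed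
    have sub: "I i \<subseteq> cbox a b" if "i \<in> F" for i
      using FK[OF that] by (auto simp: K_def I_def min_def max_def split: if_splits)
    have "?p tagged_partial_division_of cbox a b" unfolding tagged_partial_division_of_def
    proof (intro conjI allI impI)
      show "finite ?p" using F(2) by simp
      show "x \<in> k" "k \<subseteq> cbox a b" if "(x, k) \<in> ?p" for x k using that ne sub by blast+
      show "\<exists>a b. k = cbox a b" if "(x, k) \<in> ?p" for x k using that by (auto simp: I_def)
      show "interior k1 \<inter> interior k2 = {}" if P: "(x1, k1) \<in> ?p \<and> (x2, k2) \<in> ?p \<and> (x1, k1) \<noteq> (x2, k2)" for x1 k1 x2 k2
      proof -
        obtain i j where ij: "i \<in> F" "j \<in> F" "(x1, k1) = (fst i, I i)" "(x2, k2) = (fst j, I j)" using P by blast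
        hence "i \<noteq> j" using P by auto
        from disj[OF ij(1,2) this] ij(3,4) interior_subset[of k1] interior_subset[of k2] show ?thesis by auto
      qed
    qed
    moreover have "\<gamma> fine ?p" using FK by (auto simp: fine_def K_def)
    ultimately have "sum (\<lambda>(x, k). norm (measure lborel k *\<^sub>R h x - integral k h)) ?p < e * \<eta>" by (rule hen)
    hence "(\<Sum>i\<in>F. norm (measure lborel (I i) *\<^sub>R h (fst i) - integral (I i) h)) < e * \<eta>" by (simp add: sum.reindex[OF inj])
    moreover have len: "measure lborel (I i) = \<bar>snd i - fst i\<bar>" for i by (simp add: I_def min_def max_def)
    have "e * \<bar>snd i - fst i\<bar> \<le> norm (measure lborel (I i) *\<^sub>R h (fst i) - integral (I i) h)" if "i \<in> F" for i
      using FK[OF that] indefinite_integral_difference[OF h, of "fst i" "snd i"] unfolding len by (simp add: K_def I_def)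
    hence "(\<Sum>i\<in>F. e * measure lborel (I i)) \<le> (\<Sum>i\<in>F. norm (measure lborel (I i) *\<^sub>R h (fst i) - integral (I i) h))"
      unfolding len by (rule sum_mono)
    ultimately have "e * (\<Sum>i\<in>F. measure lborel (I i)) \<le> e * \<eta>" by (simp add: sum_distrib_left)
    hence "(\<Sum>i\<in>F. measure lborel (I i)) \<le> \<eta>" using \<open>0 < e\<close> by simp
    moreover have "measure lebesgue (\<Union>i\<in>F. I i) \<le> (\<Sum>i\<in>F. measure lebesgue (I i))"
      using F(2) by (intro measure_UNION_le) (auto simp: I_def)
    moreover have "measure lebesgue (I i) = measure lborel (I i)" for i by (simp add: I_def)
    ultimately show ?thesis by simp
  qed
  have meas: "I i \<in> lmeasurable" for i by (simp add: I_def)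
  have U: "(\<Union>i\<in>C. I i) \<in> lmeasurable" "measure lebesgue (\<Union>i\<in>C. I i) \<le> \<eta>"
    using fmeasurable_UN_bound[OF C(1) meas bound] measure_UN_bound[OF C(1) meas bound] by auto
  let ?T = "(?E - (\<Union>i\<in>C. I i)) \<union> (\<Union>i\<in>C. I i)"
  have N: "?E - (\<Union>i\<in>C. I i) \<in> lmeasurable" "measure lebesgue (?E - (\<Union>i\<in>C. I i)) = 0"
    using C(4) by (simp_all add: negligible_iff_measure)
  show "\<exists>T. ?E \<subseteq> T \<and> T \<in> lmeasurable \<and> measure lebesgue T \<le> \<eta>"
  proof (intro exI[of _ ?T] conjI)
    show "?T \<in> lmeasurable" by (rule fmeasurable.Un[OF N(1) U(1)])
    have "measure lebesgue ?T \<le> measure lebesgue (?E - (\<Union>i\<in>C. I i)) + measure lebesgue (\<Union>i\<in>C. I i)"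
      by (rule measure_Un_le[OF fmeasurableD[OF N(1)] fmeasurableD[OF U(1)]])
    thus "measure lebesgue ?T \<le> \<eta>" using U(2) N(2) by linarith
  qed blast
qed

text \<open>The null set is the countable union of the exceptional sets for e = 1/(n+1).\<close>

lemma indefinite_integral_differentiable_ae:
  fixes h :: "real => 'b::euclidean_space"
  assumes h: "h integrable_on {a..b}"
  shows "\<exists>N. negligible N \<and> (\<forall>x\<in>{a..b} - N. ((\<lambda>x. integral {a..x} h) has_vector_derivative h x) (at x within {a..b}))"
proof -
  let ?E = "\<lambda>e. {x \<in> {a..b}. \<forall>d>0. \<exists>y\<in>{a..b}. y \<noteq> x \<and> \<bar>y - x\<bar> < d \<and>
    e * \<bar>y - x\<bar> < norm (integral {a..y} h - integral {a..x} h - (y - x) *\<^sub>R h x)}"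
  let ?N = "\<Union>n. ?E (1 / real (Suc n))"
  have "negligible ?N"
  proof (rule negligible_countable_Union)
    fix S assume "S \<in> range (\<lambda>n. ?E (1 / real (Suc n)))"
    then obtain n where "S = ?E (1 / real (Suc n))" by (rule rangeE)
    moreover have "negligible (?E (1 / real (Suc n)))" by (rule indefinite_integral_exceptional_negligible[OF h]) simp
    ultimately show "negligible S" by (simp only:)
  qed simp
  moreover have "((\<lambda>x. integral {a..x} h) has_vector_derivative h x) (at x within {a..b})" if x: "x \<in> {a..b} - ?N" for x
    unfolding has_vector_derivative_def has_derivative_within_alt
  proof (intro conjI allI impI)
    show "bounded_linear (\<lambda>t. t *\<^sub>R h x)" by (rule bounded_linear_scaleR_left)
    fix e :: real assume "0 < e"
    then obtain n where n: "1 / real (Suc n) < e" using nat_approx_posE by metis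
    have "x \<notin> ?E (1 / real (Suc n))" using x by blast
    hence "\<not> (\<forall>d>0. \<exists>y\<in>{a..b}. y \<noteq> x \<and> \<bar>y - x\<bar> < d \<and> 1 / real (Suc n) * \<bar>y - x\<bar> <
      norm (integral {a..y} h - integral {a..x} h - (y - x) *\<^sub>R h x))" using x by blast
    then obtain d where d: "0 < d" "\<not> (\<exists>y\<in>{a..b}. y \<noteq> x \<and> \<bar>y - x\<bar> < d \<and> 1 / real (Suc n) * \<bar>y - x\<bar> <
      norm (integral {a..y} h - integral {a..x} h - (y - x) *\<^sub>R h x))" by blast
    show "\<exists>d>0. \<forall>y\<in>{a..b}. norm (y - x) < d \<longrightarrow>
      norm (integral {a..y} h - integral {a..x} h - (y - x) *\<^sub>R h x) \<le> e * norm (y - x)"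
    proof (intro exI[of _ d] conjI ballI impI d(1))
      fix y assume y: "y \<in> {a..b}" "norm (y - x) < d"
      show "norm (integral {a..y} h - integral {a..x} h - (y - x) *\<^sub>R h x) \<le> e * norm (y - x)"
      proof (cases "y = x")
        case False
        hence "norm (integral {a..y} h - integral {a..x} h - (y - x) *\<^sub>R h x) \<le> 1 / real (Suc n) * \<bar>y - x\<bar>"
          by (intro leI) (use d(2) y in auto)
        also have "\<dots> \<le> e * \<bar>y - x\<bar>" using n by (intro mult_right_mono) auto
        finally show ?thesis by simp
      qed simp
    qed
  qed
  ultimately show ?thesis by blast
qed

subsection \<open>The variation of an absolutely continuous function\<close>

lemma nonoverlapping_mono: "nonoverlapping c d n l r ==> a \<le> c ==> d \<le> b ==> nonoverlapping a b n l r"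
  unfolding nonoverlapping_def by force

lemma nonoverlapping_min:
  "nonoverlapping a b n l r ==> a \<le> s ==> nonoverlapping a s n (\<lambda>i. min (l i) s) (\<lambda>i. min (r i) s)"
  unfolding nonoverlapping_def disjoint_family_on_def by (auto simp: min_def disjoint_iff split: if_splits) force+

lemma nonoverlapping_max:
  "nonoverlapping a b n l r ==> s \<le> b ==> nonoverlapping s b n (\<lambda>i. max (l i) s) (\<lambda>i. max (r i) s)"
  unfolding nonoverlapping_def disjoint_family_on_def by (auto simp: max_def disjoint_iff split: if_splits) force+

lemma nonoverlapping_length:
  assumes lr: "nonoverlapping a b n l r" and "a \<le> b"
  shows "(\<Sum>i<n. r i - l i) \<le> b - a"
proof -
  have "(\<Sum>i<n. r i - l i) = (\<Sum>i<n. measure lborel {l i<..<r i})" using lr by (intro sum.cong) (auto simp: nonoverlapping_def)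
  also have "\<dots> = measure lborel (\<Union>i<n. {l i<..<r i})"
    using lr by (intro measure_finite_Union[symmetric]) (auto simp: nonoverlapping_def)
  also have "\<dots> \<le> measure lborel {a..b}"
  proof (rule measure_mono_fmeasurable)
    show "(\<Union>i<n. {l i<..<r i}) \<subseteq> {a..b}" using lr unfolding nonoverlapping_def by (auto intro: order_trans less_imp_le)
    show "{a..b} \<in> fmeasurable lborel" by (simp add: fmeasurable_def emeasure_lborel_Icc_eq)
  qed auto
  finally show ?thesis using \<open>a \<le> b\<close> by simp
qed

definition vsum :: "(real => complex) => nat => (nat => real) => (nat => real) => real"
  where "vsum f n l r = (\<Sum>i<n. cmod (f (r i) - f (l i)))"

text \<open>Every interval is cut at s. With \<open>min\<close> and \<open>max\<close> the number of
  intervals is kept; an interval on one side of s degenerates to a point in the other sum and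
  contributes 0 there.\<close>

lemma vsum_split: "vsum f n l r \<le> vsum f n (\<lambda>i. min (l i) s) (\<lambda>i. min (r i) s) + vsum f n (\<lambda>i. max (l i) s) (\<lambda>i. max (r i) s)"
proof -
  have "f (min x s) + f (max x s) = f x + f s" for x by (simp add: min_def max_def)
  hence "f x - f y = (f (min x s) - f (min y s)) + (f (max x s) - f (max y s))" for x y
    by (metis (no_types, lifting) add_diff_add add_diff_cancel_right)
  thus ?thesis unfolding vsum_def sum.distrib[symmetric] by (intro sum_mono) (metis norm_triangle_ineq)
qed

text \<open>On a piece of length at most \<delta>/2 all variation sums stay below 1, and finitely
  many such pieces cover [a, b].\<close>

lemma abs_continuous_bounded_variation:
  assumes f: "abs_continuous_on a b f"
  shows "\<exists>B. \<forall>n l r. nonoverlapping a b n l r \<longrightarrow> vsum f n l r \<le> B"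
proof -
  obtain \<delta> where \<delta>: "0 < \<delta>" "\<And>n l r. nonoverlapping a b n l r ==> (\<Sum>i<n. r i - l i) < \<delta> ==> vsum f n l r < 1"
    using f unfolding abs_continuous_on_def vsum_def by (meson zero_less_one)
  have *: "vsum f n l r \<le> real k"
    if "a \<le> c" "c \<le> d" "d \<le> b" "d - c \<le> real k * (\<delta> / 2)" "nonoverlapping c d n l r" for k c d n l r using that
  proof (induction k arbitrary: c d n l r)
    case 0
    hence "l i = c \<and> r i = c" if "i < n" for i using that by (force simp: nonoverlapping_def)
    thus ?case by (simp add: vsum_def)
  next
    case (Suc k)
    define s where "s = min d (c + \<delta> / 2)"
    have s: "c \<le> s" "s \<le> d" using Suc.prems \<delta>(1) by (auto simp: s_def)
    have no: "nonoverlapping c s n (\<lambda>i. min (l i) s) (\<lambda>i. min (r i) s)" by (rule nonoverlapping_min[OF Suc.prems(5) s(1)])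
    have len: "(\<Sum>i<n. min (r i) s - min (l i) s) < \<delta>" using nonoverlapping_length[OF no s(1)] \<delta>(1) by (simp add: s_def)
    have "vsum f n (\<lambda>i. min (l i) s) (\<lambda>i. min (r i) s) < 1"
      by (rule \<delta>(2)[OF nonoverlapping_mono[OF no] len]) (use Suc.prems s in auto)
    moreover have "vsum f n (\<lambda>i. max (l i) s) (\<lambda>i. max (r i) s) \<le> real k"
    proof (rule Suc.IH)
      show "nonoverlapping s d n (\<lambda>i. max (l i) s) (\<lambda>i. max (r i) s)" using Suc.prems s by (intro nonoverlapping_max)
      show "d - s \<le> real k * (\<delta> / 2)" using Suc.prems(4) \<delta>(1) by (auto simp: s_def min_def algebra_simps)
    qed (use Suc.prems s in auto)
    ultimately show ?case using vsum_split[of f n l r s] by simp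
  qed
  show ?thesis
  proof (cases "a \<le> b")
    case True
    obtain k :: nat where "(b - a) / (\<delta> / 2) \<le> real k" using real_arch_simple by blast
    hence "b - a \<le> real k * (\<delta> / 2)" using \<delta>(1) by (simp add: field_simps)
    thus ?thesis using *[of a b k] True by blast
  next
    case False
    hence "vsum f n l r \<le> 0" if "nonoverlapping a b n l r" for n l r
      using that by (cases n) (force simp: nonoverlapping_def vsum_def)+
    thus ?thesis by blast
  qed
qed

definition variation :: "(real => complex) => real => real => real"
  where "variation f a b = Sup {vsum f n l r |n l r. nonoverlapping a b n l r}"

context
  fixes f :: "real => complex" and a b :: real
  assumes f: "abs_continuous_on a b f"
begin

lemma vsum_le_variation:
  assumes "a \<le> c" "d \<le> b" "nonoverlapping c d n l r"
  shows "vsum f n l r \<le> variation f c d"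
proof -
  obtain B where B: "\<And>n l r. nonoverlapping a b n l r ==> vsum f n l r \<le> B"
    using abs_continuous_bounded_variation[OF f] by blast
  have "bdd_above {vsum f n l r |n l r. nonoverlapping c d n l r}"
    using B nonoverlapping_mono[OF _ assms(1,2)] by (intro bdd_aboveI[of _ B]) blast
  thus ?thesis unfolding variation_def using assms(3) by (intro cSup_upper) blast
qed

lemma variation_le:
  assumes "\<And>n l r. nonoverlapping c d n l r ==> vsum f n l r \<le> B"
  shows "variation f c d \<le> B"
proof -
  have "nonoverlapping c d 0 l r" for l r by (simp add: nonoverlapping_def disjoint_family_on_def)
  thus ?thesis unfolding variation_def using assms by (intro cSup_least) blast+
qed

lemma variation_split:
  assumes "a \<le> c" "c \<le> s" "s \<le> d" "d \<le> b"
  shows "variation f c d \<le> variation f c s + variation f s d"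
proof (rule variation_le)
  fix n l r assume lr: "nonoverlapping c d n l r"
  have "vsum f n (\<lambda>i. min (l i) s) (\<lambda>i. min (r i) s) \<le> variation f c s"
    using assms lr by (intro vsum_le_variation nonoverlapping_min[OF lr]) auto
  moreover have "vsum f n (\<lambda>i. max (l i) s) (\<lambda>i. max (r i) s) \<le> variation f s d"
    using assms lr by (intro vsum_le_variation nonoverlapping_max[OF lr]) auto
  ultimately show "vsum f n l r \<le> variation f c s + variation f s d" using vsum_split[of f n l r s] by simp
qed

text \<open>The interval [s, t] is appended to a family in [a, s]. The inequality keeps the
  variation monotone even after the real or imaginary part of \<open>f\<close> is added, which is
  how \<open>abs_continuous_density\<close> uses it.\<close>

lemma variation_increment:
  assumes "a \<le> s" "s \<le> t" "t \<le> b"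
  shows "variation f a s + cmod (f t - f s) \<le> variation f a t"
proof -
  have "variation f a s \<le> variation f a t - cmod (f t - f s)"
  proof (rule variation_le)
    fix n l r assume lr: "nonoverlapping a s n l r"
    let ?l = "l(n := s)" and ?r = "r(n := t)"
    have "nonoverlapping a t (Suc n) ?l ?r" using lr assms unfolding nonoverlapping_def disjoint_family_on_def
      by (auto simp: less_Suc_eq disjoint_iff)
    hence "vsum f (Suc n) ?l ?r \<le> variation f a t" using assms by (intro vsum_le_variation) auto
    thus "vsum f n l r \<le> variation f a t - cmod (f t - f s)" by (simp add: vsum_def)
  qed
  thus ?thesis by simp
qed

end

text \<open>The definition speaks of families indexed by initial segments of the natural numbers,
  whereas families of subdivisions are indexed by pairs.\<close>

lemma abs_continuous_on_finite_families:
  assumes f: "abs_continuous_on a b f" and "0 < e"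
  shows "\<exists>\<delta>>0. \<forall>I L R. finite I \<longrightarrow> (\<forall>k\<in>I. a \<le> L k \<and> L k \<le> R k \<and> R k \<le> b) \<longrightarrow>
    disjoint_family_on (\<lambda>k. {L k<..<R k}) (I :: 'i set) \<longrightarrow> (\<Sum>k\<in>I. R k - L k) < \<delta> \<longrightarrow>
    (\<Sum>k\<in>I. cmod (f (R k) - f (L k))) < e"
proof -
  obtain \<delta> where \<delta>: "0 < \<delta>" "\<And>n l r. nonoverlapping a b n l r ==> (\<Sum>i<n. r i - l i) < \<delta> ==>
      (\<Sum>i<n. cmod (f (r i) - f (l i))) < e" using f \<open>0 < e\<close> unfolding abs_continuous_on_def by meson
  show ?thesis
  proof (intro exI[of _ \<delta>] conjI allI impI \<delta>(1))
    fix I :: "'i set" and L R :: "'i => real"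
    assume I: "finite I" and LR: "\<forall>k\<in>I. a \<le> L k \<and> L k \<le> R k \<and> R k \<le> b"
      and disj: "disjoint_family_on (\<lambda>k. {L k<..<R k}) I" and len: "(\<Sum>k\<in>I. R k - L k) < \<delta>"
    obtain h where h: "bij_betw h {..<card I} I" using ex_bij_betw_nat_finite[OF I] by (auto simp: atLeast0LessThan)
    have hI: "h i \<in> I" if "i < card I" for i using h that by (auto simp: bij_betw_def)
    have "nonoverlapping a b (card I) (\<lambda>i. L (h i)) (\<lambda>i. R (h i))" unfolding nonoverlapping_def disjoint_family_on_def
    proof (intro conjI allI impI ballI)
      fix i j assume ij: "i \<in> {..<card I}" "j \<in> {..<card I}" "i \<noteq> j"
      hence "h i \<noteq> h j" using h by (auto simp: bij_betw_def inj_on_def)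
      thus "{L (h i)<..<R (h i)} \<inter> {L (h j)<..<R (h j)} = {}" using disj hI ij unfolding disjoint_family_on_def by blast
    qed (use LR hI in auto)
    moreover have "(\<Sum>i<card I. R (h i) - L (h i)) < \<delta>" using len sum.reindex_bij_betw[OF h, of "\<lambda>k. R k - L k"] by simp
    ultimately have "(\<Sum>i<card I. cmod (f (R (h i)) - f (L (h i)))) < e" by (rule \<delta>(2))
    thus "(\<Sum>k\<in>I. cmod (f (R k) - f (L k))) < e" using sum.reindex_bij_betw[OF h, of "\<lambda>k. cmod (f (R k) - f (L k))"] by simp
  qed
qed

text \<open>In each given interval a subdivision almost attains the variation. Together these form
  one family of total length below \<open>\<delta>\<close>, on which \<open>f\<close> varies by less
  than e/3, and the defects \<open>q\<close> add up to at most e/3. The divisor \<open>Suc n\<close>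
  covers the empty family.\<close>

lemma abs_continuous_on_variation:
  assumes f: "abs_continuous_on a b f"
  shows "abs_continuous_on a b (\<lambda>t. of_real (variation f a t))" unfolding abs_continuous_on_def
proof (intro allI impI)
  fix e :: real assume "0 < e"
  hence e3: "0 < e / 3" by simp
  obtain \<delta> where \<delta>: "0 < \<delta>" and fam: "\<And>I L R. finite (I :: (nat \<times> nat) set) ==> (\<forall>k\<in>I. a \<le> L k \<and> L k \<le> R k \<and> R k \<le> b) ==>
    disjoint_family_on (\<lambda>k. {L k<..<R k}) I ==> (\<Sum>k\<in>I. R k - L k) < \<delta> ==>
    (\<Sum>k\<in>I. cmod (f (R k) - f (L k))) < e / 3" using abs_continuous_on_finite_families[OF f e3] by blast
  show "\<exists>\<delta>>0. \<forall>n l r. nonoverlapping a b n l r \<longrightarrow> (\<Sum>i<n. r i - l i) < \<delta> \<longrightarrow>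
    (\<Sum>i<n. cmod (of_real (variation f a (r i)) - of_real (variation f a (l i)))) < e"
  proof (intro exI[of _ \<delta>] conjI allI impI \<delta>)
    fix n l r assume lr: "nonoverlapping a b n l r" and len: "(\<Sum>i<n. r i - l i) < \<delta>"
    have li: "a \<le> l i" "l i \<le> r i" "r i \<le> b" if "i < n" for i using lr that by (simp_all add: nonoverlapping_def)
    define q where "q = e / 3 / real (Suc n)"
    have q: "0 < q" "real n * q \<le> e / 3" using \<open>0 < e\<close> by (simp_all add: q_def field_simps)
    have "\<exists>m L R. nonoverlapping (l i) (r i) m L R \<and> variation f (l i) (r i) - q < vsum f m L R" if "i < n" for i
    proof -
      let ?X = "{vsum f m L R |m L R. nonoverlapping (l i) (r i) m L R}"
      have "nonoverlapping (l i) (r i) 0 l r" by (simp add: nonoverlapping_def disjoint_family_on_def)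
      hence ne: "?X \<noteq> {}" by blast
      have "variation f (l i) (r i) - q < Sup ?X" using q(1) by (simp add: variation_def)
      from less_cSupD[OF ne this] show ?thesis by blast
    qed
    then obtain m L R where LR: "\<And>i. i < n ==> nonoverlapping (l i) (r i) (m i) (L i) (R i)"
      "\<And>i. i < n ==> variation f (l i) (r i) - q < vsum f (m i) (L i) (R i)" by metis
    let ?I = "SIGMA i:{..<n}. {..<m i}"
    let ?L = "\<lambda>k. L (fst k) (snd k)" and ?R = "\<lambda>k. R (fst k) (snd k)"
    have in_cell: "l i \<le> L i j \<and> L i j \<le> R i j \<and> R i j \<le> r i" if "i < n" "j < m i" for i j
      using LR(1)[OF that(1)] that(2) by (simp add: nonoverlapping_def)
    have fin: "finite ?I" by simp
    moreover have "\<forall>k\<in>?I. a \<le> ?L k \<and> ?L k \<le> ?R k \<and> ?R k \<le> b" using in_cell li by fastforce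
    moreover have "disjoint_family_on (\<lambda>k. {?L k<..<?R k}) ?I" unfolding disjoint_family_on_def
    proof (intro ballI impI)
      fix k k' assume k: "k \<in> ?I" "k' \<in> ?I" "k \<noteq> k'"
      show "{?L k<..<?R k} \<inter> {?L k'<..<?R k'} = {}"
      proof (cases "fst k = fst k'")
        case True
        hence "snd k \<noteq> snd k'" using k(3) by (simp add: prod_eq_iff)
        thus ?thesis using LR(1)[of "fst k"] k True unfolding nonoverlapping_def disjoint_family_on_def by auto
      next
        case False
        hence "{l (fst k)<..<r (fst k)} \<inter> {l (fst k')<..<r (fst k')} = {}"
          using lr k unfolding nonoverlapping_def disjoint_family_on_def by auto
        moreover have "{?L k<..<?R k} \<subseteq> {l (fst k)<..<r (fst k)}" "{?L k'<..<?R k'} \<subseteq> {l (fst k')<..<r (fst k')}"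
          using in_cell[of "fst k" "snd k"] in_cell[of "fst k'" "snd k'"] k by auto
        ultimately show ?thesis by blast
      qed
    qed
    moreover have "(\<Sum>k\<in>?I. ?R k - ?L k) < \<delta>"
    proof -
      have "(\<Sum>k\<in>?I. ?R k - ?L k) = (\<Sum>i<n. \<Sum>j<m i. R i j - L i j)" by (simp add: sum.Sigma case_prod_unfold)
      also have "\<dots> \<le> (\<Sum>i<n. r i - l i)" using nonoverlapping_length[OF LR(1)] li by (intro sum_mono) auto
      finally show ?thesis using len by simp
    qed
    ultimately have "(\<Sum>k\<in>?I. cmod (f (?R k) - f (?L k))) < e / 3" by (rule fam)
    hence small: "(\<Sum>i<n. vsum f (m i) (L i) (R i)) < e / 3" by (simp add: vsum_def sum.Sigma case_prod_unfold)
    have "(\<Sum>i<n. cmod (of_real (variation f a (r i)) - of_real (variation f a (l i)))) \<le> (\<Sum>i<n. vsum f (m i) (L i) (R i) + q)"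
    proof (rule sum_mono)
      fix i assume "i \<in> {..<n}"
      hence i: "i < n" by simp
      have "variation f a (l i) \<le> variation f a (r i)"
        using variation_increment[OF f, of "l i" "r i"] li[OF i] norm_ge_zero[of "f (r i) - f (l i)"] by linarith
      moreover have "variation f a (r i) \<le> variation f a (l i) + variation f (l i) (r i)"
        using variation_split[OF f, of a "l i" "r i"] li[OF i] by simp
      ultimately show "cmod (of_real (variation f a (r i)) - of_real (variation f a (l i))) \<le> vsum f (m i) (L i) (R i) + q"
        using LR(2)[OF i] by (simp flip: of_real_diff)
    qed
    also have "\<dots> = (\<Sum>i<n. vsum f (m i) (L i) (R i)) + real n * q" by (simp add: sum.distrib)
    finally show "(\<Sum>i<n. cmod (of_real (variation f a (r i)) - of_real (variation f a (l i)))) < e"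
      using small q(2) \<open>0 < e\<close> by simp
  qed
qed

text \<open>The Lebesgue--Stieltjes measure is absolutely continuous: a compact null set is covered by the cells of a fine grid that meet it, and these have small total length.\<close>

lemma monotone_abs_continuous_density:
  fixes g :: "real => real"
  assumes mono: "\<And>s t. 0 \<le> s ==> s \<le> t ==> t \<le> 1 ==> g s \<le> g t" and ac: "abs_continuous_on 0 1 (\<lambda>t. of_real (g t))"
  shows "\<exists>h. h absolutely_integrable_on {0..1} \<and> (\<forall>t\<in>{0..1}. (h has_integral (g t - g 0)) {0..t})"
proof -
  \<comment> \<open>Constant continuation beyond [0, 1] yields a monotone function on the line, as
    \<open>interval_measure\<close> expects; its measure lives on (0, 1].\<close>
  define F where "F x = g (max 0 (min 1 x))" for x
  have F_mono: "F x \<le> F y" if "x \<le> y" for x y unfolding F_def using that by (intro mono) auto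
  have "continuous_on {0..1} (\<lambda>t. Re (of_real (g t)))" by (intro continuous_on_Re abs_continuous_on_continuous ac)
  hence cg: "continuous_on {0..1} g" by simp
  have "continuous_on UNIV F" unfolding F_def by (rule continuous_on_compose2[OF cg]) (auto intro!: continuous_intros)
  hence rc: "continuous (at_right a) F" for a
    by (simp add: continuous_on_eq_continuous_at continuous_at_imp_continuous_at_within)
  define M where "M = interval_measure F"
  have sM: "sets M = sets borel" and spM: "space M = UNIV" by (simp_all add: M_def)
  have em: "emeasure M {a<..b} = ennreal (F b - F a)" if "a \<le> b" for a b
    unfolding M_def by (rule emeasure_interval_measure_Ioc[OF that F_mono rc])
  have "(\<Union>n::nat. {- real n<..0}) \<in> null_sets M" by (rule null_sets_UN) (simp add: null_sets_def sM em F_def)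
  moreover have "(\<Union>n::nat. {- real n<..0}) = {..0}" by (auto, metis reals_Archimedean2 minus_less_iff)
  ultimately have out1: "{..0} \<in> null_sets M" by simp
  have "(\<Union>n::nat. {1<..1 + real n}) \<in> null_sets M" by (rule null_sets_UN) (simp add: null_sets_def sM em F_def)
  moreover have "(\<Union>n::nat. {1<..1 + real n}) = {1<..}"
  proof (auto)
    fix x :: real obtain n :: nat where "x - 1 < real n" using reals_Archimedean2 by blast
    thus "\<exists>n::nat. x \<le> 1 + real n" by (intro exI[of _ n]) simp
  qed
  ultimately have out2: "{1<..} \<in> null_sets M" by simp
  have out: "{..0} \<union> {1<..} \<in> null_sets M" using out1 out2 by (rule null_sets.Un)
  have "emeasure M ({0<..1} \<union> ({..0} \<union> {1<..})) = emeasure M {0<..1}" by (rule emeasure_Un_null_set[OF _ out]) (simp add: sM)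
  moreover have "{0<..1} \<union> ({..0} \<union> {1<..}) = (UNIV :: real set)" by auto
  ultimately have fin: "emeasure M (space M) \<noteq> \<infinity>" by (simp add: spM em)
  have ac_M: "absolutely_continuous lborel M" unfolding absolutely_continuous_def
  proof
    fix N :: "real set" assume N: "N \<in> null_sets lborel"
    hence Nb: "N \<in> sets borel" by (auto simp: null_sets_def)
    \<comment> \<open>Compact subsets suffice, by inner regularity of the finite measure
      \<open>M\<close>.\<close>
    have K0: "emeasure M K = 0" if K: "K \<subseteq> N" "compact K" for K
    proof (rule ccontr)
      assume "emeasure M K \<noteq> 0"
      then obtain e where e: "0 < e" "ennreal e < emeasure M K"

      proof -
        have "0 < emeasure M K" using \<open>emeasure M K \<noteq> 0\<close> by (simp add: zero_less_iff_neq_zero)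
        then obtain x where x: "0 < x" "x < emeasure M K" using dense by blast
        hence "x < top" by (meson top_greatest order_less_le_trans)
        hence "ennreal (enn2real x) = x" "0 < enn2real x" using x(1) by (simp_all add: enn2real_positive_iff)
        thus ?thesis using x(2) that[of "enn2real x"] by simp
      qed
      have Kb: "K \<in> sets borel" using K(2) by (simp add: compact_imp_closed)
      have Kn: "K \<in> null_sets lebesgue" using null_sets_subset[OF N _ K(1)] Kb by (simp add: null_sets_completionI)
      obtain \<delta> where \<delta>: "0 < \<delta>" "\<And>n l r. nonoverlapping 0 1 n l r ==> (\<Sum>i<n. r i - l i) < \<delta> ==>
          (\<Sum>i<n. cmod (of_real (g (r i)) - of_real (g (l i)))) < e" using ac e(1) unfolding abs_continuous_on_def by meson
      have "K \<in> sets lebesgue" using Kn by auto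
      then obtain T where T: "open T" "K \<subseteq> T" "T - K \<in> lmeasurable" "emeasure lebesgue (T - K) < ennreal \<delta>"
        using sets_lebesgue_outer_open \<delta>(1) by metis
      have TK: "(T - K) \<union> K = T" using T(2) by blast
      have "emeasure lebesgue T = emeasure lebesgue (T - K)"
        using emeasure_Un_null_set[OF _ Kn, of "T - K"] T(3) TK by (simp add: fmeasurableD)
      hence T\<delta>: "emeasure lebesgue T < ennreal \<delta>" using T(4) by simp
      \<comment> \<open>\<open>T\<close> is open of measure below \<open>\<delta>\<close>; a mesh
        smaller than \<open>\<epsilon>\<close> keeps every cell that meets \<open>K\<close> inside
        it, up to endpoints.\<close>
      obtain \<epsilon> where \<epsilon>: "0 < \<epsilon>" "(\<Union>x\<in>K. ball x \<epsilon>) \<subseteq> T"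
        using compact_subset_open_imp_ball_epsilon_subset[OF K(2) T(1,2)] by blast
      obtain m' where m': "1 / real (Suc m') < \<epsilon>" using nat_approx_posE[OF \<epsilon>(1)] by blast
      define m where "m = Suc m'"
      have m: "0 < m" "1 / real m < \<epsilon>" using m' by (simp_all add: m_def)
      define Z where "Z = {k. k < m \<and> {real k / real m..real (Suc k) / real m} \<inter> K \<noteq> {}}"
      define l where "l k = real k / real m" for k
      \<comment> \<open>Cells that miss \<open>K\<close> are collapsed to a point, so all
        \<open>m\<close> indices stay in the family.\<close>
      define r where "r k = (if k \<in> Z then real (Suc k) / real m else real k / real m)" for k
      have cell: "real (Suc k) / real m = real k / real m + 1 / real m" for k by (simp add: add_divide_distrib)
      have lr: "nonoverlapping 0 1 m l r" unfolding nonoverlapping_def disjoint_family_on_def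
      proof (intro conjI allI impI ballI)
        fix i assume i: "i < m"
        show "0 \<le> l i" "l i \<le> r i" using m by (simp_all add: l_def r_def divide_right_mono)
        show "r i \<le> 1" using i m by (auto simp: r_def field_simps)
      next
        fix i j :: nat assume ij: "i \<noteq> j"
        have ri: "r k \<le> real (Suc k) / real m" for k by (simp add: r_def divide_right_mono)
        show "{l i<..<r i} \<inter> {l j<..<r j} = {}"
        proof (cases "i < j")
          case True
          hence "real (Suc i) / real m \<le> l j" by (simp add: l_def divide_right_mono)
          thus ?thesis using ri[of i] by auto
        next
          case False
          hence "real (Suc j) / real m \<le> l i" using ij by (simp add: l_def divide_right_mono)
          thus ?thesis using ri[of j] by auto
        qed
      qed
      have sub: "{l i<..<r i} \<subseteq> T" if "i < m" for i
      proof (cases "i \<in> Z")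
        case True
        then obtain z where z: "z \<in> K" "l i \<le> z" "z \<le> real (Suc i) / real m" unfolding Z_def l_def by auto
        have "{l i<..<r i} \<subseteq> ball z \<epsilon>"
        proof
          fix y assume y: "y \<in> {l i<..<r i}"
          hence "\<bar>y - z\<bar> \<le> 1 / real m" using z True cell[of i] by (auto simp: r_def l_def abs_le_iff)
          thus "y \<in> ball z \<epsilon>" using m by (simp add: dist_real_def abs_minus_commute)
        qed
        thus ?thesis using \<epsilon>(2) z(1) by blast
      qed (simp add: l_def r_def)
      have "(\<Sum>i<m. r i - l i) = (\<Sum>i<m. measure lebesgue {l i<..<r i})"
        using lr by (intro sum.cong) (auto simp: nonoverlapping_def)
      also have "\<dots> = measure lebesgue (\<Union>i<m. {l i<..<r i})"
        using lr by (intro measure_finite_Union[symmetric]) (auto simp: nonoverlapping_def)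
      also have "\<dots> \<le> measure lebesgue T"
      proof (rule measure_mono_fmeasurable)
        show "T \<in> lmeasurable" using T\<delta> T(1) by (auto simp: fmeasurable_def intro: less_trans)
      qed (use sub in auto)
      also have "\<dots> < \<delta>" using T\<delta> \<delta>(1) by (simp add: measure_def enn2real_less_iff order.strict_trans[OF T\<delta> ennreal_less_top])
      finally have "(\<Sum>i<m. cmod (of_real (g (r i)) - of_real (g (l i)))) < e" by (rule \<delta>(2)[OF lr])
      moreover have "(\<Sum>i\<in>Z. F (real (Suc i) / real m) - F (real i / real m)) \<le>
          (\<Sum>i<m. cmod (of_real (g (r i)) - of_real (g (l i))))"
      proof -
        have "(\<Sum>i\<in>Z. F (real (Suc i) / real m) - F (real i / real m)) = (\<Sum>i\<in>Z. g (r i) - g (l i))"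
        proof (rule sum.cong)
          fix i assume i: "i \<in> Z"
          hence "i < m" by (simp add: Z_def)
          hence "real (Suc i) / real m \<le> 1" "real i / real m \<le> 1" using m by (auto simp: field_simps)
          thus "F (real (Suc i) / real m) - F (real i / real m) = g (r i) - g (l i)" using i by (simp add: F_def r_def l_def)
        qed simp
        also have "\<dots> \<le> (\<Sum>i\<in>Z. cmod (of_real (g (r i)) - of_real (g (l i))))" by (intro sum_mono) (simp flip: of_real_diff)
        also have "\<dots> \<le> (\<Sum>i<m. cmod (of_real (g (r i)) - of_real (g (l i))))" by (intro sum_mono2) (auto simp: Z_def)
        finally show ?thesis .
      qed
      ultimately have sum_e: "(\<Sum>i\<in>Z. F (real (Suc i) / real m) - F (real i / real m)) < e" by simp
      have ne_in: "A \<noteq> {}" if "y \<in> A" for A and y :: real using that by blast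
      let ?C = "\<Union>i\<in>Z. {real i / real m<..real (Suc i) / real m}"
      have finZ: "finite Z" unfolding Z_def by simp
      have cover: "K \<subseteq> ?C \<union> ({..0} \<union> {1<..})"
      proof
        fix x assume x: "x \<in> K"
        show "x \<in> ?C \<union> ({..0} \<union> {1<..})"
        proof (cases "0 < x \<and> x \<le> 1")
          case True
          \<comment> \<open>The covering cells are open on the left, as are the intervals in
            \<open>em\<close>, hence the ceiling minus one.\<close>
          define k where "k = nat (\<lceil>x * real m\<rceil> - 1)"
          have xm: "0 < x * real m" "x * real m \<le> real m" using True m by (auto simp: mult_le_cancel_right1)
          hence "1 \<le> \<lceil>x * real m\<rceil>" by linarith
          hence k: "real k = of_int \<lceil>x * real m\<rceil> - 1" by (simp add: k_def)
          hence kx: "real k < x * real m" "x * real m \<le> real (Suc k)" by linarith+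
          have km: "k < m" using kx(1) xm(2) by linarith
          have xk: "real k / real m < x" "x \<le> real (Suc k) / real m" using kx m by (simp_all add: field_simps)
          from xk have "x \<in> {real k / real m..real (Suc k) / real m} \<inter> K" using x by simp
          hence "{real k / real m..real (Suc k) / real m} \<inter> K \<noteq> {}" by (rule ne_in)
          hence "k \<in> Z" unfolding Z_def using km by (intro CollectI conjI)
          moreover have "x \<in> {real k / real m<..real (Suc k) / real m}" using xk by simp
          ultimately have "x \<in> ?C" by (rule UN_I)
          thus ?thesis by (rule UnI1)
        qed auto
      qed
      have "emeasure M K \<le> emeasure M (?C \<union> ({..0} \<union> {1<..}))" by (rule emeasure_mono[OF cover]) (auto simp: sM finZ)
      also have "\<dots> = emeasure M ?C" by (rule emeasure_Un_null_set[OF _ out]) (auto simp: sM finZ)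
      also have "\<dots> \<le> (\<Sum>i\<in>Z. emeasure M {real i / real m<..real (Suc i) / real m})"
        by (rule emeasure_subadditive_finite[OF finZ]) (auto simp: sM)
      also have "\<dots> = (\<Sum>i\<in>Z. ennreal (F (real (Suc i) / real m) - F (real i / real m)))"
        by (intro sum.cong em) (simp_all add: divide_right_mono)
      also have "\<dots> = ennreal (\<Sum>i\<in>Z. F (real (Suc i) / real m) - F (real i / real m))"
        by (rule sum_ennreal) (simp add: F_mono divide_right_mono)
      also have "\<dots> \<le> ennreal e" using sum_e by (intro ennreal_leI) simp
      finally show False using e(2) by simp
    qed
    have "emeasure M N = (SUP K \<in> {K. K \<subseteq> N \<and> compact K}. emeasure M K)" by (rule inner_regular) (use sM fin Nb in simp_all)
    also have "\<dots> \<le> 0" by (rule SUP_least) (simp add: K0)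
    finally show "N \<in> null_sets M" using Nb by (simp add: null_sets_def sM)
  qed
  obtain hh where hh: "hh \<in> borel_measurable lborel" "density lborel hh = M"

    using sigma_finite_measure.Radon_Nikodym[OF sigma_finite_lborel ac_M] sM by auto
  have hh': "hh \<in> borel_measurable borel" using hh(1) by simp
  have int: "((\<lambda>x. enn2real (hh x)) has_integral (g t - g 0)) {0..t}" if t: "t \<in> {0..1}" for t
  proof -
    have "(\<integral>\<^sup>+x. hh x * indicator {0..t} x \<partial>lborel) = emeasure M {0..t}"
      using hh(1) unfolding hh(2)[symmetric] by (simp add: emeasure_density)
    also have "\<dots> = emeasure M ({0<..t} \<union> {0})" using t by (intro arg_cong[of _ _ "emeasure M"]) auto
    also have "\<dots> = emeasure M {0<..t}"
    proof (rule emeasure_Un_null_set)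
      show "{0} \<in> null_sets M" by (rule null_sets_subset[OF out1]) (auto simp: sM)
    qed (simp add: sM)
    also have "\<dots> = ennreal (g t - g 0)" using t by (simp add: em F_def)
    finally have I: "(\<integral>\<^sup>+x. hh x * indicator {0..t} x \<partial>lborel) = ennreal (g t - g 0)" .
    \<comment> \<open>A finite integral makes the density finite almost everywhere on [0, t], so
      \<open>enn2real\<close> preserves its values there outside a null set.\<close>
    have "AE x in lborel. hh x * indicator {0..t} x \<noteq> \<infinity>" by (rule nn_integral_PInf_AE) (use hh' I in simp_all)
    hence "(\<integral>\<^sup>+x. ennreal (enn2real (hh x) * indicator {0..t} x) \<partial>lborel) = (\<integral>\<^sup>+x. hh x * indicator {0..t} x \<partial>lborel)"
      by (intro nn_integral_cong_AE) (auto elim!: eventually_mono simp: indicator_def top.not_eq_extremum)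
    hence "((\<lambda>x. enn2real (hh x) * indicator {0..t} x) has_integral (g t - g 0)) UNIV"
      using mono[of 0 t] t hh' by (intro nn_integral_has_integral) (simp_all add: I)
    moreover have "(\<lambda>x. enn2real (hh x) * indicator {0..t} x) = (\<lambda>x. if x \<in> {0..t} then enn2real (hh x) else 0)"
      by (auto simp: indicator_def)
    ultimately show ?thesis by (simp only: has_integral_restrict_UNIV)
  qed
  hence "(\<lambda>x. enn2real (hh x)) absolutely_integrable_on {0..1}"

    by (intro nonnegative_absolutely_integrable_1 has_integral_integrable[OF int[of 1]]) auto
  thus ?thesis using int by blast
qed

lemma abs_continuous_on_Re: "abs_continuous_on a b f ==> abs_continuous_on a b (\<lambda>t. of_real (Re (f t)))"
  by (rule abs_continuous_on_dominated[of a b f f 1])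
    (auto simp flip: of_real_diff minus_complex.simps intro: order_trans[OF abs_Re_le_cmod])

lemma abs_continuous_on_Im: "abs_continuous_on a b f ==> abs_continuous_on a b (\<lambda>t. of_real (Im (f t)))"
  by (rule abs_continuous_on_dominated[of a b f f 1])
    (auto simp flip: of_real_diff minus_complex.simps intro: order_trans[OF abs_Im_le_cmod])

text \<open>Jordan decomposition: for the variation v of \<open>f\<close>, the functions v, v + Re f
  and v + Im f are monotone and absolutely continuous, and a density of \<open>f\<close> is obtained
  from theirs by subtraction.\<close>

lemma abs_continuous_density:
  assumes f: "abs_continuous_on 0 1 f"
  shows "\<exists>h. h absolutely_integrable_on {0..1} \<and> (\<forall>t\<in>{0..1}. (h has_integral (f t - f 0)) {0..t})"
proof -
  let ?v = "variation f 0"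
  have v: "?v s + cmod (f t - f s) \<le> ?v t" if "0 \<le> s" "s \<le> t" "t \<le> 1" for s t by (rule variation_increment[OF f that])
  note acv = abs_continuous_on_variation[OF f]
  have "?v s \<le> ?v t" if "0 \<le> s" "s \<le> t" "t \<le> 1" for s t using v[OF that] norm_ge_zero[of "f t - f s"] by linarith
  from monotone_abs_continuous_density[of ?v, OF this acv]
  obtain h1 where h1: "h1 absolutely_integrable_on {0..1}" "\<And>t. t \<in> {0..1} ==> (h1 has_integral (?v t - ?v 0)) {0..t}" by blast
  have "?v s + Re (f s) \<le> ?v t + Re (f t)" if "0 \<le> s" "s \<le> t" "t \<le> 1" for s t
    using v[OF that] abs_Re_le_cmod[of "f t - f s"] by (simp add: abs_le_iff)
  from monotone_abs_continuous_density[of "\<lambda>t. ?v t + Re (f t)", OF this] abs_continuous_on_add[OF acv abs_continuous_on_Re[OF f]]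
  obtain h2 where h2: "h2 absolutely_integrable_on {0..1}"
    "\<And>t. t \<in> {0..1} ==> (h2 has_integral (?v t + Re (f t) - (?v 0 + Re (f 0)))) {0..t}" by auto
  have "?v s + Im (f s) \<le> ?v t + Im (f t)" if "0 \<le> s" "s \<le> t" "t \<le> 1" for s t
    using v[OF that] abs_Im_le_cmod[of "f t - f s"] by (simp add: abs_le_iff)
  from monotone_abs_continuous_density[of "\<lambda>t. ?v t + Im (f t)", OF this] abs_continuous_on_add[OF acv abs_continuous_on_Im[OF f]]
  obtain h3 where h3: "h3 absolutely_integrable_on {0..1}"
    "\<And>t. t \<in> {0..1} ==> (h3 has_integral (?v t + Im (f t) - (?v 0 + Im (f 0)))) {0..t}" by auto
  let ?h = "\<lambda>x. of_real (h2 x - h1 x) + \<i> * of_real (h3 x - h1 x)"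
  have bl: "bounded_linear (\<lambda>x. \<i> * of_real x)" by (intro bounded_linear_const_mult bounded_linear_of_real)
  have h21: "(\<lambda>x. h2 x - h1 x) absolutely_integrable_on {0..1}" by (intro set_integral_diff h2 h1)
  have h31: "(\<lambda>x. h3 x - h1 x) absolutely_integrable_on {0..1}" by (intro set_integral_diff h3 h1)
  have "?h absolutely_integrable_on {0..1}"
    using absolutely_integrable_linear[OF h21 bounded_linear_of_real] absolutely_integrable_linear[OF h31 bl]
    by (intro set_integral_add) (simp_all add: o_def)
  moreover have "(?h has_integral (f t - f 0)) {0..t}" if t: "t \<in> {0..1}" for t
  proof -
    have "(?h has_integral (of_real (?v t + Re (f t) - (?v 0 + Re (f 0)) - (?v t - ?v 0)) +
        \<i> * of_real (?v t + Im (f t) - (?v 0 + Im (f 0)) - (?v t - ?v 0)))) {0..t}"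
      using has_integral_linear[OF has_integral_diff[OF h2(2)[OF t] h1(2)[OF t]] bounded_linear_of_real]
        has_integral_linear[OF has_integral_diff[OF h3(2)[OF t] h1(2)[OF t]] bl]
      by (intro has_integral_add) (simp_all add: o_def)
    moreover have "of_real (?v t + Re (f t) - (?v 0 + Re (f 0)) - (?v t - ?v 0)) +
        \<i> * of_real (?v t + Im (f t) - (?v 0 + Im (f 0)) - (?v t - ?v 0)) = f t - f 0" by (simp add: complex_eq_iff)
    ultimately show ?thesis by simp
  qed
  ultimately show ?thesis by blast
qed

section \<open>Derivatives and the norm of AC([0,1])\<close>

definition AC_deriv :: "AC => real => complex"
  where "AC_deriv f t = vector_derivative (Rep_AC f) (at t within {0..1})"

lemma abs_continuous_Rep_AC: "abs_continuous_on 0 1 (Rep_AC f)" using Rep_AC[of f] by simp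

text \<open>\<open>Rep_AC f\<close> minus its initial value is the indefinite integral of a density,
  which is differentiable almost everywhere with that density as derivative. Hence
  \<open>vector_derivative\<close> agrees with the density off a null set and inherits its
  integrability.\<close>

lemma AC_deriv_facts:
  shows AC_differentiable: "\<exists>N. negligible N \<and> (\<forall>t\<in>{0..1} - N. (Rep_AC f has_vector_derivative AC_deriv f t) (at t within {0..1}))"
    and AC_deriv_absolutely_integrable: "AC_deriv f absolutely_integrable_on {0..1}"
    and AC_deriv_has_integral: "t \<in> {0..1} ==> (AC_deriv f has_integral (Rep_AC f t - Rep_AC f 0)) {0..t}"
proof -
  obtain h where h: "h absolutely_integrable_on {0..1}" "\<And>t. t \<in> {0..1} ==> (h has_integral (Rep_AC f t - Rep_AC f 0)) {0..t}"
    using abs_continuous_density[OF abs_continuous_Rep_AC] by blast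
  have "h integrable_on {0..1}" using h(1) by (simp add: absolutely_integrable_on_def)
  from indefinite_integral_differentiable_ae[OF this]
  obtain N where N: "negligible N" "\<And>t. t \<in> {0..1} - N ==> ((\<lambda>t. integral {0..t} h) has_vector_derivative h t) (at t within {0..1})" by blast
  have D: "(Rep_AC f has_vector_derivative h t) (at t within {0..1})" if t: "t \<in> {0..1} - N" for t
  proof (rule has_vector_derivative_transform)
    have "((\<lambda>t. integral {0..t} h + Rep_AC f 0) has_vector_derivative (h t + 0)) (at t within {0..1})"
      by (intro has_vector_derivative_add N t has_vector_derivative_const)
    thus "((\<lambda>t. integral {0..t} h + Rep_AC f 0) has_vector_derivative h t) (at t within {0..1})" by simp
    show "Rep_AC f s = integral {0..s} h + Rep_AC f 0" if "s \<in> {0..1}" for s using integral_unique[OF h(2)[OF that]] by simp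
  qed (use t in simp)
  have eq: "AC_deriv f t = h t" if "t \<in> {0..1} - N" for t
    unfolding AC_deriv_def using that by (intro vector_derivative_within_closed_interval D) auto
  show "\<exists>N. negligible N \<and> (\<forall>t\<in>{0..1} - N. (Rep_AC f has_vector_derivative AC_deriv f t) (at t within {0..1}))"
  proof (intro exI[of _ N] conjI ballI)
    fix t assume t: "t \<in> {0..1} - N"
    show "(Rep_AC f has_vector_derivative AC_deriv f t) (at t within {0..1})" unfolding eq[OF t] by (rule D[OF t])
  qed (rule N(1))
  show "AC_deriv f absolutely_integrable_on {0..1}" by (rule absolutely_integrable_spike[OF h(1) N(1) eq])
  show "(AC_deriv f has_integral (Rep_AC f t - Rep_AC f 0)) {0..t}" if "t \<in> {0..1}"
    by (rule has_integral_spike[OF N(1) _ h(2)[OF that]]) (use that in \<open>auto intro!: eq\<close>)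
qed

lemma AC_deriv_eqI:
  assumes "negligible N" "\<And>t. t \<in> {0..1} - N ==> (Rep_AC f has_vector_derivative h t) (at t within {0..1})"
  shows "\<exists>N. negligible N \<and> (\<forall>t\<in>{0..1} - N. AC_deriv f t = h t)"
proof (intro exI[of _ N] conjI ballI)
  fix t assume t: "t \<in> {0..1} - N"
  show "AC_deriv f t = h t" unfolding AC_deriv_def
    by (rule vector_derivative_within_closed_interval[OF _ _ assms(2)[OF t]]) (use t in simp_all)
qed (rule assms(1))

lemma AC_deriv_add:
  "\<exists>N. negligible N \<and> (\<forall>t\<in>{0..1} - N. AC_deriv (f + g) t = AC_deriv f t + AC_deriv g t)"
proof -
  obtain N where N: "negligible N" "\<And>t. t \<in> {0..1} - N ==> (Rep_AC f has_vector_derivative AC_deriv f t) (at t within {0..1})"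
    using AC_differentiable[of f] by (elim exE conjE) (rule that, assumption, erule (1) bspec)
  obtain M where M: "negligible M" "\<And>t. t \<in> {0..1} - M ==> (Rep_AC g has_vector_derivative AC_deriv g t) (at t within {0..1})"
    using AC_differentiable[of g] by (elim exE conjE) (rule that, assumption, erule (1) bspec)
  show ?thesis
  proof (rule AC_deriv_eqI[OF negligible_Un[OF N(1) M(1)]])
    fix t assume "t \<in> {0..1} - (N \<union> M)"
    hence "((\<lambda>t. Rep_AC f t + Rep_AC g t) has_vector_derivative AC_deriv f t + AC_deriv g t) (at t within {0..1})"
      by (intro has_vector_derivative_add N(2) M(2)) simp_all
    thus "(Rep_AC (f + g) has_vector_derivative AC_deriv f t + AC_deriv g t) (at t within {0..1})"
      by (simp only: plus_AC.rep_eq)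
  qed
qed

lemma AC_deriv_scaleC:
  "\<exists>N. negligible N \<and> (\<forall>t\<in>{0..1} - N. AC_deriv (c *\<^sub>C f) t = c * AC_deriv f t)"
proof -
  obtain N where N: "negligible N" "\<And>t. t \<in> {0..1} - N ==> (Rep_AC f has_vector_derivative AC_deriv f t) (at t within {0..1})"
    using AC_differentiable[of f] by (elim exE conjE) (rule that, assumption, erule (1) bspec)
  show ?thesis
  proof (rule AC_deriv_eqI[OF N(1)])
    fix t assume "t \<in> {0..1} - N"
    hence "((\<lambda>t. c * Rep_AC f t) has_vector_derivative c * AC_deriv f t) (at t within {0..1})"
      by (intro has_vector_derivative_mult_right N(2))
    thus "(Rep_AC (c *\<^sub>C f) has_vector_derivative c * AC_deriv f t) (at t within {0..1})" by (simp only: scaleC_AC.rep_eq)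
  qed
qed

lemma AC_deriv_times:
  "\<exists>N. negligible N \<and> (\<forall>t\<in>{0..1} - N. AC_deriv (f * g) t = Rep_AC f t * AC_deriv g t + AC_deriv f t * Rep_AC g t)"
proof -
  obtain N where N: "negligible N" "\<And>t. t \<in> {0..1} - N ==> (Rep_AC f has_vector_derivative AC_deriv f t) (at t within {0..1})"
    using AC_differentiable[of f] by (elim exE conjE) (rule that, assumption, erule (1) bspec)
  obtain M where M: "negligible M" "\<And>t. t \<in> {0..1} - M ==> (Rep_AC g has_vector_derivative AC_deriv g t) (at t within {0..1})"
    using AC_differentiable[of g] by (elim exE conjE) (rule that, assumption, erule (1) bspec)
  show ?thesis
  proof (rule AC_deriv_eqI[OF negligible_Un[OF N(1) M(1)]])
    fix t assume "t \<in> {0..1} - (N \<union> M)"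
    hence "((\<lambda>t. Rep_AC f t * Rep_AC g t) has_vector_derivative Rep_AC f t * AC_deriv g t + AC_deriv f t * Rep_AC g t) (at t within {0..1})"
      by (intro has_vector_derivative_mult N(2) M(2)) simp_all
    thus "(Rep_AC (f * g) has_vector_derivative Rep_AC f t * AC_deriv g t + AC_deriv f t * Rep_AC g t) (at t within {0..1})"
      by (simp only: times_AC.rep_eq)
  qed
qed

definition AC_var :: "AC => real"
  where "AC_var f = integral {0..1} (\<lambda>t. cmod (AC_deriv f t))"

lemma AC_norm_eq: "AC_norm f = cmod (Rep_AC f 0) + AC_var f" by (simp add: AC_norm_def AC_var_def AC_deriv_def)

lemma AC_deriv_norm_integrable: "(\<lambda>t. cmod (AC_deriv f t)) integrable_on {0..1}"
  using AC_deriv_absolutely_integrable by (simp add: absolutely_integrable_on_def)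

lemma AC_var_nonneg: "0 \<le> AC_var f" unfolding AC_var_def by (rule integral_nonneg[OF AC_deriv_norm_integrable]) simp

lemma AC_norm_nonneg: "0 \<le> AC_norm f" by (simp add: AC_norm_eq AC_var_nonneg)

lemma Rep_AC_le_norm: "cmod (Rep_AC f t) \<le> AC_norm f"
proof (cases "t \<in> {0..1}")
  case True
  have "Rep_AC f t - Rep_AC f 0 = integral {0..t} (AC_deriv f)"
    using integral_unique[OF AC_deriv_has_integral[OF True]] by simp
  also have "cmod \<dots> \<le> integral {0..t} (\<lambda>t. cmod (AC_deriv f t))"
  proof (rule integral_norm_bound_integral)
    show "AC_deriv f integrable_on {0..t}" using AC_deriv_has_integral[OF True] by blast
    show "(\<lambda>t. cmod (AC_deriv f t)) integrable_on {0..t}"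
      using True by (intro integrable_subinterval_real[OF AC_deriv_norm_integrable]) auto
  qed simp
  also have "\<dots> \<le> AC_var f" unfolding AC_var_def
    using True by (intro integral_subset_le integrable_subinterval_real[OF AC_deriv_norm_integrable] AC_deriv_norm_integrable) auto
  finally show ?thesis unfolding AC_norm_eq using norm_triangle_ineq2[of "Rep_AC f t" "Rep_AC f 0"] by linarith
next
  case False
  thus ?thesis using Rep_AC[of f] AC_norm_nonneg[of f] by auto
qed

lemma AC_norm_add: "AC_norm (f + g) \<le> AC_norm f + AC_norm g"
proof -
  obtain N where N: "negligible N" "\<And>t. t \<in> {0..1} - N ==> AC_deriv (f + g) t = AC_deriv f t + AC_deriv g t"
    using AC_deriv_add[of f g] by (elim exE conjE) (rule that, assumption, erule (1) bspec)
  have ab: "(\<lambda>t. AC_deriv f t + AC_deriv g t) absolutely_integrable_on {0..1}"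
    by (intro set_integral_add AC_deriv_absolutely_integrable)
  have "AC_var (f + g) = integral {0..1} (\<lambda>t. cmod (AC_deriv f t + AC_deriv g t))"
    unfolding AC_var_def by (rule integral_spike[OF N(1)]) (simp add: N(2))
  also have "\<dots> \<le> integral {0..1} (\<lambda>t. cmod (AC_deriv f t) + cmod (AC_deriv g t))"
    using ab by (intro integral_le integrable_add AC_deriv_norm_integrable)
      (auto simp: absolutely_integrable_on_def norm_triangle_ineq)
  also have "\<dots> = AC_var f + AC_var g" unfolding AC_var_def by (intro integral_add AC_deriv_norm_integrable)
  finally show ?thesis using norm_triangle_ineq[of "Rep_AC f 0" "Rep_AC g 0"] by (simp add: AC_norm_eq plus_AC.rep_eq)
qed

lemma AC_norm_scaleC: "AC_norm (c *\<^sub>C f) = cmod c * AC_norm f"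
proof -
  obtain N where N: "negligible N" "\<And>t. t \<in> {0..1} - N ==> AC_deriv (c *\<^sub>C f) t = c * AC_deriv f t"
    using AC_deriv_scaleC[of c f] by (elim exE conjE) (rule that, assumption, erule (1) bspec)
  have "AC_var (c *\<^sub>C f) = integral {0..1} (\<lambda>t. cmod c * cmod (AC_deriv f t))"
    unfolding AC_var_def by (rule integral_spike[OF N(1)]) (simp add: N(2) norm_mult)
  also have "\<dots> = cmod c * AC_var f" unfolding AC_var_def by simp
  finally show ?thesis by (simp add: AC_norm_eq scaleC_AC.rep_eq norm_mult distrib_left)
qed

lemma Rep_AC_times_deriv_integrable: "(\<lambda>t. Rep_AC f t * AC_deriv g t) absolutely_integrable_on {0..1}"
proof (rule absolutely_integrable_bounded_measurable_product[where h="(*)" and f="Rep_AC f" and g="AC_deriv g"])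
  show "bilinear ((*) :: complex => _)" by (rule bilinear_times)
  show "Rep_AC f \<in> borel_measurable (lebesgue_on {0..1})"
    by (intro continuous_imp_measurable_on_sets_lebesgue abs_continuous_on_continuous abs_continuous_Rep_AC) simp
  show "bounded (Rep_AC f ` {0..1})" using Rep_AC_le_norm by (intro boundedI[of _ "AC_norm f"]) auto
qed (simp_all add: AC_deriv_absolutely_integrable)

text \<open>The Stieltjes integral of f dg, the only way in which derivatives enter the
  homotopy.\<close>

definition AC_int :: "AC => AC => complex"
  where "AC_int f g = integral {0..1} (\<lambda>t. Rep_AC f t * AC_deriv g t)"

lemma Rep_AC_times_deriv_norm_integral:
  "integral {0..1} (\<lambda>t. cmod (Rep_AC f t * AC_deriv g t)) \<le> AC_norm f * AC_var g"
proof -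
  have "(\<lambda>t. AC_norm f * cmod (AC_deriv g t)) integrable_on {0..1}"
    using integrable_cmul[OF AC_deriv_norm_integrable, of "AC_norm f" g] by simp
  hence "integral {0..1} (\<lambda>t. cmod (Rep_AC f t * AC_deriv g t)) \<le> integral {0..1} (\<lambda>t. AC_norm f * cmod (AC_deriv g t))"
    using Rep_AC_times_deriv_integrable[of f g] by (intro integral_le)
      (auto simp: absolutely_integrable_on_def norm_mult Rep_AC_le_norm mult_right_mono)
  thus ?thesis by (simp add: AC_var_def)
qed

lemma AC_int_bound: "cmod (AC_int f g) \<le> AC_norm f * AC_norm g"
proof -
  have "cmod (AC_int f g) \<le> integral {0..1} (\<lambda>t. cmod (Rep_AC f t * AC_deriv g t))"
    unfolding AC_int_def using Rep_AC_times_deriv_integrable[of f g]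
    by (intro integral_norm_bound_integral) (auto simp: absolutely_integrable_on_def)
  also have "\<dots> \<le> AC_norm f * AC_var g" by (rule Rep_AC_times_deriv_norm_integral)
  also have "\<dots> \<le> AC_norm f * AC_norm g" by (intro mult_left_mono) (simp_all add: AC_norm_eq AC_var_nonneg)
  finally show ?thesis .
qed

text \<open>The two terms of the product rule are estimated with sup norms bounded by
  \<open>AC_norm\<close>, which costs a factor 2. The ball of radius 1/2 is still closed under
  products.\<close>

lemma AC_norm_times: "AC_norm (f * g) \<le> 2 * AC_norm f * AC_norm g"
proof -
  obtain N where N: "negligible N" "\<And>t. t \<in> {0..1} - N ==> AC_deriv (f * g) t = Rep_AC f t * AC_deriv g t + AC_deriv f t * Rep_AC g t"
    using AC_deriv_times[of f g] by (elim exE conjE) (rule that, assumption, erule (1) bspec)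
  note ai = Rep_AC_times_deriv_integrable[of f g] Rep_AC_times_deriv_integrable[of g f]
  have "AC_var (f * g) = integral {0..1} (\<lambda>t. cmod (Rep_AC f t * AC_deriv g t + Rep_AC g t * AC_deriv f t))"
    unfolding AC_var_def by (rule integral_spike[OF N(1)]) (simp add: N(2) mult.commute)
  also have "\<dots> \<le> integral {0..1} (\<lambda>t. cmod (Rep_AC f t * AC_deriv g t) + cmod (Rep_AC g t * AC_deriv f t))"
    using ai set_integral_add(1)[OF ai]
    by (intro integral_le integrable_add) (auto simp: absolutely_integrable_on_def norm_triangle_ineq)
  also have "\<dots> = integral {0..1} (\<lambda>t. cmod (Rep_AC f t * AC_deriv g t)) + integral {0..1} (\<lambda>t. cmod (Rep_AC g t * AC_deriv f t))"
    using ai by (intro integral_add) (auto simp: absolutely_integrable_on_def)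
  also have "\<dots> \<le> AC_norm f * AC_var g + AC_norm g * AC_var f" by (intro add_mono Rep_AC_times_deriv_norm_integral)
  finally have v: "AC_var (f * g) \<le> AC_norm f * AC_var g + AC_norm g * AC_var f" .
  have "AC_norm (f * g) \<le> cmod (Rep_AC f 0) * cmod (Rep_AC g 0) + (AC_norm f * AC_var g + AC_norm g * AC_var f)"
    using v by (simp add: AC_norm_eq[of "f * g"] times_AC.rep_eq norm_mult)
  also have "\<dots> \<le> 2 * AC_norm f * AC_norm g"
    unfolding AC_norm_eq using AC_var_nonneg[of f] AC_var_nonneg[of g] by (simp add: algebra_simps)
  finally show ?thesis .
qed

instance AC :: bornological_vector_space
proof
  have zero: "AC_norm 0 = 0" using AC_norm_scaleC[of 0 0] by simp
  have disk: "disk {f. AC_norm f \<le> C}" if "0 \<le> C" for C unfolding disk_def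
  proof (intro conjI ballI allI impI)
    show "{f. AC_norm f \<le> C} \<noteq> {}" using zero that by (metis empty_iff mem_Collect_eq)
    show "c *\<^sub>C f \<in> {f. AC_norm f \<le> C}" if "f \<in> {f. AC_norm f \<le> C}" "cmod c \<le> 1" for f c
      using that AC_norm_nonneg[of f] mult_left_le_one_le[of "AC_norm f" "cmod c"] by (simp add: AC_norm_scaleC)
    show "of_real (1 - t) *\<^sub>C f + of_real t *\<^sub>C g \<in> {f. AC_norm f \<le> C}"
      if "f \<in> {f. AC_norm f \<le> C}" "g \<in> {f. AC_norm f \<le> C}" "t \<in> {0..1}" for f g t
    proof -
      have "AC_norm (of_real (1 - t) *\<^sub>C f + of_real t *\<^sub>C g) \<le> (1 - t) * AC_norm f + t * AC_norm g"
        using AC_norm_add[of "of_real (1 - t) *\<^sub>C f" "of_real t *\<^sub>C g"] that(3)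
        by (simp add: AC_norm_scaleC del: of_real_diff)
      also have "\<dots> \<le> C" using that by (intro convex_bound_le) auto
      finally show ?thesis by simp
    qed
  qed
  show "convex_bornology (small :: AC set => bool)"
  proof (rule convex_bornologyI)
    show "small {f}" for f :: AC unfolding small_AC_def by (intro exI[of _ "AC_norm f"]) simp
    show "small T" if "small S" "T \<subseteq> S" for S T :: "AC set" using that unfolding small_AC_def by blast
    show "small (S + T)" if ST: "small S" "small T" for S T :: "AC set"
    proof -
      obtain C D where C: "\<forall>f\<in>S. AC_norm f \<le> C" and D: "\<forall>f\<in>T. AC_norm f \<le> D" using ST unfolding small_AC_def by blast
      have "AC_norm h \<le> C + D" if "h \<in> S + T" for h
      proof -
        obtain f g where "h = f + g" "f \<in> S" "g \<in> T" using \<open>h \<in> S + T\<close> by (rule set_plus_elim)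
        thus ?thesis using AC_norm_add[of f g] C D by fastforce
      qed
      thus ?thesis unfolding small_AC_def by blast
    qed
    show "small (disk_hull S)" if S: "small S" for S :: "AC set"
    proof -
      obtain C where C: "\<forall>f\<in>S. AC_norm f \<le> C" using S unfolding small_AC_def by blast
      have "disk_hull S \<subseteq> {f. AC_norm f \<le> max C 0}" using C by (intro disk_hull_least disk) auto
      thus ?thesis unfolding small_AC_def by blast
    qed
  qed
qed

lemma bbil_times_AC: "bounded_cbilinear ((*) :: AC => AC => AC)"
proof (rule bounded_cbilinearI)
  show "clinear (\<lambda>g. f * g)" "clinear (\<lambda>f. f * g)" for f g :: AC
    by (rule clinearI; transfer; simp add: fun_eq_iff algebra_simps)+
  fix S T :: "AC set" assume "small S" "small T"
  then obtain C D where C: "\<forall>f\<in>S. AC_norm f \<le> C" and D: "\<forall>f\<in>T. AC_norm f \<le> D" unfolding small_AC_def by blast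
  have "AC_norm (f * g) \<le> 2 * C * D" if "f \<in> S" "g \<in> T" for f g
  proof -
    have "AC_norm f * AC_norm g \<le> C * D" using C D that AC_norm_nonneg by (intro mult_mono) (auto intro: order_trans)
    thus ?thesis using AC_norm_times[of f g] by simp
  qed
  thus "small {f * g |f g. f \<in> S \<and> g \<in> T}" unfolding small_AC_def by (intro exI[of _ "2 * C * D"]) blast
qed

lemma times_AC_assoc: "(f * g) * h = f * (g * (h :: AC))" and times_AC_commute: "f * g = g * (f :: AC)"
  by (transfer, simp add: fun_eq_iff mult.assoc, transfer, simp add: fun_eq_iff mult.commute)

lift_definition AC_one :: AC is "\<lambda>t. if t \<in> {0..1} then 1 else 0"
proof -
  have "abs_continuous_on 0 1 (\<lambda>t. if t \<in> {0..1} then 1 else 0)"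
    by (rule abs_continuous_on_dominated[OF abs_continuous_on_const[of _ _ 0] abs_continuous_on_const[of _ _ 0], of 0]) auto
  thus "abs_continuous_on 0 1 (\<lambda>t::real. if t \<in> {0..1} then 1 else 0 :: complex) \<and>
    (\<forall>t. t \<notin> {0..1} \<longrightarrow> (if t \<in> {0..1} then 1 else 0) = (0::complex))" by simp
qed

lemma AC_one_times [simp]: "AC_one * f = f" "f * AC_one = f" by (transfer, auto simp: fun_eq_iff)+

lemma AC_int_one: "AC_int AC_one g = Rep_AC g 1 - Rep_AC g 0"
proof -
  have "AC_int AC_one g = integral {0..1} (AC_deriv g)"
    unfolding AC_int_def by (rule integral_cong) (simp add: AC_one.rep_eq)
  thus ?thesis using integral_unique[OF AC_deriv_has_integral[of 1 g]] by simp
qed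

lemma AC_int_times: "AC_int f (g * h) = AC_int (f * g) h + AC_int (f * h) g"
proof -
  obtain N where N: "negligible N" "\<And>t. t \<in> {0..1} - N ==> AC_deriv (g * h) t = Rep_AC g t * AC_deriv h t + AC_deriv g t * Rep_AC h t"
    using AC_deriv_times[of g h] by (elim exE conjE) (rule that, assumption, erule (1) bspec)
  have "AC_int f (g * h) = integral {0..1} (\<lambda>t. Rep_AC (f * g) t * AC_deriv h t + Rep_AC (f * h) t * AC_deriv g t)"
    unfolding AC_int_def by (rule integral_spike[OF N(1)]) (simp add: N(2) times_AC.rep_eq algebra_simps)
  also have "\<dots> = AC_int (f * g) h + AC_int (f * h) g" unfolding AC_int_def using Rep_AC_times_deriv_integrable
    by (intro integral_add) (auto simp: absolutely_integrable_on_def)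
  finally show ?thesis .
qed

lemma bbil_AC_int: "bounded_cbilinear AC_int"
proof (rule bounded_cbilinearI)
  have int: "(\<lambda>t. Rep_AC f t * AC_deriv g t) integrable_on {0..1}" for f g
    using Rep_AC_times_deriv_integrable[of f g] by (simp add: absolutely_integrable_on_def)
  show "clinear (\<lambda>g. AC_int f g)" for f
  proof (rule clinearI)
    fix g h :: AC and c
    obtain N where N: "negligible N" "\<And>t. t \<in> {0..1} - N ==> AC_deriv (g + h) t = AC_deriv g t + AC_deriv h t"
      using AC_deriv_add[of g h] by (elim exE conjE) (rule that, assumption, erule (1) bspec)
    have "AC_int f (g + h) = integral {0..1} (\<lambda>t. Rep_AC f t * AC_deriv g t + Rep_AC f t * AC_deriv h t)"
      unfolding AC_int_def by (rule integral_spike[OF N(1)]) (simp add: N(2) algebra_simps)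
    thus "AC_int f (g + h) = AC_int f g + AC_int f h" unfolding AC_int_def by (simp add: integral_add int)
    obtain M where M: "negligible M" "\<And>t. t \<in> {0..1} - M ==> AC_deriv (c *\<^sub>C g) t = c * AC_deriv g t"
      using AC_deriv_scaleC[of c g] by (elim exE conjE) (rule that, assumption, erule (1) bspec)
    have "AC_int f (c *\<^sub>C g) = integral {0..1} (\<lambda>t. c * (Rep_AC f t * AC_deriv g t))"
      unfolding AC_int_def by (rule integral_spike[OF M(1)]) (simp add: M(2))
    thus "AC_int f (c *\<^sub>C g) = c *\<^sub>C AC_int f g" unfolding AC_int_def by (simp add: scaleC_complex_def)
  qed
  show "clinear (\<lambda>f. AC_int f g)" for g
    by (rule clinearI) (simp_all add: AC_int_def plus_AC.rep_eq scaleC_AC.rep_eq distrib_right integral_add int mult.assoc scaleC_complex_def)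
  fix S T :: "AC set" assume "small S" "small T"
  then obtain C D where C: "\<forall>f\<in>S. AC_norm f \<le> C" and D: "\<forall>f\<in>T. AC_norm f \<le> D" unfolding small_AC_def by blast
  have "cmod (AC_int f g) \<le> C * D" if "f \<in> S" "g \<in> T" for f g
    using AC_int_bound[of f g] mult_mono[of "AC_norm f" C "AC_norm g" D] C D that AC_norm_nonneg by (meson order_trans)
  thus "small {AC_int f g |f g. f \<in> S \<and> g \<in> T}" unfolding small_complex_def by (intro boundedI[of _ "C * D"]) blast
qed

lemma blinear_Rep_AC: "bounded_clinear (\<lambda>f. Rep_AC f t)"
proof (rule bounded_clinearI)
  show "clinear (\<lambda>f. Rep_AC f t)" by (rule clinearI) (simp_all add: plus_AC.rep_eq scaleC_AC.rep_eq scaleC_complex_def)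
  fix S :: "AC set" assume "small S"
  then obtain C where C: "\<forall>f\<in>S. AC_norm f \<le> C" unfolding small_AC_def by blast
  thus "small ((\<lambda>f. Rep_AC f t) ` S)" unfolding small_complex_def
    by (intro boundedI[of _ C]) (auto intro: order_trans[OF Rep_AC_le_norm])
qed

lemma small_AC_absorbed:
  assumes "small S"
  shows "\<exists>r>0. \<forall>f\<in>S. \<exists>g. AC_norm g \<le> 1 / 2 \<and> f = of_real r *\<^sub>C g"
proof -
  obtain C where C: "\<forall>f\<in>S. AC_norm f \<le> C" using assms unfolding small_AC_def by blast
  define r where "r = 2 * max C 1"
  have r: "0 < r" "2 * C \<le> r" by (simp_all add: r_def)
  have "AC_norm (of_real (1 / r) *\<^sub>C f) \<le> 1 / 2" if "f \<in> S" for f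
    using C that r by (fastforce simp: AC_norm_scaleC norm_divide field_simps)
  moreover have "f = of_real r *\<^sub>C of_real (1 / r) *\<^sub>C f" for f :: AC using r by (simp add: scaleC_scaleC scaleC_one)
  ultimately show ?thesis using r(1) by blast
qed

text \<open>Serves the second summand of unitalisations. The hull of a ball is taken in place of the
  ball because it is a disk by construction.\<close>

lemma bcomplete_complex: "bcomplete TYPE(complex)" unfolding bcomplete_def
proof (intro conjI allI impI)
  show "bseparated TYPE(complex)" unfolding bseparated_def
  proof (intro allI impI)
    fix x :: complex assume "Mackey_tendsto (\<lambda>n. x) 0"
    then obtain S where S: "small S" "disk S" "disk_tendsto S (\<lambda>n. x) 0" unfolding Mackey_tendsto_def by blast
    obtain r where r: "0 < r" "\<forall>s\<in>S. cmod s \<le> r" using S(1) unfolding small_complex_def bounded_pos by blast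
    have "cmod x \<le> 0 + e" if e: "0 < e" for e
    proof -
      have "0 < e / r" using e r(1) by simp
      have ex: "\<forall>e>0. \<exists>N::nat. \<forall>n\<ge>N. x - 0 \<in> dilate e S" using S(3)[unfolded disk_tendsto_iff[OF S(2)]] by (elim conjE)
      have "x - 0 \<in> dilate (e / r) S" using ex[rule_format, OF \<open>0 < e / r\<close>] by (elim exE) (drule spec, erule mp, rule order_refl)
      then obtain s where s: "s \<in> S" "x = of_real (e / r) *\<^sub>C s" by auto
      have "cmod x = e / r * cmod s" using s(2) e r(1) by (simp add: scaleC_complex_def norm_mult norm_divide)
      also have "\<dots> \<le> e / r * r" using s(1) e r by (intro mult_left_mono) auto
      finally show ?thesis using r(1) by simp
    qed
    hence "cmod x \<le> 0" by (rule field_le_epsilon)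
    thus "x = 0" by simp
  qed
  fix S :: "complex set" assume S: "small S" "disk S"
  obtain r where r: "0 < r" "\<forall>s\<in>S. cmod s \<le> r" using S(1) unfolding small_complex_def bounded_pos by blast
  have hull: "small (disk_hull (cball 0 r) :: complex set)" by (rule small_disk_hull) (simp add: small_complex_def)
  have ball: "z \<in> dilate e (disk_hull (cball 0 r))" if "cmod z \<le> e * r" "0 < e" for z :: complex and e
  proof -
    have "z / of_real e \<in> cball 0 r" using that by (simp add: norm_divide field_simps)
    moreover have "z = of_real e *\<^sub>C (z / of_real e)" using that by (simp add: scaleC_complex_def)
    ultimately show ?thesis using disk_hull_subset[of "cball 0 r"] by blast
  qed
  have "\<exists>l\<in>disk_hull (cball 0 r). Mackey_tendsto X l" if X: "range X \<subseteq> S" "disk_Cauchy S X" for X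
  proof -
    have "Cauchy X" unfolding Cauchy_def
    proof (intro allI impI)
      fix e :: real assume e: "0 < e"
      have pos: "0 < e / (2 * r)" using e r(1) by simp
      have ex: "\<forall>e>0. \<exists>N. \<forall>m\<ge>N. \<forall>n\<ge>N. X m - X n \<in> dilate e S" using X(2)[unfolded disk_Cauchy_iff[OF S(2)]] by (elim conjE)
      have "\<exists>N. \<forall>m\<ge>N. \<forall>n\<ge>N. X m - X n \<in> dilate (e / (2 * r)) S" by (rule mp[OF spec[OF ex] pos])
      then obtain N where N: "\<forall>m\<ge>N. \<forall>n\<ge>N. X m - X n \<in> dilate (e / (2 * r)) S" by (rule exE)
      have "dist (X m) (X n) < e" if "m \<ge> N" "n \<ge> N" for m n
      proof -
        have "X m - X n \<in> dilate (e / (2 * r)) S" using N that by simp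
        then obtain s where s: "s \<in> S" "X m - X n = of_real (e / (2 * r)) *\<^sub>C s" by (elim imageE)
        hence "cmod (X m - X n) = e / (2 * r) * cmod s" using e r by (simp add: scaleC_complex_def norm_mult norm_divide)
        also have "\<dots> \<le> e / (2 * r) * r" using s(1) e r by (intro mult_left_mono) auto
        also have "\<dots> < e" using e r by simp
        finally show ?thesis by (simp add: dist_norm)
      qed
      thus "\<exists>M. \<forall>m\<ge>M. \<forall>n\<ge>M. dist (X m) (X n) < e" by blast
    qed
    then obtain l where l: "X \<longlonglongrightarrow> l" using Cauchy_convergent convergent_def by blast
    have span: "z \<in> cspan (disk_hull (cball 0 r))" for z :: complex
    proof -
      have "z \<in> dilate (cmod z / r + 1) (disk_hull (cball 0 r))"
        using r(1) by (intro ball) (simp_all add: field_simps add_pos_nonneg)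
      then obtain s where "s \<in> disk_hull (cball 0 r)" "z = of_real (cmod z / r + 1) *\<^sub>C s" by (elim imageE)
      thus ?thesis using cspan_scale[OF cspan_base] by metis
    qed
    have lim: "Mackey_tendsto X l"
    proof (rule Mackey_tendsto_nullI[OF hull disk_disk_hull span])
      fix e :: real assume e: "0 < e"
      hence "0 < e * r" using r(1) by simp
      then obtain N where N: "\<And>n. n \<ge> N ==> cmod (X n - l) < e * r" using LIMSEQ_D[OF l] by blast
      have "\<forall>n\<ge>N. X n - l \<in> dilate e (disk_hull (cball 0 r))" by (intro allI impI ball[OF less_imp_le e] N)
      thus "\<exists>N. \<forall>n\<ge>N. X n - l \<in> dilate e (disk_hull (cball 0 r))" by (rule exI)
    qed
    have "cmod l \<le> r" using X(1) r(2) by (intro LIMSEQ_le_const2[OF tendsto_norm[OF l]]) auto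
    hence "l \<in> disk_hull (cball 0 r)" by (intro subsetD[OF disk_hull_subset]) simp
    thus ?thesis by (rule bexI[of "Mackey_tendsto X", OF lim])
  qed
  thus "\<exists>T. small T \<and> disk T \<and> (\<forall>X. range X \<subseteq> S \<longrightarrow> disk_Cauchy S X \<longrightarrow> (\<exists>l\<in>T. Mackey_tendsto X l))"
    using hull disk_disk_hull by blast
qed

section \<open>Trilinear maps and identities on completed tensor products\<close>

lemma btrilinearD:
  assumes "btrilinear f"
  shows "clinear (\<lambda>y. f u x y)" and "clinear (\<lambda>x. f u x y)" and "clinear (\<lambda>u. f u x y)"
    and "small R ==> small S ==> small T ==> small {f u x y |u x y. u \<in> R \<and> x \<in> S \<and> y \<in> T}"
proof -
  note * = assms[unfolded btrilinear_def]
  show "clinear (\<lambda>y. f u x y)" by (rule *[THEN conjunct1, rule_format])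
  show "clinear (\<lambda>x. f u x y)" by (rule *[THEN conjunct2, THEN conjunct1, rule_format])
  show "clinear (\<lambda>u. f u x y)" by (rule *[THEN conjunct2, THEN conjunct2, THEN conjunct1, rule_format])
  show "small R ==> small S ==> small T ==> small {f u x y |u x y. u \<in> R \<and> x \<in> S \<and> y \<in> T}"
    by (rule *[THEN conjunct2, THEN conjunct2, THEN conjunct2, rule_format])
qed

lemma btrilinear_swap12:
  assumes f: "btrilinear f" shows "btrilinear (\<lambda>u x y. f x u y)"
proof (rule btrilinearI)
  fix R S T assume "small (R :: 'b set)" "small (S :: 'a set)" "small (T :: 'c set)"
  from btrilinearD(4)[OF f this(2,1,3)]
  show "small {f x u y |u x y. u \<in> R \<and> x \<in> S \<and> y \<in> T}" by (rule small_subset) auto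
qed (rule btrilinearD[OF f])+

lemma btrilinear_swap23:
  assumes f: "btrilinear f" shows "btrilinear (\<lambda>u x y. f u y x)"
proof (rule btrilinearI)
  fix R S T assume "small (R :: 'a set)" "small (S :: 'c set)" "small (T :: 'b set)"
  from btrilinearD(4)[OF f this(1,3,2)]
  show "small {f u y x |u x y. u \<in> R \<and> x \<in> S \<and> y \<in> T}" by (rule small_subset) auto
qed (rule btrilinearD[OF f])+

lemma btrilinear_compose:
  fixes g :: "'a::bornological_vector_space => 'b::bornological_vector_space => 'c::bornological_vector_space"
    and f :: "'c => 'd::bornological_vector_space => 'e::bornological_vector_space"
  assumes f: "bounded_cbilinear f" and g: "bounded_cbilinear g"
  shows "btrilinear (\<lambda>u x y. f (g u x) y)"
proof (rule btrilinearI)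
  fix R S T assume "small (R :: 'a set)" "small (S :: 'b set)" "small (T :: 'd set)"
  from bbil_small[OF f bbil_small[OF g this(1,2)] this(3)]
  show "small {f (g u x) y |u x y. u \<in> R \<and> x \<in> S \<and> y \<in> T}" by (rule small_subset) auto
next
  show "clinear (\<lambda>y. f (g u x) y)" for u x by (rule bbil_clinear_right[OF f])
  show "clinear (\<lambda>x. f (g u x) y)" for u y
    by (rule clinear_compose[OF bbil_clinear_right[OF g] bbil_clinear_left[OF f]])
  show "clinear (\<lambda>u. f (g u x) y)" for x y
    by (rule clinear_compose[OF bbil_clinear_left[OF g] bbil_clinear_left[OF f]])
qed

lemma btrilinear_minus:
  assumes f: "btrilinear f" and g: "btrilinear g"
  shows "btrilinear (\<lambda>u x y. f u x y - g u x y)"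
proof (rule btrilinearI)
  fix R S T assume RST: "small (R :: 'a set)" "small (S :: 'b set)" "small (T :: 'c set)"
  have "small (uminus ` {g u x y |u x y. u \<in> R \<and> x \<in> S \<and> y \<in> T})"
    by (rule blinear_small[OF blinear_uminus[OF blinear_id] btrilinearD(4)[OF g RST]])
  from small_add[OF btrilinearD(4)[OF f RST] this]
  show "small {f u x y - g u x y |u x y. u \<in> R \<and> x \<in> S \<and> y \<in> T}"
  proof (rule small_subset, safe)
    fix u x y assume "u \<in> R" "x \<in> S" "y \<in> T"
    hence "f u x y + - g u x y \<in> {f u x y |u x y. u \<in> R \<and> x \<in> S \<and> y \<in> T} + uminus ` {g u x y |u x y. u \<in> R \<and> x \<in> S \<and> y \<in> T}"
      by (intro set_plus_intro) blast+
    thus "f u x y - g u x y \<in> {f u x y |u x y. u \<in> R \<and> x \<in> S \<and> y \<in> T} + uminus ` {g u x y |u x y. u \<in> R \<and> x \<in> S \<and> y \<in> T}"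
      by simp
  qed
qed (intro clinear_minus btrilinearD[OF f] btrilinearD[OF g])+

lemma btrilinear_fix1: "btrilinear f ==> bounded_cbilinear (f u)" by (rule btrilinear_cbilinear)

lemma btrilinear_fix2: "btrilinear f ==> bounded_cbilinear (\<lambda>u y. f u x y)"
  by (drule btrilinear_swap12) (drule btrilinear_fix1)

lemma btrilinear_fix3: "btrilinear f ==> bounded_cbilinear (\<lambda>u x. f u x y)"
  by (drule btrilinear_swap23) (drule btrilinear_fix2)

lemma bseparated_ctensor: "bseparated TYPE(('a::bornological_vector_space, 'b::bornological_vector_space) ctensor)"
  by (rule bcomplete_separated[OF bcomplete_completion])

lemma ctensor_eqI:
  fixes f g :: "('a::bornological_vector_space, 'b::bornological_vector_space) ctensor => 'c::bornological_vector_space"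
  assumes "bounded_clinear f" "bounded_clinear g" "bcomplete TYPE('c)" and "\<And>x y. f (x \<otimes>\<^sub>c y) = g (x \<otimes>\<^sub>c y)"
  shows "f z = g z" using ctensor_ext[OF assms(1,2) bcomplete_separated[OF assms(3)] assms(4)] by simp

lemma ctensor_cbilinear_eqI:
  fixes f g :: "('a::bornological_vector_space, 'b::bornological_vector_space) ctensor =>
    ('c::bornological_vector_space, 'd::bornological_vector_space) ctensor => 'e::bornological_vector_space"
  assumes f: "bounded_cbilinear f" and g: "bounded_cbilinear g" and c: "bcomplete TYPE('e)"
    and eq: "\<And>x y z w. f (x \<otimes>\<^sub>c y) (z \<otimes>\<^sub>c w) = g (x \<otimes>\<^sub>c y) (z \<otimes>\<^sub>c w)"
  shows "f u v = g u v" by (rule ctensor_eqI[OF bbil_left[OF f] bbil_left[OF g] c],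
      rule ctensor_eqI[OF bbil_right[OF f] bbil_right[OF g] c], rule eq)

lemma ctensor_pure_linear:
  fixes x x' :: "'a::bornological_vector_space" and y y' :: "'b::bornological_vector_space"
  shows "(x + x') \<otimes>\<^sub>c y = x \<otimes>\<^sub>c y + x' \<otimes>\<^sub>c y" "(x - x') \<otimes>\<^sub>c y = x \<otimes>\<^sub>c y - x' \<otimes>\<^sub>c y"
    "(c *\<^sub>C x) \<otimes>\<^sub>c y = c *\<^sub>C (x \<otimes>\<^sub>c y)" "(0 :: 'a) \<otimes>\<^sub>c y = 0"
    "x \<otimes>\<^sub>c (y + y') = x \<otimes>\<^sub>c y + x \<otimes>\<^sub>c y'" "x \<otimes>\<^sub>c (y - y') = x \<otimes>\<^sub>c y - x \<otimes>\<^sub>c y'"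
    "x \<otimes>\<^sub>c (c *\<^sub>C y) = c *\<^sub>C (x \<otimes>\<^sub>c y)" "x \<otimes>\<^sub>c (0 :: 'b) = 0"
proof -
  note R = bbil_clinear_right[OF bbil_ctensor_pure] and L = bbil_clinear_left[OF bbil_ctensor_pure]
  show "(x + x') \<otimes>\<^sub>c y = x \<otimes>\<^sub>c y + x' \<otimes>\<^sub>c y" by (rule clinear_add[OF L])
  show "(x - x') \<otimes>\<^sub>c y = x \<otimes>\<^sub>c y - x' \<otimes>\<^sub>c y" by (rule clinear_diff[OF L])
  show "(c *\<^sub>C x) \<otimes>\<^sub>c y = c *\<^sub>C (x \<otimes>\<^sub>c y)" by (rule clinear_scale[OF L])
  show "(0 :: 'a) \<otimes>\<^sub>c y = 0" by (rule clinear_zero[OF L])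
  show "x \<otimes>\<^sub>c (y + y') = x \<otimes>\<^sub>c y + x \<otimes>\<^sub>c y'" by (rule clinear_add[OF R])
  show "x \<otimes>\<^sub>c (y - y') = x \<otimes>\<^sub>c y - x \<otimes>\<^sub>c y'" by (rule clinear_diff[OF R])
  show "x \<otimes>\<^sub>c (c *\<^sub>C y) = c *\<^sub>C (x \<otimes>\<^sub>c y)" by (rule clinear_scale[OF R])
  show "x \<otimes>\<^sub>c (0 :: 'b) = 0" by (rule clinear_zero[OF R])
qed

section \<open>Bimodules of differential forms\<close>

text \<open>Forms over R arise by iterating one step: a bimodule P gives P \<otimes> R, where p
  \<otimes> v stands for p dv, with the actions \<open>ext_l\<close> and \<open>ext_r\<close>.
  Starting from the unitalisation this yields one-forms, two-forms and so on, and the lemmas on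
  bimodules apply in every degree.\<close>

locale bimodule =
  fixes l :: "'r::{bornological_vector_space, ring} => 'p::bornological_vector_space => 'p" and r :: "'p => 'r => 'p"
  assumes mult: "bounded_cbilinear ((*) :: 'r => 'r => 'r)" and l: "bounded_cbilinear l" and r: "bounded_cbilinear r"
    and ll: "l (x * y) p = l x (l y p)" and rr: "r p (x * y) = r (r p x) y" and lr: "r (l x p) y = l x (r p y)"

definition ext_l :: "('r::{bornological_vector_space, ring} => 'p::bornological_vector_space => 'p) =>
    'r => ('p, 'r) ctensor => ('p, 'r) ctensor"
  where "ext_l l z = ctensor_lift (\<lambda>p v. l z p \<otimes>\<^sub>c v)"

text \<open>The Leibniz rule \<open>(p dv) z = p d(v z) - p v dz\<close>.\<close>

definition ext_r :: "('p::bornological_vector_space => 'r::{bornological_vector_space, ring} => 'p) =>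
    ('p, 'r) ctensor => 'r => ('p, 'r) ctensor"
  where "ext_r r w z = ctensor_lift (\<lambda>p v. p \<otimes>\<^sub>c (v * z) - r p v \<otimes>\<^sub>c z) w"

text \<open>The commutator map p dv -> [p, v]. On two-forms it is minus the Hochschild boundary
  (\<open>hochschild_b_eq\<close>), on one-forms it gives the boundary of the X-complex
  (\<open>X_boundary1_abs\<close>).\<close>

definition bicomm :: "('r::{bornological_vector_space, ring} => 'p::bornological_vector_space => 'p) =>
    ('p => 'r => 'p) => ('p, 'r) ctensor => 'p"
  where "bicomm l r = ctensor_lift (\<lambda>p v. r p v - l v p)"

context bimodule
begin

lemma linear_simps:
  "l z (p + p') = l z p + l z p'" "l z (p - p') = l z p - l z p'" "l z (c *\<^sub>C p) = c *\<^sub>C l z p"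
  "r (p + p') z = r p z + r p' z" "r (p - p') z = r p z - r p' z" "r (c *\<^sub>C p) z = c *\<^sub>C r p z"
  "l (z + z') p = l z p + l z' p" "l (z - z') p = l z p - l z' p"
  "r p (z + z') = r p z + r p z'" "r p (z - z') = r p z - r p z'"
proof -
  note lr = bbil_clinear_right[OF l] and ll = bbil_clinear_left[OF l]
    and rr = bbil_clinear_right[OF r] and rl = bbil_clinear_left[OF r]
  show "l z (p + p') = l z p + l z p'" by (rule clinear_add[OF lr])
  show "l z (p - p') = l z p - l z p'" by (rule clinear_diff[OF lr])
  show "l z (c *\<^sub>C p) = c *\<^sub>C l z p" by (rule clinear_scale[OF lr])
  show "r (p + p') z = r p z + r p' z" by (rule clinear_add[OF rl])
  show "r (p - p') z = r p z - r p' z" by (rule clinear_diff[OF rl])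
  show "r (c *\<^sub>C p) z = c *\<^sub>C r p z" by (rule clinear_scale[OF rl])
  show "l (z + z') p = l z p + l z' p" by (rule clinear_add[OF ll])
  show "l (z - z') p = l z p - l z' p" by (rule clinear_diff[OF ll])
  show "r p (z + z') = r p z + r p z'" by (rule clinear_add[OF rr])
  show "r p (z - z') = r p z - r p z'" by (rule clinear_diff[OF rr])
qed

lemma tri_ext_l: "btrilinear (\<lambda>z p v. l z p \<otimes>\<^sub>c v)" by (rule btrilinear_compose[OF bbil_ctensor_pure l])

lemma bbil_ext_l: "bounded_cbilinear (ext_l l)" unfolding ext_l_def[abs_def]
  by (rule bbil_ctensor_lift[OF tri_ext_l bcomplete_completion])

lemma ext_l_pure [simp]: "ext_l l z (p \<otimes>\<^sub>c v) = l z p \<otimes>\<^sub>c v" unfolding ext_l_def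
  by (rule ctensor_lift_pure[OF btrilinear_fix1[OF tri_ext_l] bcomplete_completion])

lemma tri_ext_r: "btrilinear (\<lambda>z p v. p \<otimes>\<^sub>c (v * z) - r p v \<otimes>\<^sub>c z)"
proof (rule btrilinear_minus)
  have "btrilinear (\<lambda>(z::'r) v (p::'p). p \<otimes>\<^sub>c (v * z))"
    using btrilinear_compose[OF bbil_flip[OF bbil_ctensor_pure] bbil_flip[OF mult]] by simp
  thus "btrilinear (\<lambda>(z::'r) (p::'p) v. p \<otimes>\<^sub>c (v * z))" by (rule btrilinear_swap23)
  have "btrilinear (\<lambda>p v z. r p v \<otimes>\<^sub>c z)" by (rule btrilinear_compose[OF bbil_ctensor_pure r])
  hence "btrilinear (\<lambda>p z v. r p v \<otimes>\<^sub>c z)" by (rule btrilinear_swap23)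
  thus "btrilinear (\<lambda>z p v. r p v \<otimes>\<^sub>c z)" by (rule btrilinear_swap12)
qed

lemma bbil_ext_r: "bounded_cbilinear (ext_r r)" unfolding ext_r_def[abs_def]
  by (rule bbil_flip[OF bbil_ctensor_lift[OF tri_ext_r bcomplete_completion]])

lemma ext_r_pure [simp]: "ext_r r (p \<otimes>\<^sub>c v) z = p \<otimes>\<^sub>c (v * z) - r p v \<otimes>\<^sub>c z" unfolding ext_r_def
  by (rule ctensor_lift_pure[OF btrilinear_fix1[OF tri_ext_r] bcomplete_completion])

lemma bimodule_ext: "bimodule (ext_l l) (ext_r r)"
proof
  note cl = bbil_ext_l and cr = bbil_ext_r
  note L = bbil_right[OF cl] and R = bbil_left[OF cr]
  show "ext_l l (x * y) p = ext_l l x (ext_l l y p)" for x y p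
    by (rule ctensor_eqI[OF L blinear_compose[OF L L] bcomplete_completion]) (simp add: ll)
  show "ext_r r p (x * y) = ext_r r (ext_r r p x) y" for x y p
    by (rule ctensor_eqI[OF R blinear_compose[OF R R] bcomplete_completion])
      (simp add: rr mult.assoc blin_diff[OF bbil_left[OF cr]])
  show "ext_r r (ext_l l x p) y = ext_l l x (ext_r r p y)" for x p y
    by (rule ctensor_eqI[OF blinear_compose[OF L R] blinear_compose[OF R L] bcomplete_completion])
      (simp add: lr blin_diff[OF bbil_right[OF cl]])
qed (rule mult bbil_ext_l bbil_ext_r)+

lemma bbil_bicomm: "bounded_cbilinear (\<lambda>p v. r p v - l v p)" by (rule bbil_minus[OF r bbil_flip[OF l]])

end

locale complete_bimodule = bimodule l r for l :: "'r::{bornological_vector_space, ring} => 'p::bornological_vector_space => 'p"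
    and r :: "'p => 'r => 'p" +
  assumes complete: "bcomplete TYPE('p)"
begin

lemma complete_bimodule_ext: "complete_bimodule (ext_l l) (ext_r r)"
  by (rule complete_bimodule.intro[OF bimodule_ext]) (unfold_locales, rule bcomplete_completion)

lemma blinear_bicomm: "bounded_clinear (bicomm l r)"
  unfolding bicomm_def by (rule blinear_ctensor_lift[OF bbil_bicomm complete])

lemma bicomm_pure [simp]: "bicomm l r (p \<otimes>\<^sub>c v) = r p v - l v p"
  unfolding bicomm_def by (rule ctensor_lift_pure[OF bbil_bicomm complete])

text \<open>This is b b = 0; on p dv dz it reduces to the bimodule laws.\<close>

lemma bicomm_bicomm: "bicomm l r (bicomm (ext_l l) (ext_r r) m) = 0"
proof -
  interpret ext: complete_bimodule "ext_l l" "ext_r r" by (rule complete_bimodule_ext)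
  note C = blin_diff[OF blinear_bicomm]
  have *: "bicomm l r (bicomm (ext_l l) (ext_r r) (w \<otimes>\<^sub>c z)) = 0" for w z unfolding ext.bicomm_pure
  proof (rule ctensor_eqI[where f="\<lambda>w. bicomm l r (ext_r r w z - ext_l l z w)" and g="\<lambda>w. 0" and z=w, OF _ blinear_zero complete])
    show "bounded_clinear (\<lambda>w. bicomm l r (ext_r r w z - ext_l l z w))"
      by (rule blinear_compose[OF bbil_left[OF ext.bbil_bicomm] blinear_bicomm])
    show "bicomm l r (ext_r r (p \<otimes>\<^sub>c v) z - ext_l l z (p \<otimes>\<^sub>c v)) = 0" for p v by (simp add: C linear_simps rr ll lr)
  qed
  show ?thesis by (rule ctensor_eqI[where f="\<lambda>m. bicomm l r (bicomm (ext_l l) (ext_r r) m)" and g="\<lambda>m. 0" and z=m,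
          OF blinear_compose[OF ext.blinear_bicomm blinear_bicomm] blinear_zero complete *])
qed

end

section \<open>Integration along the interval\<close>

text \<open>Informally, the integral of c p multiplied by u through \<open>\<beta>\<close>. For u =
  f \<otimes> s the function f joins the weight c under the integral \<open>i\<close>, and s acts on
  the result.\<close>

definition contr :: "('q::bornological_vector_space => 's::bornological_vector_space => 'c::bornological_vector_space) =>
    (AC => 'p::bornological_vector_space => 'q) => AC => 'p => (AC, 's) ctensor => 'c"
  where "contr \<beta> i c p = ctensor_lift (\<lambda>f s. \<beta> (i (c * f) p) s)"

locale contraction =
  fixes \<beta> :: "'q::bornological_vector_space => 's::bornological_vector_space => 'c::bornological_vector_space"
    and i :: "AC => 'p::bornological_vector_space => 'q"
  assumes \<beta>: "bounded_cbilinear \<beta>" and i: "bounded_cbilinear i" and cpl: "bcomplete TYPE('c)"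
begin

lemma bil: "bounded_cbilinear (\<lambda>f s. \<beta> (i (c * f) p) s)" by (rule bbil_compose[OF \<beta> _ blinear_id])
    (rule blinear_compose[OF bbil_right[OF bbil_times_AC] bbil_left[OF i]])

lemma pure [simp]: "contr \<beta> i c p (f \<otimes>\<^sub>c s) = \<beta> (i (c * f) p) s" unfolding contr_def by (rule ctensor_lift_pure[OF bil cpl])

lemma bounded: "bounded_clinear (contr \<beta> i c p)" unfolding contr_def by (rule blinear_ctensor_lift[OF bil cpl])

text \<open>The bilinear maps to be lifted form an equibounded family when \<open>c\<close> and
  \<open>p\<close> range over small sets; linearity in these parameters follows from uniqueness of
  the lift.\<close>

lemma trilinear: "btrilinear (contr \<beta> i)"
proof (rule btrilinearI)
  note add = blin_add[OF bbil_right[OF i]] blin_add[OF bbil_left[OF i]]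
    blin_add[OF bbil_left[OF \<beta>]] blin_add[OF bbil_left[OF bbil_times_AC]]
  note scale = blin_scale[OF bbil_right[OF i]] blin_scale[OF bbil_left[OF i]]
    blin_scale[OF bbil_left[OF \<beta>]] blin_scale[OF bbil_left[OF bbil_times_AC]]
  show "clinear (\<lambda>y. contr \<beta> i c p y)" for c p by (rule blinear_clinear[OF bounded])
  show "clinear (\<lambda>p. contr \<beta> i c p u)" for c u
  proof (rule clinearI)
    show "contr \<beta> i c (p + p') u = contr \<beta> i c p u + contr \<beta> i c p' u" for p p'
      by (rule ctensor_eqI[OF bounded blinear_plus[OF bounded bounded] cpl]) (simp add: add)
    show "contr \<beta> i c (k *\<^sub>C p) u = k *\<^sub>C contr \<beta> i c p u" for k p
      by (rule ctensor_eqI[OF bounded blinear_scaleC[OF bounded] cpl]) (simp add: scale)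
  qed
  show "clinear (\<lambda>c. contr \<beta> i c p u)" for p u
  proof (rule clinearI)
    show "contr \<beta> i (c + c') p u = contr \<beta> i c p u + contr \<beta> i c' p u" for c c'
      by (rule ctensor_eqI[OF bounded blinear_plus[OF bounded bounded] cpl]) (simp add: add)
    show "contr \<beta> i (k *\<^sub>C c) p u = k *\<^sub>C contr \<beta> i c p u" for k c
      by (rule ctensor_eqI[OF bounded blinear_scaleC[OF bounded] cpl]) (simp add: scale)
  qed
  fix C :: "AC set" and P :: "'p set" and U :: "(AC, 's) ctensor set"
  assume CP: "small C" "small P" and U: "small U"
  have "equibounded (C \<times> P) (\<lambda>(c, p). ctensor_lift (\<lambda>f s. \<beta> (i (c * f) p) s))" unfolding case_prod_beta
  proof (rule equibounded_ctensor_lift[OF bil _ cpl])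
    show "equibounded2 (C \<times> P) (\<lambda>x f s. \<beta> (i (fst x * f) (snd x)) s)" unfolding equibounded2_def
    proof (intro allI impI)
      fix F :: "AC set" and S :: "'s set" assume FS: "small F" "small S"
      from bbil_small[OF \<beta> bbil_small[OF i bbil_small[OF bbil_times_AC CP(1) FS(1)] CP(2)] FS(2)]
      show "small (\<Union>x\<in>C \<times> P. {\<beta> (i (fst x * f) (snd x)) s |f s. f \<in> F \<and> s \<in> S})" by (rule small_subset) (auto, blast)
    qed
  qed
  hence "small (\<Union>x\<in>C \<times> P. (case x of (c, p) => ctensor_lift (\<lambda>f s. \<beta> (i (c * f) p) s)) ` U)"
    using U unfolding equibounded_def by blast
  thus "small {contr \<beta> i c p u |c p u. c \<in> C \<and> p \<in> P \<and> u \<in> U}"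
  proof (rule small_subset, safe)
    fix c p u assume "c \<in> C" "p \<in> P" "u \<in> U"
    thus "contr \<beta> i c p u \<in> (\<Union>x\<in>C \<times> P. (case x of (c, p) => ctensor_lift (\<lambda>f s. \<beta> (i (c * f) p) s)) ` U)"
      unfolding contr_def by (intro UN_I[of "(c, p)"]) simp_all
  qed
qed

lemmas bounded_cp = btrilinear_fix3[OF trilinear] and bounded_cu = btrilinear_fix2[OF trilinear]
  and bounded_pu = btrilinear_fix1[OF trilinear] and bounded_p = bbil_left[OF btrilinear_fix1[OF trilinear]]

end

section \<open>The algebra AC([0,1]; TB)\<close>

type_synonym 'b AC_alg = "(AC, 'b tensor_alg) ctensor"

lemma AC_tensor_mult:
  fixes s t :: "'b::complete_bornological_algebra tensor_alg" and f g :: AC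
  shows bbil_times_AC_tensor:
    "bounded_cbilinear ((*) :: 'b AC_alg => _ => _)"
    and times_AC_tensor_pure: "(f \<otimes>\<^sub>c s) * (g \<otimes>\<^sub>c t) = (f * g) \<otimes>\<^sub>c (s * t)"
    and times_AC_tensor_assoc: "(x * y) * z = x * (y * z :: 'b AC_alg)"
proof -
  note m = bbil_times_tensor[OF bbil_times_AC bbil_times_tensor_alg]
  show "bounded_cbilinear ((*) :: 'b AC_alg => _ => _)" by (rule bbil_times_completion[OF m])
  show "(f \<otimes>\<^sub>c s) * (g \<otimes>\<^sub>c t) = (f * g) \<otimes>\<^sub>c (s * t)" unfolding ctensor_pure_def
    by (subst to_completion_times[OF m, symmetric])
      (subst times_tensor_pure[OF bbil_times_AC bbil_times_tensor_alg], rule refl)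
  show "(x * y) * z = x * (y * z :: 'b AC_alg)"
    by (rule completion_times_assoc[OF m times_tensor_assoc[OF bbil_times_AC bbil_times_tensor_alg times_AC_assoc mult.assoc]])
qed

lemmas times_AC_tensor_right = bbil_right[OF bbil_times_AC_tensor]
  and times_AC_tensor_left = bbil_left[OF bbil_times_AC_tensor]

locale AC_hom =
  fixes F :: "'a::complete_bornological_algebra tensor_alg => 'b::complete_bornological_algebra AC_alg"
  assumes F: "bounded_clinear F" and F_times: "F (x * y) = F x * F y"

text \<open>\<open>i c\<close> is integration against \<open>c\<close> of forms transported along \<open>F\<close>; it is compatible
  with the bimodule structures.\<close>

locale integration = AC_hom F + P: complete_bimodule lP rP + Q: complete_bimodule lQ rQ
  for F :: "'a::complete_bornological_algebra tensor_alg => 'b::complete_bornological_algebra AC_alg"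
    and lP :: "'a tensor_alg => 'p::bornological_vector_space => 'p" and rP
    and lQ :: "'b tensor_alg => 'q::bornological_vector_space => 'q" and rQ +
  fixes i :: "AC => 'p => 'q"
  assumes i: "bounded_cbilinear i" and i_right: "i c (rP p v) = contr rQ i c p (F v)"
    and i_left: "i c (lP v p) = contr (\<lambda>q s. lQ s q) i c p (F v)"

text \<open>Adds one differential: p dv goes to the integral of c p d(F v), where the function part
  of F v joins the weight and d acts on its algebra part.\<close>

definition ext_i where "ext_i F i c = ctensor_lift (\<lambda>p v. contr (\<otimes>\<^sub>c) i c p (F v))"

context integration
begin

sublocale R: contraction rQ i by unfold_locales (rule Q.r i Q.complete)+
sublocale L: contraction "\<lambda>q s. lQ s q" i by unfold_locales (rule bbil_flip[OF Q.l] i Q.complete)+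
sublocale T: contraction "(\<otimes>\<^sub>c)" i by unfold_locales (rule bbil_ctensor_pure i bcomplete_completion)+

lemma tri_ext_i: "btrilinear (\<lambda>c p v. contr (\<otimes>\<^sub>c) i c p (F v))"
proof (rule btrilinearI)
  fix A B C assume "small (A :: AC set)" "small (B :: 'p set)" "small (C :: 'a tensor_alg set)"
  from btrilinearD(4)[OF T.trilinear this(1,2) blinear_small[OF F this(3)]]
  show "small {contr (\<otimes>\<^sub>c) i c p (F v) |c p v. c \<in> A \<and> p \<in> B \<and> v \<in> C}" by (rule small_subset) auto
qed (rule btrilinearD[OF T.trilinear] clinear_compose[OF blinear_clinear[OF F] btrilinearD(1)[OF T.trilinear]])+

lemma bounded_ext_i: "bounded_cbilinear (ext_i F i)"
  unfolding ext_i_def[abs_def] by (rule bbil_ctensor_lift[OF tri_ext_i bcomplete_completion])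

lemma ext_i_pure [simp]: "ext_i F i c (p \<otimes>\<^sub>c v) = contr (\<otimes>\<^sub>c) i c p (F v)"
  unfolding ext_i_def by (rule ctensor_lift_pure[OF btrilinear_fix1[OF tri_ext_i] bcomplete_completion])

text \<open>Integration commutes with b: commutators are built from the two actions, with both of
  which \<open>i\<close> is compatible.\<close>

lemma bicomm_ext_i: "bicomm lQ rQ (ext_i F i c m) = i c (bicomm lP rP m)"
proof (rule ctensor_eqI[OF blinear_compose[OF bbil_right[OF bounded_ext_i] Q.blinear_bicomm]
      blinear_compose[OF P.blinear_bicomm bbil_right[OF i]] Q.complete])
  fix p v
  have "bicomm lQ rQ (contr (\<otimes>\<^sub>c) i c p u) = contr rQ i c p u - contr (\<lambda>q s. lQ s q) i c p u" for u
    by (rule ctensor_eqI[OF blinear_compose[OF T.bounded Q.blinear_bicomm]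
          blinear_minus[OF R.bounded L.bounded] Q.complete]) simp
  thus "bicomm lQ rQ (ext_i F i c (p \<otimes>\<^sub>c v)) = i c (bicomm lP rP (p \<otimes>\<^sub>c v))"
    by (simp add: blin_diff[OF bbil_right[OF i]] i_right i_left)
qed

text \<open>Allows the contraction to be iterated: \<open>iota1\<close> takes one-forms to degree 0,
  its extension two-forms to one-forms, and the next one three-forms to two-forms.\<close>

lemma integration_ext: "integration F (ext_l lP) (ext_r rP) (ext_l lQ) (ext_r rQ) (ext_i F i)"
proof -
  interpret P': complete_bimodule "ext_l lP" "ext_r rP" by (rule P.complete_bimodule_ext)
  interpret Q': complete_bimodule "ext_l lQ" "ext_r rQ" by (rule Q.complete_bimodule_ext)
  interpret R': contraction "ext_r rQ" "ext_i F i" by unfold_locales (rule Q'.r bounded_ext_i bcomplete_completion)+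
  interpret L': contraction "\<lambda>q s. ext_l lQ s q" "ext_i F i"
    by unfold_locales (rule bbil_flip[OF Q'.l] bounded_ext_i bcomplete_completion)+
  interpret R2: contraction "ext_r rQ" "\<lambda>c u. contr (\<otimes>\<^sub>c) i c p u" for p
    by unfold_locales (rule Q'.r T.bounded_cu bcomplete_completion)+
  interpret L2: contraction "\<lambda>q s. ext_l lQ s q" "\<lambda>c u. contr (\<otimes>\<^sub>c) i c p u" for p
    by unfold_locales (rule bbil_flip[OF Q'.l] T.bounded_cu bcomplete_completion)+
  note cpl = bcomplete_completion
  have right: "ext_i F i c (ext_r rP (p \<otimes>\<^sub>c v) z) = contr (ext_r rQ) (ext_i F i) c (p \<otimes>\<^sub>c v) (F z)" for c p v z
  proof -
    \<comment> \<open>The Leibniz rule that defines \<open>ext_r\<close>, carried through the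
      integral; the functions f and g may join the weight in either order since AC is
      commutative.\<close>
    have pure: "contr (\<otimes>\<^sub>c) i c p (u * (g \<otimes>\<^sub>c t)) - contr rQ i (c * g) p u \<otimes>\<^sub>c t = ext_r rQ (contr (\<otimes>\<^sub>c) i (c * g) p u) t" for u g t
    proof (rule ctensor_eqI[where f="\<lambda>u. contr (\<otimes>\<^sub>c) i c p (u * (g \<otimes>\<^sub>c t)) - contr rQ i (c * g) p u \<otimes>\<^sub>c t"
          and g="\<lambda>u. ext_r rQ (contr (\<otimes>\<^sub>c) i (c * g) p u) t" and z=u, OF _ _ cpl])
      show "bounded_clinear (\<lambda>u. contr (\<otimes>\<^sub>c) i c p (u * (g \<otimes>\<^sub>c t)) - contr rQ i (c * g) p u \<otimes>\<^sub>c t)"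
        by (intro blinear_minus blinear_compose[OF times_AC_tensor_left T.bounded]
            blinear_compose[OF R.bounded bbil_left[OF bbil_ctensor_pure]])
      show "bounded_clinear (\<lambda>u. ext_r rQ (contr (\<otimes>\<^sub>c) i (c * g) p u) t)"
        by (rule blinear_compose[OF T.bounded bbil_left[OF Q'.r]])
      show "contr (\<otimes>\<^sub>c) i c p ((f \<otimes>\<^sub>c s) * (g \<otimes>\<^sub>c t)) - contr rQ i (c * g) p (f \<otimes>\<^sub>c s) \<otimes>\<^sub>c t =
          ext_r rQ (contr (\<otimes>\<^sub>c) i (c * g) p (f \<otimes>\<^sub>c s)) t" for f s
        by (simp add: times_AC_tensor_pure times_AC_assoc times_AC_commute[of g f])
    qed
    have "contr (\<otimes>\<^sub>c) i c p (F v * w) - contr (\<otimes>\<^sub>c) i c (rP p v) w = contr (ext_r rQ) (ext_i F i) c (p \<otimes>\<^sub>c v) w" for w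
    proof (rule ctensor_eqI[OF _ R'.bounded cpl])
      show "bounded_clinear (\<lambda>w. contr (\<otimes>\<^sub>c) i c p (F v * w) - contr (\<otimes>\<^sub>c) i c (rP p v) w)"
        by (intro blinear_minus T.bounded blinear_compose[OF times_AC_tensor_right T.bounded])
      show "contr (\<otimes>\<^sub>c) i c p (F v * (g \<otimes>\<^sub>c t)) - contr (\<otimes>\<^sub>c) i c (rP p v) (g \<otimes>\<^sub>c t) =
          contr (ext_r rQ) (ext_i F i) c (p \<otimes>\<^sub>c v) (g \<otimes>\<^sub>c t)" for g t using pure[of "F v" g t] by (simp add: i_right)
    qed
    from this[of "F z"] show ?thesis by (simp add: F_times blin_diff[OF bbil_right[OF bounded_ext_i]])
  qed
  have left: "ext_i F i c (ext_l lP z (p \<otimes>\<^sub>c v)) = contr (\<lambda>q s. ext_l lQ s q) (ext_i F i) c (p \<otimes>\<^sub>c v) (F z)" for c p v z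
  proof -
    have "contr (\<otimes>\<^sub>c) i c (lP z p) u = contr (\<lambda>q s. ext_l lQ s q) (\<lambda>c u. contr (\<otimes>\<^sub>c) i c p u) c u (F z)" for u
    proof (rule ctensor_eqI[OF T.bounded L2.bounded_p cpl])
      fix f s
      have "contr (\<lambda>q s. lQ s q) i (c * f) p w \<otimes>\<^sub>c s =
          contr (\<lambda>q s. ext_l lQ s q) (\<lambda>c u. contr (\<otimes>\<^sub>c) i c p u) c (f \<otimes>\<^sub>c s) w" for w
        by (rule ctensor_eqI[OF blinear_compose[OF L.bounded bbil_left[OF bbil_ctensor_pure]] L2.bounded cpl])
          (simp add: times_AC_assoc times_AC_commute[of f])
      from this[of "F z"] show "contr (\<otimes>\<^sub>c) i c (lP z p) (f \<otimes>\<^sub>c s) =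
          contr (\<lambda>q s. ext_l lQ s q) (\<lambda>c u. contr (\<otimes>\<^sub>c) i c p u) c (f \<otimes>\<^sub>c s) (F z)" by (simp add: i_left)
    qed
    from this[of "F v"]
    have "ext_i F i c (ext_l lP z (p \<otimes>\<^sub>c v)) = contr (\<lambda>q s. ext_l lQ s q) (\<lambda>c u. contr (\<otimes>\<^sub>c) i c p u) c (F v) (F z)" by simp
    also have "\<dots> = contr (\<lambda>q s. ext_l lQ s q) (ext_i F i) c (p \<otimes>\<^sub>c v) (F z)" by (simp add: contr_def)
    finally show ?thesis .
  qed
  show ?thesis
  proof (unfold_locales; (rule bounded_ext_i)?)
    show "ext_i F i c (ext_r rP p v) = contr (ext_r rQ) (ext_i F i) c p (F v)" for c p v
      by (rule ctensor_eqI[OF blinear_compose[OF bbil_left[OF P'.r] bbil_right[OF bounded_ext_i]] R'.bounded_p cpl right])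
    show "ext_i F i c (ext_l lP v p) = contr (\<lambda>q s. ext_l lQ s q) (ext_i F i) c p (F v)" for c p v
      by (rule ctensor_eqI[OF blinear_compose[OF bbil_right[OF P'.l] bbil_right[OF bounded_ext_i]] L'.bounded_p cpl left])
  qed
qed

end

lemma bbil_scaleC: "bounded_cbilinear (\<lambda>c (x::'a::bornological_vector_space). c *\<^sub>C x)"
proof (rule bounded_cbilinearI)
  show "clinear (\<lambda>x::'a. c *\<^sub>C x)" for c by (rule clinear_scaleC)
  show "clinear (\<lambda>c. c *\<^sub>C x)" for x :: 'a
    by (rule clinearI) (simp_all add: scaleC_add_left scaleC_scaleC scaleC_complex_def)
  fix S :: "complex set" and T :: "'a set" assume S: "small S" and T: "small T"
  obtain r where r: "0 < r" "\<forall>c\<in>S. cmod c \<le> r" using S unfolding small_complex_def bounded_pos by blast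
  have D: "small (dilate r (disk_hull T))" by (rule small_dilate[OF small_disk_hull[OF T]])
  show "small {c *\<^sub>C x |c x. c \<in> S \<and> x \<in> T}"
  proof (rule small_subset[OF D], safe)
    fix c x assume "c \<in> S" and x: "x \<in> T"
    hence c: "cmod c * 1 \<le> r" using r(2) by simp
    have "x = of_real 1 *\<^sub>C x" by (simp add: scaleC_one)
    moreover have "x \<in> disk_hull T" using x disk_hull_subset by (rule rev_subsetD)
    ultimately have "x \<in> dilate 1 (disk_hull T)" by (rule image_eqI)
    thus "c *\<^sub>C x \<in> dilate r (disk_hull T)" by (rule dilate_scale[OF disk_disk_hull _ _ c r(1)]) simp
  qed
qed

lemma bbil_Pair:
  assumes f: "bounded_cbilinear f" and g: "bounded_cbilinear g"
  shows "bounded_cbilinear (\<lambda>x y. (f x y, g x y))"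
proof (rule bounded_cbilinearI)
  show "clinear (\<lambda>y. (f x y, g x y))" for x
    by (rule blinear_clinear[OF blinear_Pair[OF bbil_right[OF f] bbil_right[OF g]]])
  show "clinear (\<lambda>x. (f x y, g x y))" for y
    by (rule blinear_clinear[OF blinear_Pair[OF bbil_left[OF f] bbil_left[OF g]]])
  fix S T assume ST: "small (S :: 'a set)" "small (T :: 'b set)"
  have "small (fst ` {(f x y, g x y) |x y. x \<in> S \<and> y \<in> T})" by (rule small_subset[OF bbil_small[OF f ST]]) (auto, blast)
  moreover have "small (snd ` {(f x y, g x y) |x y. x \<in> S \<and> y \<in> T})"
    by (rule small_subset[OF bbil_small[OF g ST]]) (auto, blast)
  ultimately show "small {(f x y, g x y) |x y. x \<in> S \<and> y \<in> T}" by (simp add: small_prod_def)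
qed

lemma btrilinear_map:
  fixes f :: "'a::bornological_vector_space => 'b::bornological_vector_space => 'c::bornological_vector_space => 'd::bornological_vector_space"
    and g :: "'x::bornological_vector_space => 'b" and h :: "'y::bornological_vector_space => 'c"
    and k :: "'d => 'e::bornological_vector_space"
  assumes f: "btrilinear f" and g: "bounded_clinear g" and h: "bounded_clinear h" and k: "bounded_clinear k"
  shows "btrilinear (\<lambda>u x y. k (f u (g x) (h y)))"
proof (rule btrilinearI)
  note [intro] = blinear_clinear[OF g] blinear_clinear[OF h]
  show "clinear (\<lambda>y. k (f u (g x) (h y)))" for u x
    by (rule clinear_compose[OF clinear_compose[OF blinear_clinear[OF h] btrilinearD(1)[OF f]] blinear_clinear[OF k]])
  show "clinear (\<lambda>x. k (f u (g x) (h y)))" for u y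
    by (rule clinear_compose[OF clinear_compose[OF blinear_clinear[OF g] btrilinearD(2)[OF f]] blinear_clinear[OF k]])
  show "clinear (\<lambda>u. k (f u (g x) (h y)))" for x y by (rule clinear_compose[OF btrilinearD(3)[OF f] blinear_clinear[OF k]])
  fix R S T assume RST: "small (R :: 'a set)" "small (S :: 'x set)" "small (T :: 'y set)"
  from blinear_small[OF k btrilinearD(4)[OF f RST(1) blinear_small[OF g RST(2)] blinear_small[OF h RST(3)]]]
  show "small {k (f u (g x) (h y)) |u x y. u \<in> R \<and> x \<in> S \<and> y \<in> T}" by (rule small_subset) (safe, rule imageI, blast)
qed

lemma btrilinear_plus:
  assumes f: "btrilinear f" and g: "btrilinear g"
  shows "btrilinear (\<lambda>u x y. f u x y + g u x y)"
  using btrilinear_minus[OF f btrilinear_map[OF g blinear_id blinear_id blinear_uminus[OF blinear_id]]] by simp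

lemma blinear_inl:
  "bounded_clinear (\<lambda>x::'a::bornological_vector_space. (x, 0 :: 'b::bornological_vector_space))"
  by (rule blinear_Pair[OF blinear_id blinear_zero])

section \<open>The connection on the analytic tensor algebra\<close>

definition unit_l :: "'r::{bornological_vector_space, ring} => 'r unitalisation => 'r unitalisation"
  where "unit_l z x = (z \<cdot>\<^sub>l x, 0)"

definition unit_r :: "'r::{bornological_vector_space, ring} unitalisation => 'r => 'r unitalisation"
  where "unit_r x z = (x \<cdot>\<^sub>r z, 0)"

lemmas tensor_alg_algebra = tensor_alg_scaleC_left tensor_alg_scaleC_right scaleC_add_right scaleC_add_left scaleC_scaleC
  complex_vector.scale_right_diff_distrib complex_vector.scale_left_diff_distrib

lemma complete_bimodule_unit:
  "complete_bimodule (unit_l :: 'a::complete_bornological_algebra tensor_alg => _) unit_r"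
proof
  have "bounded_cbilinear (\<lambda>(z::'a tensor_alg) x. z * fst x + snd x *\<^sub>C z)"
    by (intro bbil_plus bbil_compose[OF bbil_times_tensor_alg blinear_id blinear_fst]
        bbil_flip[OF bbil_compose[OF bbil_scaleC blinear_snd blinear_id]])
  thus "bounded_cbilinear (unit_l :: 'a tensor_alg => _)"
    unfolding unit_l_def[abs_def] unital_mult_left_def by (rule blinear_cbilinear_compose[OF _ blinear_inl])
  have "bounded_cbilinear (\<lambda>x (z::'a tensor_alg). fst x * z + snd x *\<^sub>C z)"
    by (intro bbil_plus bbil_compose[OF bbil_times_tensor_alg blinear_fst blinear_id]
        bbil_compose[OF bbil_scaleC blinear_snd blinear_id])
  thus "bounded_cbilinear (unit_r :: _ => 'a tensor_alg => _)"
    unfolding unit_r_def[abs_def] unital_mult_right_def by (rule blinear_cbilinear_compose[OF _ blinear_inl])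
qed (simp_all add: unit_l_def unit_r_def unital_mult_left_def unital_mult_right_def algebra_simps tensor_alg_algebra
    bbil_times_tensor_alg bcomplete_prod bcomplete_tensor_alg bcomplete_complex)

abbreviation "fl1 \<equiv> ext_l unit_l"
abbreviation "fr1 \<equiv> ext_r unit_r"
abbreviation "fl2 \<equiv> ext_l fl1"
abbreviation "fr2 \<equiv> ext_r fr1"

interpretation O0: complete_bimodule "unit_l :: 'a::complete_bornological_algebra tensor_alg => _" unit_r
  by (rule complete_bimodule_unit)

interpretation O1: complete_bimodule "fl1 :: 'a::complete_bornological_algebra tensor_alg => _" fr1
  by (rule O0.complete_bimodule_ext)

interpretation O2: complete_bimodule "fl2 :: 'a::complete_bornological_algebra tensor_alg => _" fr2
  by (rule O1.complete_bimodule_ext)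

section \<open>One-forms and two-forms over the tensor algebra\<close>

definition dform :: "'r::bornological_vector_space => 'r Omega1"
  where "dform x = (0, 1) \<otimes>\<^sub>c x"

lemma blinear_dform: "bounded_clinear dform"
  unfolding dform_def[abs_def] by (rule bbil_right[OF bbil_ctensor_pure])

lemma dform_times: "dform (x * y) = fr1 (dform x) y + fl1 x (dform (y :: 'a::complete_bornological_algebra tensor_alg))"
  by (simp add: dform_def unit_l_def unit_r_def unital_mult_left_def unital_mult_right_def scaleC_one)

lemma fl1_dform: "fl1 x (dform y) = (x, 0) \<otimes>\<^sub>c (y :: 'a::complete_bornological_algebra tensor_alg)"
  by (simp add: dform_def unit_l_def unital_mult_left_def scaleC_one)

lemma fr1_dform: "fr1 (dform x) y = dform (x * y) - (x, 0) \<otimes>\<^sub>c (y :: 'a::complete_bornological_algebra tensor_alg)"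
  by (simp add: dform_def unit_r_def unital_mult_right_def scaleC_one)

lemma hochschild_b_eq: "hochschild_b = (\<lambda>m :: 'a::complete_bornological_algebra tensor_alg Omega2. - bicomm fl1 fr1 m)"
  unfolding hochschild_b_def
proof (rule the_equality)
  let ?g = "\<lambda>m :: 'a tensor_alg Omega2. - bicomm fl1 fr1 m"
  have g: "bounded_clinear ?g" by (rule blinear_uminus[OF O1.blinear_bicomm])
  have gp: "?g (x\<^sub>0 \<otimes>\<^sub>c x\<^sub>1 \<otimes>\<^sub>c x\<^sub>2) =
      (x\<^sub>0 \<cdot>\<^sub>r x\<^sub>1, 0) \<otimes>\<^sub>c x\<^sub>2 - x\<^sub>0 \<otimes>\<^sub>c (x\<^sub>1 * x\<^sub>2) + (x\<^sub>2 \<cdot>\<^sub>l x\<^sub>0, 0) \<otimes>\<^sub>c x\<^sub>1" for x\<^sub>0 x\<^sub>1 x\<^sub>2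
    by (simp add: unit_l_def unit_r_def)
  show "bounded_clinear ?g \<and> (\<forall>x\<^sub>0 x\<^sub>1 x\<^sub>2. ?g (x\<^sub>0 \<otimes>\<^sub>c x\<^sub>1 \<otimes>\<^sub>c x\<^sub>2) =
      (x\<^sub>0 \<cdot>\<^sub>r x\<^sub>1, 0) \<otimes>\<^sub>c x\<^sub>2 - x\<^sub>0 \<otimes>\<^sub>c (x\<^sub>1 * x\<^sub>2) + (x\<^sub>2 \<cdot>\<^sub>l x\<^sub>0, 0) \<otimes>\<^sub>c x\<^sub>1)" using g gp by (intro conjI allI)
  fix h :: "'a tensor_alg Omega2 => 'a tensor_alg Omega1"
  assume h: "bounded_clinear h \<and> (\<forall>x\<^sub>0 x\<^sub>1 x\<^sub>2. h (x\<^sub>0 \<otimes>\<^sub>c x\<^sub>1 \<otimes>\<^sub>c x\<^sub>2) =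
      (x\<^sub>0 \<cdot>\<^sub>r x\<^sub>1, 0) \<otimes>\<^sub>c x\<^sub>2 - x\<^sub>0 \<otimes>\<^sub>c (x\<^sub>1 * x\<^sub>2) + (x\<^sub>2 \<cdot>\<^sub>l x\<^sub>0, 0) \<otimes>\<^sub>c x\<^sub>1)"
  note hb = conjunct1[OF h] and hp = conjunct2[OF h, rule_format]
  show "h = ?g"
  proof (rule ctensor_ext[OF hb g bseparated_ctensor])
    fix w :: "'a tensor_alg Omega1" and z
    show "h (w \<otimes>\<^sub>c z) = ?g (w \<otimes>\<^sub>c z)"
      by (rule ctensor_eqI[where z=w, OF blinear_compose[OF bbil_left[OF bbil_ctensor_pure] hb]
            blinear_compose[OF bbil_left[OF bbil_ctensor_pure] g] bcomplete_completion]) (simp only: hp gp)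
  qed
qed

text \<open>The universal property of the tensor algebra, applied to the square zero extension of \<open>R\<close> by
  \<open>\<Omega>\<^sup>2 R\<close> with the cocycle \<open>dx dy\<close>, yields the connection.\<close>

definition sqz_mult :: "('a::complete_bornological_algebra tensor_alg \<times> 'a tensor_alg Omega2) => _ => _"
  where "sqz_mult x y = (fst x * fst y, fl2 (fst x) (snd y) + fr2 (snd x) (fst y) + dform (fst x) \<otimes>\<^sub>c fst y)"

lemma bbil_sqz_mult: "bounded_cbilinear sqz_mult" unfolding sqz_mult_def[abs_def]
  by (intro bbil_Pair bbil_plus
      bbil_compose[OF bbil_times_tensor_alg blinear_fst blinear_fst]
      bbil_compose[OF O2.l blinear_fst blinear_snd]
      bbil_compose[OF O2.r blinear_snd blinear_fst]
      bbil_compose[OF bbil_ctensor_pure blinear_compose[OF blinear_fst blinear_dform] blinear_fst])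

lemma sqz_mult_assoc: "sqz_mult (sqz_mult x y) z = sqz_mult x (sqz_mult y z)"
  by (simp add: sqz_mult_def mult.assoc O2.linear_simps O2.ll O2.rr O2.lr dform_times ctensor_pure_linear add.assoc)

text \<open>On second components, right multiplication by a curvature c is n -> n c + m with m in
  the small set \<open>M\<close>, so stability requires a contraction. Doubling the entries from
  \<open>S\<close> makes c a quarter of an element that maps \<open>N\<close> to itself: a quarter
  of 2 \<open>N\<close> plus \<open>N\<close> lies in 2 \<open>N\<close>. First components stay in
  \<open>D\<close>.\<close>

lemma sqz_invariant:
  assumes S: "small (S :: 'a::complete_bornological_algebra set)"
  shows "\<exists>P. small P \<and> (\<forall>a\<in>S. (tsigma a, 0) \<in> P) \<and>
    (\<forall>a\<in>S. \<forall>b\<in>S. (tcurv a b, - (dform (tsigma a) \<otimes>\<^sub>c tsigma b)) \<in> P) \<and>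
    (\<forall>p\<in>P. \<forall>a\<in>S. \<forall>b\<in>S. sqz_mult p (tcurv a b, - (dform (tsigma a) \<otimes>\<^sub>c tsigma b)) \<in> P)"
proof -
  define Y where "Y = even_forms (dilate 2 S)"
  have Y: "small Y" unfolding Y_def by (rule small_even_forms[OF small_dilate[OF S]])
  define D where "D = disk_hull Y"
  have D: "small D" "disk D" "Y \<subseteq> D" unfolding D_def by (rule small_disk_hull[OF Y] disk_disk_hull disk_hull_subset)+
  let ?c = "\<lambda>a b. tcurv (2 *\<^sub>C a) (2 *\<^sub>C b)" and ?e = "\<lambda>a b. - (dform (tsigma a) \<otimes>\<^sub>c tsigma b)"
  have two: "2 *\<^sub>C a \<in> dilate 2 S" if "a \<in> S" for a using that by auto
  have sig2: "tsigma (2 *\<^sub>C a) = 2 *\<^sub>C tsigma a" for a :: 'a by (rule blin_scale[OF blinear_tsigma])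
  have c4: "?c a b = 4 *\<^sub>C tcurv a b" for a b :: 'a
  proof -
    have tc: "tcurv a b = tsigma (a * b) - tsigma a * tsigma b" for a b :: 'a using tsigma_times[of a b] by simp
    have "(2 *\<^sub>C a) * (2 *\<^sub>C b) = 4 *\<^sub>C (a * b)" by (simp add: scaleC_mult_left scaleC_mult_right scaleC_scaleC)
    moreover have "tsigma (4 *\<^sub>C (a * b)) = 4 *\<^sub>C tsigma (a * b)" by (rule blin_scale[OF blinear_tsigma])
    ultimately show ?thesis by (simp add: tc sig2 tensor_alg_algebra)
  qed
  have quarter: "tcurv a b = (1 / 4) *\<^sub>C ?c a b" for a b :: 'a by (simp add: c4 scaleC_scaleC scaleC_one)
  have cY: "?c a b \<in> Y" if "a \<in> S" "b \<in> S" for a b unfolding Y_def by (rule even_forms_tcurv[OF two two]) (rule that)+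
  have Yc: "y * ?c a b \<in> Y" if "y \<in> Y" and ab: "a \<in> S" "b \<in> S" for y a b
    unfolding Y_def by (rule even_forms_times[OF that(1)[unfolded Y_def] two[OF ab(1)] two[OF ab(2)]])
  have Dc: "y * ?c a b \<in> D" if y: "y \<in> D" and ab: "a \<in> S" "b \<in> S" for y a b
  proof -
    have "D \<subseteq> (\<lambda>y. y * ?c a b) -` D" unfolding D_def
    proof (rule disk_hull_least)
      show "disk ((\<lambda>y. y * ?c a b) -` disk_hull Y)"
        by (rule disk_vimage[OF bbil_clinear_left[OF bbil_times_tensor_alg] disk_disk_hull])
      show "Y \<subseteq> (\<lambda>y. y * ?c a b) -` disk_hull Y" using Yc ab disk_hull_subset[of Y] by (intro subsetI vimageI2) (rule subsetD)
    qed
    thus ?thesis using y by (rule vimageD[OF subsetD])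
  qed
  define C where "C = {?e a b |a b. a \<in> S \<and> b \<in> S}"
  define Q where "Q = {tcurv a b |a b. a \<in> S \<and> b \<in> S}"
  have eb: "bounded_cbilinear (\<lambda>a b :: 'a. ?e a b)" by (rule bbil_uminus[OF bbil_compose[OF bbil_ctensor_pure
            blinear_compose[OF blinear_tsigma blinear_dform] blinear_tsigma]])
  have C: "small C" unfolding C_def by (rule bbil_small[OF eb S S])
  have Q: "small Q"
  proof (rule small_subset[OF D(1)])
    show "Q \<subseteq> D" unfolding Q_def
    proof safe
      fix a b assume "a \<in> S" "b \<in> S"
      thus "tcurv a b \<in> D" by (subst quarter) (intro disk_scale[OF D(2)] subsetD[OF D(3)] cY, simp_all)
    qed
  qed
  define M where "M = C \<union> ({fl2 y e |y e. y \<in> D \<and> e \<in> C} + {dform y \<otimes>\<^sub>c c |y c. y \<in> D \<and> c \<in> Q})"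
  have M: "small M" unfolding M_def by (intro small_Un C small_add bbil_small[OF O2.l D(1) C]
        bbil_small[OF bbil_compose[OF bbil_ctensor_pure blinear_dform blinear_id] D(1) Q])
  \<comment> \<open>Adding the products with \<open>D\<close> makes \<open>N\<close> stable under
    the quadrupled curvatures \<open>?c a b\<close>: (m y) c = m (y c), with y c again in
    \<open>D\<close>.\<close>
  define N where "N = disk_hull (M \<union> {fr2 m y |m y. m \<in> M \<and> y \<in> D})"
  have N: "small N" "disk N" unfolding N_def
    by (intro small_disk_hull small_Un M bbil_small[OF O2.r M D(1)] disk_disk_hull)+
  have MN: "m \<in> N" if "m \<in> M" for m unfolding N_def by (rule subsetD[OF disk_hull_subset]) (rule UnI1[OF that])
  have MDN: "fr2 m y \<in> N" if "m \<in> M" "y \<in> D" for m y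
    unfolding N_def by (rule subsetD[OF disk_hull_subset], rule UnI2, rule CollectI) (use that in blast)
  have Nc: "fr2 n (?c a b) \<in> N" if n: "n \<in> N" and ab: "a \<in> S" "b \<in> S" for n a b
  proof -
    have "N \<subseteq> (\<lambda>n. fr2 n (?c a b)) -` N" unfolding N_def[THEN arg_cong, of "\<lambda>N. N \<subseteq> _"]
    proof (rule disk_hull_least)
      show "disk ((\<lambda>n. fr2 n (?c a b)) -` N)" by (rule disk_vimage[OF bbil_clinear_left[OF O2.r] N(2)])
      show "M \<union> {fr2 m y |m y. m \<in> M \<and> y \<in> D} \<subseteq> (\<lambda>n. fr2 n (?c a b)) -` N"
      proof (rule subsetI, rule vimageI2)
        fix n assume "n \<in> M \<union> {fr2 m y |m y. m \<in> M \<and> y \<in> D}"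
        then consider "n \<in> M" | m y where "n = fr2 m y" "m \<in> M" "y \<in> D" by blast
        thus "fr2 n (?c a b) \<in> N"
        proof cases
          case 1 thus ?thesis by (rule MDN) (rule subsetD[OF D(3) cY[OF ab]])
        next
          case 2
          hence "fr2 n (?c a b) = fr2 m (y * ?c a b)" by (simp add: O2.rr)
          thus ?thesis using MDN[OF 2(2) Dc[OF 2(3) ab]] by simp
        qed
      qed
    qed
    thus ?thesis using n by (rule vimageD[OF subsetD])
  qed
  have half: "m = 2 *\<^sub>C (1 / 2) *\<^sub>C m" for m :: "'a tensor_alg Omega2" by (simp add: scaleC_scaleC scaleC_one)
  have twoN: "2 *\<^sub>C n \<in> dilate 2 N" if "n \<in> N" for n using that by (intro image_eqI[of _ _ n]) simp_all
  let ?P = "D \<times> dilate 2 N"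
  have small_P: "small ?P" unfolding small_prod_def
  proof
    show "small (fst ` ?P)" by (rule small_subset[OF D(1)]) auto
    show "small (snd ` ?P)" by (rule small_subset[OF small_dilate[OF N(1), of 2]]) (rule image_subsetI, erule SigmaE, simp only: snd_conv)
  qed
  have tD: "tcurv a b \<in> D" if "a \<in> S" "b \<in> S" for a b
    by (subst quarter) (intro disk_scale[OF D(2)] subsetD[OF D(3)] cY that, simp)
  show ?thesis
  proof (intro exI[of _ ?P] conjI ballI small_P)
    fix a assume a: "a \<in> S"
    have "tsigma (2 *\<^sub>C a) \<in> Y" unfolding Y_def by (rule even_forms_tsigma[OF two[OF a]])
    hence "(1 / 2) *\<^sub>C tsigma (2 *\<^sub>C a) \<in> D" by (intro disk_scale[OF D(2)] subsetD[OF D(3)]) simp_all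
    moreover have "0 \<in> dilate 2 N" using twoN[OF disk_0[OF N(2)]] by simp
    ultimately show "(tsigma a, 0) \<in> ?P" by (simp add: sig2 scaleC_scaleC scaleC_one)
  next
    fix a b assume ab: "a \<in> S" "b \<in> S"
    have "?e a b \<in> C" unfolding C_def using ab by blast
    hence "(1 / 2) *\<^sub>C ?e a b \<in> N" by (intro disk_scale[OF N(2)] MN) (simp_all add: M_def)
    from twoN[OF this] have "?e a b \<in> dilate 2 N" by (simp only: half[symmetric])
    thus "(tcurv a b, ?e a b) \<in> ?P" using tD[OF ab] by (intro SigmaI)
  next
    fix p a b assume p: "p \<in> ?P" and ab: "a \<in> S" "b \<in> S"
    obtain y n where yn: "p = (y, 2 *\<^sub>C n)" "y \<in> D" "n \<in> N" using p by (auto)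
    have 1: "y * tcurv a b \<in> D"
    proof -
      have "y * tcurv a b = (1 / 4) *\<^sub>C (y * ?c a b)" unfolding c4 by (simp add: tensor_alg_algebra scaleC_one)
      thus ?thesis using disk_scale[OF D(2) Dc[OF yn(2) ab], of "1 / 4"] by simp
    qed
    define m where "m = fl2 y (?e a b) + dform y \<otimes>\<^sub>c tcurv a b"
    have "m \<in> M" unfolding M_def m_def by (rule UnI2, rule set_plus_intro) (use ab yn in \<open>auto simp: C_def Q_def\<close>)
    hence mN: "m \<in> N" by (rule MN)
    have "fr2 (2 *\<^sub>C n) (tcurv a b) = (1 / 2) *\<^sub>C fr2 n (?c a b)"
      unfolding c4 by (simp add: O2.linear_simps blin_scale[OF bbil_right[OF O2.r]] scaleC_scaleC)
    also have "\<dots> = 2 *\<^sub>C (1 / 2) *\<^sub>C (1 / 2) *\<^sub>C fr2 n (?c a b)" by (simp add: scaleC_scaleC)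
    finally have 2: "fl2 y (?e a b) + fr2 (2 *\<^sub>C n) (tcurv a b) + dform y \<otimes>\<^sub>c tcurv a b =
        2 *\<^sub>C ((1 / 2) *\<^sub>C m + (1 / 2) *\<^sub>C (1 / 2) *\<^sub>C fr2 n (?c a b))"
      by (simp add: m_def scaleC_add_right scaleC_scaleC scaleC_one)
    have "(1 / 2) *\<^sub>C fr2 n (?c a b) \<in> N" by (rule disk_scale[OF N(2) Nc[OF yn(3) ab]]) simp
    from disk_convex[OF N(2) mN this, of "1 / 2"]
    have "(1 / 2) *\<^sub>C m + (1 / 2) *\<^sub>C (1 / 2) *\<^sub>C fr2 n (?c a b) \<in> N" by simp
    from twoN[OF this] show "sqz_mult p (tcurv a b, ?e a b) \<in> ?P"
      unfolding sqz_mult_def yn(1) fst_conv snd_conv 2 using 1 by (intro SigmaI)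
  qed
qed

text \<open>The first component of the extension is an endomorphism fixing the generators, hence the
  identity; multiplicativity in the second component is then the required rule.\<close>

lemma tensor_alg_connection:
  "\<exists>\<phi> :: 'a::complete_bornological_algebra tensor_alg => 'a tensor_alg Omega2. bounded_clinear \<phi> \<and>
    (\<forall>x y. \<phi> (x * y) = fl2 x (\<phi> y) + fr2 (\<phi> x) y + dform x \<otimes>\<^sub>c y) \<and> (\<forall>a. \<phi> (tsigma a) = 0)"
proof -
  have w: "(tcurv a b, - (dform (tsigma a) \<otimes>\<^sub>c tsigma b)) = (tsigma (a * b), 0) - sqz_mult (tsigma a, 0) (tsigma b, 0)" for a b :: 'a
    by (simp add: sqz_mult_def tsigma_times blin_zero[OF bbil_right[OF O2.l]] blin_zero[OF bbil_left[OF O2.r]])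
  have "\<exists>G. bounded_clinear G \<and> (\<forall>a::'a. G (tsigma a) = (tsigma a, 0)) \<and> (\<forall>x y. G (x * y) = sqz_mult (G x) (G y))"
    by (rule tensor_alg_universal[OF bcomplete_prod[OF bcomplete_tensor_alg bcomplete_completion] bbil_sqz_mult sqz_mult_assoc
          blinear_compose[OF blinear_tsigma blinear_inl] w sqz_invariant])
  then obtain G where G: "bounded_clinear G" "\<And>a::'a. G (tsigma a) = (tsigma a, 0)" "\<And>x y. G (x * y) = sqz_mult (G x) (G y)" by blast
  have "(\<lambda>x. fst (G x)) = (\<lambda>x. x)" by (rule tensor_alg_hom_ext[OF blinear_compose[OF G(1) blinear_fst] blinear_id
          bcomplete_separated[OF bcomplete_tensor_alg], where m="(*)"]) (simp_all add: G sqz_mult_def)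
  hence fst: "fst (G x) = x" for x by (rule fun_cong)
  show ?thesis
  proof (intro exI[of _ "\<lambda>x. snd (G x)"] conjI allI)
    show "bounded_clinear (\<lambda>x. snd (G x))" by (rule blinear_compose[OF G(1) blinear_snd])
  qed (simp_all add: G(2,3) sqz_mult_def fst)
qed

locale connection =
  fixes \<phi> :: "'a::complete_bornological_algebra tensor_alg => 'a tensor_alg Omega2"
  assumes \<phi>: "bounded_clinear \<phi>" and \<phi>_times: "\<phi> (x * y) = fl2 x (\<phi> y) + fr2 (\<phi> x) y + dform x \<otimes>\<^sub>c y"
    and \<phi>_tsigma: "\<phi> (tsigma a) = 0"
begin

definition \<psi> :: "'a tensor_alg Omega1 => 'a tensor_alg Omega2"
  where "\<psi> = ctensor_lift (\<lambda>x y. fl2 (fst x) (\<phi> y) + snd x *\<^sub>C \<phi> y)"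

lemma \<psi>_bil: "bounded_cbilinear (\<lambda>x y. fl2 (fst x) (\<phi> y) + snd x *\<^sub>C \<phi> y)"
  by (intro bbil_plus bbil_compose[OF O2.l blinear_fst \<phi>]
      bbil_compose[OF bbil_scaleC blinear_snd \<phi>])

lemma \<psi>: "bounded_clinear \<psi>" unfolding \<psi>_def by (rule blinear_ctensor_lift[OF \<psi>_bil bcomplete_completion])

lemma \<psi>_pure: "\<psi> (x \<otimes>\<^sub>c y) = fl2 (fst x) (\<phi> y) + snd x *\<^sub>C \<phi> y"
  unfolding \<psi>_def by (rule ctensor_lift_pure[OF \<psi>_bil bcomplete_completion])

lemma fl2_zero: "fl2 0 (m :: 'a tensor_alg Omega2) = 0" "fl2 x (0 :: 'a tensor_alg Omega2) = 0"
  by (rule blin_zero[OF bbil_left[OF O2.l]] blin_zero[OF bbil_right[OF O2.l]])+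

lemma fl2_scale: "fl2 (c *\<^sub>C x) (m :: 'a tensor_alg Omega2) = c *\<^sub>C fl2 x m" by (rule blin_scale[OF bbil_left[OF O2.l]])

lemma \<psi>_dform: "\<psi> (dform x) = \<phi> x" by (simp add: dform_def \<psi>_pure fl2_zero scaleC_one)

lemma \<psi>_left: "\<psi> (fl1 z w) = fl2 z (\<psi> w)"
proof (rule ctensor_eqI[where z=w, OF blinear_compose[OF bbil_right[OF O1.l] \<psi>]
      blinear_compose[OF \<psi> bbil_right[OF O2.l]] bcomplete_completion])
  show "\<psi> (fl1 z (x \<otimes>\<^sub>c y)) = fl2 z (\<psi> (x \<otimes>\<^sub>c y))" for x y
    by (simp add: \<psi>_pure unit_l_def unital_mult_left_def O2.linear_simps fl2_scale O2.ll)
qed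

text \<open>Together with \<open>\<psi>_left\<close> this says that \<psi> is a right connection on
  one-forms that is linear from the left.\<close>

lemma \<psi>_right: "\<psi> (fr1 w z) = fr2 (\<psi> w) z + w \<otimes>\<^sub>c z"
proof (rule ctensor_eqI[where z=w, OF blinear_compose[OF bbil_left[OF O1.r] \<psi>]
      blinear_plus[OF blinear_compose[OF \<psi> bbil_left[OF O2.r]] bbil_left[OF bbil_ctensor_pure]]
      bcomplete_completion])
  fix x y
  have "fl2 (fst x) (dform y \<otimes>\<^sub>c z) + snd x *\<^sub>C (dform y \<otimes>\<^sub>c z) = ((fst x, 0) \<otimes>\<^sub>c y + (snd x *\<^sub>C (0, 1)) \<otimes>\<^sub>c y) \<otimes>\<^sub>c z"
    by (simp add: fl1_dform ctensor_pure_linear) (simp add: dform_def)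
  also have "(fst x, 0) \<otimes>\<^sub>c y + (snd x *\<^sub>C (0, 1)) \<otimes>\<^sub>c y = ((fst x, 0) + snd x *\<^sub>C (0, 1)) \<otimes>\<^sub>c y"
    by (simp only: ctensor_pure_linear)
  also have "(fst x, 0) + snd x *\<^sub>C (0, 1) = x" by (simp add: scaleC_prod_def scaleC_complex_def prod_eq_iff)
  finally have *: "fl2 (fst x) (dform y \<otimes>\<^sub>c z) + snd x *\<^sub>C (dform y \<otimes>\<^sub>c z) = x \<otimes>\<^sub>c y \<otimes>\<^sub>c z" .
  have "\<psi> (fr1 (x \<otimes>\<^sub>c y) z) = fr2 (\<psi> (x \<otimes>\<^sub>c y)) z + (fl2 (fst x) (dform y \<otimes>\<^sub>c z) + snd x *\<^sub>C (dform y \<otimes>\<^sub>c z))"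
    by (simp add: \<psi>_pure blin_diff[OF \<psi>] unit_r_def unital_mult_right_def O2.linear_simps fl2_scale
        O2.ll O2.lr \<phi>_times scaleC_add_right del: O1.ext_l_pure)
  thus "\<psi> (fr1 (x \<otimes>\<^sub>c y) z) = fr2 (\<psi> (x \<otimes>\<^sub>c y)) z + x \<otimes>\<^sub>c y \<otimes>\<^sub>c z" by (simp only: *)
qed

text \<open>This is 1 + b \<psi>, \<open>bicomm\<close> being -b.\<close>

definition nabla :: "'a tensor_alg Omega1 => 'a tensor_alg Omega1"
  where "nabla w = w - bicomm fl1 fr1 (\<psi> w)"

lemma nabla: "bounded_clinear nabla" unfolding nabla_def[abs_def]
  by (rule blinear_minus[OF blinear_id blinear_compose[OF \<psi> O1.blinear_bicomm]])

text \<open>By the rules for \<psi>, \<psi>([w, z]) = [\<psi>(w), z] + w dz. The commutator map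
  kills the first term by b b = 0 and sends the second back to [w, z].\<close>

lemma nabla_bicomm: "nabla (bicomm fl1 fr1 m) = 0"
proof (rule ctensor_eqI[where z=m and g="\<lambda>m. 0", OF blinear_compose[OF O1.blinear_bicomm nabla] blinear_zero bcomplete_completion])
  fix w z
  have "\<psi> (bicomm fl1 fr1 (w \<otimes>\<^sub>c z)) = bicomm fl2 fr2 (\<psi> w \<otimes>\<^sub>c z) + w \<otimes>\<^sub>c z" by (simp add: blin_diff[OF \<psi>] \<psi>_left \<psi>_right)
  hence "bicomm fl1 fr1 (\<psi> (bicomm fl1 fr1 (w \<otimes>\<^sub>c z))) = bicomm fl1 fr1 (w \<otimes>\<^sub>c z)"
    by (simp only: blin_add[OF O1.blinear_bicomm] O1.bicomm_bicomm add_0_left)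
  thus "nabla (bicomm fl1 fr1 (w \<otimes>\<^sub>c z)) = 0" by (simp only: nabla_def diff_self)
qed

lemma nabla_tsigma: "nabla (x \<otimes>\<^sub>c tsigma a) = x \<otimes>\<^sub>c tsigma a"
  by (simp add: nabla_def \<psi>_pure \<phi>_tsigma fl2_zero blin_zero[OF O1.blinear_bicomm])

end

text \<open>Modulo commutators x d(y z) = x y dz + z x dy, so the differential of a product of
  generators reduces to differentials of generators. Density of the forms then gives the claim on
  the completion, which is why the target is separated.\<close>

lemma trace_zero:
  fixes T :: "'a::complete_bornological_algebra tensor_alg Omega1 => 'v::bornological_vector_space"
  assumes T: "bounded_clinear T" and sep: "bseparated TYPE('v)"
    and trace: "\<And>m. T (bicomm fl1 fr1 m) = 0" and sigma: "\<And>x a. T (x \<otimes>\<^sub>c tsigma a) = 0"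
  shows "T w = 0"
proof -
  note lin = blin_add[OF T] blin_diff[OF T]
  have prod: "T (x \<otimes>\<^sub>c (y * z)) = T ((x \<cdot>\<^sub>r y, 0) \<otimes>\<^sub>c z) + T ((z \<cdot>\<^sub>l x, 0) \<otimes>\<^sub>c y)" for x y z
    using trace[of "x \<otimes>\<^sub>c y \<otimes>\<^sub>c z"] by (simp add: lin unit_l_def unit_r_def algebra_simps)
  have curv: "T (x \<otimes>\<^sub>c tcurv u v) = 0" for x u v
  proof -
    have "tcurv u v = tsigma (u * v) - tsigma u * tsigma v" using tsigma_times[of u v] by simp
    thus ?thesis by (simp add: ctensor_pure_linear lin sigma prod)
  qed
  have "\<forall>x. T (x \<otimes>\<^sub>c even_form a as) = 0" if "proper_form a as" "even (length as)" for a as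
    using that by (rule even_form_induct) (simp_all add: sigma curv prod)
  hence forms: "T (x \<otimes>\<^sub>c even_form a as) = 0" if "proper_form a as" "even (length as)" for x a as using that by blast
  have "T (x \<otimes>\<^sub>c y) = 0" for x y
  proof -
    have "(\<lambda>y. T (x \<otimes>\<^sub>c y)) = (\<lambda>y. 0)"
      by (rule tensor_alg_ext[OF blinear_compose[OF bbil_right[OF bbil_ctensor_pure] T] blinear_zero sep forms])
    thus ?thesis by (rule fun_cong)
  qed
  hence "T = (\<lambda>w. 0)" by (intro ctensor_ext[OF T blinear_zero sep])
  thus ?thesis by (rule fun_cong)
qed

text \<open>The integral of c u' over [0, 1], for u in the completed tensor product with AC.\<close>

definition AC_diff :: "AC => (AC, 's::bornological_vector_space) ctensor => 's"
  where "AC_diff c = ctensor_lift (\<lambda>g t. AC_int c g *\<^sub>C t)"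

lemma AC_diff_facts:
  assumes "bcomplete TYPE('s::bornological_vector_space)"
  shows bounded_AC_diff: "bounded_cbilinear (AC_diff :: AC => (AC, 's) ctensor => 's)"
    and AC_diff_pure: "AC_diff c (g \<otimes>\<^sub>c (t::'s)) = AC_int c g *\<^sub>C t"
proof -
  have tri: "btrilinear (\<lambda>c g (t::'s). AC_int c g *\<^sub>C t)" by (rule btrilinear_compose[OF bbil_scaleC bbil_AC_int])
  show "bounded_cbilinear (AC_diff :: AC => (AC, 's) ctensor => 's)"
    unfolding AC_diff_def[abs_def] by (rule bbil_ctensor_lift[OF tri assms])
  show "AC_diff c (g \<otimes>\<^sub>c (t::'s)) = AC_int c g *\<^sub>C t"
    unfolding AC_diff_def by (rule ctensor_lift_pure[OF btrilinear_fix1[OF tri] assms])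
qed

lemma AC_eval_facts:
  assumes "bcomplete TYPE('s::bornological_vector_space)"
  shows bounded_AC_eval: "bounded_clinear (AC_eval t :: (AC, 's) ctensor => 's)"
    and AC_eval_pure: "AC_eval t (g \<otimes>\<^sub>c (s::'s)) = Rep_AC g t *\<^sub>C s"
proof -
  have bil: "bounded_cbilinear (\<lambda>g (s::'s). Rep_AC g t *\<^sub>C s)"
    by (rule bbil_compose[OF bbil_scaleC blinear_Rep_AC blinear_id])
  show "bounded_clinear (AC_eval t :: (AC, 's) ctensor => 's)"
    unfolding AC_eval_def by (rule blinear_ctensor_lift[OF bil assms])
  show "AC_eval t (g \<otimes>\<^sub>c (s::'s)) = Rep_AC g t *\<^sub>C s" unfolding AC_eval_def by (rule ctensor_lift_pure[OF bil assms])
qed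

text \<open>The fundamental theorem of calculus, through which the end points of the homotopy
  appear.\<close>

lemma AC_diff_one:
  assumes c: "bcomplete TYPE('s::bornological_vector_space)"
  shows "AC_diff AC_one u = AC_eval 1 u - AC_eval 0 (u :: (AC, 's) ctensor)"
  by (rule ctensor_eqI[OF bbil_right[OF bounded_AC_diff[OF c]]
        blinear_minus[OF bounded_AC_eval[OF c] bounded_AC_eval[OF c]] c])
    (simp add: AC_diff_pure[OF c] AC_eval_pure[OF c] AC_int_one complex_vector.scale_left_diff_distrib)

text \<open>\<open>AC_idiff c u w\<close> is the integral of \<open>c u w'\<close>.\<close>

definition AC_idiff :: "AC => 'b::complete_bornological_algebra AC_alg =>
    'b AC_alg => 'b tensor_alg"
  where "AC_idiff c u w = contr (\<lambda>q s. s * q) AC_diff c w u"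

interpretation S: contraction "\<lambda>q (s::'b::complete_bornological_algebra tensor_alg). s * q" AC_diff
  by unfold_locales (rule bbil_flip[OF bbil_times_tensor_alg] bounded_AC_diff bcomplete_tensor_alg)+

interpretation SR: contraction "(*) :: 'b::complete_bornological_algebra tensor_alg => _" AC_diff
  by unfold_locales (rule bbil_times_tensor_alg bounded_AC_diff bcomplete_tensor_alg)+

lemma bounded_AC_idiff_left: "bounded_clinear (\<lambda>u. AC_idiff c u w)" unfolding AC_idiff_def by (rule S.bounded)

lemma bounded_AC_idiff_right: "bounded_clinear (\<lambda>w. AC_idiff c u w)" unfolding AC_idiff_def by (rule S.bounded_p)

lemma bounded_AC_idiff_cw: "bounded_cbilinear (\<lambda>c w. AC_idiff c u w)" unfolding AC_idiff_def by (rule S.bounded_cp)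

lemma AC_idiff_pure [simp]: "AC_idiff c (f \<otimes>\<^sub>c s) w = s * AC_diff (c * f) w" by (simp add: AC_idiff_def)

lemmas AC_diff_pure' [simp] = AC_diff_pure[OF bcomplete_tensor_alg]
  and AC_eval_pure' [simp] = AC_eval_pure[OF bcomplete_tensor_alg]
  and bounded_AC_diff' = bounded_AC_diff[OF bcomplete_tensor_alg]
  and bounded_AC_eval' = bounded_AC_eval[OF bcomplete_tensor_alg]

lemmas tensor_alg_times_bounded_left = bbil_left[OF bbil_times_tensor_alg]
  and tensor_alg_times_bounded_right = bbil_right[OF bbil_times_tensor_alg]

interpretation SI: contraction "(*) :: 'b::complete_bornological_algebra tensor_alg => _" "\<lambda>c w. AC_idiff c u w" for u
  by unfold_locales (rule bbil_times_tensor_alg bounded_AC_idiff_cw bcomplete_tensor_alg)+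

lemma AC_eval_times: "AC_eval t (u * w) = AC_eval t u * AC_eval t (w :: 'b::complete_bornological_algebra AC_alg)"
proof (rule ctensor_cbilinear_eqI[where f="\<lambda>u w. AC_eval t (u * w)" and g="\<lambda>u w. AC_eval t u * AC_eval t w"])
  show "bounded_cbilinear (\<lambda>u w. AC_eval t (u * w :: 'b AC_alg))"
    by (rule blinear_cbilinear_compose[OF bbil_times_AC_tensor bounded_AC_eval'])
  show "bounded_cbilinear (\<lambda>u w. AC_eval t u * AC_eval t (w :: 'b AC_alg))"
    by (rule bbil_compose[OF bbil_times_tensor_alg bounded_AC_eval' bounded_AC_eval'])
qed (simp_all add: bcomplete_tensor_alg times_AC_tensor_pure times_AC.rep_eq tensor_alg_algebra mult.commute)

text \<open>The product rule under the integral: \<open>AC_idiff\<close> contributes c v w', and the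
  \<open>contr\<close> term is the integral of c v' w. The order of the factors is kept because TB
  need not be commutative.\<close>

lemma AC_diff_times: "AC_diff c (v * w) = AC_idiff c v w + contr (*) AC_diff c v w"
proof (rule ctensor_eqI[where z=v and f="\<lambda>v. AC_diff c (v * w)" and g="\<lambda>v. AC_idiff c v w + contr (*) AC_diff c v w"])
  show "bounded_clinear (\<lambda>v. AC_diff c (v * w))"
    by (rule blinear_compose[OF times_AC_tensor_left bbil_right[OF bounded_AC_diff']])
  show "bounded_clinear (\<lambda>v. AC_idiff c v w + contr (*) AC_diff c v w)"
    by (rule blinear_plus[OF bounded_AC_idiff_left SR.bounded_p])
  fix f s
  show "AC_diff c (f \<otimes>\<^sub>c s * w) = AC_idiff c (f \<otimes>\<^sub>c s) w + contr (*) AC_diff c (f \<otimes>\<^sub>c s) w"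
    by (rule ctensor_eqI[where z=w and f="\<lambda>w. AC_diff c (f \<otimes>\<^sub>c s * w)" and g="\<lambda>w. AC_idiff c (f \<otimes>\<^sub>c s) w + contr (*) AC_diff c (f \<otimes>\<^sub>c s) w"],
      rule blinear_compose[OF times_AC_tensor_right bbil_right[OF bounded_AC_diff']],
      rule blinear_plus[OF bounded_AC_idiff_right SR.bounded], simp_all add: bcomplete_tensor_alg times_AC_tensor_pure AC_int_times tensor_alg_algebra)
qed (rule bcomplete_tensor_alg)

lemma AC_idiff_mult_left_pure: "AC_idiff c ((f \<otimes>\<^sub>c s) * v) w = s * AC_idiff (c * f) v w"
by (rule ctensor_eqI[where z=v and f="\<lambda>v. AC_idiff c ((f \<otimes>\<^sub>c s) * v) w" and g="\<lambda>v. s * AC_idiff (c * f) v w"],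
    rule blinear_compose[OF times_AC_tensor_right bounded_AC_idiff_left],
    rule blinear_compose[OF bounded_AC_idiff_left tensor_alg_times_bounded_right], simp_all add: bcomplete_tensor_alg times_AC_tensor_pure mult.assoc times_AC_assoc)

lemma AC_idiff_times: "AC_idiff c u (v * w) = AC_idiff c (u * v) w + contr (*) (\<lambda>c w. AC_idiff c u w) c v w"
proof (rule ctensor_eqI[where z=w and f="\<lambda>w. AC_idiff c u (v * w)" and g="\<lambda>w. AC_idiff c (u * v) w + contr (*) (\<lambda>c w. AC_idiff c u w) c v w"])
  show "bounded_clinear (\<lambda>w. AC_idiff c u (v * w))"
    by (rule blinear_compose[OF times_AC_tensor_right bounded_AC_idiff_right])
  show "bounded_clinear (\<lambda>w. AC_idiff c (u * v) w + contr (*) (\<lambda>c w. AC_idiff c u w) c v w)"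
    by (rule blinear_plus[OF bounded_AC_idiff_right SI.bounded])
  fix h r
  have "AC_idiff c u (v * (h \<otimes>\<^sub>c r)) = AC_idiff c (u * v) (h \<otimes>\<^sub>c r) + AC_idiff (c * h) u v * r"
  proof (rule ctensor_eqI[where z=u and f="\<lambda>u. AC_idiff c u (v * (h \<otimes>\<^sub>c r))" and g="\<lambda>u. AC_idiff c (u * v) (h \<otimes>\<^sub>c r) + AC_idiff (c * h) u v * r"])
    show "bounded_clinear (\<lambda>u. AC_idiff c (u * v) (h \<otimes>\<^sub>c r) + AC_idiff (c * h) u v * r)"
      by (intro blinear_plus blinear_compose[OF times_AC_tensor_left bounded_AC_idiff_left]
          blinear_compose[OF bounded_AC_idiff_left tensor_alg_times_bounded_left])
    show "AC_idiff c (f \<otimes>\<^sub>c s) (v * (h \<otimes>\<^sub>c r)) = AC_idiff c (f \<otimes>\<^sub>c s * v) (h \<otimes>\<^sub>c r) + AC_idiff (c * h) (f \<otimes>\<^sub>c s) v * r" for f s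
      by (simp add: AC_idiff_mult_left_pure AC_diff_times distrib_left mult.assoc times_AC_assoc times_AC_commute[of h])
  qed (rule bounded_AC_idiff_left bcomplete_tensor_alg)+
  thus "AC_idiff c u (v * (h \<otimes>\<^sub>c r)) = AC_idiff c (u * v) (h \<otimes>\<^sub>c r) + contr (*) (\<lambda>c w. AC_idiff c u w) c v (h \<otimes>\<^sub>c r)" by simp
qed (rule bcomplete_tensor_alg)

context AC_hom
begin

text \<open>Contraction of x dy with d/dt along \<open>F\<close>: the integral of c F(x) F(y)', with
  the scalar part of x treated separately. The value is placed in the unitalisation, with scalar
  part 0, so that the target is the bimodule of \<open>unit_l\<close> and
  \<open>unit_r\<close>.\<close>

definition iota1 :: "AC => 'a tensor_alg Omega1 => 'b tensor_alg unitalisation"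
  where "iota1 c = ctensor_lift (\<lambda>x y. (AC_idiff c (F (fst x)) (F y) + snd x *\<^sub>C AC_diff c (F y), 0))"

lemma tri_iota1: "btrilinear (\<lambda>c x y. (AC_idiff c (F (fst x)) (F y) + snd x *\<^sub>C AC_diff c (F y), 0 :: complex))"
proof -
  have 1: "btrilinear (\<lambda>c u w. AC_idiff c u (w :: 'b AC_alg))"
    unfolding AC_idiff_def by (rule btrilinear_swap23[OF S.trilinear])
  have "btrilinear (\<lambda>c w k. k *\<^sub>C AC_diff c (w :: 'b AC_alg))"
    by (rule btrilinear_compose[OF bbil_flip[OF bbil_scaleC] bounded_AC_diff'])
  hence 2: "btrilinear (\<lambda>c k w. k *\<^sub>C AC_diff c (w :: 'b AC_alg))" by (rule btrilinear_swap23)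
  note Fst = blinear_compose[OF blinear_fst F]
  from btrilinear_plus[OF btrilinear_map[OF 1 Fst F blinear_id] btrilinear_map[OF 2 blinear_snd F blinear_id]]
  show ?thesis by (rule btrilinear_map[OF _ blinear_id blinear_id blinear_inl])
qed

lemma bcomplete_unit: "bcomplete TYPE('b tensor_alg unitalisation)"
  by (rule bcomplete_prod[OF bcomplete_tensor_alg bcomplete_complex])

lemma bounded_iota1: "bounded_cbilinear iota1"
  unfolding iota1_def[abs_def] by (rule bbil_ctensor_lift[OF tri_iota1 bcomplete_unit])

lemma iota1_pure: "iota1 c (x \<otimes>\<^sub>c y) = (AC_idiff c (F (fst x)) (F y) + snd x *\<^sub>C AC_diff c (F y), 0)"
  unfolding iota1_def by (rule ctensor_lift_pure[OF btrilinear_fix1[OF tri_iota1] bcomplete_unit])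

lemma F_linear: "F (x + y) = F x + F y" "F (c *\<^sub>C x) = c *\<^sub>C F x" "F 0 = 0" by (rule blin_add[OF F] blin_scale[OF F]
      blin_zero[OF F])+

text \<open>Compatibility with the right action is the product rule of \<open>AC_idiff_times\<close>
  and \<open>AC_diff_times\<close>; on the left the new factor only multiplies the undifferentiated
  one.\<close>

lemma integration_iota1: "integration F fl1 fr1 unit_l unit_r iota1"
proof unfold_locales
  show "bounded_cbilinear iota1" by (rule bounded_iota1)
  interpret R: contraction unit_r iota1 by unfold_locales (rule O0.r bounded_iota1 bcomplete_unit)+
  interpret L: contraction "\<lambda>q s. unit_l s q" iota1
    by unfold_locales (rule bbil_flip[OF O0.l] bounded_iota1 bcomplete_unit)+
  note lin = blin_add[OF bounded_AC_idiff_left]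
    blin_scale[OF bounded_AC_idiff_left]
    blin_diff[OF bbil_right[OF bounded_iota1]]
  have right: "iota1 c (fr1 (x \<otimes>\<^sub>c y) v) = contr unit_r iota1 c (x \<otimes>\<^sub>c y) (F v)" for c x y v
  proof -
    let ?u = "F (fst x)"
    have *: "contr unit_r iota1 c (x \<otimes>\<^sub>c y) w =
        (contr (*) (\<lambda>c w. AC_idiff c ?u w) c (F y) w + snd x *\<^sub>C contr (*) AC_diff c (F y) w, 0)" for w
    proof (rule ctensor_eqI[where z=w and f="contr unit_r iota1 c (x \<otimes>\<^sub>c y)"
          and g="\<lambda>w. (contr (*) (\<lambda>c w. AC_idiff c ?u w) c (F y) w + snd x *\<^sub>C contr (*) AC_diff c (F y) w, 0)"])
      show "bounded_clinear (\<lambda>w. (contr (*) (\<lambda>c w. AC_idiff c ?u w) c (F y) w + snd x *\<^sub>C contr (*) AC_diff c (F y) w, 0::complex))"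
        by (intro blinear_compose[OF blinear_plus[OF SI.bounded blinear_scaleC[OF SR.bounded]] blinear_inl])
    qed (rule R.bounded, rule bcomplete_unit, simp add: iota1_pure unit_r_def unital_mult_right_def distrib_right tensor_alg_algebra)
    show ?thesis unfolding *
      by (simp add: lin iota1_pure unital_mult_right_def unit_r_def F_linear F_times AC_idiff_times AC_diff_times scaleC_add_right)
  qed
  show "iota1 c (fr1 p v) = contr unit_r iota1 c p (F v)" for c p v
    by (rule ctensor_eqI[OF blinear_compose[OF bbil_left[OF O1.r] bbil_right[OF bounded_iota1]] R.bounded_p bcomplete_unit right])
  have left: "iota1 c (fl1 v (x \<otimes>\<^sub>c y)) = contr (\<lambda>q s. unit_l s q) iota1 c (x \<otimes>\<^sub>c y) (F v)" for c x y v
  proof -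
    let ?u = "F (fst x)"
    have *: "(AC_idiff c (w * ?u + snd x *\<^sub>C w) (F y), 0) = contr (\<lambda>q s. unit_l s q) iota1 c (x \<otimes>\<^sub>c y) w" for w
    proof (rule ctensor_eqI[where z=w and g="contr (\<lambda>q s. unit_l s q) iota1 c (x \<otimes>\<^sub>c y)"
          and f="\<lambda>w. (AC_idiff c (w * ?u + snd x *\<^sub>C w) (F y), 0)"])
      show "bounded_clinear (\<lambda>w. (AC_idiff c (w * ?u + snd x *\<^sub>C w) (F y), 0::complex))"
        by (intro blinear_compose[OF blinear_compose[OF blinear_plus[OF times_AC_tensor_left blinear_scaleC_right] bounded_AC_idiff_left] blinear_inl])
    qed (rule L.bounded, rule bcomplete_unit, unfold L.pure, simp add: iota1_pure unit_l_def unital_mult_left_def distrib_left tensor_alg_algebra lin AC_idiff_mult_left_pure)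
    show ?thesis using *[of "F v"] by (simp add: iota1_pure unit_l_def unital_mult_left_def F_linear F_times)
  qed
  show "iota1 c (fl1 v p) = contr (\<lambda>q s. unit_l s q) iota1 c p (F v)" for c p v
    by (rule ctensor_eqI[OF blinear_compose[OF bbil_right[OF O1.l] bbil_right[OF bounded_iota1]] L.bounded_p bcomplete_unit left])
qed

lemma iota1_dform: "iota1 c (dform x) = (AC_diff c (F x), 0)"
  by (simp add: dform_def iota1_pure F_linear scaleC_one blin_zero[OF bounded_AC_idiff_left])

end

sublocale AC_hom \<subseteq> I1: integration F fl1 fr1 unit_l unit_r iota1 by (rule integration_iota1)

sublocale AC_hom \<subseteq> I2: integration F fl2 fr2 fl1 fr1 "ext_i F iota1" by (rule I1.integration_ext)

section \<open>The homotopy operator\<close>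

interpretation K1: contraction "\<lambda>(q::'b tensor_alg) (s::'b::complete_bornological_algebra tensor_alg). (q, 0 :: complex) \<otimes>\<^sub>c s" AC_diff
  by unfold_locales (rule bbil_compose[OF bbil_ctensor_pure blinear_inl blinear_id]
      bounded_AC_diff' bcomplete_completion)+

interpretation K2: contraction "\<lambda>q (s::'b::complete_bornological_algebra tensor_alg). dform s \<otimes>\<^sub>c (q :: 'b tensor_alg)" AC_diff
  by unfold_locales (rule bbil_flip[OF bbil_compose[OF bbil_ctensor_pure blinear_dform blinear_id]]
      bounded_AC_diff' bcomplete_completion)+

text \<open>With \<open>K1\<close> the integral of \<open>u' dw\<close> and \<open>K2\<close> that of \<open>du w'\<close>, this is the Leibniz rule
  for the Lie derivative of \<open>u dw\<close>, up to a commutator.\<close>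

lemma AC_lie_derivative:
  fixes u w :: "'b::complete_bornological_algebra AC_alg"
  shows "contr (\<lambda>q s. (q, 0 :: complex) \<otimes>\<^sub>c s) AC_diff AC_one u w - contr (\<lambda>q s. (q, 0) \<otimes>\<^sub>c s) AC_diff AC_one w u +
      dform (AC_idiff AC_one u w) - ((AC_eval 1 u, 0) \<otimes>\<^sub>c AC_eval 1 w - (AC_eval 0 u, 0) \<otimes>\<^sub>c AC_eval 0 w) =
    bicomm fl1 fr1 (contr (\<lambda>q s. dform s \<otimes>\<^sub>c q) AC_diff AC_one w u)" (is "?l u w = ?r u w")
proof (rule ctensor_cbilinear_eqI[where f="?l" and g="?r"])
  have ev: "bounded_cbilinear (\<lambda>(u :: 'b AC_alg) w. (AC_eval t u, 0::complex) \<otimes>\<^sub>c AC_eval t (w :: 'b AC_alg))" for t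
    by (rule bbil_compose[OF bbil_ctensor_pure blinear_compose[OF bounded_AC_eval' blinear_inl] bounded_AC_eval'])
  have "bounded_cbilinear (\<lambda>u w. AC_idiff AC_one u (w :: 'b AC_alg))"
    unfolding AC_idiff_def by (rule bbil_flip[OF S.bounded_pu])
  hence "bounded_cbilinear (\<lambda>u w. dform (AC_idiff AC_one u (w :: 'b AC_alg)))"
    by (rule blinear_cbilinear_compose[OF _ blinear_dform])
  thus "bounded_cbilinear ?l" by (intro bbil_minus bbil_plus K1.bounded_pu bbil_flip[OF K1.bounded_pu] ev)
  show "bounded_cbilinear ?r" by (rule blinear_cbilinear_compose[OF bbil_flip[OF K2.bounded_pu] O1.blinear_bicomm])
  show "bcomplete TYPE('b tensor_alg Omega1)" by (rule bcomplete_completion)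
  fix f s g t
  \<comment> \<open>The integral of (f g)' evaluated by the fundamental theorem.\<close>
  have fg: "Rep_AC f 1 * Rep_AC g 1 = AC_int f g + AC_int g f + Rep_AC f 0 * Rep_AC g 0"
    using AC_int_times[of AC_one f g] by (simp add: AC_int_one times_AC.rep_eq algebra_simps)
  have d: "dform (c *\<^sub>C x) = c *\<^sub>C dform x" for c and x :: "'b tensor_alg" by (rule blin_scale[OF blinear_dform])
  have p: "(c *\<^sub>C x, 0 :: complex) = c *\<^sub>C (x, 0)" for c and x :: "'b tensor_alg"
    by (simp add: scaleC_prod_def scaleC_complex_def)
  have b: "bicomm fl1 fr1 (c *\<^sub>C m) = c *\<^sub>C bicomm fl1 fr1 m" for c and m :: "'b tensor_alg Omega2"
    by (rule blin_scale[OF O1.blinear_bicomm])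
  show "?l (f \<otimes>\<^sub>c s) (g \<otimes>\<^sub>c t) = ?r (f \<otimes>\<^sub>c s) (g \<otimes>\<^sub>c t)"
    by (simp add: p d b ctensor_pure_linear tensor_alg_algebra fl1_dform fr1_dform fg mult.commute[of "Rep_AC g 0"] mult.commute[of "Rep_AC g 1"] algebra_simps)
qed

lemma Omega1_map_facts:
  assumes f: "bounded_clinear f"
  shows bounded_Omega1_map: "bounded_clinear (Omega1_map f)"
    and Omega1_map_pure: "Omega1_map f (x \<otimes>\<^sub>c y) = (f (fst x), snd x) \<otimes>\<^sub>c f y"
proof -
  have bil: "bounded_cbilinear (\<lambda>x y. (f (fst x), snd x) \<otimes>\<^sub>c f y)" by (rule bbil_compose[OF bbil_ctensor_pure
          blinear_Pair[OF blinear_compose[OF blinear_fst f] blinear_snd] f])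
  show "bounded_clinear (Omega1_map f)" unfolding Omega1_map_def by (rule blinear_ctensor_lift[OF bil bcomplete_completion])
  show "Omega1_map f (x \<otimes>\<^sub>c y) = (f (fst x), snd x) \<otimes>\<^sub>c f y" unfolding Omega1_map_def by (rule ctensor_lift_pure[OF bil bcomplete_completion])
qed

text \<open>The witness is the image of \<open>m\<close> under the map that \<open>f\<close> induces
  on two-forms.\<close>

lemma Omega1_map_bicomm:
  fixes f :: "'a::complete_bornological_algebra tensor_alg => 'b::complete_bornological_algebra tensor_alg"
  assumes f: "bounded_clinear f" and fm: "\<And>x y. f (x * y) = f x * f y"
  shows "\<exists>m'. Omega1_map f (bicomm fl1 fr1 m) = bicomm fl1 fr1 m'"
proof -
  let ?g = "ctensor_lift (\<lambda>w y. Omega1_map f w \<otimes>\<^sub>c f y) :: 'a tensor_alg Omega2 => 'b tensor_alg Omega2"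
  have bil: "bounded_cbilinear (\<lambda>w y. Omega1_map f w \<otimes>\<^sub>c f y)"
    by (rule bbil_compose[OF bbil_ctensor_pure bounded_Omega1_map[OF f] f])
  note lin = blin_add[OF f] blin_scale[OF f]
    blin_diff[OF bounded_Omega1_map[OF f]]
  have pure: "Omega1_map f (bicomm fl1 fr1 (w \<otimes>\<^sub>c z)) = bicomm fl1 fr1 (?g (w \<otimes>\<^sub>c z))" for w z
    unfolding ctensor_lift_pure[OF bil bcomplete_completion] O1.bicomm_pure
  proof (rule ctensor_eqI[where z=w and f="\<lambda>w. Omega1_map f (fr1 w z - fl1 z w)" and g="\<lambda>w. fr1 (Omega1_map f w) (f z) - fl1 (f z) (Omega1_map f w)"])
    show "bounded_clinear (\<lambda>w. Omega1_map f (fr1 w z - fl1 z w))"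
      by (rule blinear_compose[OF bbil_left[OF O1.bbil_bicomm] bounded_Omega1_map[OF f]])
    show "bounded_clinear (\<lambda>w. fr1 (Omega1_map f w) (f z) - fl1 (f z) (Omega1_map f w))"
      by (rule blinear_compose[OF bounded_Omega1_map[OF f] bbil_left[OF O1.bbil_bicomm]])
    show "Omega1_map f (fr1 (x \<otimes>\<^sub>c y) z - fl1 z (x \<otimes>\<^sub>c y)) =
        fr1 (Omega1_map f (x \<otimes>\<^sub>c y)) (f z) - fl1 (f z) (Omega1_map f (x \<otimes>\<^sub>c y))" for x y
      by (simp add: lin Omega1_map_pure[OF f] unit_l_def unit_r_def unital_mult_left_def unital_mult_right_def fm)
  qed (rule bcomplete_completion)
  have "Omega1_map f (bicomm fl1 fr1 m) = bicomm fl1 fr1 (?g m)"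
    by (rule ctensor_eqI[OF blinear_compose[OF O1.blinear_bicomm bounded_Omega1_map[OF f]]
          blinear_compose[OF blinear_ctensor_lift[OF bil bcomplete_completion] O1.blinear_bicomm] bcomplete_completion pure])
  thus ?thesis by (rule exI)
qed

section \<open>Cartan's homotopy on forms\<close>

locale AC_connection = AC_hom F + connection \<phi>
  for F :: "'a::complete_bornological_algebra tensor_alg => 'b::complete_bornological_algebra AC_alg"
    and \<phi> :: "'a tensor_alg => 'a tensor_alg Omega2"
begin

definition h0 :: "'a tensor_alg => 'b tensor_alg Omega1"
  where "h0 x = ext_i F iota1 AC_one (\<phi> x)"

definition h1 :: "'a tensor_alg Omega1 => 'b tensor_alg"
  where "h1 w = fst (iota1 AC_one (nabla w))"

definition Ft :: "real => 'a tensor_alg => 'b tensor_alg"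
  where "Ft t x = AC_eval t (F x)"

lemma bounded_h0: "bounded_clinear h0"
  unfolding h0_def[abs_def] by (rule blinear_compose[OF \<phi> bbil_right[OF I1.bounded_ext_i]])

lemma bounded_fst_iota1: "bounded_clinear (\<lambda>w. fst (iota1 AC_one w))"
  by (rule blinear_compose[OF bbil_right[OF bounded_iota1] blinear_fst])

lemma bounded_h1: "bounded_clinear h1" unfolding h1_def[abs_def] by (rule blinear_compose[OF nabla bounded_fst_iota1])

lemma bounded_Ft: "bounded_clinear (Ft t)" unfolding Ft_def[abs_def] by (rule blinear_compose[OF F bounded_AC_eval'])

lemma Ft_times: "Ft t (x * y) = Ft t x * Ft t y" by (simp add: Ft_def F_times AC_eval_times)

text \<open>Integration commutes with b, so the commutator of \<open>h0 x\<close> cancels the b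
  \<psi> part of \<open>nabla (dform x)\<close>; what remains is the integral of F(x)'.\<close>

lemma homotopy0: "fst (bicomm unit_l unit_r (h0 x)) + h1 (dform x) = Ft 1 x - Ft 0 x"
  by (simp add: h0_def h1_def I1.bicomm_ext_i nabla_def \<psi>_dform blin_diff[OF bbil_right[OF bounded_iota1]]
      iota1_dform AC_diff_one[OF bcomplete_tensor_alg] Ft_def)

text \<open>The defect of the homotopy identity on one-forms, with the contraction
  \<open>iota1\<close> in place of \<open>h1\<close>. The correction \<open>nabla\<close> is applied
  to the argument later.\<close>

definition theta :: "'a tensor_alg Omega1 => 'b tensor_alg Omega1"
  where "theta w = h0 (fst (bicomm unit_l unit_r w)) + dform (fst (iota1 AC_one w)) - (Omega1_map (Ft 1) w - Omega1_map (Ft 0) w)"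

text \<open>On the forms x d\<sigma>(a) the defect \<open>theta\<close> is the commutator of
  \<open>beta\<close>. The first summand is the term of \<open>AC_lie_derivative\<close>, the second
  the integral of \<phi>(x) d\<sigma>(a).\<close>

definition beta :: "'a tensor_alg Omega1 => 'b tensor_alg Omega2"
  where "beta = ctensor_lift (\<lambda>x y. contr (\<lambda>q s. dform s \<otimes>\<^sub>c q) AC_diff AC_one (F y) (F (fst x)) +
    ext_i F (ext_i F iota1) AC_one (\<phi> (fst x) \<otimes>\<^sub>c y))"

lemma beta_bil: "bounded_cbilinear (\<lambda>x y. contr (\<lambda>q s. dform s \<otimes>\<^sub>c q) AC_diff AC_one (F y) (F (fst x)) +
    ext_i F (ext_i F iota1) AC_one (\<phi> (fst x) \<otimes>\<^sub>c y))" by (intro bbil_plus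
      bbil_flip[OF bbil_compose[OF K2.bounded_pu F blinear_compose[OF blinear_fst F]]]
      blinear_cbilinear_compose[OF bbil_compose[OF bbil_ctensor_pure
          blinear_compose[OF blinear_fst \<phi>] blinear_id] bbil_right[OF I2.bounded_ext_i]])

lemma bounded_beta: "bounded_clinear beta"
  unfolding beta_def by (rule blinear_ctensor_lift[OF beta_bil bcomplete_completion])

lemma beta_pure: "beta (x \<otimes>\<^sub>c y) = contr (\<lambda>q s. dform s \<otimes>\<^sub>c q) AC_diff AC_one (F y) (F (fst x)) +
    ext_i F (ext_i F iota1) AC_one (\<phi> (fst x) \<otimes>\<^sub>c y)"
  unfolding beta_def by (rule ctensor_lift_pure[OF beta_bil bcomplete_completion])

lemma bounded_theta: "bounded_clinear theta" unfolding theta_def[abs_def]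
  by (intro blinear_minus blinear_plus bounded_Omega1_map bounded_Ft
      blinear_compose[OF blinear_compose[OF O0.blinear_bicomm blinear_fst] bounded_h0]
      blinear_compose[OF bounded_fst_iota1 blinear_dform])

text \<open>As \<phi> vanishes on \<sigma>(a), its value on the commutator [x, \<sigma>(a)] is
  [\<phi>(x), \<sigma>(a)] + dx d\<sigma>(a) - d\<sigma>(a) dx. Integration turns the first term
  into a commutator, and \<open>AC_lie_derivative\<close> combines the other two with the
  differential of the contraction. The scalar part of x cancels separately.\<close>

lemma theta_tsigma: "theta (x \<otimes>\<^sub>c tsigma a) = bicomm fl1 fr1 (beta (x \<otimes>\<^sub>c tsigma a))"
proof -
  let ?x = "fst x" and ?y = "tsigma a"
  note i2 = blin_add[OF bbil_right[OF I1.bounded_ext_i]] blin_diff[OF bbil_right[OF I1.bounded_ext_i]]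
  note bl = blin_add[OF O1.blinear_bicomm]
  have k: "ext_i F iota1 AC_one (dform v \<otimes>\<^sub>c w) = contr (\<lambda>q s. (q, 0) \<otimes>\<^sub>c s) AC_diff AC_one (F v) (F w)" for v w
    by (simp add: contr_def iota1_dform)
  have "fst (bicomm unit_l unit_r (x \<otimes>\<^sub>c ?y)) = ?x * ?y - ?y * ?x"
    by (simp add: unit_l_def unit_r_def unital_mult_left_def unital_mult_right_def)
  hence "h0 (fst (bicomm unit_l unit_r (x \<otimes>\<^sub>c ?y))) = ext_i F iota1 AC_one (\<phi> (?x * ?y) - \<phi> (?y * ?x))"
    by (simp only: h0_def blin_diff[OF \<phi>])
  also have "\<dots> =
      ext_i F iota1 AC_one (fr2 (\<phi> ?x) ?y - fl2 ?y (\<phi> ?x) + (dform ?x \<otimes>\<^sub>c ?y - dform ?y \<otimes>\<^sub>c ?x))"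
    by (simp add: \<phi>_times \<phi>_tsigma fl2_zero
        blin_zero[OF bbil_left[OF O2.r]] algebra_simps)
  also have "\<dots> = ext_i F iota1 AC_one (bicomm fl2 fr2 (\<phi> ?x \<otimes>\<^sub>c ?y)) +
      (contr (\<lambda>q s. (q, 0) \<otimes>\<^sub>c s) AC_diff AC_one (F ?x) (F ?y) - contr (\<lambda>q s. (q, 0) \<otimes>\<^sub>c s) AC_diff AC_one (F ?y) (F ?x))"
    by (simp only: i2 O2.bicomm_pure k)
  also have "ext_i F iota1 AC_one (bicomm fl2 fr2 (\<phi> ?x \<otimes>\<^sub>c ?y)) = bicomm fl1 fr1 (ext_i F (ext_i F iota1) AC_one (\<phi> ?x \<otimes>\<^sub>c ?y))"
    by (rule I2.bicomm_ext_i[symmetric])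
  finally have A: "h0 (fst (bicomm unit_l unit_r (x \<otimes>\<^sub>c ?y))) = bicomm fl1 fr1 (ext_i F (ext_i F iota1) AC_one (\<phi> ?x \<otimes>\<^sub>c ?y)) +
      (contr (\<lambda>q s. (q, 0) \<otimes>\<^sub>c s) AC_diff AC_one (F ?x) (F ?y) - contr (\<lambda>q s. (q, 0) \<otimes>\<^sub>c s) AC_diff AC_one (F ?y) (F ?x))" .
  have B: "dform (fst (iota1 AC_one (x \<otimes>\<^sub>c ?y))) = dform (AC_idiff AC_one (F ?x) (F ?y)) + snd x *\<^sub>C (dform (Ft 1 ?y) - dform (Ft 0 ?y))"
    by (simp add: iota1_pure AC_diff_one[OF bcomplete_tensor_alg] Ft_def blin_add[OF blinear_dform]
        blin_diff[OF blinear_dform] blin_scale[OF blinear_dform])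
  have C: "Omega1_map (Ft t) (x \<otimes>\<^sub>c ?y) = (AC_eval t (F ?x), 0) \<otimes>\<^sub>c AC_eval t (F ?y) + snd x *\<^sub>C dform (Ft t ?y)" for t
  proof -
    have "(Ft t ?x, snd x) = (Ft t ?x, 0) + snd x *\<^sub>C (0, 1)" by (simp add: scaleC_prod_def scaleC_complex_def)
    hence "Omega1_map (Ft t) (x \<otimes>\<^sub>c ?y) = ((Ft t ?x, 0) + snd x *\<^sub>C (0, 1)) \<otimes>\<^sub>c Ft t ?y"
      by (simp only: Omega1_map_pure[OF bounded_Ft])
    thus ?thesis by (simp only: ctensor_pure_linear) (simp add: dform_def Ft_def)
  qed
  have "bicomm fl1 fr1 (beta (x \<otimes>\<^sub>c ?y)) = bicomm fl1 fr1 (contr (\<lambda>q s. dform s \<otimes>\<^sub>c q) AC_diff AC_one (F ?y) (F ?x)) +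
      bicomm fl1 fr1 (ext_i F (ext_i F iota1) AC_one (\<phi> ?x \<otimes>\<^sub>c ?y))" by (simp only: beta_pure bl)
  thus ?thesis unfolding theta_def A B C using AC_lie_derivative[of "F ?x" "F ?y"]
    by (simp add: complex_vector.scale_right_diff_distrib algebra_simps)
qed

lemma theta_nabla: "theta (nabla w) = bicomm fl1 fr1 (beta (nabla w))"
proof -
  have "theta (nabla w) - bicomm fl1 fr1 (beta (nabla w)) = 0"
  proof (rule trace_zero[where T="\<lambda>w. theta (nabla w) - bicomm fl1 fr1 (beta (nabla w))" and w=w])
    note * = blinear_minus[OF bounded_theta blinear_compose[OF bounded_beta O1.blinear_bicomm]]
    show "bounded_clinear (\<lambda>w. theta (nabla w) - bicomm fl1 fr1 (beta (nabla w)))" by (rule blinear_compose[OF nabla *])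
    show "theta (nabla (bicomm fl1 fr1 m)) - bicomm fl1 fr1 (beta (nabla (bicomm fl1 fr1 m))) = 0" for m
      using blin_zero[OF *] by (simp only: nabla_bicomm)
    show "theta (nabla (x \<otimes>\<^sub>c tsigma a)) - bicomm fl1 fr1 (beta (nabla (x \<otimes>\<^sub>c tsigma a))) = 0" for x a
      by (simp only: nabla_tsigma theta_tsigma diff_self)
  qed (rule bseparated_ctensor)
  thus ?thesis by simp
qed

text \<open>Passes from \<open>nabla w\<close> to \<open>w\<close> in \<open>theta_nabla\<close>.
  They differ by a commutator, which the boundary kills by b b = 0 and which the two induced maps
  send to commutators, those of \<open>m0\<close> and \<open>m1\<close>.\<close>

lemma homotopy1: "\<exists>m. h0 (fst (bicomm unit_l unit_r w)) + dform (h1 w) - (Omega1_map (Ft 1) w - Omega1_map (Ft 0) w) = bicomm fl1 fr1 m"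
proof -
  obtain m0 where m0: "Omega1_map (Ft 0) (bicomm fl1 fr1 (\<psi> w)) = bicomm fl1 fr1 m0"
    using Omega1_map_bicomm[OF bounded_Ft Ft_times] by blast
  obtain m1 where m1: "Omega1_map (Ft 1) (bicomm fl1 fr1 (\<psi> w)) = bicomm fl1 fr1 m1"
    using Omega1_map_bicomm[OF bounded_Ft Ft_times] by blast
  have lin: "Omega1_map (Ft t) (nabla w) = Omega1_map (Ft t) w - Omega1_map (Ft t) (bicomm fl1 fr1 (\<psi> w))" for t
    unfolding nabla_def by (rule blin_diff[OF bounded_Omega1_map[OF bounded_Ft]])
  have b: "bicomm unit_l unit_r (nabla w) = bicomm unit_l unit_r w"
    unfolding nabla_def by (simp add: blin_diff[OF O0.blinear_bicomm] O0.bicomm_bicomm)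
  note bl = blin_add[OF O1.blinear_bicomm] blin_diff[OF O1.blinear_bicomm]
  have "h0 (fst (bicomm unit_l unit_r w)) + dform (h1 w) - (Omega1_map (Ft 1) w - Omega1_map (Ft 0) w) =
      bicomm fl1 fr1 (beta (nabla w) - (m1 - m0))"
    unfolding bl using theta_nabla[of w] unfolding theta_def lin b m0 m1 by (simp add: h1_def algebra_simps)
  thus ?thesis by (rule exI)
qed

lemma h1_bicomm: "h1 (bicomm fl1 fr1 m) = 0" by (simp add: h1_def nabla_bicomm blin_zero[OF bounded_fst_iota1])

end

section \<open>Extension of a homotopy to the tensor algebra\<close>

text \<open>The sets contained in the hull of some A \<otimes> B form a convex bornology. For sums,
  x + y is the midpoint of 2x and 2y, and the factor 2 is put into the first tensor factor.\<close>

lemma small_tensorD: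
  fixes U :: "('a::bornological_vector_space, 'b::bornological_vector_space) tensor set"
  assumes "small U"
  shows "\<exists>A B. small A \<and> small B \<and> U \<subseteq> disk_hull {pure_tensor a b |a b. a \<in> A \<and> b \<in> B}"
proof -
  let ?p = "\<lambda>(A::'a set) (B::'b set). {pure_tensor a b |a b. a \<in> A \<and> b \<in> B}"
  let ?sm = "\<lambda>U. \<exists>A B. small A \<and> small B \<and> U \<subseteq> disk_hull (?p A B)"
  have scale: "\<exists>A'. small A' \<and> (\<lambda>x. c *\<^sub>C x) ` disk_hull (?p A B) \<subseteq> disk_hull (?p A' B)"
    if A: "small A" for c A B
  proof (intro exI[of _ "(\<lambda>x. c *\<^sub>C x) ` A"] conjI)
    show "small ((\<lambda>x. c *\<^sub>C x) ` A)" by (rule blinear_small[OF blinear_scaleC_right A])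
    have "(\<lambda>x. c *\<^sub>C x) ` ?p A B \<subseteq> ?p ((\<lambda>x. c *\<^sub>C x) ` A) B"
    proof safe
      fix a b assume "a \<in> A" "b \<in> B"
      thus "\<exists>a' b'. c *\<^sub>C pure_tensor a b = pure_tensor a' b' \<and> a' \<in> (\<lambda>x. c *\<^sub>C x) ` A \<and> b' \<in> B"
        by (intro exI[of _ "c *\<^sub>C a"] exI[of _ b] conjI imageI
            blin_scale[OF bbil_left[OF bbil_pure_tensor], symmetric])
    qed
    hence "disk_hull ((\<lambda>x. c *\<^sub>C x) ` ?p A B) \<subseteq> disk_hull (?p ((\<lambda>x. c *\<^sub>C x) ` A) B)"
      by (intro disk_hull_least disk_disk_hull order_trans[OF _ disk_hull_subset])
    thus "(\<lambda>x. c *\<^sub>C x) ` disk_hull (?p A B) \<subseteq> disk_hull (?p ((\<lambda>x. c *\<^sub>C x) ` A) B)"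
      by (simp only: disk_hull_image[OF clinear_scaleC])
  qed
  have mono: "disk_hull (?p A B) \<subseteq> disk_hull (?p A' B')" if "A \<subseteq> A'" "B \<subseteq> B'" for A A' B B'
    by (intro disk_hull_least disk_disk_hull order_trans[OF _ disk_hull_subset]) (use that in blast)
  have add: "?sm (S + T)" if ST: "?sm S" "?sm T" for S T
  proof -
    obtain A B where A: "small A" "small B" "S \<subseteq> disk_hull (?p A B)" using ST(1) by (elim exE conjE)
    obtain A' B' where A': "small A'" "small B'" "T \<subseteq> disk_hull (?p A' B')" using ST(2) by (elim exE conjE)
    obtain A2 where A2: "small A2" "(\<lambda>x. 2 *\<^sub>C x) ` disk_hull (?p (A \<union> A') (B \<union> B')) \<subseteq> disk_hull (?p A2 (B \<union> B'))"
      using scale[OF small_Un[OF A(1) A'(1)], of 2 "B \<union> B'"] by (elim exE conjE)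
    have "x + y \<in> disk_hull (?p A2 (B \<union> B'))" if xy: "x \<in> S" "y \<in> T" for x y
    proof -
      have "x \<in> disk_hull (?p (A \<union> A') (B \<union> B'))" by (rule subsetD[OF mono[OF Un_upper1 Un_upper1] subsetD[OF A(3) xy(1)]])
      hence x: "2 *\<^sub>C x \<in> disk_hull (?p A2 (B \<union> B'))" by (rule subsetD[OF A2(2) imageI])
      have "y \<in> disk_hull (?p (A \<union> A') (B \<union> B'))" by (rule subsetD[OF mono[OF Un_upper2 Un_upper2] subsetD[OF A'(3) xy(2)]])
      hence y: "2 *\<^sub>C y \<in> disk_hull (?p A2 (B \<union> B'))" by (rule subsetD[OF A2(2) imageI])
      from disk_convex[OF disk_disk_hull x y, of "1 / 2"] show ?thesis by (simp add: scaleC_scaleC scaleC_one)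
    qed
    hence "S + T \<subseteq> disk_hull (?p A2 (B \<union> B'))" by (intro subsetI) (erule set_plus_elim, simp)
    thus ?thesis using A2(1) small_Un[OF A(2) A'(2)] by (intro exI conjI)
  qed
  have pure: "?sm {pure_tensor a b}" for a b
  proof -
    have "{pure_tensor a b} \<subseteq> disk_hull (?p {a} {b})" by (rule order_trans[OF _ disk_hull_subset]) simp
    thus ?thesis by (intro exI conjI) (rule small_singleton)+
  qed
  have "csubspace {x. ?sm {x}}" unfolding csubspace_def
  proof (intro conjI ballI allI, unfold mem_Collect_eq)
    show "?sm {0}" using pure[of 0 0] by (simp only: blin_zero[OF bbil_right[OF bbil_pure_tensor]])
    show "?sm {x + y}" if "?sm {x}" "?sm {y}" for x y
    proof -
      have "{x} + {y} = {x + y}" by (auto simp: set_plus_def)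
      thus ?thesis using add[OF that] by simp
    qed
    show "?sm {c *\<^sub>C x}" if x: "?sm {x}" for c x
    proof -
      obtain A B where A: "small A" "small B" "{x} \<subseteq> disk_hull (?p A B)" using x by (elim exE conjE)
      obtain A' where A': "small A'" "(\<lambda>x. c *\<^sub>C x) ` disk_hull (?p A B) \<subseteq> disk_hull (?p A' B)"
        using scale[OF A(1), of c B] by (elim exE conjE)
      have "{c *\<^sub>C x} \<subseteq> disk_hull (?p A' B)" using A(3) A'(2) by auto
      thus ?thesis using A'(1) A(2) by (intro exI conjI)
    qed
  qed
  hence "cspan {pure_tensor x y |x y. True} \<subseteq> {x. ?sm {x}}"
    unfolding cspan_eq csubspace_eq by (rule complex_vector.span_minimal[rotated]) (use pure in auto)
  hence point: "?sm {x}" for x using cspan_pure_tensor[of x] by (rule CollectD[OF subsetD])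
  show ?thesis
  proof (rule generated_bornologyD[OF assms[unfolded small_tensor_def]])
    show "convex_bornology ?sm"
    proof (rule convex_bornologyI[OF point _ add])
      show "?sm T" if S: "?sm S" and "T \<subseteq> S" for S T
      proof -
        obtain A B where A: "small A" "small B" "S \<subseteq> disk_hull (?p A B)" using S by (elim exE conjE)
        thus ?thesis using order_trans[OF \<open>T \<subseteq> S\<close>] by (intro exI[of _ A] exI[of _ B] conjI)
      qed
      show "?sm (disk_hull S)" if S: "?sm S" for S
      proof -
        obtain A B where A: "small A" "small B" "S \<subseteq> disk_hull (?p A B)" using S by (elim exE conjE)
        thus ?thesis using disk_hull_least[OF disk_disk_hull] by (intro exI[of _ A] exI[of _ B] conjI)
      qed
    qed
    fix T assume "T \<in> {?p S T |S T. small S \<and> small T}"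
    then obtain A B where A: "small A" "small B" "T = ?p A B" by auto
    thus "?sm T" using disk_hull_subset by (intro exI[of _ A] exI[of _ B] conjI) simp_all
  qed
qed

text \<open>One argument at a time: the preimage of a disk under a linear map is a disk, so it
  contains the hull once it contains the generators.\<close>

lemma disk_hull_bilinear:
  assumes f: "cbilinear f" and D: "disk D" and sub: "\<And>a b. a \<in> A ==> b \<in> B ==> f a b \<in> D"
    and x: "x \<in> disk_hull A" and y: "y \<in> disk_hull B"
  shows "f x y \<in> D"
proof -
  have "f a y \<in> D" if a: "a \<in> A" for a
  proof -
    have "disk_hull B \<subseteq> (\<lambda>y. f a y) -` D"
      by (rule disk_hull_least[OF disk_vimage[OF cbilinear_right[OF f] D]]) (use sub[OF a] in auto)
    thus ?thesis using y by (rule vimageD[OF subsetD])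
  qed
  hence "disk_hull A \<subseteq> (\<lambda>x. f x y) -` D" by (intro disk_hull_least[OF disk_vimage[OF cbilinear_left[OF f] D]]) auto
  thus ?thesis using x by (rule vimageD[OF subsetD])
qed

lemma hat_mono: "disk S ==> disk T ==> S \<subseteq> T ==> x \<in> hat S ==> x \<in> hat T"
proof -
  assume S: "disk S" and T: "disk T" and ST: "S \<subseteq> T" and "x \<in> hat S"
  then obtain X where X: "x = cseq X" "range X \<subseteq> S" "disk_Cauchy S X" unfolding hat_def by auto
  have "S \<subseteq> dilate 1 T" using ST by (simp add: scaleC_one)
  hence "disk_Cauchy T X" by (rule disk_Cauchy_mono[OF S T _ _ X(3)]) simp
  thus "x \<in> hat T" unfolding X(1) by (rule cseq_in_hat[OF order_trans[OF X(2) ST]])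
qed

lemma hat_image:
  assumes f: "clinear f" and S: "disk S" and T: "disk T" and ST: "f ` S \<subseteq> T" and X: "range X \<subseteq> S" "disk_Cauchy S X"
  shows "cseq (\<lambda>n. f (X n)) \<in> hat T"
proof (rule cseq_in_hat)
  show "range (\<lambda>n. f (X n)) \<subseteq> T" using ST X(1) by auto
  have "f ` S \<subseteq> dilate 1 T" using ST by (simp add: scaleC_one)
  thus "disk_Cauchy T (\<lambda>n. f (X n))" by (rule disk_Cauchy_transfer[OF f S T _ _ X(2)]) simp
qed

section \<open>Curvature of the extended homotopy\<close>

definition sigma_AC :: "(AC, 'b::complete_bornological_algebra) tensor => (AC, 'b tensor_alg) tensor"
  where "sigma_AC = tensor_lift (\<lambda>c b. pure_tensor c (tsigma b))"

lemma bounded_sigma_AC: "bounded_clinear (sigma_AC :: (AC, 'b::complete_bornological_algebra) tensor => _)"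
  and sigma_AC_pure: "sigma_AC (pure_tensor c b) = pure_tensor c (tsigma (b::'b))"
proof -
  have bil: "bounded_cbilinear (\<lambda>c (b::'b). pure_tensor c (tsigma b) :: (AC, 'b tensor_alg) tensor)"
    by (rule bbil_compose[OF bbil_pure_tensor blinear_id blinear_tsigma])
  show "bounded_clinear (sigma_AC :: (AC, 'b) tensor => _)" unfolding sigma_AC_def by (rule blinear_tensor_lift[OF bil])
  show "sigma_AC (pure_tensor c b) = pure_tensor c (tsigma b)"
    unfolding sigma_AC_def by (rule tensor_lift_pure[OF bbil_cbilinear[OF bil]])
qed

definition sigma_hat :: "(AC, 'b::complete_bornological_algebra) ctensor => 'b AC_alg"
  where "sigma_hat = completion_lift (\<lambda>x. to_completion (sigma_AC x))"

lemma bounded_sigma_hat: "bounded_clinear (sigma_hat :: (AC, 'b::complete_bornological_algebra) ctensor => _)"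
  and sigma_hat_pure: "sigma_hat (c \<otimes>\<^sub>c b) = c \<otimes>\<^sub>c tsigma (b::'b)"
proof -
  have b: "bounded_clinear (\<lambda>x. to_completion (sigma_AC x :: (AC, 'b tensor_alg) tensor))"
    by (rule blinear_compose[OF bounded_sigma_AC blinear_to_completion])
  show "bounded_clinear (sigma_hat :: (AC, 'b) ctensor => _)"
    unfolding sigma_hat_def by (rule blinear_completion_lift[OF b bcomplete_completion])
  show "sigma_hat (c \<otimes>\<^sub>c b) = c \<otimes>\<^sub>c tsigma (b::'b)" unfolding sigma_hat_def ctensor_pure_def
    by (simp only: completion_lift_to_completion[OF b bcomplete_completion] sigma_AC_pure)
qed

lemmas bounded_times_AC_alg = bbil_times_tensor[OF bbil_times_AC bbil_times]
  and bounded_times_AC_tensor_alg = bbil_times_tensor[OF bbil_times_AC bbil_times_tensor_alg]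
  and AC_alg_pure = times_tensor_pure[OF bbil_times_AC bbil_times]
  and AC_tensor_alg_pure = times_tensor_pure[OF bbil_times_AC bbil_times_tensor_alg]

text \<open>The curvature of \<open>sigma_hat\<close> takes values in the forms of degree two, with coefficients in a
  ball of \<open>AC\<close> that is closed under multiplication.\<close>

lemma sigma_hat_invariant:
  fixes T :: "(AC, 'b::complete_bornological_algebra) ctensor set"
  assumes T: "small T"
  shows "\<exists>P. small P \<and> (\<forall>a\<in>T. sigma_hat a \<in> P) \<and>
    (\<forall>a\<in>T. \<forall>b\<in>T. sigma_hat (a * b) - sigma_hat a * sigma_hat b \<in> P) \<and>
    (\<forall>p\<in>P. \<forall>a\<in>T. \<forall>b\<in>T. p * (sigma_hat (a * b) - sigma_hat a * sigma_hat b) \<in> P)"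
proof -
  obtain G0 where G0: "small G0" "disk G0" "T \<subseteq> hat G0" using small_completionD[OF T] by (elim exE conjE)
  obtain A B0 where AB: "small A" "small B0" "G0 \<subseteq> disk_hull {pure_tensor a b |a b. a \<in> A \<and> b \<in> (B0 :: 'b set)}"
    using small_tensorD[OF G0(1)] by (elim exE conjE)
  obtain r where r: "0 < r" "\<And>f. f \<in> A ==> \<exists>g. AC_norm g \<le> 1 / 2 \<and> f = of_real r *\<^sub>C g"
    using small_AC_absorbed[OF AB(1)] by blast
  \<comment> \<open>\<open>C\<close> is closed under products by \<open>AC_norm_times\<close>. The
    factor \<open>r\<close> that shrinks the functions into \<open>C\<close> is moved to the algebra
    factors, which turns \<open>B0\<close> into \<open>B\<close>.\<close>
  define C where "C = {f. AC_norm f \<le> 1 / 2}"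
  define B where "B = dilate r B0"
  have C: "small C" unfolding C_def small_AC_def by blast
  have CC: "f * g \<in> C" if "f \<in> C" "g \<in> C" for f g
  proof -
    have "AC_norm f * AC_norm g \<le> 1 / 2 * (1 / 2)" using that AC_norm_nonneg unfolding C_def by (intro mult_mono) auto
    thus ?thesis using AC_norm_times[of f g] unfolding C_def by simp
  qed
  have B: "small B" unfolding B_def by (rule small_dilate[OF AB(2)])
  define G where "G = disk_hull {pure_tensor c b |c b. c \<in> C \<and> b \<in> B}"
  define Y where "Y = even_forms B"
  have Y: "small Y" unfolding Y_def by (rule small_even_forms[OF B])
  define Q where "Q = {tcurv u v |u v. u \<in> B \<and> v \<in> B}"
  have QY: "Q \<subseteq> Y" unfolding Q_def Y_def by (auto intro: even_forms_tcurv)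
  have sY: "tsigma b \<in> Y" if "b \<in> B" for b unfolding Y_def by (rule even_forms_tsigma[OF that])
  have YQ: "y * q \<in> Y" if "y \<in> Y" "q \<in> Q" for y q using that unfolding Y_def Q_def by (auto intro: even_forms_times)
  define P where "P = disk_hull {pure_tensor c y |c y. c \<in> C \<and> y \<in> Y}"
  define H where "H = disk_hull {pure_tensor c q |c q. c \<in> C \<and> q \<in> Q}"
  have G: "small G" "disk G" unfolding G_def by (intro small_disk_hull small_pure_tensor C B disk_disk_hull)+
  have P: "small P" "disk P" unfolding P_def by (intro small_disk_hull small_pure_tensor C Y disk_disk_hull)+
  have H: "small H" "disk H" unfolding H_def
    by (intro small_disk_hull small_pure_tensor C small_subset[OF Y QY] disk_disk_hull)+
  have HP: "H \<subseteq> P"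
    unfolding H_def P_def by (intro disk_hull_least disk_disk_hull order_trans[OF _ disk_hull_subset]) (use QY in blast)
  have G0G: "G0 \<subseteq> G"
  proof (rule order_trans[OF AB(3)], unfold G_def, intro disk_hull_least disk_disk_hull order_trans[OF _ disk_hull_subset], safe)
    fix a b assume ab: "a \<in> A" "b \<in> B0"
    obtain g where g: "AC_norm g \<le> 1 / 2" "a = of_real r *\<^sub>C g" using r(2)[OF ab(1)] by (elim exE conjE)
    have "pure_tensor a b = pure_tensor g (of_real r *\<^sub>C b)"
      unfolding g(2) by (simp only: blin_scale[OF bbil_left[OF bbil_pure_tensor]]
          blin_scale[OF bbil_right[OF bbil_pure_tensor]])
    thus "\<exists>c b'. pure_tensor a b = pure_tensor c b' \<and> c \<in> C \<and> b' \<in> B" using g(1) ab(2) unfolding C_def B_def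
      by (intro exI[of _ g] exI[of _ "of_real r *\<^sub>C b"] conjI imageI) simp_all
  qed
  \<comment> \<open>The curvature before completion: on pure tensors it is c c' \<otimes>
    \<open>tcurv b b'\<close>. Representing sequences carry the inclusions for \<open>H\<close> and
    \<open>P\<close> over to the completion.\<close>
  define k where "k x y = sigma_AC (x * y) - sigma_AC x * sigma_AC y" for x y :: "(AC, 'b) tensor"
  have k: "bounded_cbilinear k" unfolding k_def[abs_def]
    by (intro bbil_minus blinear_cbilinear_compose[OF bounded_times_AC_alg bounded_sigma_AC]
        bbil_compose[OF bounded_times_AC_tensor_alg bounded_sigma_AC bounded_sigma_AC])
  have k_pure: "k (pure_tensor c b) (pure_tensor c' b') = pure_tensor (c * c') (tcurv b b')" for c b c' b'
  proof -
    have "tcurv b b' = tsigma (b * b') - tsigma b * tsigma b'" using tsigma_times[of b b'] by simp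
    thus ?thesis unfolding k_def by (simp only: AC_alg_pure AC_tensor_alg_pure sigma_AC_pure
          blin_diff[OF bbil_right[OF bbil_pure_tensor]])
  qed
  have kH: "k x y \<in> H" if "x \<in> G" "y \<in> G" for x y
  proof (rule disk_hull_bilinear[OF bbil_cbilinear[OF k] H(2) _ that[unfolded G_def]])
    fix x y assume "x \<in> {pure_tensor c b |c b. c \<in> C \<and> b \<in> B}" "y \<in> {pure_tensor c b |c b. c \<in> C \<and> b \<in> B}"
    then obtain c b c' b' where "x = pure_tensor c b" "c \<in> C" "b \<in> B" "y = pure_tensor c' b'" "c' \<in> C" "b' \<in> B" by auto
    hence "k x y = pure_tensor (c * c') (tcurv b b')" "c * c' \<in> C" "tcurv b b' \<in> Q" by (auto simp: k_pure Q_def CC)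
    thus "k x y \<in> H" unfolding H_def by (intro subsetD[OF disk_hull_subset]) auto
  qed
  have PH: "x * y \<in> P" if "x \<in> P" "y \<in> H" for x y
  proof (rule disk_hull_bilinear[OF bbil_cbilinear[OF bounded_times_AC_tensor_alg] P(2) _ that[unfolded P_def H_def]])
    fix x y assume "x \<in> {pure_tensor c y |c y. c \<in> C \<and> y \<in> Y}" "y \<in> {pure_tensor c q |c q. c \<in> C \<and> q \<in> Q}"
    then obtain c b c' b' where "x = pure_tensor c b" "c \<in> C" "b \<in> Y" "y = pure_tensor c' b'" "c' \<in> C" "b' \<in> Q" by auto
    hence "x * y = pure_tensor (c * c') (b * b')" "c * c' \<in> C" "b * b' \<in> Y" by (auto simp: AC_tensor_alg_pure YQ CC)
    thus "x * y \<in> P" unfolding P_def by (intro subsetD[OF disk_hull_subset]) auto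
  qed
  have GP: "sigma_AC ` G \<subseteq> P"
  proof -
    have "sigma_AC ` {pure_tensor c b |c b. c \<in> C \<and> b \<in> B} \<subseteq> {pure_tensor c y |c y. c \<in> C \<and> y \<in> Y}"
    proof safe
      fix c b assume "c \<in> C" "b \<in> B"
      thus "\<exists>c' y. sigma_AC (pure_tensor c b) = pure_tensor c' y \<and> c' \<in> C \<and> y \<in> Y"
        by (intro exI[of _ c] exI[of _ "tsigma b"]) (simp add: sigma_AC_pure sY)
    qed
    thus ?thesis unfolding G_def P_def disk_hull_image[OF blinear_clinear[OF bounded_sigma_AC], symmetric]
      by (intro disk_hull_least disk_disk_hull order_trans[OF _ disk_hull_subset])
  qed
  have rep: "\<exists>X. a = cseq X \<and> range X \<subseteq> G \<and> disk_Cauchy G X" if "a \<in> T" for a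
  proof -
    have "a \<in> hat G" by (rule hat_mono[OF G0(2) G(2) G0G subsetD[OF G0(3) that]])
    thus ?thesis unfolding hat_def by auto
  qed
  have in_P: "sigma_hat a \<in> hat P" if "a \<in> T" for a
  proof -
    obtain X where X: "a = cseq X" "range X \<subseteq> G" "disk_Cauchy G X" using rep[OF \<open>a \<in> T\<close>] by (elim exE conjE)
    have "sigma_hat a = cseq (\<lambda>n. sigma_AC (X n))"
      unfolding X(1) sigma_hat_def by (rule completion_lift_cseq[OF bounded_sigma_AC disk_Cauchy_Mackey[OF G X(3)]])
    thus ?thesis using hat_image[OF blinear_clinear[OF bounded_sigma_AC] G(2) P(2) GP X(2,3)] by simp
  qed
  have in_H: "sigma_hat (a * b) - sigma_hat a * sigma_hat b \<in> hat H" if "a \<in> T" "b \<in> T" for a b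
  proof -
    obtain X where X: "a = cseq X" "range X \<subseteq> G" "disk_Cauchy G X" using rep[OF \<open>a \<in> T\<close>] by (elim exE conjE)
    obtain Z where Z: "b = cseq Z" "range Z \<subseteq> G" "disk_Cauchy G Z" using rep[OF \<open>b \<in> T\<close>] by (elim exE conjE)
    have MX: "Mackey_Cauchy X" and MZ: "Mackey_Cauchy Z" by (rule disk_Cauchy_Mackey[OF G X(3)] disk_Cauchy_Mackey[OF G Z(3)])+
    have XZ: "X n \<in> G" "Z n \<in> G" for n using X(2) Z(2) by auto
    have sX: "sigma_hat (cseq W) = cseq (\<lambda>n. sigma_AC (W n))" if "Mackey_Cauchy W" for W :: "nat => (AC, 'b) tensor"
      unfolding sigma_hat_def by (rule completion_lift_cseq[OF bounded_sigma_AC that])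
    have M1: "Mackey_Cauchy (\<lambda>n. X n * Z n)" by (rule Mackey_Cauchy_bilinear[OF bounded_times_AC_alg MX MZ])
    have M2: "Mackey_Cauchy (\<lambda>n. sigma_AC (X n))" "Mackey_Cauchy (\<lambda>n. sigma_AC (Z n))" "Mackey_Cauchy (\<lambda>n. sigma_AC (X n * Z n))"
      by (rule blinear_Mackey_Cauchy[OF bounded_sigma_AC MX] blinear_Mackey_Cauchy[OF bounded_sigma_AC MZ]
          blinear_Mackey_Cauchy[OF bounded_sigma_AC M1])+
    have "sigma_hat (a * b) - sigma_hat a * sigma_hat b = cseq (\<lambda>n. sigma_AC (X n * Z n)) - cseq (\<lambda>n. sigma_AC (X n) * sigma_AC (Z n))"
      unfolding X(1) Z(1) cseq_times[OF bounded_times_AC_alg MX MZ] sX[OF MX] sX[OF MZ] sX[OF M1]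
        cseq_times[OF bounded_times_AC_tensor_alg M2(1,2)] by (rule refl)
    also have "\<dots> = cseq (\<lambda>n. k (X n) (Z n))"
      unfolding k_def by (rule cseq_minus[OF M2(3) Mackey_Cauchy_bilinear[OF bounded_times_AC_tensor_alg M2(1,2)]])
    also have "\<dots> \<in> hat H"
    proof (rule cseq_in_hat)
      show "range (\<lambda>n. k (X n) (Z n)) \<subseteq> H" using kH XZ by auto
      show "disk_Cauchy H (\<lambda>n. k (X n) (Z n))"
        by (rule disk_Cauchy_bilinear[OF bbil_cbilinear[OF k] G(2) G(2) H(2) kH X(2,3) Z(2,3)])
    qed
    finally show ?thesis .
  qed
  show ?thesis
  proof (intro exI[of _ "hat P"] conjI ballI)
    show "small (hat P)" by (rule small_hat[OF P])
    show "sigma_hat a \<in> hat P" if "a \<in> T" for a by (rule in_P[OF that])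
    show "sigma_hat (a * b) - sigma_hat a * sigma_hat b \<in> hat P" if "a \<in> T" "b \<in> T" for a b
      by (rule hat_mono[OF H(2) P(2) HP in_H[OF that]])
    show "p * (sigma_hat (a * b) - sigma_hat a * sigma_hat b) \<in> hat P" if "p \<in> hat P" "a \<in> T" "b \<in> T" for p a b
      by (rule hat_times[OF bounded_times_AC_tensor_alg P H P(2) PH that(1) in_H[OF that(2,3)]])
  qed
qed

text \<open>Evaluation at t commutes with the extension because both sides are homomorphisms that
  agree on generators. That the evaluation of \<Phi> is a bounded homomorphism is supplied at t = 0
  and t = 1 by the two given maps.\<close>

lemma AC_hom_exists:
  fixes \<Phi> :: "'a::complete_bornological_algebra => (AC, 'b::complete_bornological_algebra) ctensor"
  assumes \<Phi>: "bounded_hom \<Phi>"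
  shows "\<exists>F. AC_hom F \<and> (\<forall>t. bounded_hom (AC_eval t \<circ> \<Phi>) \<longrightarrow> (\<forall>x. AC_eval t (F x) = tensor_alg_map (AC_eval t \<circ> \<Phi>) x))"
proof -
  have \<Phi>b: "bounded_clinear \<Phi>" and \<Phi>m: "\<Phi> (x * y) = \<Phi> x * \<Phi> y" for x y using \<Phi> by (simp_all add: bounded_hom_def)
  have "\<exists>F. bounded_clinear F \<and> (\<forall>a. F (tsigma a) = sigma_hat (\<Phi> a)) \<and> (\<forall>x y. F (x * y) = F x * F y)"
  proof (rule tensor_alg_universal[OF bcomplete_completion bbil_times_AC_tensor times_AC_tensor_assoc
        blinear_compose[OF \<Phi>b bounded_sigma_hat] refl])
    fix S :: "'a set" assume "small S"
    from sigma_hat_invariant[OF blinear_small[OF \<Phi>b this]]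
    show "\<exists>P. small P \<and> (\<forall>a\<in>S. sigma_hat (\<Phi> a) \<in> P) \<and>
        (\<forall>a\<in>S. \<forall>b\<in>S. sigma_hat (\<Phi> (a * b)) - sigma_hat (\<Phi> a) * sigma_hat (\<Phi> b) \<in> P) \<and>
        (\<forall>p\<in>P. \<forall>a\<in>S. \<forall>b\<in>S. p * (sigma_hat (\<Phi> (a * b)) - sigma_hat (\<Phi> a) * sigma_hat (\<Phi> b)) \<in> P)"
      by (simp only: \<Phi>m ball_simps)
  qed
  then obtain F where F: "bounded_clinear F" "\<And>a. F (tsigma a) = sigma_hat (\<Phi> a)" "\<And>x y. F (x * y) = F x * F y" by blast
  have c: "bcomplete TYPE('b)" by (rule bcomplete_complete_class)
  have ev: "AC_eval t (sigma_hat u) = tsigma (AC_eval t u)" for t and u :: "(AC, 'b) ctensor"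
    by (rule ctensor_eqI[where z=u, OF blinear_compose[OF bounded_sigma_hat bounded_AC_eval']
          blinear_compose[OF bounded_AC_eval[OF c] blinear_tsigma] bcomplete_tensor_alg])
      (simp add: sigma_hat_pure AC_eval_pure[OF c] blin_scale[OF blinear_tsigma])
  have "AC_eval t (F x) = tensor_alg_map (AC_eval t \<circ> \<Phi>) x" if h: "bounded_hom (AC_eval t \<circ> \<Phi>)" for t x
  proof -
    have "(\<lambda>x. AC_eval t (F x)) = tensor_alg_map (AC_eval t \<circ> \<Phi>)"
    proof (rule tensor_alg_hom_ext[OF blinear_compose[OF F(1) bounded_AC_eval'] blinear_tensor_alg_map[OF h]
          bcomplete_separated[OF bcomplete_tensor_alg], where m="(*)"])
      show "AC_eval t (F (tsigma a)) = tensor_alg_map (AC_eval t \<circ> \<Phi>) (tsigma a)" for a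
        by (simp add: F(2) ev tensor_alg_map_tsigma[OF h])
    qed (simp_all add: F(3) AC_eval_times tensor_alg_map_times[OF h])
    thus ?thesis by (rule fun_cong)
  qed
  moreover have "AC_hom F" by (rule AC_hom.intro[OF F(1,3)])
  ultimately show ?thesis by blast
qed

section \<open>The homotopy on the X-complex\<close>

lemma abs_X1_linear:
  "abs_X1 (x + y) = abs_X1 x + abs_X1 y" "abs_X1 (x - y) = abs_X1 x - abs_X1 y" "abs_X1 (c *\<^sub>C x) = c *\<^sub>C abs_X1 x"
  by (simp_all add: plus_X1.abs_eq minus_X1.abs_eq scaleC_X1.abs_eq)

lemma bounded_abs_X1: "bounded_clinear abs_X1"
  by (rule bounded_clinearI, rule clinearI, simp_all add: abs_X1_linear) (auto simp: small_X1_def)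

lemma abs_rep_X1: "abs_X1 (rep_X1 \<eta>) = \<eta>" by (rule Quotient_abs_rep[OF Quotient_X1])

lemma abs_X1_bicomm: "abs_X1 (bicomm fl1 fr1 (m :: 'a::complete_bornological_algebra tensor_alg Omega2)) = 0"
proof -
  have "hochschild_b (- m) = bicomm fl1 fr1 m" by (simp add: hochschild_b_eq blin_uminus[OF O1.blinear_bicomm])
  hence "bicomm fl1 fr1 m - 0 \<in> cspan (range hochschild_b)" by (metis cspan_base diff_zero rangeI)
  thus ?thesis unfolding zero_X1_def X1.abs_eq_iff by simp
qed

text \<open>Two representatives differ by an element of the range of b, on which \<open>f\<close>
  vanishes, so evaluation on \<open>rep_X1\<close> inherits linearity. A small set in X1 is the
  image of a small set of one-forms, which gives boundedness.\<close>

lemma X1_lift: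
  fixes f :: "'a::complete_bornological_algebra tensor_alg Omega1 => 'v::bornological_vector_space"
  assumes f: "bounded_clinear f" and b: "\<And>m. f (bicomm fl1 fr1 m) = 0"
  shows X1_lift_abs: "f (rep_X1 (abs_X1 w)) = f w" and bounded_X1_lift: "bounded_clinear (\<lambda>\<eta>. f (rep_X1 \<eta>))"
proof -
  have abs: "f (rep_X1 (abs_X1 w)) = f w" for w
  proof -
    have "rep_X1 (abs_X1 w) - w \<in> cspan (range hochschild_b)" unfolding X1.abs_eq_iff[symmetric] by (rule abs_rep_X1)
    hence "f (rep_X1 (abs_X1 w) - w) = 0"
    proof (rule clinear_zero_on_cspan[OF blinear_clinear[OF f], rotated])
      fix x :: "'a tensor_alg Omega1" assume "x \<in> range hochschild_b"
      then obtain m where "x = - bicomm fl1 fr1 m" by (auto simp: hochschild_b_eq)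
      thus "f x = 0" by (simp add: blin_uminus[OF f] b)
    qed
    thus ?thesis by (simp add: blin_diff[OF f])
  qed
  thus "f (rep_X1 (abs_X1 w)) = f w" .
  show "bounded_clinear (\<lambda>\<eta>. f (rep_X1 \<eta>))"
  proof (rule bounded_clinearI)
    show "clinear (\<lambda>\<eta>. f (rep_X1 \<eta>))"
    proof (rule clinearI)
      show "f (rep_X1 (x + y)) = f (rep_X1 x) + f (rep_X1 y)" for x y
        using abs[of "rep_X1 x + rep_X1 y"] by (simp add: abs_X1_linear abs_rep_X1 blin_add[OF f])
      show "f (rep_X1 (c *\<^sub>C x)) = c *\<^sub>C f (rep_X1 x)" for c x
        using abs[of "c *\<^sub>C rep_X1 x"] by (simp add: abs_X1_linear abs_rep_X1 blin_scale[OF f])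
    qed
    fix T :: "'a tensor_alg X1 set" assume "small T"
    then obtain S where S: "small S" "T = abs_X1 ` S" unfolding small_X1_def by (elim exE conjE)
    have "(\<lambda>\<eta>. f (rep_X1 \<eta>)) ` T = f ` S" unfolding S(2) image_image abs by (rule refl)
    thus "small ((\<lambda>\<eta>. f (rep_X1 \<eta>)) ` T)" using blinear_small[OF f S(1)] by simp
  qed
qed

lemma X_boundary0_eq: "X_boundary0 x = abs_X1 (dform x)" by (simp add: X_boundary0_def X1_form_def dform_def)

lemma bounded_X_boundary0: "bounded_clinear (X_boundary0 :: 'a::complete_bornological_algebra tensor_alg => _)"
  unfolding X_boundary0_eq[abs_def] by (rule blinear_compose[OF blinear_dform bounded_abs_X1])

lemma X_boundary1_facts:
  shows X_boundary1_abs: "X_boundary1 (abs_X1 w) = fst (bicomm unit_l unit_r (w :: 'a::complete_bornological_algebra tensor_alg Omega1))"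
    and bounded_X_boundary1: "bounded_clinear (X_boundary1 :: 'a tensor_alg X1 => _)"
proof -
  let ?c = "\<lambda>w :: 'a tensor_alg Omega1. fst (bicomm unit_l unit_r w)"
  have c: "bounded_clinear ?c" by (rule blinear_compose[OF O0.blinear_bicomm blinear_fst])
  have b: "?c (bicomm fl1 fr1 m) = 0" for m by (simp add: O0.bicomm_bicomm)
  note g = bounded_X1_lift[OF c b] and abs = X1_lift_abs[OF c b]
  have p: "?c (x \<otimes>\<^sub>c y) = x \<cdot>\<^sub>r y - y \<cdot>\<^sub>l x" for x and y :: "'a tensor_alg" by (simp add: unit_l_def unit_r_def)
  have eq: "X_boundary1 = (\<lambda>\<eta>. ?c (rep_X1 \<eta>))" unfolding X_boundary1_def
  proof (rule the_equality)
    show "bounded_clinear (\<lambda>\<eta>. ?c (rep_X1 \<eta>)) \<and> (\<forall>x y. ?c (rep_X1 (X1_form x y)) = x \<cdot>\<^sub>r y - y \<cdot>\<^sub>l x)"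
      using g by (simp only: X1_form_def abs p simp_thms)
    fix h :: "'a tensor_alg X1 => 'a tensor_alg"
    assume h: "bounded_clinear h \<and> (\<forall>x y. h (X1_form x y) = x \<cdot>\<^sub>r y - y \<cdot>\<^sub>l x)"
    have "h (abs_X1 w) = ?c w" for w
      by (rule ctensor_eqI[OF blinear_compose[OF bounded_abs_X1 conjunct1[OF h]] c bcomplete_tensor_alg])
        (use h in \<open>simp only: p X1_form_def\<close>)
    from this[of "rep_X1 _"] show "h = (\<lambda>\<eta>. ?c (rep_X1 \<eta>))" by (simp only: abs_rep_X1 fun_eq_iff simp_thms)
  qed
  show "X_boundary1 (abs_X1 w) = fst (bicomm unit_l unit_r w)" by (simp only: eq abs)
  show "bounded_clinear (X_boundary1 :: 'a tensor_alg X1 => _)" unfolding eq by (rule g)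
qed

lemma clinear_X_boundary: "clinear (X_boundary :: 'a::complete_bornological_algebra XT => _)"
  unfolding X_boundary_def[abs_def] by (rule blinear_clinear, rule blinear_Pair)
    (rule blinear_compose[OF blinear_snd bounded_X_boundary1]
      blinear_compose[OF blinear_fst bounded_X_boundary0])+

lemma X1_map_facts:
  fixes f :: "'a::complete_bornological_algebra tensor_alg => 'b::complete_bornological_algebra tensor_alg"
  assumes f: "bounded_clinear f" and fm: "\<And>x y. f (x * y) = f x * f y"
  shows X1_map_abs: "X1_map f (abs_X1 w) = abs_X1 (Omega1_map f w)" and bounded_X1_map: "bounded_clinear (X1_map f)"
proof -
  have g: "bounded_clinear (\<lambda>w. abs_X1 (Omega1_map f w))"
    by (rule blinear_compose[OF bounded_Omega1_map[OF f] bounded_abs_X1])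
  have b: "abs_X1 (Omega1_map f (bicomm fl1 fr1 m)) = 0" for m
  proof -
    obtain m' where "Omega1_map f (bicomm fl1 fr1 m) = bicomm fl1 fr1 m'" using Omega1_map_bicomm[OF f fm] by (rule exE)
    thus ?thesis by (simp only: abs_X1_bicomm)
  qed
  show "X1_map f (abs_X1 w) = abs_X1 (Omega1_map f w)" unfolding X1_map_def by (rule X1_lift_abs[OF g b])
  show "bounded_clinear (X1_map f)" unfolding X1_map_def[abs_def] by (rule bounded_X1_lift[OF g b])
qed

lemma bounded_X_map:
  fixes f :: "'a::complete_bornological_algebra tensor_alg => 'b::complete_bornological_algebra tensor_alg"
  assumes f: "bounded_clinear f" and fm: "\<And>x y. f (x * y) = f x * f y"
  shows "bounded_clinear (X_map f)" unfolding X_map_def[abs_def] by (rule blinear_Pair[OF blinear_compose[OF blinear_fst f]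
        blinear_compose[OF blinear_snd bounded_X1_map[OF f fm]]])

lemma X_boundary_X_map:
  fixes f :: "'a::complete_bornological_algebra tensor_alg => 'b::complete_bornological_algebra tensor_alg"
  assumes f: "bounded_clinear f" and fm: "\<And>x y. f (x * y) = f x * f y"
  shows "X_boundary (X_map f z) = X_map f (X_boundary z)"
proof -
  note lin = blin_add[OF f] blin_diff[OF f]
    blin_scale[OF f] blin_zero[OF f]
  have c: "fst (bicomm unit_l unit_r (Omega1_map f w)) = f (fst (bicomm unit_l unit_r w))" for w
    by (rule ctensor_eqI[where z=w and f="\<lambda>w. fst (bicomm unit_l unit_r (Omega1_map f w))" and g="\<lambda>w. f (fst (bicomm unit_l unit_r w))"],
      rule blinear_compose[OF bounded_Omega1_map[OF f] blinear_compose[OF O0.blinear_bicomm blinear_fst]],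
      rule blinear_compose[OF blinear_compose[OF O0.blinear_bicomm blinear_fst] f], simp_all add: bcomplete_tensor_alg Omega1_map_pure[OF f] unit_l_def unit_r_def unital_mult_left_def unital_mult_right_def lin fm)
  have 1: "X_boundary1 (X1_map f \<eta>) = f (X_boundary1 \<eta>)" for \<eta>
    using c[of "rep_X1 \<eta>"] X1_map_abs[OF f fm, of "rep_X1 \<eta>"] X_boundary1_abs[of "rep_X1 \<eta>"]
      X_boundary1_abs[of "Omega1_map f (rep_X1 \<eta>)"] by (simp only: abs_rep_X1)
  have 0: "X_boundary0 (f x) = X1_map f (X_boundary0 x)" for x
    by (simp add: X_boundary0_eq X1_map_abs[OF f fm] dform_def Omega1_map_pure[OF f] lin)
  show ?thesis by (simp add: X_boundary_def X_map_def 0 1)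
qed

lemma XT_map_facts:
  fixes f :: "'a::complete_bornological_algebra => 'b::complete_bornological_algebra"
  assumes f: "bounded_hom f"
  shows bounded_XT_map: "bounded_clinear (XT_map f)" and X_boundary_XT_map: "X_boundary (XT_map f z) = XT_map f (X_boundary z)"
    and XT_map_degree: "z \<in> degree_part k ==> XT_map f z \<in> degree_part k"
proof -
  note F = blinear_tensor_alg_map[OF f] tensor_alg_map_times[OF f]
  show "bounded_clinear (XT_map f)" unfolding XT_map_def by (rule bounded_X_map[OF F])
  show "X_boundary (XT_map f z) = XT_map f (X_boundary z)" unfolding XT_map_def by (rule X_boundary_X_map[OF F])
  show "z \<in> degree_part k ==> XT_map f z \<in> degree_part k"
    by (auto simp: degree_part_def XT_map_def X_map_def blin_zero[OF F(1)]
        blin_zero[OF bounded_X1_map[OF F]])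
qed

text \<open>The degrees are exchanged: \<open>h1\<close> descends to X1 because it kills
  commutators, and \<open>h0\<close> is followed by the quotient map. The commutator left over in
  \<open>homotopy1\<close> vanishes in X1.\<close>

lemma (in AC_connection) X_homotopy:
  "\<exists>h \<in> XT_homs 1. \<forall>z. X_map (Ft 1) z - X_map (Ft 0) z = X_boundary (h z) + h (X_boundary z)"
proof -
  let ?H1 = "\<lambda>\<eta>. h1 (rep_X1 \<eta>)" and ?H0 = "\<lambda>x. abs_X1 (h0 x)"
  let ?h = "\<lambda>z. (?H1 (snd z), ?H0 (fst z))"
  have H1: "bounded_clinear ?H1" by (rule bounded_X1_lift[OF bounded_h1 h1_bicomm])
  have H0: "bounded_clinear ?H0" by (rule blinear_compose[OF bounded_h0 bounded_abs_X1])
  have h: "bounded_clinear ?h"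
    by (rule blinear_Pair[OF blinear_compose[OF blinear_snd H1] blinear_compose[OF blinear_fst H0]])
  have abs: "?H1 (abs_X1 w) = h1 w" for w by (rule X1_lift_abs[OF bounded_h1 h1_bicomm])
  have "?h ` degree_part j \<subseteq> degree_part (j + 1)" for j by (auto simp: degree_part_def blin_zero[OF H1] blin_zero[OF H0])
  hence "?h \<in> XT_homs 1" using h by (simp add: XT_homs_def)
  moreover have "X_map (Ft 1) z - X_map (Ft 0) z = X_boundary (?h z) + ?h (X_boundary z)" for z
  proof -
    define x w where "x = fst z" and "w = rep_X1 (snd z)"
    have z: "z = (x, abs_X1 w)" by (simp add: x_def w_def abs_rep_X1)
    obtain m where m: "h0 (fst (bicomm unit_l unit_r w)) + dform (h1 w) - (Omega1_map (Ft 1) w - Omega1_map (Ft 0) w) = bicomm fl1 fr1 m"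
      using homotopy1[of w] by (rule exE)
    have "abs_X1 (Omega1_map (Ft 1) w) - abs_X1 (Omega1_map (Ft 0) w) = abs_X1 (dform (h1 w)) + abs_X1 (h0 (fst (bicomm unit_l unit_r w)))"
      using arg_cong[OF m, of abs_X1] by (simp add: abs_X1_linear abs_X1_bicomm algebra_simps)
    thus ?thesis using homotopy0[of x]
      by (simp add: z X_map_def X_boundary_def X1_map_abs[OF bounded_Ft Ft_times] abs X_boundary0_eq X_boundary1_abs)
  qed
  ultimately show ?thesis by (intro bexI[of _ ?h] allI)
qed

lemma XT_homotopy:
  fixes f\<^sub>0 f\<^sub>1 :: "'a::complete_bornological_algebra => 'b::complete_bornological_algebra"
  assumes f: "bounded_hom f\<^sub>0" "bounded_hom f\<^sub>1" and "AC_homotopic f\<^sub>0 f\<^sub>1"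
  shows "\<exists>h \<in> XT_homs 1. \<forall>z. XT_map f\<^sub>1 z - XT_map f\<^sub>0 z = X_boundary (h z) + h (X_boundary z)"
proof -
  obtain \<Phi> :: "'a => (AC, 'b) ctensor" where \<Phi>: "bounded_hom \<Phi>" "AC_eval 0 \<circ> \<Phi> = f\<^sub>0" "AC_eval 1 \<circ> \<Phi> = f\<^sub>1"
    using assms(3) unfolding AC_homotopic_def by (elim exE conjE)
  obtain F where AC_F: "AC_hom F" "\<forall>t. bounded_hom (AC_eval t \<circ> \<Phi>) \<longrightarrow> (\<forall>x. AC_eval t (F x) = tensor_alg_map (AC_eval t \<circ> \<Phi>) x)"
    using AC_hom_exists[OF \<Phi>(1)] by (elim exE conjE)
  obtain \<phi> :: "'a tensor_alg => 'a tensor_alg Omega2" where \<phi>: "bounded_clinear \<phi> \<and>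
    (\<forall>x y. \<phi> (x * y) = fl2 x (\<phi> y) + fr2 (\<phi> x) y + dform x \<otimes>\<^sub>c y) \<and> (\<forall>a. \<phi> (tsigma a) = 0)"
    using tensor_alg_connection by (rule exE)
  interpret AC_hom F by (rule AC_F(1))
  interpret AC_connection F \<phi> by unfold_locales (use \<phi> in blast)+
  have "Ft 0 = tensor_alg_map f\<^sub>0" "Ft 1 = tensor_alg_map f\<^sub>1"
    using AC_F(2)[rule_format, of 0] AC_F(2)[rule_format, of 1] f unfolding \<Phi>(2,3) by (simp_all add: fun_eq_iff Ft_def)
  thus ?thesis using X_homotopy unfolding XT_map_def by simp
qed

section \<open>Cosets\<close>

definition diff_closed :: "'a::ab_group_add set => bool"
  where "diff_closed B \<longleftrightarrow> 0 \<in> B \<and> (\<forall>x\<in>B. \<forall>y\<in>B. x - y \<in> B)"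

lemma diff_closed_0: "diff_closed B ==> 0 \<in> B" by (simp add: diff_closed_def)

lemma diff_closed_diff: "diff_closed B ==> x \<in> B ==> y \<in> B ==> x - y \<in> B" by (simp add: diff_closed_def)

lemma diff_closed_image:
  assumes "diff_closed A" and "\<And>x y. f (x - y) = f x - f y"
  shows "diff_closed (f ` A)" unfolding diff_closed_def
proof (intro conjI ballI)
  have "f 0 = 0" using assms(2)[of 0 0] by simp
  thus "0 \<in> f ` A" using assms(1) by (auto simp: diff_closed_def intro: rev_image_eqI)
  show "x - y \<in> f ` A" if "x \<in> f ` A" "y \<in> f ` A" for x y
    using that assms(1) unfolding diff_closed_def by (auto simp: assms(2)[symmetric])
qed

lemma coset_eq:
  assumes "diff_closed B" "y - x \<in> B"
  shows "x +o B = y +o B"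
proof -
  have sub: "x +o B \<subseteq> y +o B" if xy: "x - y \<in> B" for x y
  proof
    fix z assume "z \<in> x +o B"
    then obtain b where b: "b \<in> B" "z = x + b" by (auto simp: elt_set_plus_def)
    have "0 - (x - y) \<in> B" using assms(1) xy by (simp only: diff_closed_def)
    hence "b - (0 - (x - y)) \<in> B" using assms(1) b(1) by (simp only: diff_closed_def)
    moreover have "x + b = y + (b - (0 - (x - y)))" by (simp add: add.commute[of y] add.commute[of x] add.assoc)
    ultimately show "z \<in> y +o B" unfolding elt_set_plus_def b(2) by (intro CollectI bexI)
  qed
  have "0 - (y - x) \<in> B" using assms by (simp only: diff_closed_def)
  hence "x - y \<in> B" by simp
  thus ?thesis using sub[of x y] sub[OF assms(2)] by blast
qed

lemma coset_map:
  assumes C: "diff_closed C" and B: "0 \<in> B" and G: "\<And>b. b \<in> B ==> G (x + b) - G x \<in> C"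
  shows "(\<Union>z\<in>x +o B. G z +o C) = G x +o C"
proof -
  have *: "G (x + b) +o C = G x +o C" if "b \<in> B" for b by (rule coset_eq[OF C G[OF that], symmetric])
  have "x +o B = (\<lambda>b. x + b) ` B" by (auto simp: elt_set_plus_def)
  hence "(\<Union>z\<in>x +o B. G z +o C) = (\<Union>b\<in>B. G (x + b) +o C)" by (simp only: image_image)
  also have "\<dots> = (\<Union>b\<in>B. G x +o C)" by (rule SUP_cong[OF refl *])
  also have "\<dots> = G x +o C" using B by auto
  finally show ?thesis .
qed

text \<open>Homology, cohomology and both bivariant functorialities act on a class by a union over
  its coset. In each case it suffices that both maps respect cosets and differ by a boundary at one
  representative.\<close>

lemma coset_maps_eq:
  assumes C: "diff_closed C" and B: "diff_closed B" and G: "\<And>b. b \<in> B ==> G (x + b) - G x \<in> C"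
    and H: "\<And>b. b \<in> B ==> H (x + b) - H x \<in> C" and d: "H x - G x \<in> C"
  shows "(\<Union>z\<in>x +o B. G z +o C) = (\<Union>z\<in>x +o B. H z +o C)"
  by (rule trans[OF trans[OF coset_map[OF C diff_closed_0[OF B] G] coset_eq[OF C d]]
        coset_map[OF C diff_closed_0[OF B] H, symmetric]])

lemma diff_closed_degree_part: "diff_closed (degree_part k :: ('v::ab_group_add \<times> 'w::ab_group_add) set)"
  by (auto simp: diff_closed_def degree_part_def zero_prod_def)

lemma degree_part_parity: "degree_part (k + 2) = degree_part k" by (simp add: degree_part_def)

section \<open>Homogeneous maps and the groups of boundaries\<close>

lemma XT_homs_closed:
  assumes "\<phi> \<in> XT_homs k"
  shows XT_homs_bounded: "bounded_clinear \<phi>" and XT_homs_degree: "z \<in> degree_part j ==> \<phi> z \<in> degree_part (j + k)"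
  using assms by (auto simp: XT_homs_def)

lemma XT_homsI: "bounded_clinear \<phi> ==> (\<And>j z. z \<in> degree_part j ==> \<phi> z \<in> degree_part (j + k)) ==> \<phi> \<in> XT_homs k"
  by (auto simp: XT_homs_def)

lemma XT_homs_compose: "\<phi> \<in> XT_homs k ==> \<eta> \<in> XT_homs l ==> (\<lambda>z. \<eta> (\<phi> z)) \<in> XT_homs (k + l)"
  by (rule XT_homsI, rule blinear_compose) (auto dest: XT_homs_bounded XT_homs_degree simp: add.assoc[symmetric])

lemma XT_map_homs: "bounded_hom f ==> XT_map f \<in> XT_homs 0" by (rule XT_homsI) (simp_all add: bounded_XT_map XT_map_degree)

lemma diff_closed_boundaries: "diff_closed (HA_boundaries k)" unfolding HA_boundaries_def
  by (rule diff_closed_image[OF diff_closed_degree_part clinear_diff[OF clinear_X_boundary]])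

lemma diff_closed_coboundaries: "diff_closed (HA_coboundaries k)" unfolding HA_coboundaries_def
proof (rule diff_closed_image)
  show "diff_closed (XT_functionals (k + 1))" unfolding diff_closed_def XT_functionals_def
    using blinear_zero blinear_minus by (auto simp: zero_fun_def fun_diff_def)
qed (simp add: fun_eq_iff)

lemma hom_boundary_diff: "hom_boundary k (\<phi> - \<eta>) = hom_boundary k \<phi> - hom_boundary k \<eta>"
  by (simp add: fun_eq_iff hom_boundary_def clinear_diff[OF clinear_X_boundary] complex_vector.scale_right_diff_distrib algebra_simps)

lemma diff_closed_hom_boundaries: "diff_closed (HA_hom_boundaries k :: ('a::complete_bornological_algebra XT => 'b::complete_bornological_algebra XT) set)"
  unfolding HA_hom_boundaries_def
proof (rule diff_closed_image[where f="hom_boundary (k + 1)"])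
  show "diff_closed (XT_homs (k + 1) :: ('a XT => 'b XT) set)" unfolding diff_closed_def
  proof (intro conjI ballI)
    show "(0 :: 'a XT => 'b XT) \<in> XT_homs (k + 1)"
      using blinear_zero diff_closed_degree_part by (intro XT_homsI) (auto simp: zero_fun_def diff_closed_def)
    fix \<phi> \<eta> :: "'a XT => 'b XT" assume *: "\<phi> \<in> XT_homs (k + 1)" "\<eta> \<in> XT_homs (k + 1)"
    show "\<phi> - \<eta> \<in> XT_homs (k + 1)"
    proof (rule XT_homsI)
      show "bounded_clinear (\<phi> - \<eta>)" unfolding fun_diff_def by (intro blinear_minus XT_homs_bounded[OF *(1)] XT_homs_bounded[OF *(2)])
      show "(\<phi> - \<eta>) z \<in> degree_part (j + (k + 1))" if z: "z \<in> degree_part j" for j z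
        unfolding fun_diff_def by (rule diff_closed_diff[OF diff_closed_degree_part XT_homs_degree[OF *(1) z] XT_homs_degree[OF *(2) z]])
    qed
  qed
qed (rule hom_boundary_diff)

text \<open>One chain homotopy \<open>h\<close> serves all theories: applied to a cycle or composed
  with one, up to a sign, it gives a primitive of the difference of the two images.\<close>

theorem theorem3p39:
  fixes f\<^sub>0 f\<^sub>1 :: "'a::complete_bornological_algebra \<Rightarrow> 'b::complete_bornological_algebra"
  assumes "bounded_hom f\<^sub>0" and "bounded_hom f\<^sub>1" and "AC_homotopic f\<^sub>0 f\<^sub>1"
  shows "HA_class f\<^sub>0 \<in> HA_bivariant 0 \<and> HA_class f\<^sub>0 = HA_class f\<^sub>1 \<and>
    (\<forall>k. \<forall>\<zeta>\<in>HA_homology k. HA_homology_map k f\<^sub>0 \<zeta> = HA_homology_map k f\<^sub>1 \<zeta>) \<and>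
    (\<forall>k. \<forall>\<xi>\<in>HA_cohomology k. HA_cohomology_map k f\<^sub>0 \<xi> = HA_cohomology_map k f\<^sub>1 \<xi>) \<and>
    (\<forall>k. \<forall>\<kappa>\<in>HA_bivariant k :: ('d::complete_bornological_algebra XT \<Rightarrow> 'a XT) set set.
      HA_bivariant_push k f\<^sub>0 \<kappa> = HA_bivariant_push k f\<^sub>1 \<kappa>) \<and>
    (\<forall>k. \<forall>\<kappa>\<in>HA_bivariant k :: ('b XT \<Rightarrow> 'd XT) set set.
      HA_bivariant_pull k f\<^sub>0 \<kappa> = HA_bivariant_pull k f\<^sub>1 \<kappa>)"
proof (intro conjI allI ballI)
  obtain h where h: "h \<in> XT_homs 1" and hz: "\<forall>z. XT_map f\<^sub>1 z - XT_map f\<^sub>0 z = X_boundary (h z) + h (X_boundary z)"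
    using XT_homotopy[OF assms] by (rule bexE)
  note hb = XT_homs_bounded[OF h] and hz = hz[rule_format]
  note hom0 = assms(1) and hom1 = assms(2)
  have add: "XT_map f (x + y) = XT_map f x + XT_map f y" "XT_map f (x - y) = XT_map f x - XT_map f y"
    "XT_map f (c *\<^sub>C x) = c *\<^sub>C XT_map f x"
    if "bounded_hom f" for f :: "'a => 'b" and x y c
    by (rule blin_add[OF bounded_XT_map[OF that]] blin_diff[OF bounded_XT_map[OF that]]
        blin_scale[OF bounded_XT_map[OF that]])+
  have "hom_boundary 0 (XT_map f\<^sub>0) = 0" by (simp add: fun_eq_iff hom_boundary_def X_boundary_XT_map[OF hom0] scaleC_one)
  thus "HA_class f\<^sub>0 \<in> HA_bivariant 0"
    unfolding HA_class_def HA_bivariant_def using XT_map_homs[OF hom0] by (intro CollectI exI[of _ "XT_map f\<^sub>0"] conjI refl)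
  have "XT_map f\<^sub>1 - XT_map f\<^sub>0 = hom_boundary (0 + 1) h" by (simp add: fun_eq_iff hom_boundary_def scaleC_minus_one hz)
  moreover have "hom_boundary (0 + 1) h \<in> HA_hom_boundaries 0" unfolding HA_hom_boundaries_def using h by (intro imageI) simp
  ultimately show "HA_class f\<^sub>0 = HA_class f\<^sub>1"
    unfolding HA_class_def by (intro coset_eq[OF diff_closed_hom_boundaries]) simp
  show "HA_homology_map k f\<^sub>0 \<zeta> = HA_homology_map k f\<^sub>1 \<zeta>" if \<zeta>: "\<zeta> \<in> HA_homology k" for k \<zeta>
  proof -
    obtain z where z: "\<zeta> = z +o HA_boundaries k" "z \<in> degree_part k" "X_boundary z = 0"
      using \<zeta> unfolding HA_homology_def by (elim CollectE exE conjE)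
    have m: "XT_map f (z + b) - XT_map f z \<in> HA_boundaries k" if f: "bounded_hom f" and b: "b \<in> HA_boundaries k" for f :: "'a => 'b" and b
    proof -
      from b obtain y where y: "b = X_boundary y" "y \<in> degree_part (k + 1)" unfolding HA_boundaries_def by (elim imageE)
      have "XT_map f (z + b) - XT_map f z = X_boundary (XT_map f y)" by (simp add: add[OF f] y(1) X_boundary_XT_map[OF f])
      thus ?thesis
        unfolding HA_boundaries_def using XT_map_degree[OF f y(2)] by (intro image_eqI)
    qed
    have "XT_map f\<^sub>1 z - XT_map f\<^sub>0 z = X_boundary (h z)" using hz[of z] z(3) blin_zero[OF hb] by simp
    hence "XT_map f\<^sub>1 z - XT_map f\<^sub>0 z \<in> HA_boundaries k"
      unfolding HA_boundaries_def using XT_homs_degree[OF h z(2)] by (intro image_eqI)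
    note d = this
    show ?thesis unfolding HA_homology_map_def z(1)
      by (rule coset_maps_eq[where G="XT_map f\<^sub>0" and H="XT_map f\<^sub>1" and x=z], rule diff_closed_boundaries,
          rule diff_closed_boundaries, erule m[OF hom0], erule m[OF hom1], rule d)
  qed
  show "HA_cohomology_map k f\<^sub>0 \<xi> = HA_cohomology_map k f\<^sub>1 \<xi>" if \<xi>: "\<xi> \<in> HA_cohomology k" for k \<xi>
  proof -
    obtain \<phi> where \<phi>: "\<xi> = \<phi> +o HA_coboundaries k" "\<phi> \<in> XT_functionals k" "\<phi> \<circ> X_boundary = 0"
      using \<xi> unfolding HA_cohomology_def by (elim CollectE exE conjE)
    have \<phi>b: "bounded_clinear \<phi>" and \<phi>0: "\<And>z. z \<in> degree_part (k + 1) ==> \<phi> z = 0"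
      using \<phi>(2) by (auto simp: XT_functionals_def)
    have m: "((\<phi> + b) \<circ> XT_map f) - (\<phi> \<circ> XT_map f) \<in> HA_coboundaries k" if f: "bounded_hom f" and b: "b \<in> HA_coboundaries k" for f :: "'a => 'b" and b
    proof -
      from b obtain y where y: "b = y \<circ> X_boundary" "y \<in> XT_functionals (k + 1)" unfolding HA_coboundaries_def by (elim imageE)
      have "((\<phi> + b) \<circ> XT_map f) - (\<phi> \<circ> XT_map f) = (y \<circ> XT_map f) \<circ> X_boundary"
        by (simp add: fun_eq_iff y(1) X_boundary_XT_map[OF f])
      moreover have "y \<circ> XT_map f \<in> XT_functionals (k + 1)"
        using y(2) blinear_compose[OF bounded_XT_map[OF f], of y] XT_map_degree[OF f]
        by (auto simp: XT_functionals_def o_def)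
      ultimately show ?thesis
        unfolding HA_coboundaries_def by (rule image_eqI)
    qed
    have "\<phi> (X_boundary w) = 0" for w using fun_cong[OF \<phi>(3), of w] by simp
    hence "(\<phi> \<circ> XT_map f\<^sub>1) - (\<phi> \<circ> XT_map f\<^sub>0) = (\<phi> \<circ> h) \<circ> X_boundary"
      by (simp add: fun_eq_iff clinear_diff[OF blinear_clinear[OF \<phi>b], symmetric] hz blin_add[OF \<phi>b])
    moreover have "\<phi> \<circ> h \<in> XT_functionals (k + 1)"
    proof -
      \<comment> \<open>\<open>h\<close> is odd, so it takes the parity of k to that of k + 1, where
        \<phi> vanishes; degrees agree only modulo 2.\<close>
      have "\<phi> (h z) = 0" if "z \<in> degree_part (k + 1 + 1)" for z
      proof (rule \<phi>0)
        have "h z \<in> degree_part (k + 1 + 2)" using XT_homs_degree[OF h that] by simp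
        thus "h z \<in> degree_part (k + 1)" by (simp only: degree_part_parity)
      qed
      thus ?thesis using blinear_compose[OF hb \<phi>b] by (simp add: XT_functionals_def o_def)
    qed
    ultimately have "(\<phi> \<circ> XT_map f\<^sub>1) - (\<phi> \<circ> XT_map f\<^sub>0) \<in> HA_coboundaries k"
      unfolding HA_coboundaries_def by (rule image_eqI)
    note d = this
    show ?thesis unfolding HA_cohomology_map_def \<phi>(1)
      by (rule coset_maps_eq[where G="\<lambda>\<phi>. \<phi> \<circ> XT_map f\<^sub>0" and H="\<lambda>\<phi>. \<phi> \<circ> XT_map f\<^sub>1" and x=\<phi>], rule diff_closed_coboundaries,
          rule diff_closed_coboundaries, erule m[OF hom0], erule m[OF hom1], rule d)
  qed
  show "HA_bivariant_push k f\<^sub>0 \<kappa> = HA_bivariant_push k f\<^sub>1 \<kappa>"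
    if \<kappa>: "\<kappa> \<in> HA_bivariant k" for k and \<kappa> :: "('d XT => 'a XT) set"
  proof -
    obtain \<phi> where \<phi>: "\<kappa> = \<phi> +o HA_hom_boundaries k" "\<phi> \<in> XT_homs k" "hom_boundary k \<phi> = 0"
      using \<kappa> unfolding HA_bivariant_def by (elim CollectE exE conjE)
    have m: "(XT_map f \<circ> (\<phi> + b)) - (XT_map f \<circ> \<phi>) \<in> HA_hom_boundaries k" if f: "bounded_hom f" and b: "b \<in> HA_hom_boundaries k" for f :: "'a => 'b" and b
    proof -
      from b obtain y where y: "b = hom_boundary (k + 1) y" "y \<in> XT_homs (k + 1)" unfolding HA_hom_boundaries_def by (elim imageE)
      have "(XT_map f \<circ> (\<phi> + b)) - (XT_map f \<circ> \<phi>) = hom_boundary (k + 1) (\<lambda>z. XT_map f (y z))"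
        by (simp add: fun_eq_iff y(1) hom_boundary_def add[OF f] X_boundary_XT_map[OF f])
      moreover have "(\<lambda>z. XT_map f (y z)) \<in> XT_homs (k + 1)" using XT_homs_compose[OF y(2) XT_map_homs[OF f]] by simp
      ultimately show ?thesis
        unfolding HA_hom_boundaries_def by (rule image_eqI)
    qed
    have cyc: "X_boundary (\<phi> z) = (- 1) ^ k *\<^sub>C \<phi> (X_boundary z)" for z
      using fun_cong[OF \<phi>(3), of z] by (simp add: hom_boundary_def)
    have "(XT_map f\<^sub>1 \<circ> \<phi>) - (XT_map f\<^sub>0 \<circ> \<phi>) = hom_boundary (k + 1) (\<lambda>z. h (\<phi> z))"
      by (simp add: fun_eq_iff hz hom_boundary_def cyc blin_scale[OF hb] complex_vector.scale_minus_left)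
    moreover have "(\<lambda>z. h (\<phi> z)) \<in> XT_homs (k + 1)" by (rule XT_homs_compose[OF \<phi>(2) h])
    ultimately have "(XT_map f\<^sub>1 \<circ> \<phi>) - (XT_map f\<^sub>0 \<circ> \<phi>) \<in> HA_hom_boundaries k"
      unfolding HA_hom_boundaries_def by (rule image_eqI)
    note d = this
    show ?thesis unfolding HA_bivariant_push_def \<phi>(1)
      by (rule coset_maps_eq[where G="\<lambda>\<phi>. XT_map f\<^sub>0 \<circ> \<phi>" and H="\<lambda>\<phi>. XT_map f\<^sub>1 \<circ> \<phi>" and x=\<phi>], rule diff_closed_hom_boundaries,
          rule diff_closed_hom_boundaries, erule m[OF hom0], erule m[OF hom1], rule d)
  qed
  show "HA_bivariant_pull k f\<^sub>0 \<kappa> = HA_bivariant_pull k f\<^sub>1 \<kappa>"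
    if \<kappa>: "\<kappa> \<in> HA_bivariant k" for k and \<kappa> :: "('b XT => 'd XT) set"
  proof -
    obtain \<phi> where \<phi>: "\<kappa> = \<phi> +o HA_hom_boundaries k" "\<phi> \<in> XT_homs k" "hom_boundary k \<phi> = 0"
      using \<kappa> unfolding HA_bivariant_def by (elim CollectE exE conjE)
    note \<phi>b = XT_homs_bounded[OF \<phi>(2)]
    have m: "((\<phi> + b) \<circ> XT_map f) - (\<phi> \<circ> XT_map f) \<in> HA_hom_boundaries k" if f: "bounded_hom f" and b: "b \<in> HA_hom_boundaries k" for f :: "'a => 'b" and b
    proof -
      from b obtain y where y: "b = hom_boundary (k + 1) y" "y \<in> XT_homs (k + 1)" unfolding HA_hom_boundaries_def by (elim imageE)
      have "((\<phi> + b) \<circ> XT_map f) - (\<phi> \<circ> XT_map f) = hom_boundary (k + 1) (\<lambda>z. y (XT_map f z))"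
        by (simp add: fun_eq_iff y(1) hom_boundary_def X_boundary_XT_map[OF f])
      moreover have "(\<lambda>z. y (XT_map f z)) \<in> XT_homs (k + 1)" using XT_homs_compose[OF XT_map_homs[OF f] y(2)] by simp
      ultimately show ?thesis
        unfolding HA_hom_boundaries_def by (rule image_eqI)
    qed
    have cyc: "\<phi> (X_boundary z) = (- 1) ^ k *\<^sub>C X_boundary (\<phi> z)" for z
    proof -
      have "X_boundary (\<phi> z) = (- 1) ^ k *\<^sub>C \<phi> (X_boundary z)" using fun_cong[OF \<phi>(3), of z] by (simp add: hom_boundary_def)
      thus ?thesis by (simp add: scaleC_scaleC scaleC_one flip: power_mult_distrib)
    qed
    \<comment> \<open>Here \<open>h\<close> stands to the right of \<phi>, so the boundary has to
      pass \<phi>, which is a cycle of degree k; the sign compensates for this.\<close>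
    let ?g = "\<lambda>z. (- 1) ^ k *\<^sub>C \<phi> (h z)"
    have "(\<phi> \<circ> XT_map f\<^sub>1) - (\<phi> \<circ> XT_map f\<^sub>0) = hom_boundary (k + 1) ?g"
    proof (rule ext)
      fix z
      have "((\<phi> \<circ> XT_map f\<^sub>1) - (\<phi> \<circ> XT_map f\<^sub>0)) z = \<phi> (X_boundary (h z)) + \<phi> (h (X_boundary z))"
        by (simp add: clinear_diff[OF blinear_clinear[OF \<phi>b], symmetric] hz blin_add[OF \<phi>b])
      also have "\<dots> = hom_boundary (k + 1) ?g z"
        by (simp add: hom_boundary_def cyc clinear_scale[OF clinear_X_boundary] complex_vector.scale_minus_left scaleC_scaleC scaleC_one
            flip: power_mult_distrib)
      finally show "((\<phi> \<circ> XT_map f\<^sub>1) - (\<phi> \<circ> XT_map f\<^sub>0)) z = hom_boundary (k + 1) ?g z" .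
    qed
    moreover have "?g \<in> XT_homs (k + 1)"
    proof (rule XT_homsI)
      show "bounded_clinear ?g" by (rule blinear_scaleC[OF blinear_compose[OF hb \<phi>b]])
      show "?g z \<in> degree_part (j + (k + 1))" if z: "z \<in> degree_part j" for j z
      proof -
        have "\<phi> (h z) \<in> degree_part (j + (k + 1))" using XT_homs_degree[OF \<phi>(2) XT_homs_degree[OF h z]] by (simp add: ac_simps)
        thus ?thesis by (auto simp: degree_part_def scaleC_prod_def split: if_splits)
      qed
    qed
    ultimately have "(\<phi> \<circ> XT_map f\<^sub>1) - (\<phi> \<circ> XT_map f\<^sub>0) \<in> HA_hom_boundaries k"
      unfolding HA_hom_boundaries_def by (rule image_eqI)
    note d = this
    show ?thesis unfolding HA_bivariant_pull_def \<phi>(1)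
      by (rule coset_maps_eq[where G="\<lambda>\<phi>. \<phi> \<circ> XT_map f\<^sub>0" and H="\<lambda>\<phi>. \<phi> \<circ> XT_map f\<^sub>1" and x=\<phi>], rule diff_closed_hom_boundaries,
          rule diff_closed_hom_boundaries, erule m[OF hom0], erule m[OF hom1], rule d)
  qed
qed

end
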